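(* Let $\mathbf f\in W^{-1,2}(\Omega,\mathbb{R}^3)$ and, for $\eta>0$, let $\mathbf u_\eta$ be the solution of $$-\frac{\partial}{\partial x_j}\Big(C_{ijkl}\Big(\frac{\mathbf R\boldsymbol x}{\eta}\Big)\frac{\partial}{\partial x_l}u_{k\,\eta}(\boldsymbol x)\Big)=f_i(\boldsymbol x),\quad\boldsymbol x\in\Omega,\qquad \mathbf u_\eta|_{\partial\Omega}=\mathbf 0.$$ Then there exists a subsequence of $\{\mathbf u_\eta\}$ that converges weakly in $W^{1,2}_0(\Omega)$ (componentwise, i.e. in $W_0^{1,2}(\Omega,\mathbb{R}^3)$) to the solution $\mathbf u$ of the homogenized equation $$-\frac{\partial}{\partial x_j}\Big(C^h_{ijkl}\frac{\partial}{\partial x_l}u_k(\boldsymbol x)\Big)=f_i(\boldsymbol x),\quad\boldsymbol x\in\Omega,\qquad\mathbf u|_{\partial\Omega}=\mathbf 0,$$ where $$C^h_{ijkl}=\int_{Y^m}C_{ijpq}(\boldsymbol y)\big(\delta_{pk}\delta_{ql}-\nabla_{\mathbf R_q}\chi_p^{kl}(\boldsymbol y)\big)\,d\boldsymbol y$$ and $\big(\nabla_{\mathbf R_q}\chi_p^{kl}\big)_{q=1,2,3}\in L^2(Y^m;\mathbb{R}^3)$ solves the local equation $$\int_{Y^m}C_{ijpq}(\boldsymbol y)\big(\delta_{pk}\delta_{ql}-\nabla_{\mathbf R_q}\chi_p^{kl}(\boldsymbol y)\big)\,\nabla_{\mathbf R_j}\phi_i(\boldsymbol y)\,d\boldsymbol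 y=0\quad\text{for all }\phi=(\phi_i)\in W^{1,2}_\sharp(Y^m;\mathbb{R}^3),$$ with periodic boundary conditions.
   Context: $\Omega\subset\mathbb{R}^3$ is a bounded domain with Lipschitz boundary. $\mathbf R$ is a real matrix with $m$ rows and $3$ columns, $m>3$, satisfying $\mathbf R^T\boldsymbol k\neq\boldsymbol 0$ for all $\boldsymbol k\in\mathbb{Z}^m\setminus\{\boldsymbol 0\}$. $Y^m=]0,1[^m$; $\sharp$ denotes $Y^m$-periodicity. $C_{ijkl}$ is a $Y^m$-periodic symmetric rank-4 elasticity tensor (regarded as $\mathbb{R}^{9\times9}$-valued) which is bounded and coercive: $C\in L^\infty_\sharp(Y^m;\mathbb{R}^{9\times9})$, $C(\mathbf R\,\cdot/\eta)\in L^\infty(\Omega;\mathbb{R}^{9\times9})$, and there is a constant $c>0$ such that $C_{ijkl}\xi_{ij}\xi_{kl}\ge c\,\xi_{ij}\xi_{ij}$ a.e. for all $\xi\in\mathbb{R}^{3\times3}$ (for $C$ and for $C(\mathbf R\,\cdot/\eta)$). The solutions $\mathbf u_\eta$ are uniformly bounded in $W^{1,2}_0(\Omega,\mathbb{R}^3)$ with respect to $\eta$. $\nabla_{\mathbf R_q}\chi=\sum_{l=1}^m\mathbf R_{lq}\,\partial\chi/\partial y_l$ is the $q$-th component of $\nabla_{\mathbf R}\chi=(\mathbf R^T\nabla_{\boldsymbol y})\chi$. An element of $L^2_\sharp(Y^m;\mathbb{R}^3)$ is written $\nabla_{\mathbf R}\chi$ if its Fourier coefficients are $2\pi i\,\mathbf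 R^T\boldsymbol k\,\chi_{\boldsymbol k}$, $\boldsymbol k\in\mathbb{Z}^m$, for some complex scalars $\chi_{\boldsymbol k}$; the potential $\chi$ itself need not be in $L^2(Y^m)$. Summation over repeated indices in $\{1,2,3\}$ is understood.
   Formalization: Added hypothesis: for continuous periodic ψ, the integral over Ω of |C(Rx/η)−ψ(Rx/η)|² tends to |Ω| times that of |C−ψ|² over Y^m as η→0. Without it C may be changed on the null set R(ℝ³)+ℤ^m, altering every u_η but not C^h, and the claim fails. *)

theory Defs
  imports "HOL-Analysis.Analysis"
begin

section \<open>Lebesgue spaces\<close>

text \<open>
  Elements of Lebesgue and Sobolev spaces are represented by functions; two representatives
  that agree almost everywhere are interchangeable in everything below, with the exception of
  the coefficient that is composed with the cut (see \<open>cut_admissible\<close>).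
\<close>

definition L2 :: "'a measure \<Rightarrow> ('a \<Rightarrow> real) set" where
  "L2 M = {f. f \<in> borel_measurable M \<and> integrable M (\<lambda>x. (f x)\<^sup>2)}"

definition Linf :: "'a measure \<Rightarrow> ('a \<Rightarrow> 'b::{banach, second_countable_topology}) set" where
  "Linf M = {f. f \<in> borel_measurable M \<and> (\<exists>K. AE x in M. norm (f x) \<le> K)}"


section \<open>Smooth functions and test functions\<close>

definition pdiff :: "'n::finite \<Rightarrow> (real ^ 'n \<Rightarrow> real) \<Rightarrow> real ^ 'n \<Rightarrow> real" where
  "pdiff i f = (\<lambda>x. frechet_derivative f (at x) (axis i 1))"

primrec times_differentiable :: "nat \<Rightarrow> (real ^ 'n::finite \<Rightarrow> real) \<Rightarrow> bool" where
  "times_differentiable 0 f \<longleftrightarrow> continuous_on UNIV f"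
| "times_differentiable (Suc n) f \<longleftrightarrow>
     (\<forall>x. f differentiable (at x)) \<and> (\<forall>i. times_differentiable n (pdiff i f))"

definition smooth :: "(real ^ 'n::finite \<Rightarrow> real) \<Rightarrow> bool" where
  "smooth f \<longleftrightarrow> (\<forall>n. times_differentiable n f)"

definition test_functions :: "(real ^ 'n::finite) set \<Rightarrow> (real ^ 'n \<Rightarrow> real) set" where
  "test_functions \<Omega> =
     {\<phi>. smooth \<phi> \<and> compact (closure {x. \<phi> x \<noteq> 0}) \<and> closure {x. \<phi> x \<noteq> 0} \<subseteq> \<Omega>}"


section \<open>Sobolev spaces\<close>

definition has_weak_pderiv ::
    "(real ^ 'n::finite) set \<Rightarrow> 'n \<Rightarrow> (real ^ 'n \<Rightarrow> real) \<Rightarrow> (real ^ 'n \<Rightarrow> real) \<Rightarrow> bool" where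
  "has_weak_pderiv \<Omega> j u g \<longleftrightarrow>
     (\<forall>\<phi>\<in>test_functions \<Omega>.
        (LINT x|lebesgue_on \<Omega>. u x * pdiff j \<phi> x) = - (LINT x|lebesgue_on \<Omega>. g x * \<phi> x))"

definition W12 :: "(real ^ 'n::finite) set \<Rightarrow> (real ^ 'n \<Rightarrow> real) set" where
  "W12 \<Omega> = {u \<in> L2 (lebesgue_on \<Omega>). \<forall>j. \<exists>g\<in>L2 (lebesgue_on \<Omega>). has_weak_pderiv \<Omega> j u g}"

text \<open>For open \<open>\<Omega>\<close> the chosen representative is determined up to a null set.\<close>

definition weak_pderiv ::
    "(real ^ 'n::finite) set \<Rightarrow> 'n \<Rightarrow> (real ^ 'n \<Rightarrow> real) \<Rightarrow> real ^ 'n \<Rightarrow> real" where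
  "weak_pderiv \<Omega> j u = (SOME g. g \<in> L2 (lebesgue_on \<Omega>) \<and> has_weak_pderiv \<Omega> j u g)"

definition W12_norm :: "(real ^ 'n::finite) set \<Rightarrow> (real ^ 'n \<Rightarrow> real) \<Rightarrow> real" where
  "W12_norm \<Omega> u =
     sqrt ((LINT x|lebesgue_on \<Omega>. (u x)\<^sup>2)
           + (\<Sum>j\<in>UNIV. LINT x|lebesgue_on \<Omega>. (weak_pderiv \<Omega> j u x)\<^sup>2))"

definition W12_0 :: "(real ^ 'n::finite) set \<Rightarrow> (real ^ 'n \<Rightarrow> real) set" where
  "W12_0 \<Omega> = {u \<in> W12 \<Omega>. \<exists>\<phi>::nat \<Rightarrow> real ^ 'n \<Rightarrow> real.
     (\<forall>n. \<phi> n \<in> test_functions \<Omega>) \<and> (\<lambda>n. W12_norm \<Omega> (\<lambda>x. \<phi> n x - u x)) \<longlonglongrightarrow> 0}"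

definition W12_0_vec :: "(real ^ 'n::finite) set \<Rightarrow> (real ^ 'n \<Rightarrow> real ^ 'd::finite) set" where
  "W12_0_vec \<Omega> = {u. \<forall>k. (\<lambda>x. u x $ k) \<in> W12_0 \<Omega>}"

definition W12_norm_vec ::
    "(real ^ 'n::finite) set \<Rightarrow> (real ^ 'n \<Rightarrow> real ^ 'd::finite) \<Rightarrow> real" where
  "W12_norm_vec \<Omega> u = sqrt (\<Sum>k\<in>UNIV. (W12_norm \<Omega> (\<lambda>x. u x $ k))\<^sup>2)"

text \<open>
  The space $W^{-1,2}$, the dual of $W^{1,2}_0$. Boundedness forces a functional to take the
  same value on representatives that agree almost everywhere.
\<close>

definition W12_dual ::
    "(real ^ 'n::finite) set \<Rightarrow> ((real ^ 'n \<Rightarrow> real ^ 'd::finite) \<Rightarrow> real) set" where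
  "W12_dual \<Omega> = {F.
     (\<forall>a b. \<forall>v\<in>W12_0_vec \<Omega>. \<forall>w\<in>W12_0_vec \<Omega>.
        F (\<lambda>x. a *\<^sub>R v x + b *\<^sub>R w x) = a * F v + b * F w) \<and>
     (\<exists>K. \<forall>v\<in>W12_0_vec \<Omega>. \<bar>F v\<bar> \<le> K * W12_norm_vec \<Omega> v)}"

definition weakly_converges_W12_0 ::
    "(real ^ 'n::finite) set \<Rightarrow> (nat \<Rightarrow> real ^ 'n \<Rightarrow> real ^ 'd::finite)
      \<Rightarrow> (real ^ 'n \<Rightarrow> real ^ 'd) \<Rightarrow> bool" where
  "weakly_converges_W12_0 \<Omega> v u \<longleftrightarrow>
     (\<forall>n. v n \<in> W12_0_vec \<Omega>) \<and> u \<in> W12_0_vec \<Omega> \<and>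
     (\<forall>F\<in>W12_dual \<Omega>. (\<lambda>n. F (v n)) \<longlonglongrightarrow> F u)"


section \<open>Bounded Lipschitz domains\<close>

text \<open>
  Near each boundary point, \<open>\<Omega>\<close> is the part of space lying above the graph, in some direction
  \<open>e\<close>, of a Lipschitz function defined on the hyperplane orthogonal to \<open>e\<close>.
\<close>

definition bounded_lipschitz_domain :: "'a::euclidean_space set \<Rightarrow> bool" where
  "bounded_lipschitz_domain \<Omega> \<longleftrightarrow>
     open \<Omega> \<and> connected \<Omega> \<and> \<Omega> \<noteq> {} \<and> bounded \<Omega> \<and>
     (\<forall>p\<in>frontier \<Omega>. \<exists>e \<gamma> L r.
        norm e = 1 \<and> L-lipschitz_on {z. z \<bullet> e = 0} \<gamma> \<and> 0 < r \<and>
        (\<forall>x\<in>ball p r. x \<in> \<Omega> \<longleftrightarrow> \<gamma> (x - (x \<bullet> e) *\<^sub>R e) < x \<bullet> e))"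


section \<open>Periodic functions on the unit cell\<close>

definition unit_cell :: "(real ^ 'm::finite) set" where
  "unit_cell = {y. \<forall>i. 0 < y $ i \<and> y $ i < 1}"

definition int_vec :: "int ^ 'm::finite \<Rightarrow> real ^ 'm" where
  "int_vec k = (\<chi> i. of_int (k $ i))"

definition cell_periodic :: "(real ^ 'm::finite \<Rightarrow> 'b) \<Rightarrow> bool" where
  "cell_periodic g \<longleftrightarrow> (\<forall>y k. g (y + int_vec k) = g y)"

definition W12_per :: "(real ^ 'm::finite \<Rightarrow> real) set" where
  "W12_per = {u \<in> W12 unit_cell. cell_periodic u \<and>
     (\<exists>\<phi>::nat \<Rightarrow> real ^ 'm \<Rightarrow> real. (\<forall>n. smooth (\<phi> n) \<and> cell_periodic (\<phi> n)) \<and>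
       (\<lambda>n. W12_norm unit_cell (\<lambda>y. \<phi> n y - u y)) \<longlonglongrightarrow> 0)}"

definition W12_per_vec :: "(real ^ 'm::finite \<Rightarrow> real ^ 'd::finite) set" where
  "W12_per_vec = {u. \<forall>k. (\<lambda>y. u y $ k) \<in> W12_per}"

definition fourier_coeff :: "(real ^ 'm::finite \<Rightarrow> real) \<Rightarrow> int ^ 'm \<Rightarrow> complex" where
  "fourier_coeff g k =
     (LINT y|lebesgue_on unit_cell. complex_of_real (g y) * cis (- (2 * pi * (int_vec k \<bullet> y))))"


section \<open>Cut-and-projection\<close>

text \<open>The operator $\nabla_{\mathbf R} = \mathbf R^T \nabla_y$ on $W^{1,2}_\sharp$.\<close>

definition R_pderiv ::
    "real ^ 'n::finite ^ 'm::finite \<Rightarrow> 'n \<Rightarrow> (real ^ 'm \<Rightarrow> real) \<Rightarrow> real ^ 'm \<Rightarrow> real" where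
  "R_pderiv R q \<phi> y = (\<Sum>l\<in>UNIV. R $ l $ q * weak_pderiv unit_cell l \<phi> y)"

text \<open>
  The fields in $L^2_\sharp$ of the form $\nabla_{\mathbf R} \chi$. Because the numbers
  $\mathbf R^T k$ accumulate at $0$, the coefficients \<open>c\<close> need not be square summable, so
  \<open>\<chi>\<close> itself is only a formal Fourier series.
\<close>

definition is_R_gradient ::
    "real ^ 'n::finite ^ 'm::finite \<Rightarrow> (real ^ 'm \<Rightarrow> real ^ 'n) \<Rightarrow> bool" where
  "is_R_gradient R G \<longleftrightarrow>
     cell_periodic G \<and>
     (\<forall>q. (\<lambda>y. G y $ q) \<in> L2 (lebesgue_on unit_cell)) \<and>
     (\<exists>c::int ^ 'm \<Rightarrow> complex. \<forall>k q. fourier_coeff (\<lambda>y. G y $ q) k =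
        2 * of_real pi * \<i> * of_real ((transpose R *v int_vec k) $ q) * c k)"

text \<open>
  The cut $\mathbf R(\mathbb R^n) + \mathbb Z^m$ is a null set when $n < m$, so the class of a
  function \<open>g\<close> in $L^\infty_\sharp$ does not determine the function $g(\mathbf R x/\eta)$:
  changing \<open>g\<close> on the cut alone changes all these functions and none of the integrals over
  the cell. The condition below, a form of admissibility in the sense of two-scale
  convergence, expresses that $g(\mathbf R\,\cdot/\eta)$ is the trace of the class of \<open>g\<close>
  in the mean-square limit. For bounded open \<open>\<Omega>\<close>, bounded periodic functions that are continuous
  almost everywhere on the cell satisfy it when $\mathbf R^T k \neq 0$ for all nonzero integer vectors \<open>k\<close>.
\<close>

definition cut_admissible ::
    "(real ^ 'n::finite) set \<Rightarrow> real ^ 'n ^ 'm::finite \<Rightarrow> (real ^ 'm \<Rightarrow> 'b::real_normed_vector)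
      \<Rightarrow> bool" where
  "cut_admissible \<Omega> R g \<longleftrightarrow>
     (\<forall>\<psi>. continuous_on UNIV \<psi> \<longrightarrow> cell_periodic \<psi> \<longrightarrow>
        ((\<lambda>\<eta>. LINT x|lebesgue_on \<Omega>. (norm (g ((R *v x) /\<^sub>R \<eta>) - \<psi> ((R *v x) /\<^sub>R \<eta>)))\<^sup>2)
          \<longlongrightarrow> measure lebesgue \<Omega> * (LINT y|lebesgue_on unit_cell. (norm (g y - \<psi> y))\<^sup>2))
        (at_right 0))"


section \<open>Elasticity\<close>

type_synonym tensor4 = "real ^ 3 ^ 3 ^ 3 ^ 3"

text \<open>
  Symmetry is that of a $9 \times 9$ matrix with rows indexed by \<open>(i, j)\<close> and columns by
  \<open>(k, l)\<close>. The minor symmetries are not included: they would contradict coercivity, which is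
  required on all matrices and not only on the symmetric ones.
\<close>

definition symmetric_tensor :: "tensor4 \<Rightarrow> bool" where
  "symmetric_tensor A \<longleftrightarrow> (\<forall>i j k l. A $ i $ j $ k $ l = A $ k $ l $ i $ j)"

definition coercive_tensor :: "real \<Rightarrow> tensor4 \<Rightarrow> bool" where
  "coercive_tensor c A \<longleftrightarrow> (\<forall>\<xi>::real ^ 3 ^ 3.
     c * (\<Sum>i\<in>UNIV. \<Sum>j\<in>UNIV. \<xi> $ i $ j * \<xi> $ i $ j)
       \<le> (\<Sum>i\<in>UNIV. \<Sum>j\<in>UNIV. \<Sum>k\<in>UNIV. \<Sum>l\<in>UNIV.
            A $ i $ j $ k $ l * \<xi> $ i $ j * \<xi> $ k $ l))"

text \<open>
  Weak solutions of $-\partial_j (A_{ijkl} \partial_l u_k) = f_i$ in \<open>\<Omega>\<close> with zero boundary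
  values, as an equation in $W^{-1,2}$.
\<close>

definition dirichlet_solution ::
    "(real ^ 3) set \<Rightarrow> (real ^ 3 \<Rightarrow> tensor4) \<Rightarrow> ((real ^ 3 \<Rightarrow> real ^ 3) \<Rightarrow> real)
      \<Rightarrow> (real ^ 3 \<Rightarrow> real ^ 3) \<Rightarrow> bool" where
  "dirichlet_solution \<Omega> A f u \<longleftrightarrow>
     u \<in> W12_0_vec \<Omega> \<and>
     (\<forall>v\<in>W12_0_vec \<Omega>.
        (LINT x|lebesgue_on \<Omega>. (\<Sum>i\<in>UNIV. \<Sum>j\<in>UNIV. \<Sum>k\<in>UNIV. \<Sum>l\<in>UNIV.
           A x $ i $ j $ k $ l * weak_pderiv \<Omega> l (\<lambda>z. u z $ k) x
             * weak_pderiv \<Omega> j (\<lambda>z. v z $ i) x)) = f v)"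

definition kron :: "'a \<Rightarrow> 'a \<Rightarrow> real" where
  "kron a b = (if a = b then 1 else 0)"

text \<open>In what follows \<open>G k l p y $ q\<close> stands for $\nabla_{\mathbf R_q} \chi_p^{kl}(y)$.\<close>

definition local_solution ::
    "real ^ 3 ^ 'm::finite \<Rightarrow> (real ^ 'm \<Rightarrow> tensor4)
      \<Rightarrow> (3 \<Rightarrow> 3 \<Rightarrow> 3 \<Rightarrow> real ^ 'm \<Rightarrow> real ^ 3) \<Rightarrow> bool" where
  "local_solution R C G \<longleftrightarrow>
     (\<forall>k l p. is_R_gradient R (G k l p)) \<and>
     (\<forall>k l. \<forall>\<phi>::real ^ 'm \<Rightarrow> real ^ 3. \<phi> \<in> W12_per_vec \<longrightarrow>
        (LINT y|lebesgue_on unit_cell. (\<Sum>i\<in>UNIV. \<Sum>j\<in>UNIV. \<Sum>p\<in>UNIV. \<Sum>q\<in>UNIV.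
           C y $ i $ j $ p $ q * (kron p k * kron q l - G k l p y $ q)
             * R_pderiv R j (\<lambda>z. \<phi> z $ i) y)) = 0)"

definition homogenized_tensor ::
    "(real ^ 'm::finite \<Rightarrow> tensor4) \<Rightarrow> (3 \<Rightarrow> 3 \<Rightarrow> 3 \<Rightarrow> real ^ 'm \<Rightarrow> real ^ 3) \<Rightarrow> tensor4" where
  "homogenized_tensor C G =
     (\<chi> i j k l. LINT y|lebesgue_on unit_cell. (\<Sum>p\<in>UNIV. \<Sum>q\<in>UNIV.
        C y $ i $ j $ p $ q * (kron p k * kron q l - G k l p y $ q)))"

end

theory Submission
  imports Defs
begin

text \<open>
  The proof is the method of oscillating test functions, with the two-scale limits reduced to
  trigonometric polynomials on the torus. A trigonometric polynomial \<open>t\<close> restricted to the cut,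
  \<open>t (R x / \<eta>)\<close>, is a finite sum of plane waves with frequencies \<open>transpose R *v int_vec k / \<eta>\<close>. Since
  \<open>transpose R *v int_vec k\<close> vanishes for \<open>k = 0\<close> only, all waves but the constant one oscillate fast, and an
  integration by parts shows that against \<open>w \<theta>\<close>, with \<open>w\<close> in the Sobolev space and \<open>\<theta>\<close> a test function,
  \<open>t (R x / \<eta>)\<close> may be replaced by its mean with an error \<open>O(\<eta>)\<close> that depends on the Sobolev norm of \<open>w\<close>
  only (\<open>oscillation_estimate\<close>).

  On the cell, the generalised gradients \<open>G\<close> are exactly the fields orthogonal to the
  divergence-free trigonometric fields \<open>divfree R\<close> (\<open>is_R_gradient_iff\<close>), and the trigonometric fields split,
  frequency by frequency, into gradients and divergence-free fields (\<open>trig_Helmholtz\<close>). Together with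
  the completeness of the trigonometric system this gives two density statements:
  generalised gradients are limits of gradients of trigonometric polynomials, and fields orthogonal to
  all these gradients, such as the flux of a local solution, are limits of members of
  \<open>divfree R\<close> (\<open>gradient_approximation\<close>, \<open>divfree_approximation\<close>). Local solutions exist by the Riesz theorem,
  and the homogenized tensor is given by an energy, hence symmetric and coercive (\<open>Ch_form\<close>, \<open>Ch_coercive\<close>).

  For a constant matrix \<open>\<xi>\<close> let \<open>W\<close> be close to \<open>\<xi>\<close> minus the correction belonging to \<open>\<xi>\<close>, with
  trigonometric potentials, and \<open>T\<close> a divergence-free trigonometric field close to the flux of \<open>W\<close>. Testing
  the equation at scale \<open>\<eta>\<close> with \<open>\<theta> \<eta>\<close> times the potentials and using the symmetry of the tensor replaces the
  integral of \<open>\<theta>\<close> times the \<open>\<xi>\<close>-component of the flux of \<open>u \<eta>\<close> by the integral of \<open>\<theta>\<close> times the gradient of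
  \<open>u \<eta>\<close> against the flux of \<open>W\<close> on the cut. Admissibility of the coefficient replaces that flux by
  \<open>T\<close> (\<open>flux_error\<close>), and since \<open>T\<close> is divergence-free on the cut, a further integration by parts and
  the oscillation estimate replace \<open>T\<close> by its mean (\<open>divfree_limit\<close>). So the flux of \<open>u \<eta>\<close> and the homogenized
  tensor applied to its gradient have the same limit against \<open>\<theta>\<close> (\<open>flux_limit\<close>).

  Hence \<open>u \<eta> - u\<^sub>0\<close>, where \<open>u\<^sub>0\<close> solves the homogenized problem, is asymptotically orthogonal to all test fields
  in the homogenized energy product. Every functional on the Sobolev space is represented in this product
  by an element (\<open>dirichlet_exists\<close>) that test fields approximate, and \<open>u \<eta> - u\<^sub>0\<close> is bounded; this is
  weak convergence (\<open>weak_limit\<close>).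
\<close>

section \<open>Smooth functions and test functions\<close>

lemma pdiff_eqI: "(f has_derivative f') (at x) \<Longrightarrow> pdiff i f x = f' (axis i 1)"
  unfolding pdiff_def using frechet_derivative_at by metis

lemma has_derivative_pdiff:
  fixes f :: "real ^ 'n::finite \<Rightarrow> real"
  assumes "f differentiable (at x)"
  shows "(f has_derivative (\<lambda>h. \<Sum>i\<in>UNIV. h $ i * pdiff i f x)) (at x)"
proof -
  have d: "(f has_derivative frechet_derivative f (at x)) (at x)"
    using assms frechet_derivative_works by blast
  then interpret linear "frechet_derivative f (at x)"
    by (simp add: has_derivative_linear)
  have "frechet_derivative f (at x) h = (\<Sum>i\<in>UNIV. h $ i * pdiff i f x)" for h
  proof -
    have "h = (\<Sum>i\<in>UNIV. h $ i *\<^sub>R axis i 1)"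
      by (metis (no_types) basis_expansion scalar_mult_eq_scaleR)
    then have "frechet_derivative f (at x) h = frechet_derivative f (at x) (\<Sum>i\<in>UNIV. h $ i *\<^sub>R axis i 1)"
      by simp
    also have "\<dots> = (\<Sum>i\<in>UNIV. h $ i * pdiff i f x)"
      unfolding pdiff_def by (simp add: sum scale)
    finally show ?thesis .
  qed
  then show ?thesis using d by presburger
qed

lemma pdiff_add:
  "f differentiable (at x) \<Longrightarrow> g differentiable (at x) \<Longrightarrow>
    pdiff i (\<lambda>x. f x + g x) x = pdiff i f x + pdiff i g x"
  by (rule pdiff_eqI[OF has_derivative_add[OF has_derivative_pdiff has_derivative_pdiff],
        THEN trans]) (auto simp: axis_def if_distrib[of "\<lambda>t. t * _"] cong: if_cong)

lemma pdiff_mult: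
  "f differentiable (at x) \<Longrightarrow> g differentiable (at x) \<Longrightarrow>
    pdiff i (\<lambda>x. f x * g x) x = f x * pdiff i g x + pdiff i f x * g x"
  by (rule pdiff_eqI[OF has_derivative_mult[OF has_derivative_pdiff has_derivative_pdiff],
        THEN trans]) (auto simp: axis_def if_distrib[of "\<lambda>t. t * _"] cong: if_cong)

lemma pdiff_const: "pdiff i (\<lambda>x. a) x = 0"
  by (rule pdiff_eqI[OF has_derivative_const])

lemma pdiff_scale:
  "f differentiable (at x) \<Longrightarrow> pdiff i (\<lambda>x. a * f x) x = a * pdiff i f x"
  by (subst pdiff_mult) (auto simp: pdiff_const)

lemma pdiff_chain_inner:
  assumes "(h has_real_derivative h') (at (v \<bullet> x + b))"
  shows "((\<lambda>x. h (v \<bullet> x + b)) has_derivative (\<lambda>d. h' * (v \<bullet> d))) (at x)"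
    and "pdiff i (\<lambda>x. h (v \<bullet> x + b)) x = v $ i * h'"
proof -
  have 1: "((\<lambda>x. v \<bullet> x + b) has_derivative (\<lambda>d. v \<bullet> d)) (at x)"
    by (auto intro!: derivative_eq_intros)
  show 2: "((\<lambda>x. h (v \<bullet> x + b)) has_derivative (\<lambda>d. h' * (v \<bullet> d))) (at x)"
    using has_derivative_compose[OF 1, of h "(*) h'"] assms
    by (simp add: has_field_derivative_def)
  show "pdiff i (\<lambda>x. h (v \<bullet> x + b)) x = v $ i * h'"
    by (subst pdiff_eqI[OF 2]) (simp add: inner_axis)
qed

lemma times_differentiable_Suc_D: "times_differentiable (Suc n) f \<Longrightarrow> times_differentiable n f"
proof (induction n arbitrary: f)
  case 0
  then show ?case
    by (auto simp: continuous_on_eq_continuous_at differentiable_imp_continuous_within)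
next
  case (Suc n)
  then show ?case by auto
qed

lemma times_differentiable_const: "times_differentiable n (\<lambda>x. a)"
proof (induction n arbitrary: a)
  case (Suc n)
  have "pdiff i (\<lambda>x. a) = (\<lambda>x. 0)" for i :: 'a
    by (auto simp: pdiff_const)
  with Suc show ?case by auto
qed auto

lemma times_differentiable_add:
  "times_differentiable n f \<Longrightarrow> times_differentiable n g \<Longrightarrow> times_differentiable n (\<lambda>x. f x + g x)"
proof (induction n arbitrary: f g)
  case (Suc n)
  have "pdiff i (\<lambda>x. f x + g x) = (\<lambda>x. pdiff i f x + pdiff i g x)" for i
    using Suc.prems by (auto simp: pdiff_add)
  with Suc show ?case by auto
qed (auto intro: continuous_intros)

lemma times_differentiable_mult:
  "times_differentiable n f \<Longrightarrow> times_differentiable n g \<Longrightarrow> times_differentiable n (\<lambda>x. f x * g x)"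
proof (induction n arbitrary: f g)
  case (Suc n)
  have "pdiff i (\<lambda>x. f x * g x) = (\<lambda>x. f x * pdiff i g x + pdiff i f x * g x)" for i
    using Suc.prems by (auto simp: pdiff_mult)
  moreover have "times_differentiable n f" "times_differentiable n g"
    using Suc.prems times_differentiable_Suc_D by blast+
  ultimately show ?case
    using Suc by (auto intro!: times_differentiable_add)
qed (auto intro: continuous_intros)

lemma smooth_const: "smooth (\<lambda>x. a)"
  by (simp add: smooth_def times_differentiable_const)

lemma smooth_add: "smooth f \<Longrightarrow> smooth g \<Longrightarrow> smooth (\<lambda>x. f x + g x)"
  by (simp add: smooth_def times_differentiable_add)

lemma smooth_mult: "smooth f \<Longrightarrow> smooth g \<Longrightarrow> smooth (\<lambda>x. f x * g x)"
  by (simp add: smooth_def times_differentiable_mult)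

lemma smooth_prod: "(\<And>i. i \<in> I \<Longrightarrow> smooth (f i)) \<Longrightarrow> smooth (\<lambda>x. \<Prod>i\<in>I. f i x)"
  by (induction I rule: infinite_finite_induct) (auto intro: smooth_const smooth_mult)

lemma smooth_pdiff: "smooth f \<Longrightarrow> smooth (pdiff i f)"
  unfolding smooth_def using times_differentiable.simps(2) by blast

lemma smooth_differentiable: "smooth f \<Longrightarrow> f differentiable (at x)"
  unfolding smooth_def using times_differentiable.simps(2) by blast

lemma smooth_continuous: "smooth f \<Longrightarrow> continuous_on S f"
  unfolding smooth_def by (metis times_differentiable.simps(1) continuous_on_subset subset_UNIV)

text \<open>
  Smoothness is shown by exhibiting a set of differentiable functions closed under partial derivatives.
\<close>

lemma smooth_coinduct:
  assumes "f \<in> S" and "\<And>f. f \<in> S \<Longrightarrow> (\<forall>x. f differentiable (at x)) \<and> (\<forall>i. pdiff i f \<in> S)"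
  shows "smooth f"
proof -
  have "f \<in> S \<Longrightarrow> times_differentiable n f" for n f
  proof (induction n arbitrary: f)
    case 0
    then show ?case using assms(2)
      by (auto simp: continuous_on_eq_continuous_at differentiable_imp_continuous_within)
  next
    case (Suc n)
    then show ?case using assms(2) by auto
  qed
  then show ?thesis using assms(1) by (simp add: smooth_def)
qed

lemma cos_shift_deriv: "((\<lambda>t. a * cos t) has_real_derivative a * cos (t + pi / 2)) (at t)"
  by (auto intro!: derivative_eq_intros simp: cos_add)

lemma pdiff_cos: "pdiff i (\<lambda>x. a * cos (v \<bullet> x + b)) x = a * v $ i * cos (v \<bullet> x + (b + pi / 2))"
  by (rule trans[OF pdiff_chain_inner(2)[OF cos_shift_deriv]]) (simp add: algebra_simps)

lemma smooth_cos: "smooth (\<lambda>x. a * cos (v \<bullet> x + b))"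
proof (rule smooth_coinduct[where S = "range (\<lambda>(a, b) x. a * cos (v \<bullet> x + b))"])
  show "(\<lambda>x. a * cos (v \<bullet> x + b)) \<in> range (\<lambda>(a, b) x. a * cos (v \<bullet> x + b))"
    by (rule image_eqI[of _ _ "(a, b)"]) auto
next
  fix f assume "f \<in> range (\<lambda>(a, b) x. a * cos (v \<bullet> x + b))"
  then obtain a b where f: "f = (\<lambda>x. a * cos (v \<bullet> x + b))" by auto
  have "f differentiable (at x)" for x
    unfolding f using pdiff_chain_inner(1)[OF cos_shift_deriv] by (rule differentiableI)
  moreover have "pdiff i f \<in> range (\<lambda>(a, b) x. a * cos (v \<bullet> x + b))" for i
    by (rule image_eqI[of _ _ "(a * v $ i, b + pi / 2)"]) (auto simp: f pdiff_cos)
  ultimately show "(\<forall>x. f differentiable (at x)) \<and>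
      (\<forall>i. pdiff i f \<in> range (\<lambda>(a, b) x. a * cos (v \<bullet> x + b)))" by blast
qed

text \<open>
  The derivatives of \<open>exp (- 1 / t)\<close> are combinations of the functions \<open>(1 / t) ^ k * exp (- 1 / t)\<close>; treating
  this family as a whole turns smoothness into an induction for all \<open>k\<close> at once.
\<close>

definition flat_exp :: "nat \<Rightarrow> real \<Rightarrow> real" where
  "flat_exp k t = (if t > 0 then (1 / t) ^ k * exp (- (1 / t)) else 0)"

lemma flat_exp_tendsto_0: "(flat_exp k \<longlongrightarrow> 0) (at 0)"
proof -
  have "((\<lambda>t. (1 / t) ^ k / exp (1 / t)) \<longlongrightarrow> 0) (at_right (0::real))"
    using filterlim_compose[OF tendsto_power_div_exp_0[of k] filterlim_inverse_at_top_right]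
    by (simp add: inverse_eq_divide)
  then have "(flat_exp k \<longlongrightarrow> 0) (at_right 0)"
    by (rule Lim_transform_eventually)
      (auto simp: flat_exp_def exp_minus field_simps eventually_at_right[of 0 1] intro!: exI[of _ 1])
  then have "(flat_exp k \<longlongrightarrow> 0) (at 0)" if "(flat_exp k \<longlongrightarrow> 0) (at_left 0)"
    using that filterlim_split_at by blast
  moreover have "(flat_exp k \<longlongrightarrow> 0) (at_left 0)"
    by (rule Lim_transform_eventually[of "\<lambda>_. 0"])
      (auto simp: flat_exp_def eventually_at_left[of "-1" 0] intro!: exI[of _ "-1"])
  ultimately show ?thesis by blast
qed

lemma flat_exp_deriv:
  "(flat_exp k has_real_derivative flat_exp (k + 2) t - of_nat k * flat_exp (k + 1) t) (at t)"
proof -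
  consider "t > 0" | "t < 0" | "t = 0" by linarith
  then show ?thesis
  proof cases
    case 1
    have "((\<lambda>t. (1 / t) ^ k * exp (- (1 / t))) has_real_derivative
       flat_exp (k + 2) t - of_nat k * flat_exp (k + 1) t) (at t)"
      using 1 by (auto intro!: derivative_eq_intros simp: flat_exp_def field_simps power2_eq_square)
         (cases k; auto simp: field_simps)
    then show ?thesis
      by (rule has_field_derivative_transform_within_open[where S = "{0<..}"])
        (use 1 in \<open>auto simp: flat_exp_def\<close>)
  next
    case 2
    have "((\<lambda>t. 0) has_real_derivative flat_exp (k + 2) t - of_nat k * flat_exp (k + 1) t) (at t)"
      using 2 by (auto simp: flat_exp_def)
    then show ?thesis
      by (rule has_field_derivative_transform_within_open[where S = "{..<0}"])
        (use 2 in \<open>auto simp: flat_exp_def\<close>)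
  next
    case 3
    have "((\<lambda>y. (flat_exp k y - flat_exp k 0) / (y - 0)) \<longlongrightarrow> 0) (at 0)"
      by (rule Lim_transform_eventually[OF flat_exp_tendsto_0[of "Suc k"]])
        (auto simp: flat_exp_def field_simps)
    then show ?thesis
      using 3 by (simp add: has_field_derivative_iff flat_exp_def)
  qed
qed

lemma smooth_flat_exp: "smooth (\<lambda>x. flat_exp k (v \<bullet> x + b))"
  unfolding smooth_def
proof
  fix n
  show "times_differentiable n (\<lambda>x. flat_exp k (v \<bullet> x + b))"
  proof (induction n arbitrary: k)
    case 0
    have "continuous_on UNIV (flat_exp k)"
      using flat_exp_deriv by (meson DERIV_isCont continuous_at_imp_continuous_on)
    then show ?case
      by (auto intro!: continuous_on_compose2[of UNIV "flat_exp k"] continuous_intros)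
  next
    case (Suc n)
    have "pdiff i (\<lambda>x. flat_exp k (v \<bullet> x + b)) =
      (\<lambda>x. v $ i * flat_exp (k + 2) (v \<bullet> x + b) + - (v $ i * of_nat k) * flat_exp (k + 1) (v \<bullet> x + b))" for i
      by (rule ext, rule trans[OF pdiff_chain_inner(2)[OF flat_exp_deriv]]) (simp add: algebra_simps)
    moreover have "(\<lambda>x. flat_exp k (v \<bullet> x + b)) differentiable (at x)" for x
      using pdiff_chain_inner(1)[OF flat_exp_deriv] by (rule differentiableI)
    moreover have "times_differentiable n (\<lambda>x. v $ i * flat_exp (k + 2) (v \<bullet> x + b)
        + - (v $ i * of_nat k) * flat_exp (k + 1) (v \<bullet> x + b))" for i
      by (rule times_differentiable_add[OF times_differentiable_mult[OF times_differentiable_const Suc]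
            times_differentiable_mult[OF times_differentiable_const Suc]])
    ultimately show ?case
      unfolding times_differentiable.simps by presburger
  qed
qed

text \<open>
  Any compact set outside of which the function vanishes will do in place of the support.
\<close>

lemma test_functionsI:
  assumes "smooth \<phi>" "compact K" "K \<subseteq> \<Omega>" "\<And>x. x \<notin> K \<Longrightarrow> \<phi> x = 0"
  shows "\<phi> \<in> test_functions \<Omega>"
proof -
  have "closure {x. \<phi> x \<noteq> 0} \<subseteq> K"
    using assms by (intro closure_minimal) (auto intro: compact_imp_closed)
  then show ?thesis
    unfolding test_functions_def using assms
    by (auto intro: bounded_subset dest: compact_imp_bounded)
qed

lemma test_function_smooth: "\<phi> \<in> test_functions \<Omega> \<Longrightarrow> smooth \<phi>"
  by (simp add: test_functions_def)

lemma test_functionE: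
  assumes "\<phi> \<in> test_functions \<Omega>"
  obtains K where "compact K" "K \<subseteq> \<Omega>" "\<forall>x. x \<notin> K \<longrightarrow> \<phi> x = 0"
  using assms closure_subset[of "{x. \<phi> x \<noteq> 0}"] unfolding test_functions_def by blast

lemma test_function_outside: "\<phi> \<in> test_functions \<Omega> \<Longrightarrow> x \<notin> \<Omega> \<Longrightarrow> \<phi> x = 0"
  by (metis test_functionE subsetD)

lemma test_function_mult:
  assumes "\<phi> \<in> test_functions \<Omega>" "smooth g"
  shows "(\<lambda>x. \<phi> x * g x) \<in> test_functions \<Omega>"
proof -
  obtain K where K: "compact K" "K \<subseteq> \<Omega>" "\<forall>x. x \<notin> K \<longrightarrow> \<phi> x = 0"
    using assms(1) by (rule test_functionE)
  then show ?thesis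
    by (intro test_functionsI[of _ K]) (auto intro: smooth_mult assms test_function_smooth)
qed

lemma test_function_scale: "\<phi> \<in> test_functions \<Omega> \<Longrightarrow> (\<lambda>x. a * \<phi> x) \<in> test_functions \<Omega>"
  using test_function_mult[OF _ smooth_const, of \<phi> \<Omega> a] by (simp add: mult.commute)

lemma test_function_add:
  assumes "\<phi> \<in> test_functions \<Omega>" "\<psi> \<in> test_functions \<Omega>"
  shows "(\<lambda>x. \<phi> x + \<psi> x) \<in> test_functions \<Omega>"
proof -
  obtain K where K: "compact K" "K \<subseteq> \<Omega>" "\<forall>x. x \<notin> K \<longrightarrow> \<phi> x = 0"
    using assms(1) by (rule test_functionE)
  obtain L where L: "compact L" "L \<subseteq> \<Omega>" "\<forall>x. x \<notin> L \<longrightarrow> \<psi> x = 0"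
    using assms(2) by (rule test_functionE)
  show ?thesis
    using K L assms
    by (intro test_functionsI[of _ "K \<union> L"]) (auto intro: smooth_add test_function_smooth)
qed

lemma test_function_zero: "(\<lambda>x. 0) \<in> test_functions \<Omega>"
  by (rule test_functionsI[of _ "{}"]) (auto intro: smooth_const)

lemma test_function_pdiff:
  assumes "\<phi> \<in> test_functions \<Omega>"
  shows "pdiff i \<phi> \<in> test_functions \<Omega>"
proof -
  obtain K where K: "compact K" "K \<subseteq> \<Omega>" "\<forall>x. x \<notin> K \<longrightarrow> \<phi> x = 0"
    using assms by (rule test_functionE)
  have "pdiff i \<phi> x = 0" if "x \<notin> K" for x
  proof -
    have "(\<phi> has_derivative (\<lambda>h. 0)) (at x)"
      by (rule has_derivative_transform_within_open[of "\<lambda>x. 0" _ _ UNIV "-K"])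
        (use K that in \<open>auto simp: compact_imp_closed open_Compl\<close>)
    then show ?thesis using pdiff_eqI by blast
  qed
  with K show ?thesis
    by (intro test_functionsI[of _ K]) (auto intro: smooth_pdiff test_function_smooth[OF assms])
qed

text \<open>
  Raising the flat bump \<open>exp (- 1 / s)\<close> to the power \<open>1 / n\<close> amounts to the substitution
  \<open>n s\<close> for \<open>s\<close>, so the bumps below increase to the indicator function of the open box while their
  support stays inside the closed box.
\<close>

definition box_bump :: "real ^ 'n::finite \<Rightarrow> real ^ 'n \<Rightarrow> nat \<Rightarrow> real ^ 'n \<Rightarrow> real" where
  "box_bump a b n x =
     (\<Prod>i\<in>UNIV. flat_exp 0 (real n * (x $ i - a $ i)) * flat_exp 0 (real n * (b $ i - x $ i)))"

lemma box_bump_test_function: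
  assumes "cbox a b \<subseteq> \<Omega>"
  shows "box_bump a b n \<in> test_functions \<Omega>"
proof (rule test_functionsI[OF _ compact_cbox assms])
  have "smooth (\<lambda>x::real^'a. flat_exp 0 (real n * (x $ i - a $ i)))" for i
    using smooth_flat_exp[of 0 "real n *\<^sub>R axis i 1" "- real n * a $ i"]
    by (simp add: inner_axis' algebra_simps)
  moreover have "smooth (\<lambda>x::real^'a. flat_exp 0 (real n * (b $ i - x $ i)))" for i
    using smooth_flat_exp[of 0 "- real n *\<^sub>R axis i 1" "real n * b $ i"]
    by (simp add: inner_axis' algebra_simps)
  ultimately show "smooth (box_bump a b n)"
    unfolding box_bump_def by (intro smooth_prod smooth_mult)
  show "box_bump a b n x = 0" if "x \<notin> cbox a b" for x
    using that unfolding box_bump_def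
    by (auto simp: mem_box_cart flat_exp_def zero_less_mult_iff not_le prod_zero_iff)
      (metis linorder_not_less order_less_imp_le)+
qed

lemma box_bump_bounds: "0 \<le> box_bump a b n x" "box_bump a b n x \<le> 1"
  unfolding box_bump_def
  by (auto intro!: prod_nonneg prod_le_1 mult_le_one simp: flat_exp_def)

lemma box_bump_tendsto:
  "(\<lambda>n. box_bump a b n x) \<longlonglongrightarrow> indicator (box a b) x"
proof (cases "x \<in> box a b")
  case True
  have *: "(\<lambda>n. flat_exp 0 (real n * s)) \<longlonglongrightarrow> 1" if "s > 0" for s
  proof -
    have "(\<lambda>n. 1 / s * inverse (real n)) \<longlonglongrightarrow> 1 / s * 0"
      by (rule tendsto_mult[OF tendsto_const lim_inverse_n])
    then have "(\<lambda>n. exp (- (1 / (real n * s)))) \<longlonglongrightarrow> exp (- 0)"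
      by (intro tendsto_exp tendsto_minus) (simp add: field_simps)
    then have "(\<lambda>n. exp (- (1 / (real n * s)))) \<longlonglongrightarrow> 1" by simp
    then show ?thesis
      by (rule Lim_transform_eventually)
        (use that in \<open>auto simp: flat_exp_def eventually_sequentially intro!: exI[of _ 1]\<close>)
  qed
  have "(\<lambda>n. box_bump a b n x) \<longlonglongrightarrow> (\<Prod>i\<in>(UNIV::'a set). 1 * 1)"
    unfolding box_bump_def using True
    by (intro tendsto_prod tendsto_mult *) (auto simp: mem_box_cart)
  then show ?thesis using True by simp
next
  case False
  then have "box_bump a b n x = 0" for n
    unfolding box_bump_def
    by (auto simp: mem_box_cart flat_exp_def zero_less_mult_iff not_less prod_zero_iff)
      (metis linorder_not_less order_less_imp_le)+
  then show ?thesis using False by simp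
qed

section \<open>Square integrable fields\<close>

text \<open>
  The values lie in a Euclidean space, which covers displacements, their gradients, tensors, and
  pairs of these in a single theory.
\<close>

definition L2v :: "'a measure \<Rightarrow> ('a \<Rightarrow> 'b::euclidean_space) set" where
  "L2v M = {f. f \<in> borel_measurable M \<and> integrable M (\<lambda>x. (norm (f x))\<^sup>2)}"

definition L2ip :: "'a measure \<Rightarrow> ('a \<Rightarrow> 'b::euclidean_space) \<Rightarrow> ('a \<Rightarrow> 'b) \<Rightarrow> real" where
  "L2ip M f g = (LINT x|M. f x \<bullet> g x)"

definition L2norm :: "'a measure \<Rightarrow> ('a \<Rightarrow> 'b::euclidean_space) \<Rightarrow> real" where
  "L2norm M f = sqrt (LINT x|M. (norm (f x))\<^sup>2)"

lemma L2v_real: "L2v M = L2 M"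
  by (simp add: L2v_def L2_def)

lemma L2v_measurable: "f \<in> L2v M \<Longrightarrow> f \<in> borel_measurable M"
  by (simp add: L2v_def)

lemma L2norm_nonneg [simp]: "0 \<le> L2norm M f"
  by (simp add: L2norm_def)

lemma L2norm_power2: "(L2norm M f)\<^sup>2 = (LINT x|M. (norm (f x))\<^sup>2)"
  by (simp add: L2norm_def)

lemma L2ip_self: "L2ip M f f = (L2norm M f)\<^sup>2"
  by (simp add: L2norm_power2 L2ip_def power2_norm_eq_inner)

lemma L2ip_commute: "L2ip M f g = L2ip M g f"
  by (simp add: L2ip_def inner_commute)

lemma L2v_inner_integrable:
  assumes "f \<in> L2v M" "g \<in> L2v M"
  shows "integrable M (\<lambda>x. f x \<bullet> g x)"
proof (rule Bochner_Integration.integrable_bound)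
  show "integrable M (\<lambda>x. (norm (f x))\<^sup>2 + (norm (g x))\<^sup>2)"
    using assms by (auto simp: L2v_def)
  show "(\<lambda>x. f x \<bullet> g x) \<in> borel_measurable M"
    using assms by (auto simp: L2v_def)
  have "norm (f x \<bullet> g x) \<le> norm ((norm (f x))\<^sup>2 + (norm (g x))\<^sup>2)" for x
  proof -
    have "\<bar>f x \<bullet> g x\<bar> \<le> norm (f x) * norm (g x)"
      by (rule Cauchy_Schwarz_ineq2)
    also have "\<dots> \<le> (norm (f x))\<^sup>2 + (norm (g x))\<^sup>2"
      using sum_squares_bound[of "norm (f x)" "norm (g x)"]
        mult_nonneg_nonneg[OF norm_ge_zero[of "f x"] norm_ge_zero[of "g x"]] by linarith
    finally show ?thesis by simp
  qed
  then show "AE x in M. norm (f x \<bullet> g x) \<le> norm ((norm (f x))\<^sup>2 + (norm (g x))\<^sup>2)" by simp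
qed

text \<open>
  This is how membership and norm bounds are obtained for products with bounded factors,
  components and linear images.
\<close>

lemma L2v_dominated:
  fixes f :: "'a \<Rightarrow> 'b::euclidean_space" and h :: "'a \<Rightarrow> 'c::euclidean_space"
  assumes f: "f \<in> L2v M" and h: "h \<in> borel_measurable M"
    and le: "AE x in M. norm (h x) \<le> K * norm (f x)" and K: "K \<ge> 0"
  shows "h \<in> L2v M" and "L2norm M h \<le> K * L2norm M f"
proof -
  have le2: "AE x in M. (norm (h x))\<^sup>2 \<le> K\<^sup>2 * (norm (f x))\<^sup>2"
    using le
  proof eventually_elim
    case (elim x)
    then show ?case using power_mono[OF elim norm_ge_zero, of 2] by (simp add: power_mult_distrib)
  qed
  have int: "integrable M (\<lambda>x. K\<^sup>2 * (norm (f x))\<^sup>2)"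
    using f by (auto simp: L2v_def)
  have int': "integrable M (\<lambda>x. (norm (h x))\<^sup>2)"
    by (rule Bochner_Integration.integrable_bound[OF int]) (use h le2 in auto)
  then show "h \<in> L2v M" using h by (auto simp: L2v_def)
  have "(LINT x|M. (norm (h x))\<^sup>2) \<le> (LINT x|M. K\<^sup>2 * (norm (f x))\<^sup>2)"
    by (rule integral_mono_AE[OF int' int le2])
  then have "sqrt (LINT x|M. (norm (h x))\<^sup>2) \<le> sqrt (K\<^sup>2 * (LINT x|M. (norm (f x))\<^sup>2))"
    by simp
  then show "L2norm M h \<le> K * L2norm M f"
    using K by (simp add: L2norm_def real_sqrt_mult)
qed

lemma L2v_scale:
  assumes "f \<in> L2v M"
  shows "(\<lambda>x. a *\<^sub>R f x) \<in> L2v M"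
  by (rule L2v_dominated(1)[OF assms, where K = "\<bar>a\<bar>"])
    (use assms in \<open>auto intro: borel_measurable_scaleR simp: L2v_def\<close>)

lemma L2v_add:
  assumes "f \<in> L2v M" "g \<in> L2v M"
  shows "(\<lambda>x. f x + g x) \<in> L2v M"
proof -
  have [measurable]: "f \<in> borel_measurable M" "g \<in> borel_measurable M"
    using assms by (auto simp: L2v_def)
  have "integrable M (\<lambda>x. (norm (f x))\<^sup>2 + (norm (g x))\<^sup>2 + 2 * (f x \<bullet> g x))"
    using assms L2v_inner_integrable[OF assms] by (auto simp: L2v_def)
  then have "integrable M (\<lambda>x. (norm (f x + g x))\<^sup>2)"
    by (simp add: power2_norm_eq_inner algebra_simps inner_commute)
  then show ?thesis by (auto simp: L2v_def)
qed

lemma L2v_lin: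
  "f \<in> L2v M \<Longrightarrow> g \<in> L2v M \<Longrightarrow> (\<lambda>x. a *\<^sub>R f x + b *\<^sub>R g x) \<in> L2v M"
  by (intro L2v_add L2v_scale)

lemma L2v_diff: "f \<in> L2v M \<Longrightarrow> g \<in> L2v M \<Longrightarrow> (\<lambda>x. f x - g x) \<in> L2v M"
  using L2v_lin[of f M g 1 "-1"] by simp

lemma L2v_zero: "(\<lambda>x. 0) \<in> L2v M"
  by (auto simp: L2v_def)

lemma L2v_sum: "(\<And>i. i \<in> I \<Longrightarrow> f i \<in> L2v M) \<Longrightarrow> (\<lambda>x. \<Sum>i\<in>I. f i x) \<in> L2v M"
  by (induction I rule: infinite_finite_induct) (auto intro: L2v_zero L2v_add)

lemma L2v_integrable_norm:
  assumes "finite_measure M" "f \<in> L2v M"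
  shows "integrable M (\<lambda>x. norm (f x))"
proof -
  interpret finite_measure M by fact
  have "(\<lambda>x. 1::real) \<in> L2v M"
    by (auto simp: L2v_def)
  moreover have "(\<lambda>x. norm (f x)) \<in> L2v M"
    using assms by (auto simp: L2v_def)
  ultimately show ?thesis
    using L2v_inner_integrable[of "\<lambda>x. norm (f x)" M "\<lambda>x. 1"] by simp
qed

lemma L2v_integrable:
  assumes "finite_measure M" "f \<in> L2v M"
  shows "integrable M f"
  using L2v_integrable_norm[OF assms] assms(2)
  by (simp add: L2v_def integrable_norm_iff)

lemma L2v_bounded:
  assumes "finite_measure M" "f \<in> borel_measurable M" "AE x in M. norm (f x) \<le> K"
  shows "f \<in> L2v M"
proof -
  interpret finite_measure M by fact
  have "(\<lambda>x. 1::real) \<in> L2v M"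
    by (auto simp: L2v_def)
  moreover have "AE x in M. norm (f x) \<le> max K 0 * norm (1::real)"
    using assms(3) by eventually_elim auto
  ultimately show ?thesis
    by (rule L2v_dominated(1)[OF _ assms(2)]) auto
qed

lemma quadratic_nonneg_discriminant:
  fixes a b d :: real
  assumes "\<And>t. 0 \<le> a + 2 * t * d + t\<^sup>2 * b" "b \<ge> 0"
  shows "d\<^sup>2 \<le> a * b"
proof (cases "b = 0")
  case True
  have "d = 0"
  proof (rule ccontr)
    assume "d \<noteq> 0"
    then show False using assms(1)[of "- (a + 1) / (2 * d)"] True by (simp add: field_simps)
  qed
  then show ?thesis using True by simp
next
  case False
  then have "b > 0" using assms(2) by simp
  have "0 \<le> a + 2 * (- d / b) * d + (- d / b)\<^sup>2 * b" by (rule assms(1))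
  then have "0 \<le> (a + 2 * (- d / b) * d + (- d / b)\<^sup>2 * b) * b"
    using \<open>b > 0\<close> by simp
  also have "\<dots> = a * b - d\<^sup>2"
    using \<open>b > 0\<close> by (simp add: field_simps power2_eq_square)
  finally show ?thesis by simp
qed

lemma L2norm_lin_power2:
  assumes "f \<in> L2v M" "g \<in> L2v M"
  shows "(L2norm M (\<lambda>x. f x + t *\<^sub>R g x))\<^sup>2 = (L2norm M f)\<^sup>2 + 2 * t * L2ip M f g + t\<^sup>2 * (L2norm M g)\<^sup>2"
proof -
  have "(norm (f x + t *\<^sub>R g x))\<^sup>2
      = (norm (f x))\<^sup>2 + (2 * t * (f x \<bullet> g x) + t\<^sup>2 * (norm (g x))\<^sup>2)" for x
    by (simp only: power2_norm_eq_inner) (simp add: inner_add_left inner_add_right inner_commute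
        power2_eq_square[of t] algebra_simps)
  then have "(L2norm M (\<lambda>x. f x + t *\<^sub>R g x))\<^sup>2
      = (LINT x|M. (norm (f x))\<^sup>2 + (2 * t * (f x \<bullet> g x) + t\<^sup>2 * (norm (g x))\<^sup>2))"
    by (simp add: L2norm_power2)
  then show ?thesis
    using assms L2v_inner_integrable[OF assms]
    by (simp add: L2norm_power2 L2ip_def L2v_def)
qed

lemma L2ip_Cauchy_Schwarz:
  assumes "f \<in> L2v M" "g \<in> L2v M"
  shows "\<bar>L2ip M f g\<bar> \<le> L2norm M f * L2norm M g"
proof -
  have "(L2ip M f g)\<^sup>2 \<le> (L2norm M f)\<^sup>2 * (L2norm M g)\<^sup>2"
    by (rule quadratic_nonneg_discriminant)
      (use L2norm_lin_power2[OF assms] in \<open>metis zero_le_power2\<close>, simp)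
  then show ?thesis
    by (metis abs_le_square_iff abs_of_nonneg mult_nonneg_nonneg L2norm_nonneg power_mult_distrib)
qed

lemma L2norm_triangle:
  assumes "f \<in> L2v M" "g \<in> L2v M"
  shows "L2norm M (\<lambda>x. f x + g x) \<le> L2norm M f + L2norm M g"
proof (rule power2_le_imp_le)
  have "(L2norm M (\<lambda>x. f x + g x))\<^sup>2 = (L2norm M f)\<^sup>2 + 2 * L2ip M f g + (L2norm M g)\<^sup>2"
    using L2norm_lin_power2[OF assms, of 1] by simp
  also have "\<dots> \<le> (L2norm M f + L2norm M g)\<^sup>2"
    using L2ip_Cauchy_Schwarz[OF assms] by (simp add: power2_sum)
  finally show "(L2norm M (\<lambda>x. f x + g x))\<^sup>2 \<le> (L2norm M f + L2norm M g)\<^sup>2" .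
qed simp

lemma L2norm_scale: "L2norm M (\<lambda>x. a *\<^sub>R f x) = \<bar>a\<bar> * L2norm M f"
  by (simp add: L2norm_def power_mult_distrib real_sqrt_mult)

lemma L2norm_minus_commute: "L2norm M (\<lambda>x. f x - g x) = L2norm M (\<lambda>x. g x - f x)"
  by (simp add: L2norm_def norm_minus_commute)

lemma L2norm_cong_AE:
  assumes "f \<in> borel_measurable M" "g \<in> borel_measurable M" "AE x in M. f x = g x"
  shows "L2norm M f = L2norm M g"
proof -
  have "(LINT x|M. (norm (f x))\<^sup>2) = (LINT x|M. (norm (g x))\<^sup>2)"
    using assms by (intro integral_cong_AE) auto
  then show ?thesis by (simp add: L2norm_def)
qed

lemma L2norm_eq_0_AE:
  assumes "f \<in> L2v M" "L2norm M f = 0"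
  shows "AE x in M. f x = 0"
proof -
  have "(LINT x|M. (norm (f x))\<^sup>2) = 0" using assms(2) by (simp add: L2norm_def)
  then have "AE x in M. (norm (f x))\<^sup>2 = 0"
    using assms(1) by (subst (asm) integral_nonneg_eq_0_iff_AE) (auto simp: L2v_def)
  then show ?thesis by simp
qed

lemma L2ip_lin:
  assumes "f \<in> L2v M" "g \<in> L2v M" "h \<in> L2v M"
  shows "L2ip M (\<lambda>x. a *\<^sub>R f x + b *\<^sub>R g x) h = a * L2ip M f h + b * L2ip M g h"
  using L2v_inner_integrable[OF assms(1,3)] L2v_inner_integrable[OF assms(2,3)]
  by (simp add: L2ip_def inner_add_left)

lemma L2ip_sum_left:
  fixes f :: "'i \<Rightarrow> 'a \<Rightarrow> 'b::euclidean_space"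
  assumes "\<And>i. i \<in> I \<Longrightarrow> f i \<in> L2v M" "g \<in> L2v M"
  shows "L2ip M (\<lambda>x. \<Sum>i\<in>I. f i x) g = (\<Sum>i\<in>I. L2ip M (f i) g)"
  unfolding L2ip_def inner_sum_left
  by (intro Bochner_Integration.integral_sum L2v_inner_integrable assms)

lemma L2ip_diff:
  assumes "f \<in> L2v M" "g \<in> L2v M" "h \<in> L2v M"
  shows "L2ip M (\<lambda>x. f x - g x) h = L2ip M f h - L2ip M g h"
  using L2ip_lin[OF assms, of 1 "-1"] by simp

lemma L2norm_tendsto:
  assumes f: "\<And>n. f n \<in> L2v M" "g \<in> L2v M" and lim: "(\<lambda>n. L2norm M (\<lambda>x. f n x - g x)) \<longlonglongrightarrow> 0"
  shows "(\<lambda>n. L2norm M (f n)) \<longlonglongrightarrow> L2norm M g"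
proof (rule LIM_zero_cancel, rule Lim_null_comparison[OF _ lim], rule always_eventually, rule allI)
  fix n
  have "L2norm M (f n) \<le> L2norm M (\<lambda>x. f n x - g x) + L2norm M g"
    using L2norm_triangle[OF L2v_diff[OF f] f(2)] by simp
  moreover have "L2norm M g \<le> L2norm M (\<lambda>x. g x - f n x) + L2norm M (f n)"
    using L2norm_triangle[OF L2v_diff[OF f(2) f(1)[of n]] f(1)[of n]] by simp
  ultimately show "norm (L2norm M (f n) - L2norm M g) \<le> L2norm M (\<lambda>x. f n x - g x)"
    by (simp add: L2norm_minus_commute[of M g])
qed

lemma L2ip_tendsto:
  assumes f: "\<And>n. f n \<in> L2v M" "g \<in> L2v M" and lim: "(\<lambda>n. L2norm M (\<lambda>x. f n x - g x)) \<longlonglongrightarrow> 0"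
    and h: "h \<in> L2v M"
  shows "(\<lambda>n. L2ip M (f n) h) \<longlonglongrightarrow> L2ip M g h"
proof (rule LIM_zero_cancel, rule Lim_null_comparison)
  show "(\<lambda>n. L2norm M (\<lambda>x. f n x - g x) * L2norm M h) \<longlonglongrightarrow> 0"
    using tendsto_mult_left_zero[OF lim] .
  have "norm (L2ip M (f n) h - L2ip M g h) \<le> L2norm M (\<lambda>x. f n x - g x) * L2norm M h" for n
    using L2ip_Cauchy_Schwarz[OF L2v_diff[OF f] h] L2ip_diff[OF f h] by simp
  then show "\<forall>\<^sub>F n in sequentially. norm (L2ip M (f n) h - L2ip M g h) \<le> L2norm M (\<lambda>x. f n x - g x) * L2norm M h"
    by simp
qed

lemma norm_integral_le_L2norm:
  assumes "finite_measure M" "f \<in> L2v M"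
  shows "(LINT x|M. norm (f x)) \<le> sqrt (measure M (space M)) * L2norm M f"
proof -
  interpret finite_measure M by fact
  have 1: "(\<lambda>x. 1::real) \<in> L2v M"
    by (auto simp: L2v_def)
  have 2: "(\<lambda>x. norm (f x)) \<in> L2v M"
    using assms by (auto simp: L2v_def)
  show ?thesis
    using L2ip_Cauchy_Schwarz[OF 2 1] by (simp add: L2ip_def L2norm_def mult.commute)
qed

text \<open>On a finite measure space mean-square Cauchy sequences are Cauchy in the mean, hence
  a subsequence converges almost everywhere; Fatou's lemma makes its limit the mean-square limit.\<close>

lemma L2v_complete:
  fixes f :: "nat \<Rightarrow> 'a \<Rightarrow> 'b::euclidean_space"
  assumes fin: "finite_measure M" and f: "\<And>n. f n \<in> L2v M"
    and cauchy: "\<And>e. e > 0 \<Longrightarrow> \<exists>N. \<forall>i\<ge>N. \<forall>j\<ge>N. L2norm M (\<lambda>x. f i x - f j x) < e"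
  shows "\<exists>g\<in>L2v M. (\<lambda>n. L2norm M (\<lambda>x. f n x - g x)) \<longlonglongrightarrow> 0"
proof -
  interpret finite_measure M by fact
  have [measurable]: "f n \<in> borel_measurable M" for n
    using f by (auto simp: L2v_def)
  define m where "m = sqrt (measure M (space M)) + 1"
  have m: "m > 0" by (simp add: m_def add_nonneg_pos)
  have "\<exists>N. \<forall>i\<ge>N. \<forall>j\<ge>N. (LINT x|M. norm (f i x - f j x)) < e" if e: "e > 0" for e
  proof -
    obtain N where N: "\<forall>i\<ge>N. \<forall>j\<ge>N. L2norm M (\<lambda>x. f i x - f j x) < e / m"
      using cauchy[of "e / m"] e m by auto
    have "(LINT x|M. norm (f i x - f j x)) < e" if "i \<ge> N" "j \<ge> N" for i j
    proof -
      have "(LINT x|M. norm (f i x - f j x)) \<le> sqrt (measure M (space M)) * L2norm M (\<lambda>x. f i x - f j x)"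
        by (rule norm_integral_le_L2norm[OF fin L2v_diff[OF f f]])
      also have "\<dots> \<le> m * L2norm M (\<lambda>x. f i x - f j x)"
        by (intro mult_right_mono) (auto simp: m_def)
      also have "\<dots> < m * (e / m)"
        using N that m by (intro mult_strict_left_mono) auto
      finally show ?thesis using m by simp
    qed
    then show ?thesis by blast
  qed
  then obtain r where r: "strict_mono r" "AE x in M. Cauchy (\<lambda>i. f (r i) x)"
    using cauchy_L1_AE_cauchy_subseq[of M f] L2v_integrable[OF fin f] by metis
  define g where "g = (\<lambda>x. lim (\<lambda>i. f (r i) x))"
  have g[measurable]: "g \<in> borel_measurable M"
    unfolding g_def by (rule borel_measurable_lim_metric) simp
  have lim: "AE x in M. (\<lambda>i. f (r i) x) \<longlonglongrightarrow> g x"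
    using r(2) by eventually_elim (simp add: g_def Cauchy_convergent convergent_LIMSEQ_iff[symmetric])
  have est: "\<exists>N. \<forall>i\<ge>N. (\<lambda>x. f i x - g x) \<in> L2v M \<and> L2norm M (\<lambda>x. f i x - g x) \<le> e" if e: "e > 0" for e
  proof -
    obtain N where N: "\<forall>i\<ge>N. \<forall>j\<ge>N. L2norm M (\<lambda>x. f i x - f j x) < e"
      using cauchy[OF e] by auto
    have "(\<lambda>x. f i x - g x) \<in> L2v M \<and> L2norm M (\<lambda>x. f i x - g x) \<le> e" if i: "i \<ge> N" for i
    proof -
      have "(\<integral>\<^sup>+x. ennreal ((norm (f i x - g x))\<^sup>2) \<partial>M)
          \<le> (\<integral>\<^sup>+x. liminf (\<lambda>j. ennreal ((norm (f i x - f (r j) x))\<^sup>2)) \<partial>M)"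
      proof (rule nn_integral_mono_AE)
        show "AE x in M. ennreal ((norm (f i x - g x))\<^sup>2)
            \<le> liminf (\<lambda>j. ennreal ((norm (f i x - f (r j) x))\<^sup>2))"
          using lim
        proof eventually_elim
          case (elim x)
          have "(\<lambda>j. ennreal ((norm (f i x - f (r j) x))\<^sup>2)) \<longlonglongrightarrow> ennreal ((norm (f i x - g x))\<^sup>2)"
            by (intro tendsto_ennrealI tendsto_intros elim)
          from lim_imp_Liminf[OF sequentially_bot this] show ?case by (rule eq_refl[OF sym])
        qed
      qed
      also have "\<dots> \<le> liminf (\<lambda>j. \<integral>\<^sup>+x. ennreal ((norm (f i x - f (r j) x))\<^sup>2) \<partial>M)"
        by (rule nn_integral_liminf) simp
      also have "\<dots> \<le> ennreal (e\<^sup>2)"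
      proof (rule Liminf_le)
        show "\<forall>\<^sub>F j in sequentially. (\<integral>\<^sup>+x. ennreal ((norm (f i x - f (r j) x))\<^sup>2) \<partial>M) \<le> ennreal (e\<^sup>2)"
          using eventually_ge_at_top[of N]
        proof eventually_elim
          case (elim j)
          then have "r j \<ge> N" using seq_suble[OF r(1), of j] by simp
          then have "L2norm M (\<lambda>x. f i x - f (r j) x) < e" using N i by auto
          then have "(L2norm M (\<lambda>x. f i x - f (r j) x))\<^sup>2 \<le> e\<^sup>2"
            by (intro power_mono) auto
          moreover have "(\<integral>\<^sup>+x. ennreal ((norm (f i x - f (r j) x))\<^sup>2) \<partial>M)
              = ennreal ((L2norm M (\<lambda>x. f i x - f (r j) x))\<^sup>2)"
            unfolding L2norm_power2
            using L2v_diff[OF f f, of i "r j"] by (intro nn_integral_eq_integral) (auto simp: L2v_def)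
          ultimately show ?case by (simp add: ennreal_leI)
        qed
      qed simp
      finally have fin_int: "(\<integral>\<^sup>+x. ennreal ((norm (f i x - g x))\<^sup>2) \<partial>M) \<le> ennreal (e\<^sup>2)" .
      have int: "integrable M (\<lambda>x. (norm (f i x - g x))\<^sup>2)"
      proof (rule integrableI_bounded)
        show "(\<integral>\<^sup>+x. ennreal (norm ((norm (f i x - g x))\<^sup>2)) \<partial>M) < \<infinity>"
          using le_less_trans[OF fin_int ennreal_less_top] by simp
      qed simp
      have "ennreal ((L2norm M (\<lambda>x. f i x - g x))\<^sup>2) \<le> ennreal (e\<^sup>2)"
        unfolding L2norm_power2 using nn_integral_eq_integral[OF int] fin_int by simp
      then have "(L2norm M (\<lambda>x. f i x - g x))\<^sup>2 \<le> e\<^sup>2"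
        by (subst (asm) ennreal_le_iff) (rule zero_le_power2)
      then have "L2norm M (\<lambda>x. f i x - g x) \<le> e"
        by (rule power2_le_imp_le) (use e in simp)
      then show ?thesis using int by (simp add: L2v_def)
    qed
    then show ?thesis by blast
  qed
  obtain N where "(\<lambda>x. f N x - g x) \<in> L2v M" using est[of 1] by auto
  from L2v_diff[OF f[of N] this] have "g \<in> L2v M" by simp
  moreover have "(\<lambda>n. L2norm M (\<lambda>x. f n x - g x)) \<longlonglongrightarrow> 0"
  proof (rule LIMSEQ_I)
    fix e :: real assume "e > 0"
    then obtain N where "\<forall>i\<ge>N. L2norm M (\<lambda>x. f i x - g x) \<le> e / 2"
      using est[of "e / 2"] by auto
    then show "\<exists>no. \<forall>n\<ge>no. norm (L2norm M (\<lambda>x. f n x - g x) - 0) < e"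
      using \<open>e > 0\<close> by (intro exI[of _ N]) force
  qed
  ultimately show ?thesis by blast
qed

text \<open>
  The Riesz representation theorem on the closure of a subspace. A minimising sequence of
  \<open>B v v - 2 l v\<close> is Cauchy by the parallelogram identity, and being an almost minimiser it
  almost satisfies the Euler equation.
\<close>

lemma Riesz_on_subspace:
  fixes V :: "('a \<Rightarrow> 'b::euclidean_space) set"
  assumes fin: "finite_measure M" and V: "V \<subseteq> L2v M" "V \<noteq> {}"
    and V_lin: "\<And>a b v w. v \<in> V \<Longrightarrow> w \<in> V \<Longrightarrow> (\<lambda>x. a *\<^sub>R v x + b *\<^sub>R w x) \<in> V"
    and B_lin: "\<And>a b u v w. u \<in> L2v M \<Longrightarrow> v \<in> L2v M \<Longrightarrow> w \<in> L2v M \<Longrightarrow>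
      B (\<lambda>x. a *\<^sub>R u x + b *\<^sub>R v x) w = a * B u w + b * B v w"
    and B_sym: "\<And>u v. u \<in> L2v M \<Longrightarrow> v \<in> L2v M \<Longrightarrow> B u v = B v u"
    and B_bound: "\<And>u v. u \<in> L2v M \<Longrightarrow> v \<in> L2v M \<Longrightarrow> \<bar>B u v\<bar> \<le> K * L2norm M u * L2norm M v"
    and B_coercive: "\<And>v. v \<in> V \<Longrightarrow> c * (L2norm M v)\<^sup>2 \<le> B v v" and c: "c > 0"
    and l_lin: "\<And>a b v w. v \<in> V \<Longrightarrow> w \<in> V \<Longrightarrow> l (\<lambda>x. a *\<^sub>R v x + b *\<^sub>R w x) = a * l v + b * l w"
    and l_bound: "\<And>v. v \<in> V \<Longrightarrow> \<bar>l v\<bar> \<le> L * L2norm M v"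
  shows "\<exists>F H. (\<forall>n. F n \<in> V) \<and> H \<in> L2v M \<and> (\<lambda>n. L2norm M (\<lambda>x. F n x - H x)) \<longlonglongrightarrow> 0 \<and>
    (\<forall>w\<in>V. B H w = l w)"
proof -
  have VL: "v \<in> V \<Longrightarrow> v \<in> L2v M" for v using V by auto
  define J where "J = (\<lambda>v. B v v - 2 * l v)"
  (* completing the square shows that the functional is bounded below *)
  have J_lower: "- (L\<^sup>2 / c) \<le> J v" if v: "v \<in> V" for v
  proof -
    have "c * J v \<ge> c * (c * (L2norm M v)\<^sup>2 - 2 * (L * L2norm M v))"
      using B_coercive[OF v] l_bound[OF v] c unfolding J_def by (intro mult_left_mono) auto
    also have "c * (c * (L2norm M v)\<^sup>2 - 2 * (L * L2norm M v)) = (c * L2norm M v - L)\<^sup>2 - L\<^sup>2"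
      by (simp add: power2_eq_square algebra_simps)
    also have "\<dots> \<ge> - L\<^sup>2" by simp
    finally show ?thesis using c by (simp add: field_simps)
  qed
  define m where "m = (INF v\<in>V. J v)"
  have bdd: "bdd_below (J ` V)" using J_lower by (auto intro!: bdd_belowI[of _ "- (L\<^sup>2 / c)"])
  have m_le: "m \<le> J v" if "v \<in> V" for v
    unfolding m_def using that bdd by (rule cINF_lower[rotated])
  have "\<exists>v\<in>V. J v < m + e" if "e > 0" for e
    using cINF_less_iff[OF V(2) bdd, of "m + e"] that unfolding m_def by auto
  then have "\<forall>n. \<exists>v\<in>V. J v < m + (1 / real (Suc n))\<^sup>2" by simp
  then obtain F where F: "\<And>n. F n \<in> V" "\<And>n. J (F n) < m + (1 / real (Suc n))\<^sup>2"
    by metis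
  have B_expand: "B (\<lambda>x. a *\<^sub>R v x + b *\<^sub>R w x) (\<lambda>x. a *\<^sub>R v x + b *\<^sub>R w x)
      = a\<^sup>2 * B v v + 2 * a * b * B v w + b\<^sup>2 * B w w" if "v \<in> V" "w \<in> V" for a b v w
  proof -
    note L = VL[OF that(1)] VL[OF that(2)] VL[OF V_lin[OF that]]
    have "B (\<lambda>x. a *\<^sub>R v x + b *\<^sub>R w x) (\<lambda>x. a *\<^sub>R v x + b *\<^sub>R w x)
        = a * B (\<lambda>x. a *\<^sub>R v x + b *\<^sub>R w x) v + b * B (\<lambda>x. a *\<^sub>R v x + b *\<^sub>R w x) w"
      using B_lin[OF L(1,2) L(3)] B_sym[OF L(1) L(3)] B_sym[OF L(2) L(3)] by simp
    also have "\<dots> = a * (a * B v v + b * B w v) + b * (a * B v w + b * B w w)"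
      using B_lin[OF L(1,2) L(1)] B_lin[OF L(1,2) L(2)] by simp
    finally show ?thesis using B_sym[OF L(1,2)] by (simp add: power2_eq_square algebra_simps)
  qed
  have euler: "(B (F n) w - l w)\<^sup>2 \<le> (1 / real (Suc n))\<^sup>2 * B w w" if w: "w \<in> V" for n w
  proof (rule quadratic_nonneg_discriminant)
    show "0 \<le> B w w"
      using B_coercive[OF w] c by (meson mult_nonneg_nonneg order.trans less_imp_le zero_le_power2)
    fix t
    have "m \<le> J (\<lambda>x. 1 *\<^sub>R F n x + t *\<^sub>R w x)"
      by (rule m_le[OF V_lin[OF F(1) w]])
    also have "\<dots> = J (F n) + 2 * t * (B (F n) w - l w) + t\<^sup>2 * B w w"
      unfolding J_def B_expand[OF F(1) w] l_lin[OF F(1) w] by (simp add: algebra_simps)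
    finally show "0 \<le> (1 / real (Suc n))\<^sup>2 + 2 * t * (B (F n) w - l w) + t\<^sup>2 * B w w"
      using F(2)[of n] by linarith
  qed
  have cauchy: "c * (L2norm M (\<lambda>x. F i x - F j x))\<^sup>2 \<le> 2 * ((1 / real (Suc i))\<^sup>2 + (1 / real (Suc j))\<^sup>2)" for i j
  proof -
    have "c * (L2norm M (\<lambda>x. 1 *\<^sub>R F i x + (-1) *\<^sub>R F j x))\<^sup>2 \<le> B (F i) (F i) - 2 * B (F i) (F j) + B (F j) (F j)"
      using B_coercive[OF V_lin[OF F(1) F(1)], of 1 i "-1" j] B_expand[OF F(1) F(1), of 1 i "-1" j] by simp
    also have "\<dots> = 2 * J (F i) + 2 * J (F j) - 4 * J (\<lambda>x. (1/2) *\<^sub>R F i x + (1/2) *\<^sub>R F j x)"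
      unfolding J_def B_expand[OF F(1) F(1)] l_lin[OF F(1) F(1)] by (simp add: power2_eq_square algebra_simps)
    also have "\<dots> \<le> 2 * ((1 / real (Suc i))\<^sup>2 + (1 / real (Suc j))\<^sup>2)"
      using F(2)[of i] F(2)[of j] m_le[OF V_lin[OF F(1) F(1)], of "1/2" i "1/2" j] by argo
    finally show ?thesis by simp
  qed
  have "\<exists>H\<in>L2v M. (\<lambda>n. L2norm M (\<lambda>x. F n x - H x)) \<longlonglongrightarrow> 0"
  proof (rule L2v_complete[OF fin VL[OF F(1)]])
    fix e :: real assume e: "e > 0"
    have "(\<lambda>n. 4 * (inverse (real (Suc n)))\<^sup>2) \<longlonglongrightarrow> 4 * 0\<^sup>2"
      by (intro tendsto_intros LIMSEQ_inverse_real_of_nat)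
    then have "\<forall>\<^sub>F n in sequentially. 4 * (inverse (real (Suc n)))\<^sup>2 < c * e\<^sup>2"
      using c e by (intro order_tendstoD(2)[where y = "4 * 0\<^sup>2"]) auto
    then obtain N where N: "4 * (inverse (real (Suc N)))\<^sup>2 < c * e\<^sup>2"
      using eventually_happens by force
    have "L2norm M (\<lambda>x. F i x - F j x) < e" if "i \<ge> N" "j \<ge> N" for i j
    proof -
      have "(1 / real (Suc k))\<^sup>2 \<le> (inverse (real (Suc N)))\<^sup>2" if "k \<ge> N" for k
        using that by (intro power_mono) (auto simp: field_simps)
      from this[OF that(1)] this[OF that(2)]
      have "2 * ((1 / real (Suc i))\<^sup>2 + (1 / real (Suc j))\<^sup>2)
          \<le> 2 * ((inverse (real (Suc N)))\<^sup>2 + (inverse (real (Suc N)))\<^sup>2)"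
        by (intro mult_left_mono add_mono) auto
      also have "\<dots> < c * e\<^sup>2" using N by simp
      finally have "c * (L2norm M (\<lambda>x. F i x - F j x))\<^sup>2 < c * e\<^sup>2"
        using cauchy[of i j] by (rule le_less_trans[rotated])
      then have "(L2norm M (\<lambda>x. F i x - F j x))\<^sup>2 < e\<^sup>2" using c by simp
      then show ?thesis by (rule power2_less_imp_less) (use e in simp)
    qed
    then show "\<exists>N. \<forall>i\<ge>N. \<forall>j\<ge>N. L2norm M (\<lambda>x. F i x - F j x) < e" by blast
  qed
  then obtain H where H: "H \<in> L2v M" "(\<lambda>n. L2norm M (\<lambda>x. F n x - H x)) \<longlonglongrightarrow> 0" by blast
  have "B H w = l w" if w: "w \<in> V" for w
  proof -
    have "(\<lambda>n. B (F n) w) \<longlonglongrightarrow> B H w"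
    proof (rule LIM_zero_cancel, rule Lim_null_comparison)
      show "(\<lambda>n. K * L2norm M (\<lambda>x. F n x - H x) * L2norm M w) \<longlonglongrightarrow> 0"
        by (intro tendsto_mult_left_zero tendsto_mult_right_zero H)
      have "norm (B (F n) w - B H w) \<le> K * L2norm M (\<lambda>x. F n x - H x) * L2norm M w" for n
        using B_bound[OF L2v_diff[OF VL[OF F(1)] H(1)] VL[OF w], of n]
          B_lin[OF VL[OF F(1)] H(1) VL[OF w], of 1 n "-1"] by simp
      then show "\<forall>\<^sub>F n in sequentially. norm (B (F n) w - B H w) \<le> K * L2norm M (\<lambda>x. F n x - H x) * L2norm M w"
        by simp
    qed
    moreover have "(\<lambda>n. B (F n) w) \<longlonglongrightarrow> l w"
    proof (rule LIM_zero_cancel, rule Lim_null_comparison)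
      show "(\<lambda>n. inverse (real (Suc n)) * sqrt (B w w)) \<longlonglongrightarrow> 0"
        by (intro tendsto_mult_left_zero LIMSEQ_inverse_real_of_nat)
      have "norm (B (F n) w - l w) \<le> inverse (real (Suc n)) * sqrt (B w w)" for n
        using real_sqrt_le_mono[OF euler[OF w, of n]]
        by (simp add: real_sqrt_mult inverse_eq_divide)
      then show "\<forall>\<^sub>F n in sequentially. norm (B (F n) w - l w) \<le> inverse (real (Suc n)) * sqrt (B w w)"
        by simp
    qed
    ultimately show ?thesis by (rule LIMSEQ_unique)
  qed
  with F H show ?thesis by blast
qed

section \<open>Integration by parts and the fundamental lemma\<close>

lemma finite_measure_lebesgue_on_bounded:
  fixes S :: "'a::euclidean_space set"
  assumes "bounded S" "S \<in> sets lebesgue"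
  shows "finite_measure (lebesgue_on S)"
  using bounded_set_imp_lmeasurable[OF assms] by (rule finite_measure_lebesgue_on)

lemma lebesgue_on_measurable_continuous:
  assumes "continuous_on UNIV f" "S \<in> sets lebesgue"
  shows "f \<in> borel_measurable (lebesgue_on S)"
  using assms continuous_imp_measurable_on_sets_lebesgue continuous_on_subset by blast

lemma continuous_bounded_on:
  fixes f :: "'a::euclidean_space \<Rightarrow> 'b::real_normed_vector"
  assumes "continuous_on UNIV f" "bounded S"
  shows "\<exists>K\<ge>0. \<forall>x\<in>S. norm (f x) \<le> K"
proof -
  have "compact (f ` closure S)"
    using assms by (intro compact_continuous_image) (auto intro: continuous_on_subset)
  then have "bounded (f ` closure S)" by (rule compact_imp_bounded)
  then obtain K where "\<forall>x\<in>closure S. norm (f x) \<le> K"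
    by (auto simp: bounded_iff)
  then show ?thesis
    using closure_subset[of S] by (intro exI[of _ "max K 0"]) (force simp: le_max_iff_disj)
qed

lemma continuous_L2v:
  fixes f :: "'a::euclidean_space \<Rightarrow> 'b::euclidean_space"
  assumes "continuous_on UNIV f" "bounded S" "S \<in> sets lebesgue"
  shows "f \<in> L2v (lebesgue_on S)"
proof -
  obtain K where "\<forall>x\<in>S. norm (f x) \<le> K" using continuous_bounded_on assms by blast
  then show ?thesis
    using assms by (intro L2v_bounded[of _ _ K])
      (auto intro: finite_measure_lebesgue_on_bounded lebesgue_on_measurable_continuous)
qed

lemma continuous_integrable:
  fixes f :: "'a::euclidean_space \<Rightarrow> 'b::euclidean_space"
  assumes "continuous_on UNIV f" "bounded S" "S \<in> sets lebesgue"
  shows "integrable (lebesgue_on S) f"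
  by (intro L2v_integrable continuous_L2v finite_measure_lebesgue_on_bounded assms)

text \<open>
  If all small translations in a coordinate direction preserve the integral over \<open>S\<close>, then the
  difference quotients have integral zero, and so has their limit. This covers functions of
  compact support as well as periodic functions on their cell.
\<close>

lemma integral_pdiff_eq_0:
  fixes g :: "real ^ 'n::finite \<Rightarrow> real"
  assumes S: "bounded S" "S \<in> sets lebesgue"
    and diff: "\<And>x. g differentiable (at x)" and cont: "continuous_on UNIV (pdiff i g)"
    and inv: "\<And>h. 0 < h \<Longrightarrow> h < 1 \<Longrightarrow>
      (LINT x|lebesgue_on S. g (x + h *\<^sub>R axis i 1)) = (LINT x|lebesgue_on S. g x)"
  shows "(LINT x|lebesgue_on S. pdiff i g x) = 0"
proof -
  define h :: "nat \<Rightarrow> real" where "h = (\<lambda>n. 1 / (real n + 2))"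
  have h: "0 < h n" "h n < 1" for n by (auto simp: h_def)
  have h0: "h \<longlonglongrightarrow> 0"
    unfolding h_def by real_asymp
  define q where "q = (\<lambda>n x. (g (x + h n *\<^sub>R axis i 1) - g x) / h n)"
  have g: "continuous_on UNIV g"
    using diff by (auto simp: continuous_on_eq_continuous_at differentiable_imp_continuous_within)
  have gt: "continuous_on UNIV (\<lambda>x. g (x + v))" for v
    by (intro continuous_on_compose2[OF g] continuous_intros) auto
  have qz: "(LINT x|lebesgue_on S. q n x) = 0" for n
    unfolding q_def
    using continuous_integrable[OF g S] continuous_integrable[OF gt S] inv[OF h] by simp
  have mvt: "\<exists>z. 0 < z \<and> z < h n \<and> q n x = pdiff i g (x + z *\<^sub>R axis i 1)" for n x
  proof -
    have "((\<lambda>t. g (x + t *\<^sub>R axis i 1)) has_real_derivative pdiff i g (x + t *\<^sub>R axis i 1)) (at t)" for t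
    proof -
      have "((\<lambda>t. x + t *\<^sub>R axis i 1) has_derivative (\<lambda>d. d *\<^sub>R axis i (1::real))) (at t)"
        by (auto intro!: derivative_eq_intros)
      from has_derivative_compose[OF this has_derivative_pdiff[OF diff]]
      show ?thesis
        by (auto simp: has_field_derivative_def axis_def if_distrib[of "\<lambda>t. t * _"]
            if_distrib[of "\<lambda>t. _ * t"] mult.commute cong: if_cong elim!: has_derivative_eq_rhs)
    qed
    from MVT2[of 0 "h n" "\<lambda>t. g (x + t *\<^sub>R axis i 1)" "\<lambda>t. pdiff i g (x + t *\<^sub>R axis i 1)", OF h(1) this]
    obtain z where "z > 0" "z < h n" "g (x + h n *\<^sub>R axis i 1) - g x = h n * pdiff i g (x + z *\<^sub>R axis i 1)"
      by auto
    then show ?thesis using h(1)[of n] by (auto simp: q_def field_simps)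
  qed
  obtain z where z: "\<And>n x. 0 < z n x" "\<And>n x. z n x < h n"
    "\<And>n x. q n x = pdiff i g (x + z n x *\<^sub>R axis i 1)"
    using mvt by metis
  have "bounded (\<Union>x\<in>S. \<Union>y\<in>cball 0 1. {x + y})"
    using S(1) bounded_cball by (rule bounded_sums)
  then obtain K where K: "\<forall>x\<in>(\<Union>x\<in>S. \<Union>y\<in>cball 0 1. {x + y}). norm (pdiff i g x) \<le> K"
    using continuous_bounded_on[OF cont] by blast
  interpret finite_measure "lebesgue_on S"
    by (rule finite_measure_lebesgue_on_bounded[OF S])
  have "(\<lambda>n. LINT x|lebesgue_on S. q n x) \<longlonglongrightarrow> (LINT x|lebesgue_on S. pdiff i g x)"
  proof (rule integral_dominated_convergence[where w = "\<lambda>x. K"])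
    show "pdiff i g \<in> borel_measurable (lebesgue_on S)"
      by (rule lebesgue_on_measurable_continuous[OF cont S(2)])
    show "q n \<in> borel_measurable (lebesgue_on S)" for n
      unfolding q_def using h(1)[of n]
      by (intro lebesgue_on_measurable_continuous S continuous_intros g gt) auto
    show "AE x in lebesgue_on S. norm (q n x) \<le> K" for n
    proof (rule AE_I2)
      fix x assume "x \<in> space (lebesgue_on S)"
      moreover have "z n x *\<^sub>R axis i (1::real) \<in> cball 0 1"
        using z(1,2)[of n x] h(2)[of n] by (simp add: norm_axis_1)
      ultimately show "norm (q n x) \<le> K"
        unfolding z(3) using K by (force simp: space_restrict_space)
    qed
    show "AE x in lebesgue_on S. (\<lambda>n. q n x) \<longlonglongrightarrow> pdiff i g x"
    proof (rule AE_I2)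
      fix x
      have "(\<lambda>n. z n x) \<longlonglongrightarrow> 0"
        by (rule tendsto_sandwich[OF _ _ tendsto_const h0]) (auto intro!: always_eventually less_imp_le z)
      then have "(\<lambda>n. x + z n x *\<^sub>R axis i (1::real)) \<longlonglongrightarrow> x + 0 *\<^sub>R axis i 1"
        by (intro tendsto_intros)
      then show "(\<lambda>n. q n x) \<longlonglongrightarrow> pdiff i g x"
        unfolding z(3) using cont
        by (intro isCont_tendsto_compose[where g = "pdiff i g"]) (auto simp: continuous_on_eq_continuous_at)
    qed
  qed simp
  then show ?thesis using qz by (simp add: LIMSEQ_const_iff)
qed

lemma lborel_integral_translation:
  fixes f :: "'a::euclidean_space \<Rightarrow> real"
  assumes "f \<in> borel_measurable borel"
  shows "(LINT x|lborel. f (x + c)) = (LINT x|lborel. f x)"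
proof -
  have "(LINT x|lborel. f x) = (LINT x|distr lborel borel ((+) c). f x)"
    by (simp add: lborel_distr_plus)
  also have "\<dots> = (LINT x|lborel. f (c + x))"
    using assms by (intro integral_distr) auto
  finally show ?thesis by (simp add: add.commute)
qed

lemma lebesgue_on_integral_borel:
  fixes f :: "'a::euclidean_space \<Rightarrow> real"
  assumes "S \<in> sets borel" "f \<in> borel_measurable borel"
  shows "(LINT x|lebesgue_on S. f x) = (LINT x|lborel. indicator S x * f x)"
proof -
  have "(LINT x|lebesgue_on S. f x) = (LINT x|lebesgue. indicator S x *\<^sub>R f x)"
    using assms by (intro integral_restrict_space) auto
  also have "\<dots> = (LINT x|lborel. indicator S x *\<^sub>R f x)"
    using assms by (intro integral_completion) auto
  finally show ?thesis by simp
qed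

lemma integral_pdiff_test_function:
  assumes S: "S \<in> sets borel" and \<phi>: "\<phi> \<in> test_functions S"
  shows "(LINT x|lebesgue_on S. pdiff i \<phi> x) = 0"
proof -
  have sm: "smooth \<phi>" using \<phi> by (rule test_function_smooth)
  obtain K where K: "compact K" "K \<subseteq> S" "\<forall>x. x \<notin> K \<longrightarrow> \<phi> x = 0"
    using \<phi> by (rule test_functionE)
  obtain r where r: "r > 0" "K \<subseteq> ball 0 r"
    using compact_imp_bounded[OF K(1)] bounded_subset_ballD by blast
  define T :: "(real ^ 'a) set" where "T = ball 0 (r + 1)"
  have meas: "f \<in> borel_measurable borel" if "continuous_on UNIV f" for f :: "real ^ 'a \<Rightarrow> real"
    using that by (rule borel_measurable_continuous_onI)
  have full: "(LINT x|lebesgue_on A. f x) = (LINT x|lborel. f x)"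
    if "A \<in> sets borel" "continuous_on UNIV f" "\<And>x. x \<notin> A \<Longrightarrow> f x = 0" for A and f :: "real ^ 'a \<Rightarrow> real"
    unfolding lebesgue_on_integral_borel[OF that(1) meas[OF that(2)]]
    by (intro Bochner_Integration.integral_cong) (auto simp: indicator_def that(3))
  have dz: "pdiff i \<phi> x = 0" if "x \<notin> A" "K \<subseteq> A" for x A
  proof -
    have "\<phi> \<in> test_functions K"
      using K sm by (intro test_functionsI[of _ K]) auto
    then show ?thesis
      using test_function_outside[OF test_function_pdiff, of \<phi> K x i] that by blast
  qed
  have cont: "continuous_on UNIV \<phi>" "continuous_on UNIV (pdiff i \<phi>)"
    using sm smooth_continuous smooth_pdiff by blast+
  have KT: "K \<subseteq> T" using r by (auto simp: T_def)
  have "(LINT x|lebesgue_on S. pdiff i \<phi> x) = (LINT x|lborel. pdiff i \<phi> x)"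
    by (rule full[OF S cont(2) dz[OF _ K(2)]])
  also have "\<dots> = (LINT x|lebesgue_on T. pdiff i \<phi> x)"
    by (rule full[OF _ cont(2) dz[OF _ KT], symmetric]) (auto simp: T_def)
  also have "\<dots> = 0"
  proof (rule integral_pdiff_eq_0)
    fix h :: real assume h: "0 < h" "h < 1"
    have "(LINT x|lebesgue_on T. \<phi> (x + h *\<^sub>R axis i 1)) = (LINT x|lborel. \<phi> (x + h *\<^sub>R axis i 1))"
    proof (rule full)
      show "continuous_on UNIV (\<lambda>x. \<phi> (x + h *\<^sub>R axis i 1))"
        by (intro continuous_on_compose2[OF cont(1)] continuous_intros) auto
      fix x assume x: "x \<notin> T"
      have "norm x \<le> norm (x + h *\<^sub>R axis i 1) + norm (h *\<^sub>R axis i (1::real))"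
        by (metis add_diff_cancel norm_triangle_ineq4)
      then have "x + h *\<^sub>R axis i 1 \<notin> ball 0 r"
        using x h by (auto simp: T_def norm_axis_1)
      then show "\<phi> (x + h *\<^sub>R axis i 1) = 0" using K r by blast
    qed (auto simp: T_def)
    also have "\<dots> = (LINT x|lborel. \<phi> x)"
      by (rule lborel_integral_translation[OF meas[OF cont(1)]])
    also have "\<dots> = (LINT x|lebesgue_on T. \<phi> x)"
      by (rule full[symmetric]) (use cont K KT in \<open>auto simp: T_def\<close>)
    finally show "(LINT x|lebesgue_on T. \<phi> (x + h *\<^sub>R axis i 1)) = (LINT x|lebesgue_on T. \<phi> x)" .
  qed (use sm cont in \<open>auto simp: T_def intro: smooth_differentiable\<close>)
  finally show ?thesis .
qed

lemma unit_cell_eq_box: "unit_cell = box (0 :: real ^ 'm::finite) 1"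
  by (auto simp: unit_cell_def mem_box_cart)

lemma open_unit_cell: "open (unit_cell :: (real ^ 'm::finite) set)"
  by (simp add: unit_cell_eq_box open_box)

lemma bounded_unit_cell: "bounded (unit_cell :: (real ^ 'm::finite) set)"
  by (simp add: unit_cell_eq_box bounded_box)

lemma unit_cell_sets: "unit_cell \<in> sets borel" "(unit_cell :: (real ^ 'm::finite) set) \<in> sets lebesgue"
  by (simp_all add: open_unit_cell borel_open)

lemma measure_unit_cell: "measure lebesgue (unit_cell :: (real ^ 'm::finite) set) = 1"
proof -
  have 1: "(1 :: real ^ 'm) \<bullet> b = 1" if "b \<in> Basis" for b
    using that by (auto simp: Basis_vec_def inner_axis)
  have "measure lebesgue (unit_cell :: (real ^ 'm) set) = measure lborel (box (0 :: real ^ 'm) 1)"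
    unfolding unit_cell_eq_box by (rule measure_completion) simp
  also have "\<dots> = (\<Prod>b\<in>(Basis :: (real ^ 'm) set). (1 - 0) \<bullet> b)"
    unfolding measure_lborel_box_eq by (rule if_P) (simp add: 1)
  also have "\<dots> = 1"
    by (rule prod.neutral) (simp add: 1)
  finally show ?thesis .
qed

lemma AE_coordinate_neq: "AE x in lborel. (x :: real ^ 'm::finite) $ i \<noteq> c"
proof (rule AE_I')
  have "{x :: real ^ 'm. x $ i = c} \<in> null_sets lebesgue"
    using negligible_standard_hyperplane[of "axis i (1::real)" c]
    by (simp add: inner_axis negligible_iff_null_sets)
  moreover have "closed {x :: real ^ 'm. x $ i = c}"
    by (rule closed_Collect_eq) (auto intro!: continuous_intros)
  ultimately show "{x :: real ^ 'm. x $ i = c} \<in> null_sets lborel"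
    by (simp add: null_sets_def)
qed auto

text \<open>
  The translated cell is cut at \<open>y $ i = 1\<close>, and the part beyond the cut is moved back by a period.
\<close>

lemma integral_unit_cell_translation:
  fixes g :: "real ^ 'm::finite \<Rightarrow> real"
  assumes g: "continuous_on UNIV g" "cell_periodic g" and h: "0 < h" "h < 1"
  shows "(LINT y|lebesgue_on unit_cell. g (y + h *\<^sub>R axis i 1)) = (LINT y|lebesgue_on unit_cell. g y)"
proof -
  note [measurable] = unit_cell_sets(1)
  have [measurable]: "g \<in> borel_measurable borel"
    using g(1) by (rule borel_measurable_continuous_onI)
  define e :: "real ^ 'm" where "e = axis i 1"
  have e: "e $ j = (if j = i then 1 else 0)" for j by (simp add: e_def axis_def)
  have per: "g (y + e) = g y" for y
  proof -
    have "e = int_vec (axis i 1)" by (simp add: e_def int_vec_def axis_def vec_eq_iff)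
    then show ?thesis using g(2) by (simp add: cell_periodic_def)
  qed
  define slab where "slab = (\<lambda>s t. {y :: real ^ 'm. (\<forall>j. j \<noteq> i \<longrightarrow> 0 < y $ j \<and> y $ j < 1) \<and> s < y $ i \<and> y $ i < t})"
  have slab_open: "open (slab s t)" for s t
  proof -
    have "slab s t = box (\<chi> j. if j = i then s else 0) (\<chi> j. if j = i then t else 1)"
      by (auto simp: slab_def mem_box_cart split: if_splits)
    then show ?thesis by (simp add: open_box)
  qed
  have [measurable]: "slab s t \<in> sets borel" for s t using slab_open by auto
  have slab_bdd: "bounded (slab s t)" for s t
  proof -
    have "slab s t = box (\<chi> j. if j = i then s else 0) (\<chi> j. if j = i then t else 1)"
      by (auto simp: slab_def mem_box_cart split: if_splits)
    then show ?thesis by (simp add: bounded_box)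
  qed
  have int: "integrable lborel (\<lambda>y. indicator (slab s t) y * g y)" for s t
  proof -
    have "integrable (lebesgue_on (slab s t)) g"
      using slab_open by (intro continuous_integrable g slab_bdd) auto
    then have "integrable lebesgue (\<lambda>y. indicator (slab s t) y *\<^sub>R g y)"
      using slab_open by (subst (asm) integrable_restrict_space) auto
    then have "integrable lebesgue (\<lambda>y. indicator (slab s t) y * g y)"
      by simp
    then show ?thesis by (subst (asm) integrable_completion) auto
  qed
  have "(LINT y|lebesgue_on unit_cell. g (y + h *\<^sub>R e)) = (LINT y|lborel. indicator unit_cell y * g (y + h *\<^sub>R e))"
    by (rule lebesgue_on_integral_borel[OF unit_cell_sets(1)]) measurable
  also have "\<dots> = (LINT y|lborel. (\<lambda>z. indicator unit_cell (z - h *\<^sub>R e) * g z) (y + h *\<^sub>R e))"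
    by simp
  also have "\<dots> = (LINT z|lborel. indicator unit_cell (z - h *\<^sub>R e) * g z)"
    by (rule lborel_integral_translation) measurable
  also have "\<dots> = (LINT z|lborel. indicator (slab h 1) z * g z + indicator (slab 1 (1 + h)) z * g z)"
  proof (rule integral_cong_AE)
    show "AE z in lborel. indicator unit_cell (z - h *\<^sub>R e) * g z
        = indicator (slab h 1) z * g z + indicator (slab 1 (1 + h)) z * g z"
      using AE_coordinate_neq[of i 1]
    proof eventually_elim
      case (elim z)
      have "z - h *\<^sub>R e \<in> unit_cell \<longleftrightarrow> z \<in> slab h (1 + h)"
      proof
        assume "z - h *\<^sub>R e \<in> unit_cell"
        then have *: "0 < z $ j - h * e $ j" "z $ j - h * e $ j < 1" for j
          by (auto simp: unit_cell_def)
        have "0 < z $ j \<and> z $ j < 1" if "j \<noteq> i" for j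
          using *[of j] that by (simp add: e)
        then show "z \<in> slab h (1 + h)"
          unfolding slab_def using *[of i] by (simp add: e)
      next
        assume z: "z \<in> slab h (1 + h)"
        have "0 < z $ j - h * e $ j \<and> z $ j - h * e $ j < 1" for j
          using z by (cases "j = i") (auto simp: slab_def e)
        then show "z - h *\<^sub>R e \<in> unit_cell" by (simp add: unit_cell_def)
      qed
      then show ?case
        using elim h by (auto simp: indicator_def slab_def)
    qed
  qed measurable
  also have "\<dots> = (LINT z|lborel. indicator (slab h 1) z * g z) + (LINT z|lborel. indicator (slab 1 (1 + h)) z * g z)"
    by (rule Bochner_Integration.integral_add[OF int int])
  also have "(LINT z|lborel. indicator (slab 1 (1 + h)) z * g z)
      = (LINT z|lborel. indicator (slab 1 (1 + h)) (z + e) * g (z + e))"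
    by (rule lborel_integral_translation[symmetric]) measurable
  also have "\<dots> = (LINT z|lborel. indicator (slab 0 h) z * g z)"
    by (intro Bochner_Integration.integral_cong refl arg_cong2[where f = "(*)"] per)
      (auto simp: indicator_def slab_def e)
  also have "(LINT z|lborel. indicator (slab h 1) z * g z) + (LINT z|lborel. indicator (slab 0 h) z * g z)
      = (LINT z|lborel. indicator (slab h 1) z * g z + indicator (slab 0 h) z * g z)"
    by (rule Bochner_Integration.integral_add[OF int int, symmetric])
  also have "\<dots> = (LINT z|lborel. indicator unit_cell z * g z)"
  proof (rule integral_cong_AE)
    show "AE z in lborel. indicator (slab h 1) z * g z + indicator (slab 0 h) z * g z = indicator unit_cell z * g z"
      using AE_coordinate_neq[of i h]
    proof eventually_elim
      case (elim z)
      have "z \<in> unit_cell \<longleftrightarrow> z \<in> slab 0 1"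
        by (auto simp: slab_def unit_cell_def)
      then show ?case
        using elim h by (auto simp: indicator_def slab_def)
    qed
  qed measurable
  also have "\<dots> = (LINT y|lebesgue_on unit_cell. g y)"
    by (rule lebesgue_on_integral_borel[OF unit_cell_sets(1), symmetric]) measurable
  finally show ?thesis by (simp add: e_def)
qed

lemma integral_pdiff_periodic:
  fixes g :: "real ^ 'm::finite \<Rightarrow> real"
  assumes "smooth g" "cell_periodic g"
  shows "(LINT y|lebesgue_on unit_cell. pdiff i g y) = 0"
  by (rule integral_pdiff_eq_0[OF bounded_unit_cell unit_cell_sets(2)])
    (use assms in \<open>auto intro: smooth_differentiable smooth_continuous smooth_pdiff
      integral_unit_cell_translation\<close>)

text \<open>
  Boxes generate the Borel sets, so by Dynkin's theorem a function whose integral over all boxes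
  vanishes has vanishing integral over all measurable sets.
\<close>

lemma AE_zero_of_box_integrals:
  fixes g :: "real ^ 'n::finite \<Rightarrow> real"
  assumes S: "open S" and g: "integrable (lebesgue_on S) g"
    and box: "\<And>a b. cbox a b \<subseteq> S \<Longrightarrow> (LINT x|lebesgue_on S. indicator (box a b) x * g x) = 0"
  shows "AE x in lebesgue_on S. g x = 0"
proof -
  have Sm: "S \<in> sets lebesgue" "S \<in> sets borel" using S by auto
  define g0 where "g0 = (\<lambda>x. indicator S x * g x)"
  have g0: "integrable lebesgue g0"
    using g Sm by (subst (asm) integrable_restrict_space) (auto simp: g0_def)
  obtain g1 where g1: "g1 \<in> borel_measurable lborel" "AE x in lborel. g0 x = g1 x"
    using completion_ex_borel_measurable_real borel_measurable_integrable[OF g0] by blast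
  have g01: "AE x in lebesgue. g0 x = g1 x" using g1(2) by (rule AE_completion)
  have [measurable]: "g1 \<in> borel_measurable borel" using g1(1) by simp
  have int1: "integrable lborel g1"
  proof -
    have "integrable lebesgue g1"
      using g01 by (intro integrable_cong_AE_imp[OF g0] measurable_completion g1(1)) (auto simp: eq_commute)
    then show ?thesis using g1(1) by (subst (asm) integrable_completion) auto
  qed
  have box1: "(LINT x|lborel. indicator (box a b) x * g1 x) = 0" if "cbox a b \<subseteq> S" for a b
  proof -
    have "(LINT x|lborel. indicator (box a b) x * g1 x) = (LINT x|lebesgue. indicator (box a b) x * g1 x)"
      by (rule integral_completion[symmetric]) measurable
    also have "\<dots> = (LINT x|lebesgue. indicator S x *\<^sub>R (indicator (box a b) x * g x))"
    proof (rule integral_cong_AE)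
      show "AE x in lebesgue. indicator (box a b) x * g1 x = indicator S x *\<^sub>R (indicator (box a b) x * g x)"
        using g01 by eventually_elim (auto simp: g0_def indicator_def)
      have "(\<lambda>x. indicator (box a b) x * g0 x) \<in> borel_measurable lebesgue"
        using borel_measurable_integrable[OF g0] by (intro borel_measurable_times borel_measurable_indicator) auto
      then show "(\<lambda>x. indicator S x *\<^sub>R (indicator (box a b) x * g x)) \<in> borel_measurable lebesgue"
        by (simp add: g0_def mult.left_commute)
      show "(\<lambda>x. indicator (box a b) x * g1 x) \<in> borel_measurable lebesgue"
        by (rule measurable_completion) measurable
    qed
    also have "\<dots> = (LINT x|lebesgue_on S. indicator (box a b) x * g x)"
      using Sm by (intro integral_restrict_space[symmetric]) auto
    finally show ?thesis using box[OF that] by simp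
  qed
  have intm: "integrable lborel (\<lambda>x. indicator A x * g1 x)" if "A \<in> sets borel" for A
    using integrable_mult_indicator[OF _ int1, of A] that by simp
  have AEbox: "AE x in lborel. x \<in> box a b \<longrightarrow> g1 x = 0" if ab: "cbox a b \<subseteq> S" for a b
  proof -
    have "(LINT x|lborel. indicator (A \<inter> box a b) x * g1 x) = 0" if "A \<in> sets borel" for A
    proof -
      have stable: "Int_stable (range (\<lambda>(a, b). box a b :: (real ^ 'n) set))"
        by (rule Int_stableI) (auto simp: box_Int_box intro: range_eqI[of _ _ "(_, _)"])
      have sub: "range (\<lambda>(a, b). box a b :: (real ^ 'n) set) \<subseteq> Pow UNIV" by simp
      have "A \<in> sigma_sets UNIV (range (\<lambda>(a, b). box a b :: (real ^ 'n) set))"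
        using that by (simp add: borel_eq_box)
      from stable sub this show ?thesis
      proof (induction rule: sigma_sets_induct_disjoint)
        case (basic A)
        then obtain c d where A: "A = box c d" by auto
        obtain p q where pq: "box c d \<inter> box a b = box p q"
          by (rule that[OF box_Int_box])
        show ?case
        proof (cases "box p q = {}")
          case False
          have "box p q \<subseteq> cbox a b"
            using pq box_subset_cbox[of a b] by auto
          then have "closure (box p q) \<subseteq> cbox a b"
            by (rule closure_minimal) (rule closed_cbox)
          then have "cbox p q \<subseteq> S"
            using closure_box[OF False] ab by simp
          then show ?thesis using box1[of p q] unfolding A pq by simp
        qed (use A pq in auto)
      next
        case empty
        then show ?case by simp
      next
        case (compl A)
        have A: "A \<in> sets borel" using compl by (simp add: borel_eq_box)
        have "(LINT x|lborel. indicator ((UNIV - A) \<inter> box a b) x * g1 x)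
            = (LINT x|lborel. indicator (box a b) x * g1 x - indicator (A \<inter> box a b) x * g1 x)"
          by (intro Bochner_Integration.integral_cong) (auto simp: indicator_def)
        also have "\<dots> = 0"
          using A compl box1[OF ab] by (subst Bochner_Integration.integral_diff) (auto intro!: intm)
        finally show ?case .
      next
        case (union A)
        have A: "A i \<in> sets borel" for i using union(2) by (auto simp: borel_eq_box)
        have "(LINT x|lborel. indicator ((\<Union>i. A i) \<inter> box a b) x *\<^sub>R g1 x)
            = (LINT x:(\<Union>i. A i \<inter> box a b)|lborel. g1 x)"
          by (simp add: set_lebesgue_integral_def)
        also have "\<dots> = (\<Sum>i. (LINT x:A i \<inter> box a b|lborel. g1 x))"
        proof (rule lebesgue_integral_countable_add)
          show "set_integrable lborel (\<Union>i. A i \<inter> box a b) g1"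
            using intm[of "\<Union>i. A i \<inter> box a b"] A by (auto simp: set_integrable_def)
          show "i \<noteq> j \<Longrightarrow> A i \<inter> box a b \<inter> (A j \<inter> box a b) = {}" for i j
            using union(1) by (auto simp: disjoint_family_on_def)
        qed (use A in auto)
        also have "\<dots> = 0" using union(3) by (simp add: set_lebesgue_integral_def)
        finally show ?case by simp
      qed
    qed
    then have "AE x in lborel. indicator (box a b) x * g1 x = 0"
      by (intro sigma_finite_measure.density_zero[OF sigma_finite_lborel] intm) (auto simp: set_lebesgue_integral_def indicator_inter_arith mult.assoc)
    then show ?thesis by eventually_elim (auto simp: indicator_def)
  qed
  define P where "P = {U. \<exists>a b. U = box a b \<and> cbox a b \<subseteq> S}"
  obtain D where D: "D \<subseteq> P" "countable D" "\<Union>D = \<Union>P"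
    by (rule Lindelof[of P]) (auto simp: P_def open_box)
  have "AE x in lborel. \<forall>U\<in>D. x \<in> U \<longrightarrow> g1 x = 0"
    unfolding AE_ball_countable[OF D(2)] using D(1) AEbox by (auto simp: P_def)
  moreover have "S \<subseteq> \<Union>D"
    unfolding D(3)
  proof
    fix x assume "x \<in> S"
    then obtain a b where "cbox a b \<subseteq> S" "x \<in> box a b"
      using open_contains_cbox[OF S] by metis
    then show "x \<in> \<Union>P" by (auto simp: P_def)
  qed
  ultimately have "AE x in lborel. x \<in> S \<longrightarrow> g1 x = 0"
    by (auto elim!: eventually_mono)
  then have "AE x in lebesgue. x \<in> S \<longrightarrow> g1 x = 0" by (rule AE_completion)
  with g01 have "AE x in lebesgue. x \<in> S \<longrightarrow> g x = 0"
    by eventually_elim (auto simp: g0_def)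
  then show ?thesis
    using Sm by (subst AE_restrict_space_iff) auto
qed

text \<open>
  The fundamental lemma of the calculus of variations; the bumps converge boundedly to the
  indicator functions of boxes.
\<close>

lemma AE_zero_of_test_functions:
  assumes S: "open S" "bounded S" and g: "integrable (lebesgue_on S) g"
    and zero: "\<And>\<phi>. \<phi> \<in> test_functions S \<Longrightarrow> (LINT x|lebesgue_on S. g x * \<phi> x) = 0"
  shows "AE x in lebesgue_on S. g x = 0"
proof (rule AE_zero_of_box_integrals[OF S(1) g])
  fix a b assume ab: "cbox a b \<subseteq> S"
  have Sm: "S \<in> sets lebesgue" using S by auto
  have [measurable]: "g \<in> borel_measurable (lebesgue_on S)"
    using g by (rule borel_measurable_integrable)
  have m: "box_bump a b n \<in> borel_measurable (lebesgue_on S)" for n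
    by (intro lebesgue_on_measurable_continuous Sm smooth_continuous
        test_function_smooth[OF box_bump_test_function[OF ab]])
  have "(\<lambda>n. LINT x|lebesgue_on S. g x * box_bump a b n x)
      \<longlonglongrightarrow> (LINT x|lebesgue_on S. g x * indicator (box a b) x)"
  proof (rule integral_dominated_convergence[where w = "\<lambda>x. norm (g x)"])
    show "(\<lambda>x. g x * indicator (box a b) x) \<in> borel_measurable (lebesgue_on S)"
      by (rule borel_measurable_times[OF _ measurable_restrict_space1]) (auto intro!: borel_measurable_indicator)
    show "AE x in lebesgue_on S. (\<lambda>n. g x * box_bump a b n x) \<longlonglongrightarrow> g x * indicator (box a b) x"
      by (intro AE_I2 tendsto_intros box_bump_tendsto)
    show "AE x in lebesgue_on S. norm (g x * box_bump a b n x) \<le> norm (g x)" for n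
      using box_bump_bounds[of a b n] by (auto simp: abs_mult intro!: mult_left_le)
  qed (use g m in auto)
  moreover have "(LINT x|lebesgue_on S. g x * box_bump a b n x) = 0" for n
    by (rule zero[OF box_bump_test_function[OF ab]])
  ultimately show "(LINT x|lebesgue_on S. indicator (box a b) x * g x) = 0"
    by (simp add: LIMSEQ_const_iff mult.commute)
qed

section \<open>Weak derivatives\<close>

lemma test_function_L2v:
  assumes "\<phi> \<in> test_functions A" "bounded S" "S \<in> sets lebesgue"
  shows "\<phi> \<in> L2v (lebesgue_on S)"
  by (intro continuous_L2v smooth_continuous test_function_smooth[OF assms(1)] assms)

lemma smooth_has_weak_pderiv:
  assumes S: "open S" "bounded S" and u: "smooth u"
  shows "has_weak_pderiv S j u (pdiff j u)"
  unfolding has_weak_pderiv_def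
proof
  fix \<phi> assume \<phi>: "\<phi> \<in> test_functions S"
  have sm: "smooth \<phi>" using \<phi> by (rule test_function_smooth)
  have Sm: "S \<in> sets lebesgue" "S \<in> sets borel" using S by auto
  have i1: "integrable (lebesgue_on S) (\<lambda>x. u x * pdiff j \<phi> x)"
    by (intro continuous_integrable smooth_continuous smooth_mult smooth_pdiff u sm S Sm)
  have i2: "integrable (lebesgue_on S) (\<lambda>x. pdiff j u x * \<phi> x)"
    by (intro continuous_integrable smooth_continuous smooth_mult smooth_pdiff u sm S Sm)
  have "(\<lambda>x. \<phi> x * u x) \<in> test_functions S" by (rule test_function_mult[OF \<phi> u])
  then have "(\<lambda>x. u x * \<phi> x) \<in> test_functions S" by (simp add: mult.commute)
  from integral_pdiff_test_function[OF Sm(2) this]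
  have "0 = (LINT x|lebesgue_on S. pdiff j (\<lambda>x. u x * \<phi> x) x)" by simp
  also have "\<dots> = (LINT x|lebesgue_on S. u x * pdiff j \<phi> x + pdiff j u x * \<phi> x)"
    using u sm by (simp add: pdiff_mult smooth_differentiable)
  also have "\<dots> = (LINT x|lebesgue_on S. u x * pdiff j \<phi> x) + (LINT x|lebesgue_on S. pdiff j u x * \<phi> x)"
    by (rule Bochner_Integration.integral_add[OF i1 i2])
  finally show "(LINT x|lebesgue_on S. u x * pdiff j \<phi> x) = - (LINT x|lebesgue_on S. pdiff j u x * \<phi> x)"
    by simp
qed

lemma has_weak_pderiv_L2ip:
  "has_weak_pderiv S j u g \<longleftrightarrow>
    (\<forall>\<phi>\<in>test_functions S. L2ip (lebesgue_on S) u (pdiff j \<phi>) = - L2ip (lebesgue_on S) g \<phi>)"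
  by (simp add: has_weak_pderiv_def L2ip_def)

text \<open>
  By uniqueness the representative picked by \<open>weak_pderiv\<close> may be replaced by any weak derivative at
  hand, up to a null set.
\<close>

lemma weak_pderiv_unique:
  assumes S: "open S" "bounded S" and gh: "g \<in> L2v (lebesgue_on S)" "h \<in> L2v (lebesgue_on S)"
    and w: "has_weak_pderiv S j u g" "has_weak_pderiv S j u h"
  shows "AE x in lebesgue_on S. g x = h x"
proof -
  have Sm: "S \<in> sets lebesgue" using S by auto
  have "AE x in lebesgue_on S. g x - h x = 0"
  proof (rule AE_zero_of_test_functions[OF S])
    show "integrable (lebesgue_on S) (\<lambda>x. g x - h x)"
      by (intro L2v_integrable L2v_diff gh finite_measure_lebesgue_on_bounded S Sm)
    fix \<phi> assume \<phi>: "\<phi> \<in> test_functions S"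
    have "L2ip (lebesgue_on S) (\<lambda>x. g x - h x) \<phi> = 0"
      using w \<phi> by (simp add: L2ip_diff[OF gh test_function_L2v[OF \<phi> S(2) Sm]] has_weak_pderiv_L2ip)
    then show "(LINT x|lebesgue_on S. (g x - h x) * \<phi> x) = 0" by (simp add: L2ip_def)
  qed
  then show ?thesis by simp
qed

lemma W12_weak_pderiv:
  assumes "u \<in> W12 S"
  shows "u \<in> L2v (lebesgue_on S)" "weak_pderiv S j u \<in> L2v (lebesgue_on S)"
    "has_weak_pderiv S j u (weak_pderiv S j u)"
proof -
  show "u \<in> L2v (lebesgue_on S)" using assms by (simp add: W12_def L2v_real)
  obtain g where "g \<in> L2 (lebesgue_on S) \<and> has_weak_pderiv S j u g"
    using assms by (auto simp: W12_def)
  from someI[of "\<lambda>g. g \<in> L2 (lebesgue_on S) \<and> has_weak_pderiv S j u g", OF this]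
  show "weak_pderiv S j u \<in> L2v (lebesgue_on S)" "has_weak_pderiv S j u (weak_pderiv S j u)"
    by (auto simp: weak_pderiv_def L2v_real)
qed

lemma weak_pderiv_eqI:
  assumes S: "open S" "bounded S" and g: "g \<in> L2v (lebesgue_on S)" "has_weak_pderiv S j u g"
  shows "AE x in lebesgue_on S. weak_pderiv S j u x = g x"
proof -
  from someI[of "\<lambda>g. g \<in> L2 (lebesgue_on S) \<and> has_weak_pderiv S j u g" g] g
  have "weak_pderiv S j u \<in> L2v (lebesgue_on S)" "has_weak_pderiv S j u (weak_pderiv S j u)"
    by (auto simp: weak_pderiv_def L2v_real)
  from weak_pderiv_unique[OF S this(1) g(1) this(2) g(2)] show ?thesis .
qed

lemma weak_pderiv_measurable:
  assumes "g \<in> L2v (lebesgue_on S)" "has_weak_pderiv S j u g"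
  shows "weak_pderiv S j u \<in> borel_measurable (lebesgue_on S)"
  using someI[of "\<lambda>g. g \<in> L2 (lebesgue_on S) \<and> has_weak_pderiv S j u g" g] assms
  by (auto simp: weak_pderiv_def L2v_def L2_def)

lemma W12I:
  assumes "u \<in> L2v (lebesgue_on S)" "\<And>j. g j \<in> L2v (lebesgue_on S)" "\<And>j. has_weak_pderiv S j u (g j)"
  shows "u \<in> W12 S"
  using assms by (auto simp: W12_def L2v_real)

lemma smooth_W12:
  assumes "open S" "bounded S" "smooth u"
  shows "u \<in> W12 S" "AE x in lebesgue_on S. weak_pderiv S j u x = pdiff j u x"
    "u \<in> L2v (lebesgue_on S)" "pdiff j u \<in> L2v (lebesgue_on S)"
proof -
  have Sm: "S \<in> sets lebesgue" using assms by auto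
  show L: "u \<in> L2v (lebesgue_on S)" "pdiff j u \<in> L2v (lebesgue_on S)" for j
    by (intro continuous_L2v smooth_continuous smooth_pdiff assms Sm)+
  show "u \<in> W12 S"
    using L smooth_has_weak_pderiv[OF assms] by (rule W12I)
  show "AE x in lebesgue_on S. weak_pderiv S j u x = pdiff j u x"
    by (intro weak_pderiv_eqI assms L smooth_has_weak_pderiv)
qed

lemma has_weak_pderiv_lin:
  assumes S: "bounded S" "S \<in> sets lebesgue"
    and L: "u \<in> L2v (lebesgue_on S)" "v \<in> L2v (lebesgue_on S)" "g \<in> L2v (lebesgue_on S)" "h \<in> L2v (lebesgue_on S)"
    and w: "has_weak_pderiv S j u g" "has_weak_pderiv S j v h"
  shows "has_weak_pderiv S j (\<lambda>x. a * u x + b * v x) (\<lambda>x. a * g x + b * h x)"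
  unfolding has_weak_pderiv_L2ip
proof
  fix \<phi> assume \<phi>: "\<phi> \<in> test_functions S"
  note L\<phi> = test_function_L2v[OF \<phi> S] test_function_L2v[OF test_function_pdiff[OF \<phi>] S, of j]
  show "L2ip (lebesgue_on S) (\<lambda>x. a * u x + b * v x) (pdiff j \<phi>)
      = - L2ip (lebesgue_on S) (\<lambda>x. a * g x + b * h x) \<phi>"
    using w \<phi> L2ip_lin[OF L(1,2) L\<phi>(2), of a b] L2ip_lin[OF L(3,4) L\<phi>(1), of a b]
    by (simp add: has_weak_pderiv_L2ip)
qed

lemma has_weak_pderiv_limit:
  assumes S: "bounded S" "S \<in> sets lebesgue"
    and L: "\<And>n. u n \<in> L2v (lebesgue_on S)" "\<And>n. g n \<in> L2v (lebesgue_on S)"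
      "v \<in> L2v (lebesgue_on S)" "h \<in> L2v (lebesgue_on S)"
    and lim: "(\<lambda>n. L2norm (lebesgue_on S) (\<lambda>x. u n x - v x)) \<longlonglongrightarrow> 0"
      "(\<lambda>n. L2norm (lebesgue_on S) (\<lambda>x. g n x - h x)) \<longlonglongrightarrow> 0"
    and w: "\<And>n. has_weak_pderiv S j (u n) (g n)"
  shows "has_weak_pderiv S j v h"
  unfolding has_weak_pderiv_L2ip
proof
  fix \<phi> assume \<phi>: "\<phi> \<in> test_functions S"
  note L\<phi> = test_function_L2v[OF \<phi> S] test_function_L2v[OF test_function_pdiff[OF \<phi>] S, of j]
  have "(\<lambda>n. L2ip (lebesgue_on S) (u n) (pdiff j \<phi>)) \<longlonglongrightarrow> L2ip (lebesgue_on S) v (pdiff j \<phi>)"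
    by (rule L2ip_tendsto[OF L(1,3) lim(1) L\<phi>(2)])
  moreover have "(\<lambda>n. - L2ip (lebesgue_on S) (g n) \<phi>) \<longlonglongrightarrow> - L2ip (lebesgue_on S) h \<phi>"
    by (intro tendsto_minus L2ip_tendsto[OF L(2,4) lim(2) L\<phi>(1)])
  moreover have "L2ip (lebesgue_on S) (u n) (pdiff j \<phi>) = - L2ip (lebesgue_on S) (g n) \<phi>" for n
    using w \<phi> by (auto simp: has_weak_pderiv_L2ip)
  ultimately show "L2ip (lebesgue_on S) v (pdiff j \<phi>) = - L2ip (lebesgue_on S) h \<phi>"
    by (simp add: LIMSEQ_unique)
qed

lemma weak_pderiv_diff_smooth:
  assumes S: "open S" "bounded S" and u: "u \<in> W12 S" and \<phi>: "smooth \<phi>"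
  shows "AE x in lebesgue_on S. weak_pderiv S j (\<lambda>x. \<phi> x - u x) x = pdiff j \<phi> x - weak_pderiv S j u x"
proof (rule weak_pderiv_eqI[OF S])
  have Sm: "S \<in> sets lebesgue" using S by auto
  show "(\<lambda>x. pdiff j \<phi> x - weak_pderiv S j u x) \<in> L2v (lebesgue_on S)"
    by (intro L2v_diff smooth_W12 S \<phi> W12_weak_pderiv u)
  show "has_weak_pderiv S j (\<lambda>x. \<phi> x - u x) (\<lambda>x. pdiff j \<phi> x - weak_pderiv S j u x)"
    using has_weak_pderiv_lin[OF S(2) Sm smooth_W12(3)[OF S \<phi>] W12_weak_pderiv(1)[OF u]
        smooth_W12(4)[OF S \<phi>] W12_weak_pderiv(2)[OF u] smooth_has_weak_pderiv[OF S \<phi>]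
        W12_weak_pderiv(3)[OF u], where a = 1 and b = "-1"] by simp
qed

lemma W12_norm_diff_smooth:
  assumes S: "open S" "bounded S" and u: "u \<in> W12 S" and \<phi>: "smooth \<phi>"
  shows "W12_norm S (\<lambda>x. \<phi> x - u x) = sqrt ((L2norm (lebesgue_on S) (\<lambda>x. \<phi> x - u x))\<^sup>2
    + (\<Sum>j\<in>UNIV. (L2norm (lebesgue_on S) (\<lambda>x. pdiff j \<phi> x - weak_pderiv S j u x))\<^sup>2))"
proof -
  have "(LINT x|lebesgue_on S. (weak_pderiv S j (\<lambda>x. \<phi> x - u x) x)\<^sup>2)
      = (L2norm (lebesgue_on S) (\<lambda>x. pdiff j \<phi> x - weak_pderiv S j u x))\<^sup>2" for j
  proof -
    have w: "has_weak_pderiv S j (\<lambda>x. \<phi> x - u x) (\<lambda>x. pdiff j \<phi> x - weak_pderiv S j u x)"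
      using has_weak_pderiv_lin[OF S(2) _ smooth_W12(3)[OF S \<phi>] W12_weak_pderiv(1)[OF u]
        smooth_W12(4)[OF S \<phi>] W12_weak_pderiv(2)[OF u] smooth_has_weak_pderiv[OF S \<phi>]
        W12_weak_pderiv(3)[OF u], where a = 1 and b = "-1"] S by simp
    have L: "(\<lambda>x. pdiff j \<phi> x - weak_pderiv S j u x) \<in> L2v (lebesgue_on S)"
      by (intro L2v_diff smooth_W12 S \<phi> W12_weak_pderiv u)
    have "L2norm (lebesgue_on S) (weak_pderiv S j (\<lambda>x. \<phi> x - u x))
        = L2norm (lebesgue_on S) (\<lambda>x. pdiff j \<phi> x - weak_pderiv S j u x)"
      by (intro L2norm_cong_AE weak_pderiv_diff_smooth assms L2v_measurable[OF L] weak_pderiv_measurable[OF L w])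
    then show ?thesis
      using L2norm_power2[of "lebesgue_on S" "weak_pderiv S j (\<lambda>x. \<phi> x - u x)"] by simp
  qed
  then show ?thesis by (simp add: W12_norm_def L2norm_power2)
qed

lemma W12_norm_diff_smooth_tendsto:
  assumes S: "open S" "bounded S" and u: "u \<in> W12 S" and \<phi>: "\<And>n. smooth (\<phi> n)"
  shows "(\<lambda>n. W12_norm S (\<lambda>x. \<phi> n x - u x)) \<longlonglongrightarrow> 0 \<longleftrightarrow>
    (\<lambda>n. L2norm (lebesgue_on S) (\<lambda>x. \<phi> n x - u x)) \<longlonglongrightarrow> 0 \<and>
    (\<forall>j. (\<lambda>n. L2norm (lebesgue_on S) (\<lambda>x. pdiff j (\<phi> n) x - weak_pderiv S j u x)) \<longlonglongrightarrow> 0)"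
  (is "?l \<longleftrightarrow> ?r1 \<and> ?r2")
proof
  assume l: ?l
  show "?r1 \<and> ?r2"
  proof (intro conjI allI)
    have le1: "L2norm (lebesgue_on S) (\<lambda>x. \<phi> n x - u x) \<le> W12_norm S (\<lambda>x. \<phi> n x - u x)" for n
      unfolding W12_norm_diff_smooth[OF S u \<phi>] by (intro real_le_rsqrt) (auto intro: sum_nonneg)
    show ?r1
      by (rule tendsto_sandwich[OF _ _ tendsto_const l]) (auto intro!: always_eventually le1)
    fix j
    have le2: "L2norm (lebesgue_on S) (\<lambda>x. pdiff j (\<phi> n) x - weak_pderiv S j u x) \<le> W12_norm S (\<lambda>x. \<phi> n x - u x)" for n
      unfolding W12_norm_diff_smooth[OF S u \<phi>]
      by (intro real_le_rsqrt add_increasing zero_le_power2 member_le_sum[of j UNIV]) auto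
    show "(\<lambda>n. L2norm (lebesgue_on S) (\<lambda>x. pdiff j (\<phi> n) x - weak_pderiv S j u x)) \<longlonglongrightarrow> 0"
      by (rule tendsto_sandwich[OF _ _ tendsto_const l]) (auto intro!: always_eventually le2)
  qed
next
  assume r: "?r1 \<and> ?r2"
  have "(\<lambda>n. sqrt ((L2norm (lebesgue_on S) (\<lambda>x. \<phi> n x - u x))\<^sup>2
    + (\<Sum>j\<in>UNIV. (L2norm (lebesgue_on S) (\<lambda>x. pdiff j (\<phi> n) x - weak_pderiv S j u x))\<^sup>2)))
    \<longlonglongrightarrow> sqrt (0\<^sup>2 + (\<Sum>j\<in>(UNIV::'a set). 0\<^sup>2))"
    using r by (intro tendsto_real_sqrt tendsto_add tendsto_sum tendsto_power) simp_all
  then show ?l by (simp add: W12_norm_diff_smooth[OF S u \<phi>])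
qed

lemma W12_0E:
  assumes S: "open S" "bounded S" and u: "u \<in> W12_0 S"
  obtains \<phi> :: "nat \<Rightarrow> real ^ 'n::finite \<Rightarrow> real" where "\<And>n. \<phi> n \<in> test_functions S"
    "(\<lambda>n. L2norm (lebesgue_on S) (\<lambda>x. \<phi> n x - u x)) \<longlonglongrightarrow> 0"
    "\<And>j. (\<lambda>n. L2norm (lebesgue_on S) (\<lambda>x. pdiff j (\<phi> n) x - weak_pderiv S j u x)) \<longlonglongrightarrow> 0"
proof -
  have uW: "u \<in> W12 S" using u by (simp add: W12_0_def)
  obtain \<phi> where \<phi>: "\<And>n. \<phi> n \<in> test_functions S" "(\<lambda>n. W12_norm S (\<lambda>x. \<phi> n x - u x)) \<longlonglongrightarrow> 0"
    using u by (auto simp: W12_0_def)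
  show ?thesis
    using W12_norm_diff_smooth_tendsto[OF S uW test_function_smooth[OF \<phi>(1)], THEN iffD1, OF \<phi>(2)]
    by (intro that[OF \<phi>(1)]) auto
qed

lemma W12_0I:
  assumes S: "open S" "bounded S" and \<phi>: "\<And>n. \<phi> n \<in> test_functions S"
    and L: "u \<in> L2v (lebesgue_on S)" "\<And>j. g j \<in> L2v (lebesgue_on S)"
    and lim: "(\<lambda>n. L2norm (lebesgue_on S) (\<lambda>x. \<phi> n x - u x)) \<longlonglongrightarrow> 0"
      "\<And>j. (\<lambda>n. L2norm (lebesgue_on S) (\<lambda>x. pdiff j (\<phi> n) x - g j x)) \<longlonglongrightarrow> 0"
  shows "u \<in> W12_0 S" "AE x in lebesgue_on S. weak_pderiv S j u x = g j x"
proof -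
  have Sm: "S \<in> sets lebesgue" using S by auto
  note sm = test_function_smooth[OF \<phi>]
  have w: "has_weak_pderiv S j u (g j)" for j
    by (rule has_weak_pderiv_limit[OF S(2) Sm smooth_W12(3)[OF S sm] smooth_W12(4)[OF S sm] L lim])
      (rule smooth_has_weak_pderiv[OF S sm])
  have uW: "u \<in> W12 S" by (rule W12I[OF L w])
  show eq: "AE x in lebesgue_on S. weak_pderiv S j u x = g j x" for j
    by (rule weak_pderiv_eqI[OF S L(2) w])
  have "L2norm (lebesgue_on S) (\<lambda>x. pdiff j (\<phi> n) x - weak_pderiv S j u x)
      = L2norm (lebesgue_on S) (\<lambda>x. pdiff j (\<phi> n) x - g j x)" for j n
  proof (rule L2norm_cong_AE)
    show "(\<lambda>x. pdiff j (\<phi> n) x - weak_pderiv S j u x) \<in> borel_measurable (lebesgue_on S)"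
      by (intro L2v_measurable L2v_diff smooth_W12 S sm W12_weak_pderiv uW)
    show "(\<lambda>x. pdiff j (\<phi> n) x - g j x) \<in> borel_measurable (lebesgue_on S)"
      by (intro L2v_measurable L2v_diff smooth_W12 S sm L)
    show "AE x in lebesgue_on S. pdiff j (\<phi> n) x - weak_pderiv S j u x = pdiff j (\<phi> n) x - g j x"
      using eq[of j] by eventually_elim simp
  qed
  then have "(\<lambda>n. W12_norm S (\<lambda>x. \<phi> n x - u x)) \<longlonglongrightarrow> 0"
    using lim by (subst W12_norm_diff_smooth_tendsto[OF S uW sm]) auto
  then show "u \<in> W12_0 S"
    using uW \<phi> by (auto simp: W12_0_def)
qed

section \<open>Sobolev spaces of vector fields\<close>

lemma measurable_vec_iff:
  fixes f :: "'a \<Rightarrow> 'b::euclidean_space ^ 'n::finite"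
  shows "f \<in> borel_measurable M \<longleftrightarrow> (\<forall>i. (\<lambda>x. f x $ i) \<in> borel_measurable M)"
proof
  assume f: "f \<in> borel_measurable M"
  have "continuous_on UNIV (\<lambda>v :: 'b ^ 'n. v $ i)" for i by (intro continuous_intros)
  then have "(\<lambda>v :: 'b ^ 'n. v $ i) \<in> borel_measurable borel" for i
    by (rule borel_measurable_continuous_onI)
  from measurable_compose[OF f this] show "\<forall>i. (\<lambda>x. f x $ i) \<in> borel_measurable M" by blast
next
  assume f: "\<forall>i. (\<lambda>x. f x $ i) \<in> borel_measurable M"
  show "f \<in> borel_measurable M"
    unfolding borel_measurable_euclidean_space[of f]
  proof
    fix b :: "'b ^ 'n" assume "b \<in> Basis"
    then obtain i u where "b = axis i u" by (auto simp: Basis_vec_def)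
    moreover have "(\<lambda>x. f x $ i \<bullet> u) \<in> borel_measurable M"
      by (rule borel_measurable_inner) (use f in simp_all)
    ultimately show "(\<lambda>x. f x \<bullet> b) \<in> borel_measurable M"
      by (simp add: inner_axis)
  qed
qed

lemma norm_vec_power2: "(norm (v :: 'b::real_inner ^ 'n::finite))\<^sup>2 = (\<Sum>i\<in>UNIV. (norm (v $ i))\<^sup>2)"
  by (simp add: power2_norm_eq_inner inner_vec_def)

lemma L2v_vec_iff:
  fixes f :: "'a \<Rightarrow> 'b::euclidean_space ^ 'n::finite"
  shows "f \<in> L2v M \<longleftrightarrow> (\<forall>i. (\<lambda>x. f x $ i) \<in> L2v M)"
proof
  assume f: "f \<in> L2v M"
  then show "\<forall>i. (\<lambda>x. f x $ i) \<in> L2v M"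
    by (auto intro!: L2v_dominated(1)[OF f, where K = 1] simp: Finite_Cartesian_Product.norm_nth_le)
      (simp add: L2v_def measurable_vec_iff)
next
  assume f: "\<forall>i. (\<lambda>x. f x $ i) \<in> L2v M"
  then show "f \<in> L2v M"
    by (simp add: L2v_def norm_vec_power2 measurable_vec_iff[of f])
qed

lemma L2norm_vec_power2:
  fixes f :: "'a \<Rightarrow> 'b::euclidean_space ^ 'n::finite"
  assumes "f \<in> L2v M"
  shows "(L2norm M f)\<^sup>2 = (\<Sum>i\<in>UNIV. (L2norm M (\<lambda>x. f x $ i))\<^sup>2)"
proof -
  have "integrable M (\<lambda>x. (norm (f x $ i))\<^sup>2)" for i
    using assms by (simp add: L2v_vec_iff) (simp add: L2v_def)
  then show ?thesis
    by (simp add: L2norm_power2 norm_vec_power2)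
qed

lemma L2norm_nth_le:
  fixes f :: "'a \<Rightarrow> 'b::euclidean_space ^ 'n::finite"
  assumes "f \<in> L2v M"
  shows "L2norm M (\<lambda>x. f x $ i) \<le> L2norm M f"
proof (rule power2_le_imp_le)
  show "(L2norm M (\<lambda>x. f x $ i))\<^sup>2 \<le> (L2norm M f)\<^sup>2"
    unfolding L2norm_vec_power2[OF assms] by (intro member_le_sum[of i UNIV]) auto
qed simp

lemma L2norm_vec_le_sum:
  fixes F :: "'x \<Rightarrow> 'b::euclidean_space ^ 'i::finite"
  assumes "F \<in> L2v N"
  shows "L2norm N F \<le> (\<Sum>i\<in>UNIV. L2norm N (\<lambda>x. F x $ i))"
proof -
  have "L2norm N F = L2_set (\<lambda>i. L2norm N (\<lambda>x. F x $ i)) UNIV"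
    using L2norm_vec_power2[OF assms] by (simp add: L2_set_def real_sqrt_unique flip: L2norm_vec_power2[OF assms])
  then show ?thesis by (simp add: L2_set_le_sum)
qed

lemma L2norm_vec_tendsto_0_iff:
  fixes f :: "nat \<Rightarrow> 'a \<Rightarrow> 'b::euclidean_space ^ 'n::finite"
  assumes "\<And>n. f n \<in> L2v M"
  shows "(\<lambda>n. L2norm M (f n)) \<longlonglongrightarrow> 0 \<longleftrightarrow> (\<forall>i. (\<lambda>n. L2norm M (\<lambda>x. f n x $ i)) \<longlonglongrightarrow> 0)"
proof
  assume l: "(\<lambda>n. L2norm M (f n)) \<longlonglongrightarrow> 0"
  show "\<forall>i. (\<lambda>n. L2norm M (\<lambda>x. f n x $ i)) \<longlonglongrightarrow> 0"
    by (intro allI tendsto_sandwich[OF _ _ tendsto_const l]) (auto intro!: always_eventually L2norm_nth_le assms)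
next
  assume r: "\<forall>i. (\<lambda>n. L2norm M (\<lambda>x. f n x $ i)) \<longlonglongrightarrow> 0"
  have "(\<lambda>n. sqrt (\<Sum>i\<in>UNIV. (L2norm M (\<lambda>x. f n x $ i))\<^sup>2)) \<longlonglongrightarrow> sqrt (\<Sum>i\<in>(UNIV :: 'n set). 0\<^sup>2)"
    using r by (intro tendsto_real_sqrt tendsto_sum tendsto_power) simp_all
  then show "(\<lambda>n. L2norm M (f n)) \<longlonglongrightarrow> 0"
    by (simp add: L2norm_vec_power2[OF assms, symmetric])
qed

definition test_fields :: "(real ^ 'n::finite) set \<Rightarrow> (real ^ 'n \<Rightarrow> real ^ 'd::finite) set" where
  "test_fields S = {\<phi>. \<forall>k. (\<lambda>x. \<phi> x $ k) \<in> test_functions S}"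

definition jac :: "(real ^ 'n::finite \<Rightarrow> real ^ 'd::finite) \<Rightarrow> real ^ 'n \<Rightarrow> real ^ 'n ^ 'd" where
  "jac \<phi> x = (\<chi> i j. pdiff j (\<lambda>z. \<phi> z $ i) x)"

definition grad :: "(real ^ 'n::finite) set \<Rightarrow> (real ^ 'n \<Rightarrow> real ^ 'd::finite) \<Rightarrow> real ^ 'n \<Rightarrow> real ^ 'n ^ 'd" where
  "grad S u x = (\<chi> i j. weak_pderiv S j (\<lambda>z. u z $ i) x)"

lemma AE_all_finite: "(AE x in M. \<forall>i::'n::finite. P i x) \<longleftrightarrow> (\<forall>i. AE x in M. P i x)"
  using AE_ball_countable[of "UNIV :: 'n set" "\<lambda>x i. P i x" M] by (simp add: countable_finite)

lemma test_field_L2v: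
  assumes S: "open S" "bounded S" and \<phi>: "\<phi> \<in> test_fields A"
  shows "\<phi> \<in> L2v (lebesgue_on S)" "jac \<phi> \<in> L2v (lebesgue_on S)"
proof -
  have "smooth (\<lambda>x. \<phi> x $ k)" for k
    using \<phi> by (auto simp: test_fields_def intro: test_function_smooth)
  from smooth_W12(3,4)[OF S this]
  show "\<phi> \<in> L2v (lebesgue_on S)" "jac \<phi> \<in> L2v (lebesgue_on S)"
    by (auto simp: L2v_vec_iff jac_def)
qed

lemma jac_lin:
  assumes "\<phi> \<in> test_fields A" "\<psi> \<in> test_fields A"
  shows "jac (\<lambda>x. a *\<^sub>R \<phi> x + b *\<^sub>R \<psi> x) x = a *\<^sub>R jac \<phi> x + b *\<^sub>R jac \<psi> x"
proof -
  have d: "(\<lambda>x. \<phi> x $ i) differentiable (at x)" "(\<lambda>x. \<psi> x $ i) differentiable (at x)" for i x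
    using assms by (auto simp: test_fields_def intro: smooth_differentiable test_function_smooth)
  show ?thesis
    using d by (simp add: jac_def vec_eq_iff pdiff_add pdiff_scale)
qed

lemma test_field_lin:
  assumes "\<phi> \<in> test_fields A" "\<psi> \<in> test_fields A"
  shows "(\<lambda>x. a *\<^sub>R \<phi> x + b *\<^sub>R \<psi> x) \<in> test_fields A"
  using assms by (auto simp: test_fields_def intro!: test_function_add test_function_scale)

lemma W12_0_vec_L2v:
  assumes "u \<in> W12_0_vec S"
  shows "u \<in> L2v (lebesgue_on S)" "grad S u \<in> L2v (lebesgue_on S)"
    "has_weak_pderiv S j (\<lambda>x. u x $ i) (\<lambda>x. grad S u x $ i $ j)"
proof -
  have "(\<lambda>x. u x $ i) \<in> W12 S" for i using assms by (simp add: W12_0_vec_def W12_0_def)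
  from W12_weak_pderiv[OF this] show "u \<in> L2v (lebesgue_on S)" "grad S u \<in> L2v (lebesgue_on S)"
    "has_weak_pderiv S j (\<lambda>x. u x $ i) (\<lambda>x. grad S u x $ i $ j)"
    by (auto simp: L2v_vec_iff grad_def)
qed

text \<open>
  The next two lemmas translate membership in \<open>W12_0_vec\<close> into mean-square convergence of test fields and
  their Jacobians, the only form in which the space is used below. In the converse direction the
  limit of the Jacobians is a hypothesis, and the lemma identifies it as the gradient.
\<close>

lemma W12_0_vecE:
  fixes u :: "real ^ 'n::finite \<Rightarrow> real ^ 'd::finite"
  assumes S: "open S" "bounded S" and u: "u \<in> W12_0_vec S"
  obtains \<phi> where "\<And>n. \<phi> n \<in> test_fields S"
    "(\<lambda>n. L2norm (lebesgue_on S) (\<lambda>x. \<phi> n x - u x)) \<longlonglongrightarrow> 0"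
    "(\<lambda>n. L2norm (lebesgue_on S) (\<lambda>x. jac (\<phi> n) x - grad S u x)) \<longlonglongrightarrow> 0"
proof -
  have "\<exists>\<phi>. (\<forall>n::nat. \<phi> n \<in> test_functions S) \<and>
    (\<lambda>n. L2norm (lebesgue_on S) (\<lambda>x. \<phi> n x - u x $ i)) \<longlonglongrightarrow> 0 \<and>
    (\<forall>j. (\<lambda>n. L2norm (lebesgue_on S) (\<lambda>x. pdiff j (\<phi> n) x - weak_pderiv S j (\<lambda>z. u z $ i) x)) \<longlonglongrightarrow> 0)"
    (is "\<exists>\<phi>. ?P i \<phi>") for i
  proof -
    have ui: "(\<lambda>x. u x $ i) \<in> W12_0 S" using u by (simp add: W12_0_vec_def)
    show ?thesis by (rule W12_0E[OF S ui]) blast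
  qed
  then have "\<exists>\<phi>. \<forall>i. ?P i (\<phi> i)" by (intro choice allI)
  then obtain \<phi> where \<phi>0: "\<forall>i. ?P i (\<phi> i)" ..
  then have \<phi>: "\<And>i n. \<phi> i n \<in> test_functions S"
    "\<And>i. (\<lambda>n. L2norm (lebesgue_on S) (\<lambda>x. \<phi> i n x - u x $ i)) \<longlonglongrightarrow> 0"
    "\<And>i j. (\<lambda>n. L2norm (lebesgue_on S) (\<lambda>x. pdiff j (\<phi> i n) x - weak_pderiv S j (\<lambda>z. u z $ i) x)) \<longlonglongrightarrow> 0"
    by blast+
  define \<Phi> where "\<Phi> = (\<lambda>n x. \<chi> i. \<phi> i n x)"
  have t: "\<Phi> n \<in> test_fields S" for n using \<phi>(1) by (simp add: test_fields_def \<Phi>_def)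
  note L = test_field_L2v[OF S t] W12_0_vec_L2v[OF u]
  show ?thesis
  proof (rule that[OF t])
    show "(\<lambda>n. L2norm (lebesgue_on S) (\<lambda>x. \<Phi> n x - u x)) \<longlonglongrightarrow> 0"
      by (subst L2norm_vec_tendsto_0_iff) (use \<phi>(2) L in \<open>auto simp: \<Phi>_def intro: L2v_diff\<close>)
    have D: "(\<lambda>x. jac (\<Phi> n) x - grad S u x) \<in> L2v (lebesgue_on S)" for n
      by (intro L2v_diff L)
    then have "(\<lambda>x. (jac (\<Phi> n) x - grad S u x) $ i) \<in> L2v (lebesgue_on S)" for n i
      by (subst (asm) L2v_vec_iff) blast
    then show "(\<lambda>n. L2norm (lebesgue_on S) (\<lambda>x. jac (\<Phi> n) x - grad S u x)) \<longlonglongrightarrow> 0"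
      using \<phi>(3)
      by (subst L2norm_vec_tendsto_0_iff[OF D], intro allI, subst L2norm_vec_tendsto_0_iff)
        (auto simp: jac_def grad_def \<Phi>_def)
  qed
qed

lemma W12_0_vecI:
  fixes u :: "real ^ 'n::finite \<Rightarrow> real ^ 'd::finite"
  assumes S: "open S" "bounded S" and \<phi>: "\<And>n. \<phi> n \<in> test_fields S"
    and L: "u \<in> L2v (lebesgue_on S)" "g \<in> L2v (lebesgue_on S)"
    and lim: "(\<lambda>n. L2norm (lebesgue_on S) (\<lambda>x. \<phi> n x - u x)) \<longlonglongrightarrow> 0"
      "(\<lambda>n. L2norm (lebesgue_on S) (\<lambda>x. jac (\<phi> n) x - g x)) \<longlonglongrightarrow> 0"
  shows "u \<in> W12_0_vec S" "AE x in lebesgue_on S. grad S u x = g x"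
proof -
  note L\<phi> = test_field_L2v[OF S \<phi>]
  have D: "(\<lambda>x. jac (\<phi> n) x - g x) \<in> L2v (lebesgue_on S)" for n
    by (intro L2v_diff L L\<phi>)
  have D': "(\<lambda>x. (jac (\<phi> n) x - g x) $ i) \<in> L2v (lebesgue_on S)" for n i
    using D by (subst (asm) L2v_vec_iff) blast
  have g': "(\<lambda>x. g x $ i $ j) \<in> L2v (lebesgue_on S)" for i j
    using L(2) by (simp add: L2v_vec_iff)
  have u': "(\<lambda>x. u x $ i) \<in> L2v (lebesgue_on S)" for i
    using L(1) by (simp add: L2v_vec_iff)
  have t: "(\<lambda>x. \<phi> n x $ i) \<in> test_functions S" for i n
    using \<phi> by (simp add: test_fields_def)
  have l1: "(\<lambda>n. L2norm (lebesgue_on S) (\<lambda>x. \<phi> n x $ i - u x $ i)) \<longlonglongrightarrow> 0" for i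
    using lim(1) by (subst (asm) L2norm_vec_tendsto_0_iff) (auto intro: L2v_diff L L\<phi>)
  have l2: "(\<lambda>n. L2norm (lebesgue_on S) (\<lambda>x. pdiff j (\<lambda>x. \<phi> n x $ i) x - g x $ i $ j)) \<longlonglongrightarrow> 0" for i j
  proof -
    have "(\<lambda>n. L2norm (lebesgue_on S) (\<lambda>x. (jac (\<phi> n) x - g x) $ i)) \<longlonglongrightarrow> 0"
      using lim(2) L2norm_vec_tendsto_0_iff[of "\<lambda>n x. jac (\<phi> n) x - g x", OF D] by blast
    then have "(\<lambda>n. L2norm (lebesgue_on S) (\<lambda>x. (jac (\<phi> n) x - g x) $ i $ j)) \<longlonglongrightarrow> 0"
      using L2norm_vec_tendsto_0_iff[of "\<lambda>n x. (jac (\<phi> n) x - g x) $ i", OF D'] by blast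
    then show ?thesis by (simp add: jac_def)
  qed
  show "u \<in> W12_0_vec S"
    unfolding W12_0_vec_def using W12_0I(1)[OF S t u' g' l1 l2] by blast
  have "AE x in lebesgue_on S. weak_pderiv S j (\<lambda>x. u x $ i) x = g x $ i $ j" for i j
    by (rule W12_0I(2)[OF S t u' g' l1 l2])
  then show "AE x in lebesgue_on S. grad S u x = g x"
    by (simp add: grad_def vec_eq_iff AE_all_finite)
qed

lemma test_field_W12_0_vec:
  assumes S: "open S" "bounded S" and \<phi>: "\<phi> \<in> test_fields S"
  shows "\<phi> \<in> W12_0_vec S" "AE x in lebesgue_on S. grad S \<phi> x = jac \<phi> x"
  using W12_0_vecI[OF S, of "\<lambda>_. \<phi>" \<phi> "jac \<phi>"] test_field_L2v[OF S \<phi>] \<phi>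
  by (auto simp: L2norm_def)

lemma W12_0_vec_lin:
  fixes u v :: "real ^ 'n::finite \<Rightarrow> real ^ 'd::finite"
  assumes S: "open S" "bounded S" and u: "u \<in> W12_0_vec S" and v: "v \<in> W12_0_vec S"
  shows "(\<lambda>x. a *\<^sub>R u x + b *\<^sub>R v x) \<in> W12_0_vec S"
    "AE x in lebesgue_on S. grad S (\<lambda>x. a *\<^sub>R u x + b *\<^sub>R v x) x = a *\<^sub>R grad S u x + b *\<^sub>R grad S v x"
proof -
  obtain \<phi> where \<phi>: "\<And>n. \<phi> n \<in> test_fields S"
    "(\<lambda>n. L2norm (lebesgue_on S) (\<lambda>x. \<phi> n x - u x)) \<longlonglongrightarrow> 0"
    "(\<lambda>n. L2norm (lebesgue_on S) (\<lambda>x. jac (\<phi> n) x - grad S u x)) \<longlonglongrightarrow> 0"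
    using W12_0_vecE[OF S u] by blast
  obtain \<psi> where \<psi>: "\<And>n. \<psi> n \<in> test_fields S"
    "(\<lambda>n. L2norm (lebesgue_on S) (\<lambda>x. \<psi> n x - v x)) \<longlonglongrightarrow> 0"
    "(\<lambda>n. L2norm (lebesgue_on S) (\<lambda>x. jac (\<psi> n) x - grad S v x)) \<longlonglongrightarrow> 0"
    using W12_0_vecE[OF S v] by blast
  have comb: "(\<lambda>n. L2norm (lebesgue_on S) (\<lambda>x. (a *\<^sub>R f n x + b *\<^sub>R g n x) - (a *\<^sub>R f' x + b *\<^sub>R g' x))) \<longlonglongrightarrow> 0"
    if "\<And>n. f n \<in> L2v (lebesgue_on S)" "\<And>n. g n \<in> L2v (lebesgue_on S)"
      "f' \<in> L2v (lebesgue_on S)" "g' \<in> L2v (lebesgue_on S)"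
      "(\<lambda>n. L2norm (lebesgue_on S) (\<lambda>x. f n x - f' x)) \<longlonglongrightarrow> 0"
      "(\<lambda>n. L2norm (lebesgue_on S) (\<lambda>x. g n x - g' x)) \<longlonglongrightarrow> 0"
    for f g :: "nat \<Rightarrow> real ^ 'n \<Rightarrow> 'c::euclidean_space" and f' g'
  proof (rule tendsto_sandwich[OF _ _ tendsto_const])
    show "\<forall>\<^sub>F n in sequentially. L2norm (lebesgue_on S) (\<lambda>x. (a *\<^sub>R f n x + b *\<^sub>R g n x) - (a *\<^sub>R f' x + b *\<^sub>R g' x))
      \<le> \<bar>a\<bar> * L2norm (lebesgue_on S) (\<lambda>x. f n x - f' x) + \<bar>b\<bar> * L2norm (lebesgue_on S) (\<lambda>x. g n x - g' x)"
    proof (intro always_eventually allI)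
      fix n
      show "L2norm (lebesgue_on S) (\<lambda>x. (a *\<^sub>R f n x + b *\<^sub>R g n x) - (a *\<^sub>R f' x + b *\<^sub>R g' x))
        \<le> \<bar>a\<bar> * L2norm (lebesgue_on S) (\<lambda>x. f n x - f' x) + \<bar>b\<bar> * L2norm (lebesgue_on S) (\<lambda>x. g n x - g' x)"
      proof -
        have "(\<lambda>x. (a *\<^sub>R f n x + b *\<^sub>R g n x) - (a *\<^sub>R f' x + b *\<^sub>R g' x))
            = (\<lambda>x. a *\<^sub>R (f n x - f' x) + b *\<^sub>R (g n x - g' x))"
          by (simp add: algebra_simps)
        then show ?thesis
          using L2norm_triangle[OF L2v_scale[OF L2v_diff[OF that(1) that(3)], of a n] L2v_scale[OF L2v_diff[OF that(2) that(4)], of b n]]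
          by (simp only: L2norm_scale)
      qed
    qed
    show "(\<lambda>n. \<bar>a\<bar> * L2norm (lebesgue_on S) (\<lambda>x. f n x - f' x) + \<bar>b\<bar> * L2norm (lebesgue_on S) (\<lambda>x. g n x - g' x)) \<longlonglongrightarrow> 0"
      by (intro tendsto_add_zero tendsto_mult_right_zero that)
  qed simp
  note L\<phi> = test_field_L2v[OF S \<phi>(1)] test_field_L2v[OF S \<psi>(1)]
  note Lu = W12_0_vec_L2v(1,2)[OF u] W12_0_vec_L2v(1,2)[OF v]
  note I = W12_0_vecI[OF S, of "\<lambda>n x. a *\<^sub>R \<phi> n x + b *\<^sub>R \<psi> n x" "\<lambda>x. a *\<^sub>R u x + b *\<^sub>R v x"
      "\<lambda>x. a *\<^sub>R grad S u x + b *\<^sub>R grad S v x", OF test_field_lin[OF \<phi>(1) \<psi>(1)] L2v_lin[OF Lu(1,3)]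
      L2v_lin[OF Lu(2,4)] comb[OF L\<phi>(1,3) Lu(1,3) \<phi>(2) \<psi>(2)], unfolded jac_lin[OF \<phi>(1) \<psi>(1)],
      OF comb[OF L\<phi>(2,4) Lu(2,4) \<phi>(3) \<psi>(3)]]
  show "(\<lambda>x. a *\<^sub>R u x + b *\<^sub>R v x) \<in> W12_0_vec S"
    "AE x in lebesgue_on S. grad S (\<lambda>x. a *\<^sub>R u x + b *\<^sub>R v x) x = a *\<^sub>R grad S u x + b *\<^sub>R grad S v x"
    by (rule I)+
qed

text \<open>
  Poincare's inequality, from the vanishing of the integral of the derivative of \<open>x $ i * (\<phi> x)\<^sup>2\<close>.
\<close>

lemma Poincare_test_function:
  fixes \<phi> :: "real ^ 'n::finite \<Rightarrow> real"
  assumes S: "open S" and r: "\<And>x. x \<in> S \<Longrightarrow> norm x \<le> r" "r \<ge> 0" and \<phi>: "\<phi> \<in> test_functions S"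
  shows "L2norm (lebesgue_on S) \<phi> \<le> 2 * r * L2norm (lebesgue_on S) (pdiff i \<phi>)"
proof -
  have bdd: "bounded S" using r by (auto simp: bounded_iff)
  have Sm: "S \<in> sets lebesgue" "S \<in> sets borel" using S by auto
  have sm: "smooth \<phi>" using \<phi> by (rule test_function_smooth)
  have dcoord: "((\<lambda>x. x $ i) has_derivative (\<lambda>h. h $ i)) (at x)" for x :: "real ^ 'n"
    by (rule bounded_linear_imp_has_derivative) (rule bounded_linear_vec_nth)
  have pcoord: "pdiff j (\<lambda>x :: real ^ 'n. x $ i) = (\<lambda>x. if j = i then 1 else 0)" for j
    by (rule ext, subst pdiff_eqI[OF dcoord]) (auto simp: axis_def)
  have scoord: "smooth (\<lambda>x :: real ^ 'n. x $ i)"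
  proof (rule smooth_coinduct[where S = "insert (\<lambda>x. x $ i) (range (\<lambda>a x. a))"])
    fix f :: "real ^ 'n \<Rightarrow> real" assume "f \<in> insert (\<lambda>x. x $ i) (range (\<lambda>a x. a))"
    then consider "f = (\<lambda>x. x $ i)" | a where "f = (\<lambda>x. a)" by auto
    then show "(\<forall>x. f differentiable at x) \<and> (\<forall>j. pdiff j f \<in> insert (\<lambda>x. x $ i) (range (\<lambda>a x. a)))"
    proof cases
      case 1
      then show ?thesis using dcoord by (auto simp: pcoord differentiable_def)
    next
      case 2
      have "pdiff j f = (\<lambda>x. 0)" for j unfolding 2 by (rule ext) (rule pdiff_const)
      then show ?thesis using 2 by auto
    qed
  qed simp
  have "(\<lambda>x. \<phi> x * (x $ i * \<phi> x)) \<in> test_functions S"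
    by (intro test_function_mult \<phi> smooth_mult scoord sm)
  from integral_pdiff_test_function[OF Sm(2) this, of i]
  have "0 = (LINT x|lebesgue_on S. pdiff i (\<lambda>x. \<phi> x * (x $ i * \<phi> x)) x)" by simp
  also have "\<dots> = (LINT x|lebesgue_on S. \<phi> x * \<phi> x + (2 * (x $ i * \<phi> x)) * pdiff i \<phi> x)"
    using sm scoord by (intro Bochner_Integration.integral_cong)
      (auto simp: pdiff_mult smooth_differentiable smooth_mult pcoord algebra_simps)
  also have "\<dots> = L2ip (lebesgue_on S) \<phi> \<phi> + L2ip (lebesgue_on S) (\<lambda>x. 2 * (x $ i * \<phi> x)) (pdiff i \<phi>)"
    unfolding L2ip_def inner_real_def
    by (intro Bochner_Integration.integral_add continuous_integrable smooth_continuous smooth_mult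
        smooth_const scoord sm smooth_pdiff bdd Sm)
  finally have eq: "(L2norm (lebesgue_on S) \<phi>)\<^sup>2 = - L2ip (lebesgue_on S) (\<lambda>x. 2 * (x $ i * \<phi> x)) (pdiff i \<phi>)"
    by (simp add: L2ip_self)
  have L: "\<phi> \<in> L2v (lebesgue_on S)" "pdiff i \<phi> \<in> L2v (lebesgue_on S)" "(\<lambda>x. 2 * (x $ i * \<phi> x)) \<in> L2v (lebesgue_on S)"
    by (intro continuous_L2v smooth_continuous smooth_mult smooth_const scoord sm smooth_pdiff bdd Sm)+
  have "L2norm (lebesgue_on S) (\<lambda>x. 2 * (x $ i * \<phi> x)) \<le> (2 * r) * L2norm (lebesgue_on S) \<phi>"
  proof (rule L2v_dominated(2)[OF L(1) L2v_measurable[OF L(3)]])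
    show "AE x in lebesgue_on S. norm (2 * (x $ i * \<phi> x)) \<le> 2 * r * norm (\<phi> x)"
    proof (rule AE_I2)
      fix x assume "x \<in> space (lebesgue_on S)"
      then have "\<bar>x $ i\<bar> \<le> r" using r(1)[of x] component_le_norm_cart[of x i] by (simp add: space_restrict_space)
      then show "norm (2 * (x $ i * \<phi> x)) \<le> 2 * r * norm (\<phi> x)"
        by (simp add: abs_mult mult_right_mono)
    qed
  qed (use r in simp)
  then have "(L2norm (lebesgue_on S) \<phi>)\<^sup>2 \<le> (2 * r * L2norm (lebesgue_on S) \<phi>) * L2norm (lebesgue_on S) (pdiff i \<phi>)"
    unfolding eq using L2ip_Cauchy_Schwarz[OF L(3,2)]
    by (smt (verit) mult_right_mono L2norm_nonneg)
  then have le: "L2norm (lebesgue_on S) \<phi> * L2norm (lebesgue_on S) \<phi>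
      \<le> (2 * r * L2norm (lebesgue_on S) (pdiff i \<phi>)) * L2norm (lebesgue_on S) \<phi>"
    by (simp add: power2_eq_square mult_ac)
  show ?thesis
  proof (cases "L2norm (lebesgue_on S) \<phi> = 0")
    case False
    then have "0 < L2norm (lebesgue_on S) \<phi>" using L2norm_nonneg[of "lebesgue_on S" \<phi>] by linarith
    with le show ?thesis by (rule mult_right_le_imp_le)
  qed (use r in simp)
qed

text \<open>
  Componentwise from test functions to test fields, then by density.
\<close>

lemma Poincare:
  fixes S :: "(real ^ 'n::finite) set"
  assumes S: "open S" "bounded S"
  shows "\<exists>K\<ge>0. \<forall>u \<in> (W12_0_vec S :: (real ^ 'n \<Rightarrow> real ^ 'd::finite) set).
    L2norm (lebesgue_on S) u \<le> K * L2norm (lebesgue_on S) (grad S u)"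
proof -
  obtain r where r: "\<forall>x\<in>S. norm x \<le> r" using S(2) by (auto simp: bounded_iff)
  define K where "K = 2 * max r 0"
  have K: "K \<ge> 0" by (simp add: K_def)
  have test: "L2norm (lebesgue_on S) \<phi> \<le> K * L2norm (lebesgue_on S) (jac \<phi>)"
    if \<phi>: "\<phi> \<in> test_fields S" for \<phi> :: "real ^ 'n \<Rightarrow> real ^ 'd"
  proof (rule power2_le_imp_le)
    note L = test_field_L2v[OF S \<phi>]
    obtain j :: 'n where True by blast
    have "(L2norm (lebesgue_on S) (\<lambda>x. \<phi> x $ k))\<^sup>2 \<le> (K * L2norm (lebesgue_on S) (\<lambda>x. jac \<phi> x $ k))\<^sup>2" for k
    proof (rule power_mono)
      have "L2norm (lebesgue_on S) (\<lambda>x. \<phi> x $ k) \<le> K * L2norm (lebesgue_on S) (pdiff j (\<lambda>x. \<phi> x $ k))"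
        unfolding K_def
        by (rule Poincare_test_function[OF S(1)]) (use r \<phi> in \<open>auto simp: test_fields_def le_max_iff_disj\<close>)
      also have "\<dots> \<le> K * L2norm (lebesgue_on S) (\<lambda>x. jac \<phi> x $ k)"
        using L2norm_nth_le[of "\<lambda>x. jac \<phi> x $ k" "lebesgue_on S" j] L(2)
        by (intro mult_left_mono K) (simp add: jac_def L2v_vec_iff)
      finally show "L2norm (lebesgue_on S) (\<lambda>x. \<phi> x $ k) \<le> K * L2norm (lebesgue_on S) (\<lambda>x. jac \<phi> x $ k)" .
    qed simp
    then show "(L2norm (lebesgue_on S) \<phi>)\<^sup>2 \<le> (K * L2norm (lebesgue_on S) (jac \<phi>))\<^sup>2"
      unfolding power_mult_distrib L2norm_vec_power2[OF L(1)] L2norm_vec_power2[OF L(2)] sum_distrib_left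
      by (intro sum_mono)
  qed (use K in simp)
  have "L2norm (lebesgue_on S) u \<le> K * L2norm (lebesgue_on S) (grad S u)"
    if u: "u \<in> W12_0_vec S" for u :: "real ^ 'n \<Rightarrow> real ^ 'd"
  proof -
    obtain \<phi> where \<phi>: "\<And>n. \<phi> n \<in> test_fields S"
      "(\<lambda>n. L2norm (lebesgue_on S) (\<lambda>x. \<phi> n x - u x)) \<longlonglongrightarrow> 0"
      "(\<lambda>n. L2norm (lebesgue_on S) (\<lambda>x. jac (\<phi> n) x - grad S u x)) \<longlonglongrightarrow> 0"
      using W12_0_vecE[OF S u] by blast
    show ?thesis
    proof (rule LIMSEQ_le)
      show "(\<lambda>n. L2norm (lebesgue_on S) (\<phi> n)) \<longlonglongrightarrow> L2norm (lebesgue_on S) u"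
        by (rule L2norm_tendsto[OF test_field_L2v(1)[OF S \<phi>(1)] W12_0_vec_L2v(1)[OF u] \<phi>(2)])
      show "(\<lambda>n. K * L2norm (lebesgue_on S) (jac (\<phi> n))) \<longlonglongrightarrow> K * L2norm (lebesgue_on S) (grad S u)"
        by (intro tendsto_mult tendsto_const
            L2norm_tendsto[OF test_field_L2v(2)[OF S \<phi>(1)] W12_0_vec_L2v(2)[OF u] \<phi>(3)])
    qed (use test[OF \<phi>(1)] in blast)
  qed
  then show ?thesis using K by blast
qed

lemma W12_norm_vec_eq:
  assumes "u \<in> W12_0_vec S"
  shows "W12_norm_vec S u = sqrt ((L2norm (lebesgue_on S) u)\<^sup>2 + (L2norm (lebesgue_on S) (grad S u))\<^sup>2)"
proof -
  note L = W12_0_vec_L2v[OF assms]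
  have "(W12_norm S (\<lambda>x. u x $ k))\<^sup>2 = (L2norm (lebesgue_on S) (\<lambda>x. u x $ k))\<^sup>2
      + (L2norm (lebesgue_on S) (\<lambda>x. grad S u x $ k))\<^sup>2" for k
  proof -
    have "(\<lambda>x. grad S u x $ k) \<in> L2v (lebesgue_on S)" using L(2) by (simp add: L2v_vec_iff)
    from L2norm_vec_power2[OF this] show ?thesis
      by (simp add: W12_norm_def L2norm_power2 grad_def sum_nonneg)
  qed
  then show ?thesis
    by (simp add: W12_norm_vec_def L2norm_vec_power2[OF L(1)] L2norm_vec_power2[OF L(2)] sum.distrib)
qed

text \<open>
  By Poincare's inequality the gradient alone controls a functional.
\<close>

lemma W12_dual_bound:
  fixes F :: "(real ^ 'n::finite \<Rightarrow> real ^ 'd::finite) \<Rightarrow> real"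
  assumes S: "open S" "bounded S" and F: "F \<in> W12_dual S"
  shows "\<exists>L\<ge>0. \<forall>u\<in>W12_0_vec S. \<bar>F u\<bar> \<le> L * L2norm (lebesgue_on S) (grad S u)"
proof -
  obtain K where K: "\<forall>v\<in>W12_0_vec S. \<bar>F v\<bar> \<le> K * W12_norm_vec S v"
    using F by (auto simp: W12_dual_def)
  obtain P where P: "P \<ge> 0" "\<forall>u \<in> (W12_0_vec S :: (real ^ 'n \<Rightarrow> real ^ 'd) set).
    L2norm (lebesgue_on S) u \<le> P * L2norm (lebesgue_on S) (grad S u)"
    using Poincare[OF S, where 'd = 'd] by blast
  have "\<bar>F u\<bar> \<le> (\<bar>K\<bar> * (P + 1)) * L2norm (lebesgue_on S) (grad S u)" if u: "u \<in> W12_0_vec S" for u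
  proof -
    have "W12_norm_vec S u \<le> L2norm (lebesgue_on S) u + L2norm (lebesgue_on S) (grad S u)"
      unfolding W12_norm_vec_eq[OF u] by (intro sqrt_sum_squares_le_sum) auto
    also have "\<dots> \<le> (P + 1) * L2norm (lebesgue_on S) (grad S u)"
      using P u by (auto simp: algebra_simps)
    finally have le: "W12_norm_vec S u \<le> (P + 1) * L2norm (lebesgue_on S) (grad S u)" .
    have "\<bar>F u\<bar> \<le> K * W12_norm_vec S u" using K u by blast
    also have "\<dots> \<le> \<bar>K\<bar> * W12_norm_vec S u"
      by (intro mult_right_mono) (auto simp: W12_norm_vec_eq[OF u])
    also have "\<dots> \<le> \<bar>K\<bar> * ((P + 1) * L2norm (lebesgue_on S) (grad S u))"
      using le by (intro mult_left_mono) auto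
    finally show ?thesis by (simp add: mult.assoc)
  qed
  then show ?thesis using P by (intro exI[of _ "\<bar>K\<bar> * (P + 1)"]) auto
qed

lemma W12_dual_lin:
  assumes "F \<in> W12_dual S" "u \<in> W12_0_vec S" "v \<in> W12_0_vec S"
  shows "F (\<lambda>x. a *\<^sub>R u x + b *\<^sub>R v x) = a * F u + b * F v"
  using assms by (auto simp: W12_dual_def)

section \<open>The Dirichlet problem with constant coefficients\<close>

lemma linear_L2v:
  fixes T :: "'b::euclidean_space \<Rightarrow> 'c::euclidean_space"
  assumes "linear T"
  obtains K where "K \<ge> 0"
    "\<And>f M. f \<in> L2v M \<Longrightarrow> (\<lambda>x. T (f x)) \<in> L2v M \<and> L2norm M (\<lambda>x. T (f x)) \<le> K * L2norm M f"
proof -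
  have bl: "bounded_linear T" using assms by (simp add: linear_conv_bounded_linear)
  then obtain K where K: "K \<ge> 0" "\<And>x. norm (T x) \<le> K * norm x"
    using bounded_linear.nonneg_bounded by (metis mult.commute)
  have meas: "T \<in> borel_measurable borel"
    using bl by (intro borel_measurable_continuous_onI linear_continuous_on)
  show ?thesis
  proof (rule that[OF K(1)], rule conjI)
    fix f :: "'d \<Rightarrow> 'b" and M assume f: "f \<in> L2v M"
    have m: "(\<lambda>x. T (f x)) \<in> borel_measurable M"
      using measurable_compose[OF L2v_measurable[OF f] meas] .
    show "(\<lambda>x. T (f x)) \<in> L2v M" "L2norm M (\<lambda>x. T (f x)) \<le> K * L2norm M f"
      by (rule L2v_dominated[OF f m]; use K in simp)+
  qed
qed

lemma L2ip_cong_AE: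
  assumes "f \<in> borel_measurable M" "f' \<in> borel_measurable M" "g \<in> borel_measurable M" "g' \<in> borel_measurable M"
    and "AE x in M. f x = f' x" "AE x in M. g x = g' x"
  shows "L2ip M f g = L2ip M f' g'"
  unfolding L2ip_def
proof (rule integral_cong_AE)
  show "AE x in M. f x \<bullet> g x = f' x \<bullet> g' x"
    using assms(5,6) by eventually_elim simp
qed (use assms(1-4) in \<open>auto intro: borel_measurable_inner\<close>)

lemma L2ip_vec:
  fixes f g :: "'a \<Rightarrow> 'b::euclidean_space ^ 'n::finite"
  assumes "f \<in> L2v M" "g \<in> L2v M"
  shows "L2ip M f g = (\<Sum>i\<in>UNIV. L2ip M (\<lambda>x. f x $ i) (\<lambda>x. g x $ i))"
proof -
  have "integrable M (\<lambda>x. f x $ i \<bullet> g x $ i)" for i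
    using assms by (intro L2v_inner_integrable) (auto simp: L2v_vec_iff)
  then show ?thesis by (simp add: L2ip_def inner_vec_def)
qed

lemma W12_dual_tendsto:
  fixes F :: "(real ^ 'n::finite \<Rightarrow> real ^ 'd::finite) \<Rightarrow> real"
  assumes S: "open S" "bounded S" and F: "F \<in> W12_dual S" and \<phi>: "\<And>n. \<phi> n \<in> test_fields S"
    and v: "v \<in> W12_0_vec S"
    and lim: "(\<lambda>n. L2norm (lebesgue_on S) (\<lambda>x. jac (\<phi> n) x - grad S v x)) \<longlonglongrightarrow> 0"
  shows "(\<lambda>n. F (\<phi> n)) \<longlonglongrightarrow> F v"
proof -
  obtain L where L: "L \<ge> 0" "\<And>u. u \<in> W12_0_vec S \<Longrightarrow> \<bar>F u\<bar> \<le> L * L2norm (lebesgue_on S) (grad S u)"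
    using W12_dual_bound[OF S F] by blast
  note t = test_field_W12_0_vec[OF S \<phi>]
  have "\<bar>F (\<phi> n) - F v\<bar> \<le> L * L2norm (lebesgue_on S) (\<lambda>x. jac (\<phi> n) x - grad S v x)" for n
  proof -
    define w where "w = (\<lambda>x. 1 *\<^sub>R \<phi> n x + (-1) *\<^sub>R v x)"
    have w: "w \<in> W12_0_vec S" "AE x in lebesgue_on S. grad S w x = 1 *\<^sub>R grad S (\<phi> n) x + (-1) *\<^sub>R grad S v x"
      unfolding w_def by (rule W12_0_vec_lin[OF S t(1) v])+
    have ae: "AE x in lebesgue_on S. grad S w x = jac (\<phi> n) x - grad S v x"
      using w(2) t(2)[of n] by eventually_elim simp
    have "F (\<phi> n) - F v = F w"
      unfolding w_def by (subst W12_dual_lin[OF F t(1) v]) simp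
    also have "\<bar>F w\<bar> \<le> L * L2norm (lebesgue_on S) (grad S w)" by (rule L(2)[OF w(1)])
    also have "L2norm (lebesgue_on S) (grad S w) = L2norm (lebesgue_on S) (\<lambda>x. jac (\<phi> n) x - grad S v x)"
      using W12_0_vec_L2v(2)[OF w(1)] L2v_diff[OF test_field_L2v(2)[OF S \<phi>] W12_0_vec_L2v(2)[OF v]]
      by (intro L2norm_cong_AE ae L2v_measurable)
    finally show ?thesis by simp
  qed
  then have "\<forall>\<^sub>F n in sequentially. norm (F (\<phi> n) - F v)
      \<le> L * L2norm (lebesgue_on S) (\<lambda>x. jac (\<phi> n) x - grad S v x)"
    by simp
  from Lim_null_comparison[OF this tendsto_mult_right_zero[OF lim]] show ?thesis
    by (rule LIM_zero_cancel)
qed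

lemma L2v_fst_snd:
  assumes "f \<in> L2v M"
  shows "(\<lambda>x. fst (f x)) \<in> L2v M" "(\<lambda>x. snd (f x)) \<in> L2v M"
    "L2norm M (\<lambda>x. fst (f x)) \<le> L2norm M f" "L2norm M (\<lambda>x. snd (f x)) \<le> L2norm M f"
proof -
  have m: "(\<lambda>x. fst (f x)) \<in> borel_measurable M" "(\<lambda>x. snd (f x)) \<in> borel_measurable M"
    using L2v_measurable[OF assms]
    by (auto intro!: borel_measurable_continuous_on[of fst] borel_measurable_continuous_on[of snd]
        continuous_intros)
  have "norm (fst p) \<le> norm p" "norm (snd p) \<le> norm p" for p :: "'b \<times> 'c"
    by (metis norm_fst_le norm_snd_le prod.collapse)+
  then show "(\<lambda>x. fst (f x)) \<in> L2v M" "L2norm M (\<lambda>x. fst (f x)) \<le> L2norm M f"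
    "(\<lambda>x. snd (f x)) \<in> L2v M" "L2norm M (\<lambda>x. snd (f x)) \<le> L2norm M f"
    using L2v_dominated[OF assms m(1), of 1] L2v_dominated[OF assms m(2), of 1] by auto
qed

lemma L2v_Pair:
  assumes "f \<in> L2v M" "g \<in> L2v M"
  shows "(\<lambda>x. (f x, g x)) \<in> L2v M" "(L2norm M (\<lambda>x. (f x, g x)))\<^sup>2 = (L2norm M f)\<^sup>2 + (L2norm M g)\<^sup>2"
  using assms by (auto simp: L2v_def L2norm_power2 norm_Pair borel_measurable_Pair)

text \<open>
  Displacements and their gradients are kept together as one square integrable field, so that
  the Riesz theorem applied to the test fields produces both at once; coercivity on these pairs is
  Poincare's inequality.
\<close>

lemma dirichlet_exists:
  fixes T :: "real ^ 'n::finite ^ 'd::finite \<Rightarrow> real ^ 'n ^ 'd"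
  assumes S: "open S" "bounded S"
    and T: "linear T" "\<And>\<xi> \<zeta>. T \<xi> \<bullet> \<zeta> = T \<zeta> \<bullet> \<xi>" "\<And>\<xi>. c * (norm \<xi>)\<^sup>2 \<le> T \<xi> \<bullet> \<xi>" "c > 0"
    and F: "F \<in> W12_dual S"
  shows "\<exists>z\<in>W12_0_vec S. \<forall>v\<in>W12_0_vec S.
    L2ip (lebesgue_on S) (\<lambda>x. T (grad S z x)) (grad S v) = F v"
proof -
  let ?M = "lebesgue_on S"
  have Sm: "S \<in> sets lebesgue" using S by auto
  have fin: "finite_measure ?M" by (rule finite_measure_lebesgue_on_bounded[OF S(2) Sm])
  obtain K where K: "K \<ge> 0" "\<And>f :: real ^ 'n \<Rightarrow> real ^ 'n ^ 'd. f \<in> L2v ?M \<Longrightarrow>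
      (\<lambda>x. T (f x)) \<in> L2v ?M \<and> L2norm ?M (\<lambda>x. T (f x)) \<le> K * L2norm ?M f"
    using linear_L2v[OF T(1)] by metis
  obtain P where P: "P \<ge> 0" "\<And>u :: real ^ 'n \<Rightarrow> real ^ 'd. u \<in> W12_0_vec S \<Longrightarrow> L2norm ?M u \<le> P * L2norm ?M (grad S u)"
    using Poincare[OF S, where 'd = 'd] by blast
  obtain L where L: "L \<ge> 0" "\<And>u. u \<in> W12_0_vec S \<Longrightarrow> \<bar>F u\<bar> \<le> L * L2norm ?M (grad S u)"
    using W12_dual_bound[OF S F] by blast
  define V where "V = (\<lambda>\<phi> x. (\<phi> x :: real ^ 'd, jac \<phi> x)) ` test_fields S"
  define B where "B = (\<lambda>f g. L2ip ?M (\<lambda>x. T (snd (f x :: (real ^ 'd) \<times> (real ^ 'n ^ 'd)))) (\<lambda>x. snd (g x :: (real ^ 'd) \<times> (real ^ 'n ^ 'd))))"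
  define l where "l = (\<lambda>f. F (\<lambda>x. fst (f x :: (real ^ 'd) \<times> (real ^ 'n ^ 'd))))"
  note tW = test_field_W12_0_vec[OF S]
  have n2grad: "L2norm ?M (grad S \<phi>) = L2norm ?M (jac \<phi>)" if "\<phi> \<in> test_fields S" for \<phi> :: "real ^ 'n \<Rightarrow> real ^ 'd"
    by (intro L2norm_cong_AE tW that L2v_measurable[OF W12_0_vec_L2v(2)[OF tW(1)[OF that]]]
        L2v_measurable[OF test_field_L2v(2)[OF S that]])
  have "\<exists>Fn H. (\<forall>n. Fn n \<in> V) \<and> H \<in> L2v ?M \<and> (\<lambda>n. L2norm ?M (\<lambda>x. Fn n x - H x)) \<longlonglongrightarrow> 0 \<and>
    (\<forall>w\<in>V. B H w = l w)"
  proof (rule Riesz_on_subspace[OF fin])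
    show "V \<subseteq> L2v ?M"
      unfolding V_def using L2v_Pair(1)[OF test_field_L2v[OF S]] by blast
    have "(\<lambda>x. 0) \<in> test_fields S" by (simp add: test_fields_def test_function_zero)
    then show "V \<noteq> {}" by (auto simp: V_def)
    show "(\<lambda>x. a *\<^sub>R v x + b *\<^sub>R w x) \<in> V" if vw: "v \<in> V" "w \<in> V" for a b v w
    proof -
      obtain \<phi> \<psi> where "\<phi> \<in> test_fields S" "v = (\<lambda>x. (\<phi> x, jac \<phi> x))" "\<psi> \<in> test_fields S" "w = (\<lambda>x. (\<psi> x, jac \<psi> x))"
        using vw by (auto simp: V_def)
      then show ?thesis
        unfolding V_def
        by (intro image_eqI[of _ _ "\<lambda>x. a *\<^sub>R \<phi> x + b *\<^sub>R \<psi> x"]) (auto simp: jac_lin test_field_lin)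
    qed
    show "l (\<lambda>x. a *\<^sub>R v x + b *\<^sub>R w x) = a * l v + b * l w" if vw: "v \<in> V" "w \<in> V" for a b v w
    proof -
      obtain \<phi> \<psi> where "\<phi> \<in> test_fields S" "v = (\<lambda>x. (\<phi> x, jac \<phi> x))" "\<psi> \<in> test_fields S" "w = (\<lambda>x. (\<psi> x, jac \<psi> x))"
        using vw by (auto simp: V_def)
      then show ?thesis
        unfolding l_def using W12_dual_lin[OF F tW(1) tW(1)] by simp
    qed
    show "\<bar>l v\<bar> \<le> L * L2norm ?M v" if v: "v \<in> V" for v
    proof -
      obtain \<phi> where \<phi>: "\<phi> \<in> test_fields S" "v = (\<lambda>x. (\<phi> x, jac \<phi> x))"
        using v by (auto simp: V_def)
      have "\<bar>l v\<bar> \<le> L * L2norm ?M (jac \<phi>)"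
        using L(2)[OF tW(1)[OF \<phi>(1)]] by (simp add: l_def \<phi>(2) n2grad[OF \<phi>(1)])
      also have "\<dots> \<le> L * L2norm ?M v"
        using L2v_fst_snd(4)[OF L2v_Pair(1)[OF test_field_L2v[OF S \<phi>(1)]]]
        by (intro mult_left_mono L) (simp add: \<phi>(2))
      finally show ?thesis .
    qed
    show "B (\<lambda>x. a *\<^sub>R u x + b *\<^sub>R v x) w = a * B u w + b * B v w"
      if uvw: "u \<in> L2v ?M" "v \<in> L2v ?M" "w \<in> L2v ?M" for a b u v w
      using L2ip_lin[of "\<lambda>x. T (snd (u x))" ?M "\<lambda>x. T (snd (v x))" "\<lambda>x. snd (w x)" a b]
        K(2)[OF L2v_fst_snd(2)[OF uvw(1)]] K(2)[OF L2v_fst_snd(2)[OF uvw(2)]] L2v_fst_snd(2)[OF uvw(3)]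
      by (simp add: B_def linear_add[OF T(1)] linear_cmul[OF T(1)])
    show "B u v = B v u" for u v
      unfolding B_def L2ip_def by (simp add: T(2))
    show "\<bar>B u v\<bar> \<le> K * L2norm ?M u * L2norm ?M v" if uv: "u \<in> L2v ?M" "v \<in> L2v ?M" for u v
    proof -
      have "\<bar>B u v\<bar> \<le> L2norm ?M (\<lambda>x. T (snd (u x))) * L2norm ?M (\<lambda>x. snd (v x))"
        unfolding B_def using K(2)[OF L2v_fst_snd(2)[OF uv(1)]] L2v_fst_snd(2)[OF uv(2)]
        by (intro L2ip_Cauchy_Schwarz) auto
      also have "\<dots> \<le> (K * L2norm ?M (\<lambda>x. snd (u x))) * L2norm ?M (\<lambda>x. snd (v x))"
        using K(2)[OF L2v_fst_snd(2)[OF uv(1)]] by (intro mult_right_mono) auto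
      also have "\<dots> \<le> (K * L2norm ?M u) * L2norm ?M v"
        using L2v_fst_snd(4)[OF uv(1)] L2v_fst_snd(4)[OF uv(2)] K(1)
        by (intro mult_mono mult_left_mono mult_nonneg_nonneg) auto
      finally show ?thesis .
    qed
    show "(c / (P\<^sup>2 + 1)) * (L2norm ?M v)\<^sup>2 \<le> B v v" if v: "v \<in> V" for v
    proof -
      obtain \<phi> where \<phi>: "\<phi> \<in> test_fields S" "v = (\<lambda>x. (\<phi> x, jac \<phi> x))"
        using v by (auto simp: V_def)
      note L\<phi> = test_field_L2v[OF S \<phi>(1)]
      have "(L2norm ?M \<phi>)\<^sup>2 \<le> (P * L2norm ?M (jac \<phi>))\<^sup>2"
        using P(2)[OF tW(1)[OF \<phi>(1)]] n2grad[OF \<phi>(1)] by (intro power_mono) auto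
      then have "(L2norm ?M v)\<^sup>2 \<le> (P\<^sup>2 + 1) * (L2norm ?M (jac \<phi>))\<^sup>2"
        using L2v_Pair(2)[OF L\<phi>] by (simp add: \<phi>(2) algebra_simps)
      moreover have "P\<^sup>2 + 1 > 0" by (simp add: add_nonneg_pos)
      ultimately have "(c / (P\<^sup>2 + 1)) * (L2norm ?M v)\<^sup>2 \<le> (c / (P\<^sup>2 + 1)) * ((P\<^sup>2 + 1) * (L2norm ?M (jac \<phi>))\<^sup>2)"
        using T(4) by (intro mult_left_mono) auto
      also have "\<dots> = c * (L2norm ?M (jac \<phi>))\<^sup>2"
        using \<open>P\<^sup>2 + 1 > 0\<close> by simp
      also have "\<dots> = (LINT x|?M. c * (norm (jac \<phi> x))\<^sup>2)"
        by (simp add: L2norm_power2)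
      also have "\<dots> \<le> B v v"
        unfolding B_def \<phi>(2) L2ip_def snd_conv
        using L\<phi>(2) K(2)[OF L\<phi>(2)] L2v_inner_integrable[of "\<lambda>x. T (jac \<phi> x)" ?M "jac \<phi>"]
        by (intro integral_mono T(3)) (auto simp: L2v_def)
      finally show ?thesis .
    qed
    show "c / (P\<^sup>2 + 1) > 0" using T(4) by (simp add: add_nonneg_pos)
  qed
  then obtain Fn H where FH: "\<And>n. Fn n \<in> V" "H \<in> L2v ?M" "(\<lambda>n. L2norm ?M (\<lambda>x. Fn n x - H x)) \<longlonglongrightarrow> 0"
    "\<And>w. w \<in> V \<Longrightarrow> B H w = l w" by blast
  have "\<forall>n. \<exists>\<phi>\<in>test_fields S. Fn n = (\<lambda>x. (\<phi> x, jac \<phi> x))"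
    using FH(1) by (auto simp: V_def)
  then obtain \<phi> where \<phi>: "\<And>n. \<phi> n \<in> test_fields S" "\<And>n. Fn n = (\<lambda>x. (\<phi> n x, jac (\<phi> n) x))"
    by metis
  define z where "z = (\<lambda>x. fst (H x))"
  have FnL: "(\<lambda>x. Fn n x - H x) \<in> L2v ?M" for n
    unfolding \<phi>(2) by (intro L2v_diff L2v_Pair(1) test_field_L2v[OF S \<phi>(1)] FH)
  have l1: "(\<lambda>n. L2norm ?M (\<lambda>x. \<phi> n x - z x)) \<longlonglongrightarrow> 0"
    by (rule tendsto_sandwich[OF _ _ tendsto_const FH(3)])
      (use L2v_fst_snd(3)[OF FnL] in \<open>auto simp: \<phi>(2) z_def intro!: always_eventually\<close>)
  have l2: "(\<lambda>n. L2norm ?M (\<lambda>x. jac (\<phi> n) x - snd (H x))) \<longlonglongrightarrow> 0"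
    by (rule tendsto_sandwich[OF _ _ tendsto_const FH(3)])
      (use L2v_fst_snd(4)[OF FnL] in \<open>auto simp: \<phi>(2) intro!: always_eventually\<close>)
  have Lz: "z \<in> L2v ?M" unfolding z_def by (rule L2v_fst_snd(1)[OF FH(2)])
  note Lg = L2v_fst_snd(2)[OF FH(2)]
  have z: "z \<in> W12_0_vec S" "AE x in ?M. grad S z x = snd (H x)"
    by (rule W12_0_vecI[OF S \<phi>(1) Lz Lg l1 l2])+
  have TL: "(\<lambda>x. T (grad S z x)) \<in> L2v ?M" "(\<lambda>x. T (snd (H x))) \<in> L2v ?M"
    using K(2) W12_0_vec_L2v(2)[OF z(1)] Lg by blast+
  have test: "L2ip ?M (\<lambda>x. T (grad S z x)) (jac \<psi>) = F \<psi>" if \<psi>: "\<psi> \<in> test_fields S" for \<psi>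
  proof -
    have "L2ip ?M (\<lambda>x. T (grad S z x)) (jac \<psi>) = L2ip ?M (\<lambda>x. T (snd (H x))) (jac \<psi>)"
    proof (rule L2ip_cong_AE)
      show "AE x in ?M. T (grad S z x) = T (snd (H x))"
        using z(2) by eventually_elim simp
    qed (use TL test_field_L2v(2)[OF S \<psi>] in \<open>auto intro: L2v_measurable\<close>)
    also have "\<dots> = B H (\<lambda>x. (\<psi> x, jac \<psi> x))" by (simp add: B_def)
    also have "\<dots> = l (\<lambda>x. (\<psi> x, jac \<psi> x))" using \<psi> by (intro FH(4)) (auto simp: V_def)
    finally show ?thesis by (simp add: l_def)
  qed
  have "L2ip ?M (\<lambda>x. T (grad S z x)) (grad S v) = F v" if v: "v \<in> W12_0_vec S" for v
  proof -
    obtain \<psi> where \<psi>: "\<And>n. \<psi> n \<in> test_fields S"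
      "(\<lambda>n. L2norm ?M (\<lambda>x. \<psi> n x - v x)) \<longlonglongrightarrow> 0"
      "(\<lambda>n. L2norm ?M (\<lambda>x. jac (\<psi> n) x - grad S v x)) \<longlonglongrightarrow> 0"
      using W12_0_vecE[OF S v] by blast
    have "(\<lambda>n. L2ip ?M (jac (\<psi> n)) (\<lambda>x. T (grad S z x))) \<longlonglongrightarrow> L2ip ?M (grad S v) (\<lambda>x. T (grad S z x))"
      by (rule L2ip_tendsto[OF test_field_L2v(2)[OF S \<psi>(1)] W12_0_vec_L2v(2)[OF v] \<psi>(3) TL(1)])
    moreover have "(\<lambda>n. F (\<psi> n)) \<longlonglongrightarrow> F v"
      by (rule W12_dual_tendsto[OF S F \<psi>(1) v \<psi>(3)])
    ultimately show ?thesis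
      by (simp add: L2ip_commute[of _ "jac _"] test[OF \<psi>(1)] L2ip_commute[of _ "grad S v"] LIMSEQ_unique)
  qed
  with z(1) show ?thesis by blast
qed

text \<open>
  By the representation of functionals through the Dirichlet problem, bounded sequences need to be
  tested against gradients of test fields only.
\<close>

lemma W12_dual_null:
  fixes T :: "real ^ 'n::finite ^ 'd::finite \<Rightarrow> real ^ 'n ^ 'd"
  assumes S: "open S" "bounded S"
    and T: "linear T" "\<And>\<xi> \<zeta>. T \<xi> \<bullet> \<zeta> = T \<zeta> \<bullet> \<xi>" "\<And>\<xi>. c * (norm \<xi>)\<^sup>2 \<le> T \<xi> \<bullet> \<xi>" "c > 0"
    and F: "F \<in> W12_dual S" and w: "\<And>n. w n \<in> W12_0_vec S" "\<And>n. L2norm (lebesgue_on S) (grad S (w n)) \<le> m"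
    and null: "\<And>\<phi>. \<phi> \<in> test_fields S \<Longrightarrow>
      (\<lambda>n. L2ip (lebesgue_on S) (\<lambda>x. T (jac \<phi> x)) (grad S (w n))) \<longlonglongrightarrow> 0"
  shows "(\<lambda>n. F (w n)) \<longlonglongrightarrow> 0"
proof (rule LIMSEQ_I)
  let ?M = "lebesgue_on S"
  fix e :: real assume e: "e > 0"
  obtain z where z: "z \<in> W12_0_vec S" "\<And>v. v \<in> W12_0_vec S \<Longrightarrow> L2ip ?M (\<lambda>x. T (grad S z x)) (grad S v) = F v"
    using dirichlet_exists[OF S T F] by blast
  obtain K where K: "K \<ge> 0" "\<And>f :: real ^ 'n \<Rightarrow> real ^ 'n ^ 'd. f \<in> L2v ?M \<Longrightarrow>
      (\<lambda>x. T (f x)) \<in> L2v ?M \<and> L2norm ?M (\<lambda>x. T (f x)) \<le> K * L2norm ?M f"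
    using linear_L2v[OF T(1)] by metis
  obtain \<phi> where \<phi>: "\<And>n. \<phi> n \<in> test_fields S" "(\<lambda>n. L2norm ?M (\<lambda>x. \<phi> n x - z x)) \<longlonglongrightarrow> 0"
    "(\<lambda>n. L2norm ?M (\<lambda>x. jac (\<phi> n) x - grad S z x)) \<longlonglongrightarrow> 0"
    using W12_0_vecE[OF S z(1)] by blast
  have m: "m \<ge> 0" using w(2)[of 0] L2norm_nonneg order_trans by blast
  define \<delta> where "\<delta> = e / (2 * (K * m + 1))"
  have Km: "K * m + 1 > 0" using K(1) m by (simp add: add_nonneg_pos)
  then have \<delta>: "\<delta> > 0" using e by (simp add: \<delta>_def)
  obtain n0 where n0: "L2norm ?M (\<lambda>x. jac (\<phi> n0) x - grad S z x) < \<delta>"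
    using LIMSEQ_D[OF \<phi>(3) \<delta>] by auto
  obtain N where N: "\<And>n. n \<ge> N \<Longrightarrow> \<bar>L2ip ?M (\<lambda>x. T (jac (\<phi> n0) x)) (grad S (w n))\<bar> < e / 2"
    using LIMSEQ_D[OF null[OF \<phi>(1)], of "e / 2"] e by auto
  have "norm (F (w n) - 0) < e" if n: "n \<ge> N" for n
  proof -
    note Lw = W12_0_vec_L2v(2)[OF w(1)] and Lz = W12_0_vec_L2v(2)[OF z(1)] and L\<phi> = test_field_L2v(2)[OF S \<phi>(1)]
    have LD: "(\<lambda>x. jac (\<phi> n0) x - grad S z x) \<in> L2v ?M" by (intro L2v_diff L\<phi> Lz)
    have "L2ip ?M (\<lambda>x. T (jac (\<phi> n0) x)) (grad S (w n)) - F (w n)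
        = L2ip ?M (\<lambda>x. T (jac (\<phi> n0) x - grad S z x)) (grad S (w n))"
      using L2ip_diff[of "\<lambda>x. T (jac (\<phi> n0) x)" ?M "\<lambda>x. T (grad S z x)" "grad S (w n)"]
        K(2)[OF L\<phi>] K(2)[OF Lz] Lw z(2)[OF w(1)] by (simp add: linear_diff[OF T(1)])
    also have "\<bar>\<dots>\<bar> \<le> L2norm ?M (\<lambda>x. T (jac (\<phi> n0) x - grad S z x)) * L2norm ?M (grad S (w n))"
      using K(2)[OF LD] Lw by (intro L2ip_Cauchy_Schwarz) auto
    also have "\<dots> \<le> (K * L2norm ?M (\<lambda>x. jac (\<phi> n0) x - grad S z x)) * m"
      using K(2)[OF LD] w(2)[of n] K(1) by (intro mult_mono) auto
    also have "\<dots> \<le> (K * \<delta>) * m"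
      using n0 K(1) m by (intro mult_right_mono mult_left_mono) auto
    also have "\<dots> \<le> \<delta> * (K * m + 1)" using \<delta> by (simp add: algebra_simps)
    also have "\<dots> = e / 2" using Km unfolding \<delta>_def by (simp add: field_split_simps)
    finally show ?thesis using N[OF n] by (simp only: real_norm_def diff_zero)
  qed
  then show "\<exists>N. \<forall>n\<ge>N. norm (F (w n) - 0) < e" by blast
qed

text \<open>
  For a test field two integrations by parts are possible, and the second derivatives are tested with
  \<open>w n\<close> itself. In the proof of the theorem this disposes of the oscillating test fields.
\<close>

lemma W12_dual_null_of_L2_null:
  fixes w :: "nat \<Rightarrow> real ^ 'n::finite \<Rightarrow> real ^ 'd::finite"
  assumes S: "open S" "bounded S" and F: "F \<in> W12_dual S"
    and w: "\<And>n. w n \<in> W12_0_vec S" "\<And>n. L2norm (lebesgue_on S) (grad S (w n)) \<le> m"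
    and null: "(\<lambda>n. L2norm (lebesgue_on S) (w n)) \<longlonglongrightarrow> 0"
  shows "(\<lambda>n. F (w n)) \<longlonglongrightarrow> 0"
proof (rule W12_dual_null[OF S, of "\<lambda>\<xi>. \<xi>" 1])
  let ?M = "lebesgue_on S"
  have Sm: "S \<in> sets lebesgue" using S by auto
  fix \<phi> :: "real ^ 'n \<Rightarrow> real ^ 'd" assume \<phi>: "\<phi> \<in> test_fields S"
  note L\<phi> = test_field_L2v[OF S \<phi>]
  have t: "(\<lambda>x. \<phi> x $ i) \<in> test_functions S" for i using \<phi> by (simp add: test_fields_def)
  have Lw: "(\<lambda>x. w n x $ i) \<in> L2v ?M" for n i using W12_0_vec_L2v(1)[OF w(1)] by (simp add: L2v_vec_iff)
  have Lg: "(\<lambda>x. grad S (w n) x $ i) \<in> L2v ?M" for n i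
    using W12_0_vec_L2v(2)[OF w(1)] by (subst (asm) L2v_vec_iff) blast
  have Lj: "(\<lambda>x. jac \<phi> x $ i) \<in> L2v ?M" for i
    using L\<phi>(2) by (subst (asm) L2v_vec_iff) blast
  have Lt: "pdiff j (pdiff j (\<lambda>x. \<phi> x $ i)) \<in> L2v ?M" for i j
    by (rule test_function_L2v[OF test_function_pdiff[OF test_function_pdiff[OF t]] S(2) Sm])
  have eq: "L2ip ?M (jac \<phi>) (grad S (w n))
      = - (\<Sum>i\<in>UNIV. \<Sum>j\<in>UNIV. L2ip ?M (\<lambda>x. w n x $ i) (pdiff j (pdiff j (\<lambda>x. \<phi> x $ i))))" for n
  proof -
    have "L2ip ?M (jac \<phi>) (grad S (w n))
        = (\<Sum>i\<in>UNIV. \<Sum>j\<in>UNIV. L2ip ?M (\<lambda>x. jac \<phi> x $ i $ j) (\<lambda>x. grad S (w n) x $ i $ j))"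
      unfolding L2ip_vec[OF L\<phi>(2) W12_0_vec_L2v(2)[OF w(1)]] L2ip_vec[OF Lj Lg] ..
    moreover have "L2ip ?M (\<lambda>x. jac \<phi> x $ i $ j) (\<lambda>x. grad S (w n) x $ i $ j)
        = - L2ip ?M (\<lambda>x. w n x $ i) (pdiff j (pdiff j (\<lambda>x. \<phi> x $ i)))" for i j
      using W12_0_vec_L2v(3)[OF w(1)[of n], of j i] test_function_pdiff[OF t, of j i]
      by (simp add: has_weak_pderiv_L2ip jac_def L2ip_commute[of _ "pdiff j (\<lambda>x. \<phi> x $ i)"])
    ultimately show ?thesis by (simp add: sum_negf)
  qed
  have "(\<lambda>n. L2ip ?M (\<lambda>x. w n x $ i) (pdiff j (pdiff j (\<lambda>x. \<phi> x $ i)))) \<longlonglongrightarrow> 0" for i j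
  proof (rule Lim_null_comparison)
    show "(\<lambda>n. L2norm ?M (w n) * L2norm ?M (pdiff j (pdiff j (\<lambda>x. \<phi> x $ i)))) \<longlonglongrightarrow> 0"
      by (rule tendsto_mult_left_zero[OF null])
    have "norm (L2ip ?M (\<lambda>x. w n x $ i) (pdiff j (pdiff j (\<lambda>x. \<phi> x $ i))))
        \<le> L2norm ?M (w n) * L2norm ?M (pdiff j (pdiff j (\<lambda>x. \<phi> x $ i)))" for n
      using L2ip_Cauchy_Schwarz[OF Lw[of n i] Lt[of j i]] L2norm_nth_le[OF W12_0_vec_L2v(1)[OF w(1)[of n]], of i]
      by (smt (verit) mult_right_mono L2norm_nonneg real_norm_def)
    then show "\<forall>\<^sub>F n in sequentially. norm (L2ip ?M (\<lambda>x. w n x $ i) (pdiff j (pdiff j (\<lambda>x. \<phi> x $ i))))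
        \<le> L2norm ?M (w n) * L2norm ?M (pdiff j (pdiff j (\<lambda>x. \<phi> x $ i)))" by simp
  qed
  then have "(\<lambda>n. - (\<Sum>i\<in>UNIV. \<Sum>j\<in>UNIV. L2ip ?M (\<lambda>x. w n x $ i) (pdiff j (pdiff j (\<lambda>x. \<phi> x $ i))))) \<longlonglongrightarrow> - 0"
    by (intro tendsto_minus tendsto_null_sum)
  then show "(\<lambda>n. L2ip ?M (jac \<phi>) (grad S (w n))) \<longlonglongrightarrow> 0" by (simp add: eq)
qed (use F w in \<open>auto simp: inner_commute power2_norm_eq_inner intro: linear_id[unfolded id_def]\<close>)

section \<open>Trigonometric polynomials\<close>

definition wave :: "int ^ 'm::finite \<Rightarrow> real \<Rightarrow> real ^ 'm \<Rightarrow> real" where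
  "wave k b y = cos (2 * pi * (int_vec k \<bullet> y) + b)"

text \<open>
  The phase makes cosine and sine one function; derivatives of a wave and products of two waves are
  again combinations of waves.
\<close>

inductive_set trig :: "(real ^ 'm::finite \<Rightarrow> real) set" where
  trig_wave: "(\<lambda>y. a * wave k b y) \<in> trig"
| trig_add: "f \<in> trig \<Longrightarrow> g \<in> trig \<Longrightarrow> (\<lambda>y. f y + g y) \<in> trig"

lemma int_vec_0 [simp]: "int_vec 0 = 0"
  by (simp add: int_vec_def vec_eq_iff)

lemma int_vec_add: "int_vec (k + l) = int_vec k + int_vec l"
  by (simp add: int_vec_def vec_eq_iff)

lemma int_vec_diff: "int_vec (k - l) = int_vec k - int_vec l"
  by (simp add: int_vec_def vec_eq_iff)

lemma wave_eq: "wave k b = (\<lambda>y. cos ((2 * pi) *\<^sub>R int_vec k \<bullet> y + b))"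
  by (simp add: wave_def fun_eq_iff)

lemma smooth_wave: "smooth (\<lambda>y. a * wave k b y)"
  unfolding wave_eq by (rule smooth_cos)

lemma pdiff_wave: "pdiff i (\<lambda>y. a * wave k b y) y = a * (2 * pi * of_int (k $ i)) * wave k (b + pi / 2) y"
  unfolding wave_eq by (subst pdiff_cos) (simp add: int_vec_def)

lemma wave_periodic: "wave k b (y + int_vec l) = wave k b y"
proof -
  have "2 * pi * (int_vec k \<bullet> (y + int_vec l)) + b
      = (2 * pi * (int_vec k \<bullet> y) + b) + 2 * pi * of_int (\<Sum>i\<in>UNIV. k $ i * l $ i)"
    by (simp add: inner_add_right inner_vec_def int_vec_def distrib_left sum.distrib)
  then show ?thesis
    by (simp only: wave_def cos_add[of _ "2 * pi * of_int _"] cos_int_2pin sin_int_2pin)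
qed

lemma wave_mult:
  "wave k b y * wave l c y = (1/2) * wave (k - l) (b - c) y + (1/2) * wave (k + l) (b + c) y"
  unfolding wave_def cos_times_cos by (simp add: int_vec_add int_vec_diff algebra_simps)

lemma trig_smooth: "f \<in> trig \<Longrightarrow> smooth f"
  by (induction rule: trig.induct) (auto intro: smooth_wave smooth_add)

lemma trig_periodic: "f \<in> trig \<Longrightarrow> cell_periodic f"
  by (induction rule: trig.induct) (auto simp: cell_periodic_def wave_periodic)

lemma trig_const: "(\<lambda>y. a) \<in> trig"
  using trig_wave[of a 0 0] by (simp add: wave_def)

lemma trig_scale: "f \<in> trig \<Longrightarrow> (\<lambda>y. a * f y) \<in> trig"
proof (induction rule: trig.induct)
  case (trig_wave c k b)
  show ?case using trig.trig_wave[of "a * c" k b] by (simp add: mult.assoc)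
next
  case (trig_add f g)
  then show ?case using trig.trig_add by (simp add: distrib_left)
qed

lemma trig_diff: "f \<in> trig \<Longrightarrow> g \<in> trig \<Longrightarrow> (\<lambda>y. f y - g y) \<in> trig"
  using trig_add[OF _ trig_scale, of f g "-1"] by simp

lemma trig_mult:
  assumes "f \<in> trig" "g \<in> trig"
  shows "(\<lambda>y. f y * g y) \<in> trig"
  using assms(1)
proof (induction rule: trig.induct)
  case (trig_wave a k b)
  show ?case
    using assms(2)
  proof (induction rule: trig.induct)
    case (trig_wave a' l c)
    have "(\<lambda>y. a * wave k b y * (a' * wave l c y))
        = (\<lambda>y. (a * a' / 2) * wave (k - l) (b - c) y + (a * a' / 2) * wave (k + l) (b + c) y)"
      using wave_mult[of k b _ l c] by (simp add: fun_eq_iff algebra_simps)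
    then show ?case by (simp only:) (intro trig.trig_add trig.trig_wave)
  next
    case (trig_add f g)
    then show ?case using trig.trig_add by (simp add: distrib_left)
  qed
next
  case (trig_add f g)
  then show ?case using trig.trig_add by (simp add: distrib_right)
qed

lemma trig_pdiff: "f \<in> trig \<Longrightarrow> pdiff i f \<in> trig"
proof (induction rule: trig.induct)
  case (trig_wave a k b)
  show ?case using trig.trig_wave by (simp add: pdiff_wave[abs_def])
next
  case (trig_add f g)
  have "pdiff i (\<lambda>y. f y + g y) = (\<lambda>y. pdiff i f y + pdiff i g y)"
    using smooth_differentiable[OF trig_smooth[OF trig_add(1)]] smooth_differentiable[OF trig_smooth[OF trig_add(2)]]
    by (simp add: fun_eq_iff pdiff_add)
  then show ?case using trig_add trig.trig_add by simp
qed

lemma trig_sum: "(\<And>i. i \<in> I \<Longrightarrow> f i \<in> trig) \<Longrightarrow> (\<lambda>y. \<Sum>i\<in>I. f i y) \<in> trig"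
  by (induction I rule: infinite_finite_induct) (auto intro: trig_const trig_add)

lemma trig_prod: "(\<And>i. i \<in> I \<Longrightarrow> f i \<in> trig) \<Longrightarrow> (\<lambda>y. \<Prod>i\<in>I. f i y) \<in> trig"
  by (induction I rule: infinite_finite_induct) (auto intro: trig_const trig_mult)

lemma trig_L2v: "f \<in> trig \<Longrightarrow> f \<in> L2v (lebesgue_on unit_cell)"
  by (intro continuous_L2v smooth_continuous trig_smooth bounded_unit_cell unit_cell_sets)

lemma trig_polynomial:
  assumes "real_polynomial_function (p :: real \<Rightarrow> real)" "t \<in> trig"
  shows "(\<lambda>y. p (t y)) \<in> trig"
  using assms(1)
proof (induction rule: real_polynomial_function.induct)
  case (linear f)
  have "f (t y) = f 1 * t y" for y
    using linear_scale[OF bounded_linear.linear[OF linear], of "t y" 1] by (simp add: mult.commute)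
  then show ?case using trig_scale[OF assms(2)] by simp
qed (auto intro: trig_const trig_add trig_mult)

text \<open>
  The cosine centred at the midpoint of the interval exceeds its value at the end points exactly
  inside; \<open>0 < a\<close> and \<open>b < 1\<close> keep the next period away from the cell.
\<close>

lemma cos_gt_iff_interval:
  fixes a b s :: real
  assumes "0 < a" "a < b" "b < 1" "0 < s" "s < 1"
  shows "cos (2 * pi * s - pi * (a + b)) > cos (pi * (b - a)) \<longleftrightarrow> a < s \<and> s < b"
proof -
  define d where "d = \<bar>2 * pi * s - pi * (a + b)\<bar>"
  define H where "H = pi * (b - a)"
  have cd: "cos (2 * pi * s - pi * (a + b)) = cos d" by (simp add: d_def)
  have H: "0 < H" "H < pi" using assms by (auto simp: H_def)
  have d0: "0 \<le> d" by (simp add: d_def)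
  have iff: "a < s \<and> s < b \<longleftrightarrow> d < H"
  proof -
    have "d = pi * \<bar>2 * s - (a + b)\<bar>"
      by (simp add: d_def abs_mult[of pi, simplified, symmetric] algebra_simps)
    then have "d < H \<longleftrightarrow> \<bar>2 * s - (a + b)\<bar> < b - a"
      by (simp add: H_def)
    then show ?thesis by auto
  qed
  have dH: "d \<le> 2 * pi - H"
  proof -
    have "pi * (2 * s - (a + b)) \<le> pi * (2 - (b - a))" "pi * ((a + b) - 2 * s) \<le> pi * (2 - (b - a))"
      using assms by (auto intro!: mult_left_mono)
    then show ?thesis by (auto simp: d_def H_def abs_le_iff algebra_simps)
  qed
  consider "d < H" | "H \<le> d" "d \<le> pi" | "pi < d" by linarith
  then show ?thesis
  proof cases
    case 1
    then have "cos H < cos d" using H d0 by (intro cos_monotone_0_pi) auto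
    then show ?thesis using 1 iff cd by (simp add: H_def)
  next
    case 2
    then have "cos d \<le> cos H" using H by (intro cos_monotone_0_pi_le) auto
    then show ?thesis using 2 iff cd by (simp add: H_def)
  next
    case 3
    have "cos (2 * pi - d) \<le> cos H" using H dH 3 by (intro cos_monotone_0_pi_le) auto
    then have "cos d \<le> cos H" by (simp add: cos_diff)
    moreover have "\<not> d < H" using 3 H(2) by simp
    ultimately show ?thesis using iff cd by (simp add: H_def)
  qed
qed

text \<open>
  On the cell a box is cut out by inequalities between trigonometric polynomials. Composing these
  polynomials with polynomial approximations of steeper and steeper ramps gives uniformly bounded
  trigonometric polynomials that converge to the indicator function of the box.
\<close>

lemma trig_box_approximation:
  fixes a b :: "real ^ 'm::finite"
  assumes ab: "cbox a b \<subseteq> unit_cell" "box a b \<noteq> {}"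
  shows "\<exists>P. (\<forall>n::nat. P n \<in> trig) \<and> (\<forall>n y. \<bar>P n y\<bar> \<le> 2 ^ CARD('m)) \<and>
    (\<forall>y\<in>unit_cell. (\<lambda>n. P n y) \<longlonglongrightarrow> indicator (box a b) y)"
proof -
  have lt: "a $ i < b $ i" for i
    using ab(2) by (auto simp: mem_box_cart simp flip: ex_in_conv intro: less_trans)
  have "a \<in> cbox a b" "b \<in> cbox a b" using lt by (auto simp: mem_box_cart less_imp_le)
  then have in01: "0 < a $ i" "b $ i < 1" for i using ab(1) by (auto simp: unit_cell_def)
  define t where "t = (\<lambda>i y. 1 * wave (axis i 1) (- (pi * (a $ i + b $ i))) y - cos (pi * (b $ i - a $ i)))"
  have t: "t i \<in> trig" for i unfolding t_def by (intro trig_diff trig_const trig_wave)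
  have t_eq: "t i y = cos (2 * pi * y $ i - pi * (a $ i + b $ i)) - cos (pi * (b $ i - a $ i))" for i y
  proof -
    have "int_vec (axis i 1) = (axis i 1 :: real ^ 'm)"
      by (simp add: int_vec_def axis_def vec_eq_iff)
    then show ?thesis by (simp add: t_def wave_def inner_axis')
  qed
  have t_range: "t i y \<in> {-2..2}" for i y
    using cos_le_one[of "2 * pi * y $ i - pi * (a $ i + b $ i)"] cos_ge_minus_one[of "2 * pi * y $ i - pi * (a $ i + b $ i)"]
      cos_le_one[of "pi * (b $ i - a $ i)"] cos_ge_minus_one[of "pi * (b $ i - a $ i)"]
    unfolding t_eq atLeastAtMost_iff by linarith
  define h :: "nat \<Rightarrow> real \<Rightarrow> real" where "h = (\<lambda>n s. min 1 (max 0 (real n * s)))"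
  have "\<exists>p. real_polynomial_function p \<and> (\<forall>s\<in>{-2..2}. \<bar>h n s - p s\<bar> < inverse (real (Suc n)))" for n
  proof -
    have "continuous_on {-2..2} (h n)" unfolding h_def by (intro continuous_intros)
    then obtain p where "real_polynomial_function p" "\<And>s. s \<in> {-2..2} \<Longrightarrow> \<bar>h n s - p s\<bar> < inverse (real (Suc n))"
      using Stone_Weierstrass_real_polynomial_function[OF compact_Icc, of "-2" 2 "h n" "inverse (real (Suc n))"]
      by auto
    then show ?thesis by blast
  qed
  then have "\<exists>p. \<forall>n. real_polynomial_function (p n) \<and> (\<forall>s\<in>{-2..2}. \<bar>h n s - p n s\<bar> < inverse (real (Suc n)))"
    by (intro choice allI)
  then obtain p where p: "\<And>n. real_polynomial_function (p n)"
    "\<And>n s. s \<in> {-2..2} \<Longrightarrow> \<bar>h n s - p n s\<bar> < inverse (real (Suc n))" by blast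
  define P where "P = (\<lambda>n y. \<Prod>i\<in>UNIV. p n (t i y))"
  have "P n \<in> trig" for n
    unfolding P_def by (rule trig_prod) (rule trig_polynomial[OF p(1) t])
  moreover have "\<bar>P n y\<bar> \<le> 2 ^ CARD('m)" for n y
  proof -
    have "\<bar>p n (t i y)\<bar> \<le> 2" for i
    proof -
      have "inverse (real (Suc n)) \<le> 1" by (simp add: field_simps)
      moreover have "0 \<le> h n (t i y)" "h n (t i y) \<le> 1" by (auto simp: h_def)
      ultimately show ?thesis using p(2)[OF t_range, of n i y] by linarith
    qed
    then have "(\<Prod>i\<in>UNIV. \<bar>p n (t i y)\<bar>) \<le> (\<Prod>i\<in>(UNIV :: 'm set). 2)"
      by (intro prod_mono) auto
    then show ?thesis by (simp add: P_def abs_prod)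
  qed
  moreover have "(\<lambda>n. P n y) \<longlonglongrightarrow> indicator (box a b) y" if y: "y \<in> unit_cell" for y
  proof -
    have "(\<lambda>n. p n (t i y)) \<longlonglongrightarrow> (if t i y > 0 then 1 else 0)" for i
    proof -
      have 1: "(\<lambda>n. h n (t i y)) \<longlonglongrightarrow> (if t i y > 0 then 1 else 0)"
      proof (cases "t i y > 0")
        case True
        obtain N where N: "1 < real N * t i y" using reals_Archimedean3[OF True] by blast
        have "\<forall>\<^sub>F n in sequentially. h n (t i y) = 1"
          using eventually_ge_at_top[of N]
        proof eventually_elim
          case (elim n)
          then have "real N * t i y \<le> real n * t i y" using True by (intro mult_right_mono) auto
          then show ?case using N by (auto simp: h_def)
        qed
        then show ?thesis using True by (simp add: tendsto_eventually)
      next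
        case False
        then have "real n * t i y \<le> 0" for n by (simp add: mult_nonneg_nonpos)
        then have "h n (t i y) = 0" for n by (simp add: h_def max_absorb1)
        then show ?thesis using False by simp
      qed
      have "(\<lambda>n. p n (t i y) - h n (t i y)) \<longlonglongrightarrow> 0"
      proof (rule Lim_null_comparison[OF _ LIMSEQ_inverse_real_of_nat])
        have "norm (p n (t i y) - h n (t i y)) \<le> inverse (real (Suc n))" for n
          using p(2)[OF t_range, of n i y] by simp
        then show "\<forall>\<^sub>F n in sequentially. norm (p n (t i y) - h n (t i y)) \<le> inverse (real (Suc n))" by simp
      qed
      from tendsto_add[OF this 1] show ?thesis by simp
    qed
    then have "(\<lambda>n. P n y) \<longlonglongrightarrow> (\<Prod>i\<in>UNIV. if t i y > 0 then 1 else 0)"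
      unfolding P_def by (intro tendsto_prod)
    moreover have "(\<Prod>i\<in>UNIV. if t i y > 0 then 1 else 0) = (indicator (box a b) y :: real)"
    proof -
      have "t i y > 0 \<longleftrightarrow> a $ i < y $ i \<and> y $ i < b $ i" for i
        unfolding t_eq using cos_gt_iff_interval[OF in01(1)[of i] lt[of i] in01(2)[of i], of "y $ i"] y
        by (simp add: unit_cell_def)
      then have iff: "y \<in> box a b \<longleftrightarrow> (\<forall>i. t i y > 0)" by (simp add: mem_box_cart)
      show ?thesis
      proof (cases "y \<in> box a b")
        case False
        then obtain i where "\<not> t i y > 0" using iff by blast
        then have "(\<Prod>i\<in>UNIV. if t i y > 0 then 1 else 0) = (0::real)"
          by (intro prod_zero) auto
        then show ?thesis using False by simp
      qed (use iff in simp)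
    qed
    ultimately show ?thesis by simp
  qed
  ultimately show ?thesis by blast
qed

text \<open>Completeness of the trigonometric system.\<close>

lemma AE_zero_of_trig:
  fixes g :: "real ^ 'm::finite \<Rightarrow> real"
  assumes g: "g \<in> L2v (lebesgue_on unit_cell)"
    and orth: "\<And>t. t \<in> trig \<Longrightarrow> L2ip (lebesgue_on unit_cell) g t = 0"
  shows "AE y in lebesgue_on unit_cell. g y = 0"
proof (rule AE_zero_of_box_integrals[OF open_unit_cell])
  let ?M = "lebesgue_on (unit_cell :: (real ^ 'm) set)"
  show int: "integrable ?M g"
    by (intro L2v_integrable finite_measure_lebesgue_on_bounded bounded_unit_cell unit_cell_sets g)
  fix a b :: "real ^ 'm" assume ab: "cbox a b \<subseteq> unit_cell"
  show "(LINT y|?M. indicator (box a b) y * g y) = 0"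
  proof (cases "box a b = {}")
    case False
    obtain P where P: "\<And>n. P n \<in> trig" "\<And>n y. \<bar>P n y\<bar> \<le> 2 ^ CARD('m)"
      "\<And>y. y \<in> unit_cell \<Longrightarrow> (\<lambda>n. P (n::nat) y) \<longlonglongrightarrow> indicator (box a b) y"
      using trig_box_approximation[OF ab False] by blast
    have [measurable]: "g \<in> borel_measurable ?M" "P n \<in> borel_measurable ?M" for n
      using L2v_measurable[OF g] L2v_measurable[OF trig_L2v[OF P(1)]] by auto
    have "(\<lambda>n. LINT y|?M. g y * P n y) \<longlonglongrightarrow> (LINT y|?M. g y * indicator (box a b) y)"
    proof (rule integral_dominated_convergence[where w = "\<lambda>y. norm (g y) * 2 ^ CARD('m)"])
      show "(\<lambda>y. g y * indicator (box a b) y) \<in> borel_measurable ?M"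
        by (rule borel_measurable_times[OF _ measurable_restrict_space1])
          (auto intro!: borel_measurable_indicator)
      show "AE y in ?M. (\<lambda>n. g y * P n y) \<longlonglongrightarrow> g y * indicator (box a b) y"
        by (rule AE_I2) (auto intro!: tendsto_mult P(3) simp: space_restrict_space)
      show "AE y in ?M. norm (g y * P n y) \<le> norm (g y) * 2 ^ CARD('m)" for n
        using P(2)[of n] by (auto simp: abs_mult intro!: mult_left_mono)
      show "integrable ?M (\<lambda>y. norm (g y) * 2 ^ CARD('m))" using int by simp
    qed measurable
    moreover have "(LINT y|?M. g y * P n y) = 0" for n
      using orth[OF P(1)] by (simp add: L2ip_def)
    ultimately show ?thesis by (simp add: LIMSEQ_const_iff mult.commute)
  qed simp
qed

section \<open>Gradients and divergence-free fields on the cell\<close>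

abbreviation cell :: "(real ^ 'm::finite) measure" where "cell \<equiv> lebesgue_on unit_cell"

lemma finite_measure_cell: "finite_measure cell"
  by (intro finite_measure_lebesgue_on_bounded bounded_unit_cell unit_cell_sets)

lemma L2norm_cell_const: "L2norm cell (\<lambda>y :: real ^ 'm::finite. v) = norm v"
  using measure_unit_cell[where 'm = 'm]
  by (simp add: L2norm_def measure_restrict_space space_restrict_space unit_cell_sets)

text \<open>
  Orthogonal projection onto the closure of a subspace, with the approximating sequence.
\<close>

lemma L2v_projection:
  fixes V :: "('a \<Rightarrow> 'b::euclidean_space) set"
  assumes "finite_measure M" "V \<subseteq> L2v M" "V \<noteq> {}"
    and "\<And>a b v w. v \<in> V \<Longrightarrow> w \<in> V \<Longrightarrow> (\<lambda>x. a *\<^sub>R v x + b *\<^sub>R w x) \<in> V"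
    and F: "F \<in> L2v M"
  obtains v P where "\<And>n::nat. v n \<in> V" "P \<in> L2v M" "(\<lambda>n. L2norm M (\<lambda>x. v n x - P x)) \<longlonglongrightarrow> 0"
    "\<And>w. w \<in> V \<Longrightarrow> L2ip M P w = L2ip M F w"
proof -
  have V: "v \<in> V \<Longrightarrow> v \<in> L2v M" for v using assms(2) by blast
  have "\<exists>v P. (\<forall>n. v n \<in> V) \<and> P \<in> L2v M \<and> (\<lambda>n. L2norm M (\<lambda>x. v n x - P x)) \<longlonglongrightarrow> 0 \<and>
    (\<forall>w\<in>V. L2ip M P w = L2ip M F w)"
  proof (rule Riesz_on_subspace[OF assms(1-4), where c = 1 and K = 1 and L = "L2norm M F"])
    show "L2ip M F (\<lambda>x. a *\<^sub>R v x + b *\<^sub>R w x) = a * L2ip M F v + b * L2ip M F w" if "v \<in> V" "w \<in> V" for a b v w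
      using L2ip_lin[OF V[OF that(1)] V[OF that(2)] F] by (simp add: L2ip_commute[of M F])
  qed (use V F L2ip_Cauchy_Schwarz L2ip_commute in \<open>auto simp: L2ip_lin L2ip_self\<close>)
  then show ?thesis using that by blast
qed

definition Rgrad :: "real ^ 'n::finite ^ 'm::finite \<Rightarrow> (real ^ 'm \<Rightarrow> real) \<Rightarrow> real ^ 'm \<Rightarrow> real ^ 'n" where
  "Rgrad R \<phi> y = (\<chi> q. \<Sum>l\<in>UNIV. R $ l $ q * pdiff l \<phi> y)"

text \<open>
  The amplitude \<open>a\<close> of a generator is orthogonal to \<open>transpose R *v int_vec k\<close>, so \<open>divfree R\<close> consists of the
  trigonometric fields whose restriction to the cut has divergence zero. The constants are
  among them, with \<open>k = 0\<close>.
\<close>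

inductive_set divfree :: "real ^ 'n::finite ^ 'm::finite \<Rightarrow> (real ^ 'm \<Rightarrow> real ^ 'n) set" for R where
  divfree_wave: "a \<bullet> (transpose R *v int_vec k) = 0 \<Longrightarrow> (\<lambda>y. wave k b y *\<^sub>R a) \<in> divfree R"
| divfree_add: "f \<in> divfree R \<Longrightarrow> g \<in> divfree R \<Longrightarrow> (\<lambda>y. f y + g y) \<in> divfree R"

lemma divfree_scale: "d \<in> divfree R \<Longrightarrow> (\<lambda>y. a *\<^sub>R d y) \<in> divfree R"
proof (induction rule: divfree.induct)
  case (divfree_wave v k b)
  then have "(\<lambda>y. wave k b y *\<^sub>R (a *\<^sub>R v)) \<in> divfree R" by (intro divfree.divfree_wave) simp
  then show ?case by (simp add: mult.commute)
next
  case (divfree_add f g)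
  then show ?case by (simp add: scaleR_add_right divfree.divfree_add)
qed

lemma divfree_trig: "d \<in> divfree R \<Longrightarrow> (\<lambda>y. d y $ q) \<in> trig"
proof (induction rule: divfree.induct)
  case (divfree_wave a k b)
  show ?case using trig_wave[of "a $ q" k b] by (simp add: mult.commute)
qed (auto intro: trig_add)

lemma divfree_L2v: "d \<in> divfree R \<Longrightarrow> d \<in> L2v cell"
  by (simp add: L2v_vec_iff divfree_trig trig_L2v)

lemma Rgrad_lin:
  assumes "smooth \<phi>" "smooth \<psi>"
  shows "Rgrad R (\<lambda>y. a * \<phi> y + b * \<psi> y) y = a *\<^sub>R Rgrad R \<phi> y + b *\<^sub>R Rgrad R \<psi> y"
proof -
  have d: "\<phi> differentiable at y" "\<psi> differentiable at y" for y
    using assms by (auto intro: smooth_differentiable)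
  have s: "(\<lambda>y. a * \<phi> y) differentiable at y" "(\<lambda>y. b * \<psi> y) differentiable at y" for y
    by (rule smooth_differentiable[OF smooth_mult[OF smooth_const assms(1)]])
      (rule smooth_differentiable[OF smooth_mult[OF smooth_const assms(2)]])
  have "pdiff l (\<lambda>y. a * \<phi> y + b * \<psi> y) y = a * pdiff l \<phi> y + b * pdiff l \<psi> y" for l
    by (simp only: pdiff_add[OF s] pdiff_scale[OF d(1)] pdiff_scale[OF d(2)])
  then show ?thesis
    by (simp add: Rgrad_def vec_eq_iff sum.distrib sum_distrib_left algebra_simps)
qed

lemma Rgrad_trig: "t \<in> trig \<Longrightarrow> (\<lambda>y. Rgrad R t y $ q) \<in> trig"
  unfolding Rgrad_def by (simp add: trig_sum trig_scale trig_pdiff)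

lemma Rgrad_continuous: "smooth \<phi> \<Longrightarrow> continuous_on UNIV (Rgrad R \<phi>)"
  unfolding Rgrad_def by (intro continuous_intros smooth_continuous smooth_pdiff)

lemma Rgrad_L2v:
  assumes "smooth \<phi>"
  shows "Rgrad R \<phi> \<in> L2v cell"
  by (intro continuous_L2v Rgrad_continuous assms bounded_unit_cell unit_cell_sets)

lemma Rgrad_wave: "Rgrad R (\<lambda>y. a * wave k b y) y = (2 * pi * a * wave k (b + pi / 2) y) *\<^sub>R (transpose R *v int_vec k)"
  by (simp add: Rgrad_def vec_eq_iff pdiff_wave matrix_vector_mult_def transpose_def int_vec_def
      sum_distrib_left algebra_simps)

text \<open>
  A divergence-free wave has an amplitude \<open>a\<close> with \<open>R a\<close> orthogonal to its frequency, so it is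
  constant in the direction \<open>R a\<close> and integration by parts in this direction leaves no term.
\<close>

lemma Rgrad_orthogonal_divfree:
  fixes R :: "real ^ 'n::finite ^ 'm::finite"
  assumes \<phi>: "smooth \<phi>" "cell_periodic \<phi>" and d: "d \<in> divfree R"
  shows "L2ip cell (Rgrad R \<phi>) d = 0"
  using d
proof (induction rule: divfree.induct)
  case (divfree_wave a k b)
  have w: "smooth (wave k c)" "cell_periodic (wave k c)" for c
    using smooth_wave[of 1 k c] by (auto simp: cell_periodic_def wave_periodic)
  have dw: "pdiff l (wave k b) y = (2 * pi * of_int (k $ l)) * wave k (b + pi / 2) y" for l y
    using pdiff_wave[of l 1 k b y] by simp
  have orth: "(\<Sum>l\<in>UNIV. (R *v a) $ l * of_int (k $ l)) = 0"
  proof -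
    have "(\<Sum>l\<in>UNIV. (R *v a) $ l * of_int (k $ l)) = (R *v a) \<bullet> int_vec k"
      by (simp add: inner_vec_def int_vec_def)
    also have "\<dots> = int_vec k \<bullet> (R *v a)"
      by (rule inner_commute)
    also have "\<dots> = (int_vec k v* R) \<bullet> a"
      by (rule dot_lmul_matrix[symmetric])
    also have "\<dots> = a \<bullet> (int_vec k v* R)"
      by (rule inner_commute)
    also have "\<dots> = a \<bullet> (transpose R *v int_vec k)"
      by simp
    finally show ?thesis using divfree_wave by simp
  qed
  have "Rgrad R \<phi> y \<bullet> (wave k b y *\<^sub>R a) = (\<Sum>l\<in>UNIV. (R *v a) $ l * pdiff l (\<lambda>y. \<phi> y * wave k b y) y)" for y
  proof -
    have "(\<Sum>l\<in>UNIV. (R *v a) $ l * pdiff l (\<lambda>y. \<phi> y * wave k b y) y)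
        = (\<Sum>l\<in>UNIV. (R *v a) $ l * (\<phi> y * pdiff l (wave k b) y + pdiff l \<phi> y * wave k b y))"
      using \<phi>(1) w(1) by (simp add: pdiff_mult smooth_differentiable)
    also have "\<dots> = \<phi> y * (2 * pi) * wave k (b + pi / 2) y * (\<Sum>l\<in>UNIV. (R *v a) $ l * of_int (k $ l))
        + wave k b y * (\<Sum>l\<in>UNIV. (R *v a) $ l * pdiff l \<phi> y)"
      unfolding dw by (simp add: sum.distrib sum_distrib_left algebra_simps)
    also have "\<dots> = wave k b y * (\<Sum>l\<in>UNIV. (R *v a) $ l * pdiff l \<phi> y)"
      by (simp only: orth mult_zero_right add_0)
    also have "(\<Sum>l\<in>UNIV. (R *v a) $ l * pdiff l \<phi> y)
        = (\<Sum>l\<in>UNIV. \<Sum>q\<in>UNIV. R $ l $ q * a $ q * pdiff l \<phi> y)"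
      by (simp add: matrix_vector_mult_def sum_distrib_right)
    also have "(\<Sum>l\<in>UNIV. \<Sum>q\<in>UNIV. R $ l $ q * a $ q * pdiff l \<phi> y)
        = (\<Sum>q\<in>UNIV. \<Sum>l\<in>UNIV. R $ l $ q * a $ q * pdiff l \<phi> y)"
      by (rule sum.swap)
    finally show ?thesis
      by (simp add: Rgrad_def inner_vec_def sum_distrib_right sum_distrib_left mult_ac)
  qed
  then have "L2ip cell (Rgrad R \<phi>) (\<lambda>y. wave k b y *\<^sub>R a)
      = (LINT y|cell. (\<Sum>l\<in>UNIV. (R *v a) $ l * pdiff l (\<lambda>y. \<phi> y * wave k b y) y))"
    by (simp add: L2ip_def)
  also have "\<dots> = (\<Sum>l\<in>UNIV. LINT y|cell. (R *v a) $ l * pdiff l (\<lambda>y. \<phi> y * wave k b y) y)"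
    by (intro Bochner_Integration.integral_sum continuous_integrable smooth_continuous smooth_mult smooth_const
        smooth_pdiff \<phi> w bounded_unit_cell unit_cell_sets)
  also have "\<dots> = 0"
  proof (intro sum.neutral ballI)
    fix l
    have "smooth (\<lambda>y. \<phi> y * wave k b y)" "cell_periodic (\<lambda>y. \<phi> y * wave k b y)"
      using \<phi> w by (auto intro: smooth_mult simp: cell_periodic_def)
    from integral_pdiff_periodic[OF this, of l]
    show "(LINT y|cell. (R *v a) $ l * pdiff l (\<lambda>y. \<phi> y * wave k b y) y) = 0" by simp
  qed
  finally show ?case .
next
  case (divfree_add f g)
  then show ?case
    using L2ip_lin[OF divfree_L2v[OF divfree_add(1)] divfree_L2v[OF divfree_add(2)] Rgrad_L2v[OF \<phi>(1), of R], where a = 1 and b = 1]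
    by (simp add: L2ip_commute[of _ "Rgrad R \<phi>"])
qed

text \<open>
  The Helmholtz decomposition, one frequency at a time: the amplitude is split into a multiple of
  \<open>transpose R *v int_vec k\<close>, which is the amplitude of a gradient, and a vector orthogonal to it,
  which is the amplitude of a divergence-free wave.
\<close>

lemma trig_Helmholtz:
  fixes R :: "real ^ 'n::finite ^ 'm::finite"
  assumes t: "t \<in> trig"
  shows "\<exists>\<omega>\<in>trig. \<exists>d\<in>divfree R. \<forall>y. t y *\<^sub>R v = Rgrad R \<omega> y + d y"
  using t
proof (induction rule: trig.induct)
  case (trig_wave a k b)
  define x where "x = transpose R *v int_vec k"
  define s where "s = (v \<bullet> x) / (x \<bullet> x)"
  have orth: "(a *\<^sub>R (v - s *\<^sub>R x)) \<bullet> x = 0"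
    by (cases "x = 0") (auto simp: s_def inner_diff_left)
  define \<omega> where "\<omega> = (\<lambda>y. (a * s / (2 * pi)) * wave k (b - pi / 2) y)"
  have "(a * wave k b y) *\<^sub>R v = Rgrad R \<omega> y + wave k b y *\<^sub>R (a *\<^sub>R (v - s *\<^sub>R x))" for y
    unfolding \<omega>_def Rgrad_wave x_def[symmetric] by (simp add: algebra_simps)
  moreover have "\<omega> \<in> trig" unfolding \<omega>_def by (rule trig.trig_wave)
  moreover have "(\<lambda>y. wave k b y *\<^sub>R (a *\<^sub>R (v - s *\<^sub>R x))) \<in> divfree R"
    using orth by (intro divfree.divfree_wave) (simp add: x_def)
  ultimately show ?case by (intro bexI allI)
next
  case (trig_add f g)
  then obtain \<omega> d \<omega>' d' where *: "\<omega> \<in> trig" "d \<in> divfree R" "\<And>y. f y *\<^sub>R v = Rgrad R \<omega> y + d y"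
    "\<omega>' \<in> trig" "d' \<in> divfree R" "\<And>y. g y *\<^sub>R v = Rgrad R \<omega>' y + d' y" by blast
  have "(f y + g y) *\<^sub>R v = Rgrad R (\<lambda>y. \<omega> y + \<omega>' y) y + (d y + d' y)" for y
    using Rgrad_lin[OF trig_smooth[OF *(1)] trig_smooth[OF *(4)], of R 1 1 y]
    by (simp add: scaleR_add_left *(3,6))
  then show ?case
    by (intro bexI[of _ "\<lambda>y. \<omega> y + \<omega>' y"] bexI[of _ "\<lambda>y. d y + d' y"] allI)
      (auto intro: trig.trig_add divfree.divfree_add *)
qed

text \<open>
  Gradients and divergence-free fields together span all trigonometric fields, so only zero is
  orthogonal to both. Hence each of the two closures is the orthogonal complement of the other, which
  the two approximation lemmas below spell out.
\<close>

lemma AE_zero_of_Helmholtz: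
  fixes R :: "real ^ 'n::finite ^ 'm::finite"
  assumes F: "F \<in> L2v cell"
    and orth: "\<And>\<omega>. \<omega> \<in> trig \<Longrightarrow> L2ip cell F (Rgrad R \<omega>) = 0" "\<And>d. d \<in> divfree R \<Longrightarrow> L2ip cell F d = 0"
  shows "AE y in cell. F y = 0"
proof -
  have "AE y in cell. F y $ q = 0" for q
  proof (rule AE_zero_of_trig)
    show "(\<lambda>y. F y $ q) \<in> L2v cell" using F by (simp add: L2v_vec_iff)
    fix t :: "real ^ 'm \<Rightarrow> real" assume t: "t \<in> trig"
    obtain \<omega> d where *: "\<omega> \<in> trig" "d \<in> divfree R" "\<And>y. t y *\<^sub>R axis q 1 = Rgrad R \<omega> y + d y"
      using trig_Helmholtz[OF t, where v = "axis q 1" and R = R] by blast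
    have "L2ip cell (\<lambda>y. F y $ q) t = L2ip cell F (\<lambda>y. t y *\<^sub>R axis q 1)"
      by (simp add: L2ip_def inner_axis mult.commute)
    also have "\<dots> = L2ip cell (\<lambda>y. 1 *\<^sub>R Rgrad R \<omega> y + 1 *\<^sub>R d y) F"
      by (simp add: *(3) L2ip_commute)
    also have "\<dots> = 0"
      by (subst L2ip_lin[OF Rgrad_L2v[OF trig_smooth[OF *(1)]] divfree_L2v[OF *(2)] F])
        (simp add: L2ip_commute[of _ _ F] orth *)
    finally show "L2ip cell (\<lambda>y. F y $ q) t = 0" .
  qed
  then show ?thesis by (simp add: vec_eq_iff AE_all_finite)
qed

lemma Rgrad_trig_subspace:
  "Rgrad R ` trig \<subseteq> L2v cell" "Rgrad R ` trig \<noteq> {}"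
  "v \<in> Rgrad R ` trig \<Longrightarrow> w \<in> Rgrad R ` trig \<Longrightarrow> (\<lambda>y. a *\<^sub>R v y + b *\<^sub>R w y) \<in> Rgrad R ` trig"
proof -
  show "Rgrad R ` trig \<subseteq> L2v cell" using Rgrad_L2v[OF trig_smooth] by blast
  show "Rgrad R ` trig \<noteq> {}" using trig_const by blast
  assume "v \<in> Rgrad R ` trig" "w \<in> Rgrad R ` trig"
  then obtain \<phi> \<psi> where "\<phi> \<in> trig" "\<psi> \<in> trig" "v = Rgrad R \<phi>" "w = Rgrad R \<psi>" by blast
  then show "(\<lambda>y. a *\<^sub>R v y + b *\<^sub>R w y) \<in> Rgrad R ` trig"
    by (intro image_eqI[of _ _ "\<lambda>y. a * \<phi> y + b * \<psi> y"]) (auto simp: Rgrad_lin trig_smooth intro: trig_add trig_scale)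
qed

lemma divfree_subspace:
  "divfree R \<subseteq> L2v cell" "divfree R \<noteq> {}"
  "v \<in> divfree R \<Longrightarrow> w \<in> divfree R \<Longrightarrow> (\<lambda>y. a *\<^sub>R v y + b *\<^sub>R w y) \<in> divfree R"
  using divfree_L2v divfree_wave[of 0 R 0 0] by (auto intro: divfree_add divfree_scale)

lemma L2norm_eq_of_AE_zero_diff:
  assumes "F \<in> L2v M" "P \<in> L2v M" "AE y in M. F y - P y = 0" "v \<in> L2v M"
  shows "L2norm M (\<lambda>y. v y - P y) = L2norm M (\<lambda>y. v y - F y)"
proof (rule L2norm_cong_AE)
  show "AE y in M. v y - P y = v y - F y" using assms(3) by eventually_elim simp
qed (intro L2v_measurable L2v_diff assms)+

lemma gradient_approximation:
  fixes R :: "real ^ 'n::finite ^ 'm::finite"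
  assumes F: "F \<in> L2v cell"
    and orth: "\<And>d. d \<in> divfree R \<Longrightarrow> L2ip cell F d = 0" and e: "e > 0"
  shows "\<exists>\<omega>\<in>trig. L2norm cell (\<lambda>y. Rgrad R \<omega> y - F y) < e"
proof -
  obtain v P where v: "\<And>n. v n \<in> Rgrad R ` trig" "P \<in> L2v cell" "(\<lambda>n. L2norm cell (\<lambda>y. v n y - P y)) \<longlonglongrightarrow> 0"
    "\<And>w. w \<in> Rgrad R ` trig \<Longrightarrow> L2ip cell P w = L2ip cell F w"
    using L2v_projection[OF finite_measure_cell Rgrad_trig_subspace F] by blast
  have vL: "v n \<in> L2v cell" for n using v(1) Rgrad_trig_subspace(1) by blast
  have zero: "AE y in cell. F y - P y = 0"
  proof (rule AE_zero_of_Helmholtz[OF L2v_diff[OF F v(2)]])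
    show "L2ip cell (\<lambda>y. F y - P y) (Rgrad R \<omega>) = 0" if "\<omega> \<in> trig" for \<omega>
      using that v(4)[of "Rgrad R \<omega>"] by (simp add: L2ip_diff[OF F v(2) Rgrad_L2v[OF trig_smooth]])
    show "L2ip cell (\<lambda>y. F y - P y) d = 0" if d: "d \<in> divfree R" for d
    proof -
      have "L2ip cell (v n) d = 0" for n
        using v(1)[of n] Rgrad_orthogonal_divfree[OF trig_smooth trig_periodic d] by auto
      then have "L2ip cell P d = 0"
        using L2ip_tendsto[OF vL v(2,3) divfree_L2v[OF d]] by (simp add: LIMSEQ_const_iff)
      then show ?thesis by (simp add: L2ip_diff[OF F v(2) divfree_L2v[OF d]] orth[OF d])
    qed
  qed
  obtain n where "L2norm cell (\<lambda>y. v n y - P y) < e"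
    using LIMSEQ_D[OF v(3) e] by auto
  then have "L2norm cell (\<lambda>y. v n y - F y) < e"
    using L2norm_eq_of_AE_zero_diff[OF F v(2) zero vL] by simp
  then show ?thesis using v(1)[of n] by auto
qed

lemma divfree_approximation:
  fixes R :: "real ^ 'n::finite ^ 'm::finite"
  assumes F: "F \<in> L2v cell"
    and orth: "\<And>\<omega>. \<omega> \<in> trig \<Longrightarrow> L2ip cell F (Rgrad R \<omega>) = 0" and e: "e > 0"
  shows "\<exists>d\<in>divfree R. L2norm cell (\<lambda>y. d y - F y) < e"
proof -
  obtain v P where v: "\<And>n. v n \<in> divfree R" "P \<in> L2v cell" "(\<lambda>n. L2norm cell (\<lambda>y. v n y - P y)) \<longlonglongrightarrow> 0"
    "\<And>w. w \<in> divfree R \<Longrightarrow> L2ip cell P w = L2ip cell F w"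
    using L2v_projection[OF finite_measure_cell divfree_subspace F] by blast
  have vL: "v n \<in> L2v cell" for n using v(1) divfree_L2v by blast
  have zero: "AE y in cell. F y - P y = 0"
  proof (rule AE_zero_of_Helmholtz[OF L2v_diff[OF F v(2)]])
    show "L2ip cell (\<lambda>y. F y - P y) d = 0" if d: "d \<in> divfree R" for d
      using v(4)[OF d] by (simp add: L2ip_diff[OF F v(2) divfree_L2v[OF d]])
    show "L2ip cell (\<lambda>y. F y - P y) (Rgrad R \<omega>) = 0" if \<omega>: "\<omega> \<in> trig" for \<omega>
    proof -
      have "L2ip cell (v n) (Rgrad R \<omega>) = 0" for n
        using Rgrad_orthogonal_divfree[OF trig_smooth[OF \<omega>] trig_periodic[OF \<omega>] v(1)] by (simp add: L2ip_commute)
      then have "L2ip cell P (Rgrad R \<omega>) = 0"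
        using L2ip_tendsto[OF vL v(2,3) Rgrad_L2v[OF trig_smooth[OF \<omega>]], of R] by (simp add: LIMSEQ_const_iff)
      then show ?thesis by (simp add: L2ip_diff[OF F v(2) Rgrad_L2v[OF trig_smooth[OF \<omega>]]] orth[OF \<omega>])
    qed
  qed
  obtain n where "L2norm cell (\<lambda>y. v n y - P y) < e"
    using LIMSEQ_D[OF v(3) e] by auto
  then have "L2norm cell (\<lambda>y. v n y - F y) < e"
    using L2norm_eq_of_AE_zero_diff[OF F v(2) zero vL] by simp
  then show ?thesis using v(1)[of n] by auto
qed

lemma trig_approximation:
  fixes g :: "real ^ 'm::finite \<Rightarrow> real"
  assumes g: "g \<in> L2v cell" and e: "e > 0"
  shows "\<exists>t\<in>trig. L2norm cell (\<lambda>y. t y - g y) < e"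
proof -
  have sub: "trig \<subseteq> L2v cell" "(trig :: (real ^ 'm \<Rightarrow> real) set) \<noteq> {}"
    "v \<in> trig \<Longrightarrow> w \<in> trig \<Longrightarrow> (\<lambda>y. a *\<^sub>R v y + b *\<^sub>R w y) \<in> trig" for a b and v w :: "real ^ 'm \<Rightarrow> real"
    using trig_L2v trig_const by (auto intro: trig_add trig_scale)
  obtain v P where v: "\<And>n. v n \<in> trig" "P \<in> L2v cell" "(\<lambda>n. L2norm cell (\<lambda>y. v n y - P y)) \<longlonglongrightarrow> 0"
    "\<And>w. w \<in> trig \<Longrightarrow> L2ip cell P w = L2ip cell g w"
    using L2v_projection[OF finite_measure_cell sub g] by blast
  have vL: "v n \<in> L2v cell" for n using v(1) trig_L2v by blast
  have zero: "AE y in cell. g y - P y = 0"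
    by (rule AE_zero_of_trig[OF L2v_diff[OF g v(2)]]) (simp add: L2ip_diff[OF g v(2) trig_L2v] v(4))
  obtain n where "L2norm cell (\<lambda>y. v n y - P y) < e"
    using LIMSEQ_D[OF v(3) e] by auto
  then have "L2norm cell (\<lambda>y. v n y - g y) < e"
    using L2norm_eq_of_AE_zero_diff[OF g v(2) zero vL] by simp
  then show ?thesis using v(1)[of n] by auto
qed

lemma L2ip_wave:
  assumes g: "g \<in> L2v cell"
  shows "L2ip cell g (wave k b) = Re (fourier_coeff g k * cis (- b))"
proof -
  have "(\<lambda>y. cis (- (2 * pi * (int_vec k \<bullet> y)))) \<in> borel_measurable cell"
    by (intro lebesgue_on_measurable_continuous unit_cell_sets continuous_intros)
  then have m: "(\<lambda>y. of_real (g y) * cis (- (2 * pi * (int_vec k \<bullet> y)))) \<in> borel_measurable cell"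
    using measurable_compose[OF L2v_measurable[OF g] borel_measurable_continuous_onI[OF continuous_on_of_real_id]]
    by (intro borel_measurable_times) auto
  have int: "integrable cell (\<lambda>y. of_real (g y) * cis (- (2 * pi * (int_vec k \<bullet> y))))"
    by (rule Bochner_Integration.integrable_bound[OF L2v_integrable_norm[OF finite_measure_cell g] m])
      (simp add: norm_mult)
  have "fourier_coeff g k * cis (- b)
      = (LINT y|cell. of_real (g y) * cis (- (2 * pi * (int_vec k \<bullet> y))) * cis (- b))"
    unfolding fourier_coeff_def by (rule integral_mult_left_zero[symmetric])
  then have "Re (fourier_coeff g k * cis (- b))
      = (LINT y|cell. Re (of_real (g y) * cis (- (2 * pi * (int_vec k \<bullet> y))) * cis (- b)))"
    using int by (subst integral_Re) auto
  also have "\<dots> = (LINT y|cell. g y * wave k b y)"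
  proof (intro Bochner_Integration.integral_cong refl)
    fix y
    have "cis (- (2 * pi * (int_vec k \<bullet> y))) * cis (- b) = cis (- (2 * pi * (int_vec k \<bullet> y) + b))"
      by (simp add: cis_mult)
    then have "of_real (g y) * cis (- (2 * pi * (int_vec k \<bullet> y))) * cis (- b)
        = of_real (g y) * cis (- (2 * pi * (int_vec k \<bullet> y) + b))"
      by (simp only: mult.assoc)
    then show "Re (of_real (g y) * cis (- (2 * pi * (int_vec k \<bullet> y))) * cis (- b)) = g y * wave k b y"
      by (simp only: wave_def) (simp add: cos_minus[of "2 * pi * (int_vec k \<bullet> y) + b"] del: minus_add_distrib)
  qed
  finally show ?thesis by (simp add: L2ip_def)
qed

lemma L2ip_wave_amplitude:
  assumes "G \<in> L2v M" "(\<lambda>y. w y *\<^sub>R a) \<in> L2v M"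
  shows "L2ip M G (\<lambda>y. w y *\<^sub>R a) = (\<Sum>q\<in>UNIV. a $ q * L2ip M (\<lambda>y. G y $ q) w)"
proof -
  have "(LINT y|M. G y $ q * (w y * a $ q)) = a $ q * (LINT y|M. G y $ q * w y)" for q
  proof -
    have "G y $ q * (w y * a $ q) = a $ q * (G y $ q * w y)" for y by simp
    then show ?thesis by (simp only: integral_mult_right_zero)
  qed
  then show ?thesis
    unfolding L2ip_vec[OF assms] by (simp add: L2ip_def)
qed

text \<open>
  The space of generalised gradients is the orthogonal complement of the divergence-free
  trigonometric fields; this form passes to limits without reference to the potential.
\<close>

lemma is_R_gradient_iff:
  fixes R :: "real ^ 'n::finite ^ 'm::finite"
  shows "is_R_gradient R G \<longleftrightarrow> cell_periodic G \<and> G \<in> L2v cell \<and> (\<forall>d\<in>divfree R. L2ip cell G d = 0)"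
proof
  assume G: "is_R_gradient R G"
  have per: "cell_periodic G" using G by (simp add: is_R_gradient_def)
  have L: "(\<lambda>y. G y $ q) \<in> L2v cell" for q using G by (simp add: is_R_gradient_def L2v_real)
  then have GL: "G \<in> L2v cell" by (simp add: L2v_vec_iff)
  obtain c where c: "\<And>k q. fourier_coeff (\<lambda>y. G y $ q) k
      = 2 * of_real pi * \<i> * of_real ((transpose R *v int_vec k) $ q) * c k"
    using G by (auto simp: is_R_gradient_def)
  have "L2ip cell G d = 0" if "d \<in> divfree R" for d
    using that
  proof (induction rule: divfree.induct)
    case (divfree_wave a k b)
    have wa: "(\<lambda>y. wave k b y *\<^sub>R a) \<in> L2v cell"
      by (rule divfree_L2v[OF divfree.divfree_wave[OF divfree_wave]])
    have "L2ip cell G (\<lambda>y. wave k b y *\<^sub>R a) = (\<Sum>q\<in>UNIV. a $ q * L2ip cell (\<lambda>y. G y $ q) (wave k b))"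
      by (rule L2ip_wave_amplitude[OF GL wa])
    also have "\<dots> = (\<Sum>q\<in>UNIV. (a $ q * (transpose R *v int_vec k) $ q) * Re (2 * of_real pi * \<i> * c k * cis (- b)))"
      unfolding L2ip_wave[OF L] c by (intro sum.cong refl) (simp add: algebra_simps)
    also have "\<dots> = (a \<bullet> (transpose R *v int_vec k)) * Re (2 * of_real pi * \<i> * c k * cis (- b))"
      by (simp add: inner_vec_def sum_distrib_right)
    finally show ?case using divfree_wave by simp
  next
    case (divfree_add f g)
    then show ?case
      using L2ip_lin[OF divfree_L2v[OF divfree_add(1)] divfree_L2v[OF divfree_add(2)] GL, where a = 1 and b = 1]
      by (simp add: L2ip_commute[of _ G])
  qed
  then show "cell_periodic G \<and> G \<in> L2v cell \<and> (\<forall>d\<in>divfree R. L2ip cell G d = 0)"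
    using per GL by blast
next
  assume G: "cell_periodic G \<and> G \<in> L2v cell \<and> (\<forall>d\<in>divfree R. L2ip cell G d = 0)"
  then have L: "(\<lambda>y. G y $ q) \<in> L2v cell" for q by (simp add: L2v_vec_iff)
  have par: "\<exists>s. \<forall>q. L2ip cell (\<lambda>y. G y $ q) (wave k b) = s * (transpose R *v int_vec k) $ q" for k b
  proof -
    define x where "x = transpose R *v int_vec k"
    define v :: "real ^ 'n" where "v = (\<chi> q. L2ip cell (\<lambda>y. G y $ q) (wave k b))"
    define a where "a = v - ((v \<bullet> x) / (x \<bullet> x)) *\<^sub>R x"
    have ax: "a \<bullet> x = 0" by (cases "x = 0") (auto simp: a_def inner_diff_left)
    then have d: "(\<lambda>y. wave k b y *\<^sub>R a) \<in> divfree R" by (intro divfree_wave) (simp add: x_def)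
    have "0 = L2ip cell G (\<lambda>y. wave k b y *\<^sub>R a)" using G d by simp
    also have "\<dots> = (\<Sum>q\<in>UNIV. a $ q * L2ip cell (\<lambda>y. G y $ q) (wave k b))"
      using G by (intro L2ip_wave_amplitude divfree_L2v[OF d]) blast
    also have "\<dots> = a \<bullet> v" by (simp add: inner_vec_def v_def)
    finally have av: "a \<bullet> v = 0" by simp
    have "a \<bullet> a = a \<bullet> v - ((v \<bullet> x) / (x \<bullet> x)) * (a \<bullet> x)"
      by (subst (2) a_def) (simp add: inner_diff_right)
    then have "a = 0" using av ax by simp
    then have "v = ((v \<bullet> x) / (x \<bullet> x)) *\<^sub>R x" by (simp add: a_def)
    then obtain r where "v = r *\<^sub>R x" by blast
    then have "\<forall>q. L2ip cell (\<lambda>y. G y $ q) (wave k b) = r * x $ q"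
      by (simp add: v_def vec_eq_iff)
    then show ?thesis unfolding x_def by (rule exI)
  qed
  define s where "s = (\<lambda>k b. SOME s. \<forall>q. L2ip cell (\<lambda>y. G y $ q) (wave k b) = s * (transpose R *v int_vec k) $ q)"
  have s: "L2ip cell (\<lambda>y. G y $ q) (wave k b) = s k b * (transpose R *v int_vec k) $ q" for k b q
    using someI_ex[OF par[of k b]] unfolding s_def by blast
  define c where "c = (\<lambda>k. Complex (s k 0) (s k (pi / 2)) / (2 * of_real pi * \<i>))"
  have "fourier_coeff (\<lambda>y. G y $ q) k = 2 * of_real pi * \<i> * of_real ((transpose R *v int_vec k) $ q) * c k" for k q
  proof -
    have "fourier_coeff (\<lambda>y. G y $ q) k
        = Complex (L2ip cell (\<lambda>y. G y $ q) (wave k 0)) (L2ip cell (\<lambda>y. G y $ q) (wave k (pi / 2)))"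
      unfolding L2ip_wave[OF L] by (simp add: complex_eq_iff)
    also have "\<dots> = of_real ((transpose R *v int_vec k) $ q) * Complex (s k 0) (s k (pi / 2))"
      unfolding s by (simp add: complex_eq_iff mult.commute)
    finally show ?thesis by (simp add: c_def)
  qed
  then show "is_R_gradient R G"
    using G L by (auto simp: is_R_gradient_def L2v_real)
qed

section \<open>Elasticity tensors\<close>

definition tensor_app :: "tensor4 \<Rightarrow> real ^ 3 ^ 3 \<Rightarrow> real ^ 3 ^ 3" where
  "tensor_app A \<xi> = (\<chi> i j. \<Sum>k\<in>UNIV. \<Sum>l\<in>UNIV. A $ i $ j $ k $ l * \<xi> $ k $ l)"

lemma linear_tensor_app: "linear (tensor_app A)"
  by (rule linearI) (simp_all add: tensor_app_def vec_eq_iff distrib_left sum.distrib sum_distrib_left mult_ac)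

lemmas tensor_app_add = linear_add[OF linear_tensor_app]
  and tensor_app_diff = linear_diff[OF linear_tensor_app]
  and tensor_app_scale = linear_cmul[OF linear_tensor_app]
  and tensor_app_sum = linear_sum[OF linear_tensor_app]

lemma tensor_app_inner:
  "tensor_app A \<xi> \<bullet> \<zeta> = (\<Sum>i\<in>UNIV. \<Sum>j\<in>UNIV. \<Sum>k\<in>UNIV. \<Sum>l\<in>UNIV. A $ i $ j $ k $ l * \<xi> $ k $ l * \<zeta> $ i $ j)"
  by (simp add: tensor_app_def inner_vec_def sum_distrib_right)

lemma sum4_swap:
  "(\<Sum>i\<in>A. \<Sum>j\<in>B. \<Sum>k\<in>C. \<Sum>l\<in>D. f i j k l) = (\<Sum>k\<in>C. \<Sum>l\<in>D. \<Sum>i\<in>A. \<Sum>j\<in>B. f i j k l)"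
proof -
  have "(\<Sum>i\<in>A. \<Sum>j\<in>B. \<Sum>k\<in>C. \<Sum>l\<in>D. f i j k l) = (\<Sum>i\<in>A. \<Sum>k\<in>C. \<Sum>j\<in>B. \<Sum>l\<in>D. f i j k l)"
    by (intro sum.cong refl sum.swap)
  also have "\<dots> = (\<Sum>i\<in>A. \<Sum>k\<in>C. \<Sum>l\<in>D. \<Sum>j\<in>B. f i j k l)"
    by (intro sum.cong refl sum.swap)
  also have "\<dots> = (\<Sum>k\<in>C. \<Sum>i\<in>A. \<Sum>l\<in>D. \<Sum>j\<in>B. f i j k l)"
    by (rule sum.swap)
  also have "\<dots> = (\<Sum>k\<in>C. \<Sum>l\<in>D. \<Sum>i\<in>A. \<Sum>j\<in>B. f i j k l)"
    by (intro sum.cong refl sum.swap)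
  finally show ?thesis .
qed

lemma tensor_app_symmetric:
  assumes "symmetric_tensor A"
  shows "tensor_app A \<xi> \<bullet> \<zeta> = tensor_app A \<zeta> \<bullet> \<xi>"
proof -
  have "tensor_app A \<xi> \<bullet> \<zeta> = (\<Sum>k\<in>UNIV. \<Sum>l\<in>UNIV. \<Sum>i\<in>UNIV. \<Sum>j\<in>UNIV. A $ i $ j $ k $ l * \<xi> $ k $ l * \<zeta> $ i $ j)"
    unfolding tensor_app_inner by (rule sum4_swap)
  also have "\<dots> = tensor_app A \<zeta> \<bullet> \<xi>"
  proof -
    have "A $ i $ j $ k $ l * x * y = A $ k $ l $ i $ j * y * x" for i j k l x y
      using assms[unfolded symmetric_tensor_def, rule_format, of i j k l] by simp
    then show ?thesis
      unfolding tensor_app_inner by (intro sum.cong refl)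
  qed
  finally show ?thesis .
qed

lemma tensor_app_coercive:
  assumes "coercive_tensor c A"
  shows "c * (norm \<xi>)\<^sup>2 \<le> tensor_app A \<xi> \<bullet> \<xi>"
proof -
  have "c * (norm \<xi>)\<^sup>2 = c * (\<Sum>i\<in>UNIV. \<Sum>j\<in>UNIV. \<xi> $ i $ j * \<xi> $ i $ j)"
    by (simp only: norm_vec_power2 real_norm_def power2_abs) (simp only: power2_eq_square)
  also have "\<dots> \<le> (\<Sum>i\<in>UNIV. \<Sum>j\<in>UNIV. \<Sum>k\<in>UNIV. \<Sum>l\<in>UNIV. A $ i $ j $ k $ l * \<xi> $ i $ j * \<xi> $ k $ l)"
    using assms by (simp add: coercive_tensor_def)
  also have "\<dots> = tensor_app A \<xi> \<bullet> \<xi>"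
    unfolding tensor_app_inner by (simp add: mult_ac)
  finally show ?thesis .
qed

lemma tensor_component_le: "\<bar>A $ i $ j $ k $ l\<bar> \<le> norm (A :: tensor4)"
proof -
  have "\<bar>A $ i $ j $ k $ l\<bar> \<le> norm (A $ i $ j $ k)" using component_le_norm_cart by blast
  also have "\<dots> \<le> norm (A $ i $ j)" by (rule Finite_Cartesian_Product.norm_nth_le)
  also have "\<dots> \<le> norm (A $ i)" by (rule Finite_Cartesian_Product.norm_nth_le)
  also have "\<dots> \<le> norm A" by (rule Finite_Cartesian_Product.norm_nth_le)
  finally show ?thesis .
qed

lemma matrix_component_le: "\<bar>\<xi> $ i $ j\<bar> \<le> norm (\<xi> :: real ^ 'n::finite ^ 'd::finite)"
  using component_le_norm_cart[of "\<xi> $ i" j] Finite_Cartesian_Product.norm_nth_le[of \<xi> i] by linarith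

lemma norm_tensor_app_le: "norm (tensor_app A \<xi>) \<le> 81 * norm A * norm \<xi>"
proof -
  have c: "\<bar>tensor_app A \<xi> $ i $ j\<bar> \<le> 9 * (norm A * norm \<xi>)" for i j
  proof -
    have "\<bar>tensor_app A \<xi> $ i $ j\<bar> \<le> (\<Sum>k\<in>(UNIV::3 set). \<Sum>l\<in>(UNIV::3 set). norm A * norm \<xi>)"
    proof -
      have 1: "\<bar>A $ i $ j $ k $ l * \<xi> $ k $ l\<bar> \<le> norm A * norm \<xi>" for k l
        unfolding abs_mult by (rule mult_mono[OF tensor_component_le matrix_component_le]) simp_all
      have 2: "\<bar>\<Sum>l\<in>(UNIV::3 set). A $ i $ j $ k $ l * \<xi> $ k $ l\<bar> \<le> (\<Sum>l\<in>(UNIV::3 set). norm A * norm \<xi>)" for k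
        by (rule order_trans[OF sum_abs sum_mono]) (rule 1)
      show ?thesis
        unfolding tensor_app_def vec_lambda_beta by (rule order_trans[OF sum_abs sum_mono]) (rule 2)
    qed
    then show ?thesis by simp
  qed
  have "norm (tensor_app A \<xi>) \<le> (\<Sum>i\<in>UNIV. norm (tensor_app A \<xi> $ i))"
    unfolding norm_vec_def[of "tensor_app A \<xi>"] by (rule L2_set_le_sum) simp
  also have "\<dots> \<le> (\<Sum>i\<in>UNIV. \<Sum>j\<in>UNIV. \<bar>tensor_app A \<xi> $ i $ j\<bar>)"
    by (intro sum_mono norm_le_l1_cart)
  also have "\<dots> \<le> (\<Sum>i\<in>(UNIV::3 set). \<Sum>j\<in>(UNIV::3 set). 9 * (norm A * norm \<xi>))"
    by (intro sum_mono c)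
  finally show ?thesis by simp
qed

lemma measurable_row:
  fixes f :: "'a \<Rightarrow> 'b::euclidean_space ^ 'n::finite"
  shows "f \<in> borel_measurable M \<Longrightarrow> (\<lambda>x. f x $ i) \<in> borel_measurable M"
  by (rule measurable_vec_iff[THEN iffD1, THEN spec])

lemma tensor_measurable:
  assumes "A \<in> borel_measurable M"
  shows "(\<lambda>x. (A x :: tensor4) $ i $ j $ k $ l) \<in> borel_measurable M"
  by (rule measurable_row[OF measurable_row[OF measurable_row[OF measurable_row[OF assms]]]])

lemma matrix_measurable:
  assumes "F \<in> borel_measurable M"
  shows "(\<lambda>x. (F x :: real ^ 'n::finite ^ 'd::finite) $ i $ j) \<in> borel_measurable M"
  by (rule measurable_row[OF measurable_row[OF assms]])

lemma tensor_app_measurable: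
  assumes "A \<in> borel_measurable M" "F \<in> borel_measurable M"
  shows "(\<lambda>x. tensor_app (A x) (F x)) \<in> borel_measurable M"
proof -
  have "(\<lambda>x. tensor_app (A x) (F x) $ i $ j) \<in> borel_measurable M" for i j
    unfolding tensor_app_def using tensor_measurable[OF assms(1)] matrix_measurable[OF assms(2)]
    by (auto intro!: borel_measurable_sum borel_measurable_times)
  then have "(\<lambda>x. tensor_app (A x) (F x) $ i) \<in> borel_measurable M" for i
    using measurable_vec_iff[of "\<lambda>x. tensor_app (A x) (F x) $ i"] by blast
  then show ?thesis using measurable_vec_iff[of "\<lambda>x. tensor_app (A x) (F x)"] by blast
qed

lemma Linf_bound:
  assumes "A \<in> Linf M"
  obtains K where "K \<ge> 0" "AE x in M. norm (A x) \<le> K"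
proof -
  obtain K where "AE x in M. norm (A x) \<le> K" using assms by (auto simp: Linf_def)
  then have "AE x in M. norm (A x) \<le> max K 0" by eventually_elim auto
  then show ?thesis using that[of "max K 0"] by simp
qed

lemma tensor_app_L2v:
  assumes A: "A \<in> borel_measurable M" "AE x in M. norm (A x) \<le> K" "K \<ge> 0" and F: "F \<in> L2v M"
  shows "(\<lambda>x. tensor_app (A x) (F x)) \<in> L2v M" "L2norm M (\<lambda>x. tensor_app (A x) (F x)) \<le> 81 * K * L2norm M F"
proof -
  have m: "(\<lambda>x. tensor_app (A x) (F x)) \<in> borel_measurable M"
    using A(1) L2v_measurable[OF F] by (rule tensor_app_measurable)
  have le: "AE x in M. norm (tensor_app (A x) (F x)) \<le> (81 * K) * norm (F x)"
    using A(2)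
  proof eventually_elim
    case (elim x)
    have "norm (tensor_app (A x) (F x)) \<le> 81 * norm (A x) * norm (F x)" by (rule norm_tensor_app_le)
    also have "\<dots> \<le> 81 * K * norm (F x)" using elim by (intro mult_right_mono mult_left_mono) auto
    finally show ?case .
  qed
  show "(\<lambda>x. tensor_app (A x) (F x)) \<in> L2v M" "L2norm M (\<lambda>x. tensor_app (A x) (F x)) \<le> 81 * K * L2norm M F"
    using L2v_dominated[OF F m le] A(3) by auto
qed

lemma tensor_app_Linf_L2v: "A \<in> Linf M \<Longrightarrow> F \<in> L2v M \<Longrightarrow> (\<lambda>x. tensor_app (A x) (F x)) \<in> L2v M"
  by (rule Linf_bound) (auto intro: tensor_app_L2v(1) simp: Linf_def)

lemma L2ip_tensor_app_symmetric:
  assumes "\<And>x. symmetric_tensor (A x)"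
  shows "L2ip M (\<lambda>x. tensor_app (A x) (F x)) G = L2ip M (\<lambda>x. tensor_app (A x) (G x)) F"
  unfolding L2ip_def using tensor_app_symmetric[OF assms] by simp

lemma L2ip_tensor_app_coercive:
  assumes A: "A \<in> Linf M" "AE x in M. coercive_tensor c (A x)" and F: "F \<in> L2v M"
  shows "c * (L2norm M F)\<^sup>2 \<le> L2ip M (\<lambda>x. tensor_app (A x) (F x)) F"
proof -
  have "c * (L2norm M F)\<^sup>2 = (LINT x|M. c * (norm (F x))\<^sup>2)" by (simp add: L2norm_power2)
  also have "\<dots> \<le> (LINT x|M. tensor_app (A x) (F x) \<bullet> F x)"
  proof (rule integral_mono_AE)
    show "integrable M (\<lambda>x. c * (norm (F x))\<^sup>2)" using F by (auto simp: L2v_def)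
    show "integrable M (\<lambda>x. tensor_app (A x) (F x) \<bullet> F x)"
      by (intro L2v_inner_integrable tensor_app_Linf_L2v A F)
    show "AE x in M. c * (norm (F x))\<^sup>2 \<le> tensor_app (A x) (F x) \<bullet> F x"
      using A(2) by eventually_elim (rule tensor_app_coercive)
  qed
  finally show ?thesis by (simp add: L2ip_def)
qed

section \<open>The local problem\<close>

lemma Rgrad_eq: "Rgrad R \<phi> y = transpose R *v (\<chi> l. pdiff l \<phi> y)"
  by (simp add: Rgrad_def matrix_vector_mult_def transpose_def vec_eq_iff)

definition weak_Rgrad :: "real ^ 'n::finite ^ 'm::finite \<Rightarrow> (real ^ 'm \<Rightarrow> real) \<Rightarrow> real ^ 'm \<Rightarrow> real ^ 'n" where
  "weak_Rgrad R \<phi> y = (\<chi> q. R_pderiv R q \<phi> y)"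

lemma weak_Rgrad_eq: "weak_Rgrad R \<phi> y = transpose R *v (\<chi> l. weak_pderiv unit_cell l \<phi> y)"
  by (simp add: weak_Rgrad_def R_pderiv_def matrix_vector_mult_def transpose_def vec_eq_iff)

lemma weak_Rgrad_smooth:
  assumes "smooth \<phi>"
  shows "AE y in cell. weak_Rgrad R \<phi> y = Rgrad R \<phi> y"
proof -
  have "AE y in cell. \<forall>l. weak_pderiv unit_cell l \<phi> y = pdiff l \<phi> y"
    unfolding AE_all_finite using smooth_W12(2)[OF open_unit_cell bounded_unit_cell assms] by blast
  then show ?thesis by eventually_elim (simp add: weak_Rgrad_eq Rgrad_eq)
qed

lemma W12_weak_Rgrad_L2v:
  assumes "\<phi> \<in> W12 unit_cell"
  shows "weak_Rgrad R \<phi> \<in> L2v cell"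
proof -
  have "(\<lambda>y. \<chi> l. weak_pderiv unit_cell l \<phi> y) \<in> L2v cell"
    using W12_weak_pderiv(2)[OF assms] by (simp add: L2v_vec_iff)
  moreover have "linear (\<lambda>v. transpose R *v v)" by (rule matrix_vector_mul_linear)
  ultimately show ?thesis
    unfolding weak_Rgrad_eq[abs_def] by (metis linear_L2v)
qed

lemma W12_per_orthogonal_divfree:
  fixes R :: "real ^ 'n::finite ^ 'm::finite"
  assumes \<phi>: "\<phi> \<in> W12_per" and d: "d \<in> divfree R"
  shows "L2ip cell (weak_Rgrad R \<phi>) d = 0"
proof -
  note U = open_unit_cell bounded_unit_cell
  have W: "\<phi> \<in> W12 unit_cell" using \<phi> by (simp add: W12_per_def)
  obtain \<psi> where \<psi>: "\<And>n::nat. smooth (\<psi> n)" "\<And>n. cell_periodic (\<psi> n)"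
    "(\<lambda>n. W12_norm unit_cell (\<lambda>y. \<psi> n y - \<phi> y)) \<longlonglongrightarrow> 0"
    using \<phi> by (auto simp: W12_per_def)
  define g where "g = (\<lambda>y. \<chi> l. weak_pderiv unit_cell l \<phi> y)"
  define p where "p = (\<lambda>n y. \<chi> l. pdiff l (\<psi> n) y)"
  have gL: "g \<in> L2v cell" using W12_weak_pderiv(2)[OF W] by (simp add: L2v_vec_iff g_def)
  have pL: "p n \<in> L2v cell" for n using smooth_W12(4)[OF U \<psi>(1)] by (simp add: L2v_vec_iff p_def)
  have pg: "(\<lambda>n. L2norm cell (\<lambda>y. p n y - g y)) \<longlonglongrightarrow> 0"
  proof (subst L2norm_vec_tendsto_0_iff)
    show "(\<lambda>y. p n y - g y) \<in> L2v cell" for n by (intro L2v_diff pL gL)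
    show "\<forall>l. (\<lambda>n. L2norm cell (\<lambda>y. (p n y - g y) $ l)) \<longlonglongrightarrow> 0"
      using \<psi>(3) by (subst (asm) W12_norm_diff_smooth_tendsto[OF U W \<psi>(1)]) (simp add: p_def g_def)
  qed
  have lin: "linear (\<lambda>v. transpose R *v v)" by (rule matrix_vector_mul_linear)
  obtain K where K: "\<And>f :: real ^ 'm \<Rightarrow> real ^ 'm. f \<in> L2v cell \<Longrightarrow>
      (\<lambda>y. transpose R *v f y) \<in> L2v cell \<and> L2norm cell (\<lambda>y. transpose R *v f y) \<le> K * L2norm cell f"
    using linear_L2v[OF lin] by metis
  have le: "L2norm cell (\<lambda>y. Rgrad R (\<psi> n) y - weak_Rgrad R \<phi> y) \<le> K * L2norm cell (\<lambda>y. p n y - g y)" for n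
    using K[OF L2v_diff[OF pL gL], of n]
    by (simp add: Rgrad_eq weak_Rgrad_eq p_def g_def matrix_vector_mult_diff_distrib)
  have "(\<lambda>n. L2norm cell (\<lambda>y. Rgrad R (\<psi> n) y - weak_Rgrad R \<phi> y)) \<longlonglongrightarrow> 0"
    by (rule tendsto_sandwich[OF _ _ tendsto_const tendsto_mult_right_zero[OF pg, of K]])
      (auto intro!: always_eventually le)
  from L2ip_tendsto[OF Rgrad_L2v[OF \<psi>(1)] W12_weak_Rgrad_L2v[OF W] this divfree_L2v[OF d]]
  show ?thesis
    using Rgrad_orthogonal_divfree[OF \<psi>(1,2) d] by (simp add: LIMSEQ_const_iff)
qed

lemma trig_W12_per:
  fixes t :: "real ^ 'm::finite \<Rightarrow> real"
  assumes "t \<in> trig"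
  shows "t \<in> W12_per"
proof -
  note U = open_unit_cell bounded_unit_cell
  note sm = trig_smooth[OF assms]
  note W = smooth_W12[OF U sm]
  have zero: "L2norm cell (\<lambda>y. pdiff l t y - weak_pderiv unit_cell l t y) = L2norm cell (\<lambda>y :: real ^ 'm. 0 :: real)" for l
  proof (rule L2norm_cong_AE)
    show "AE y in cell. pdiff l t y - weak_pderiv unit_cell l t y = 0"
      using W(2)[of l] by eventually_elim simp
    show "(\<lambda>y. pdiff l t y - weak_pderiv unit_cell l t y) \<in> borel_measurable cell"
      by (intro L2v_measurable L2v_diff W(4) W12_weak_pderiv W(1))
  qed simp
  have "(\<lambda>n::nat. W12_norm unit_cell (\<lambda>y. t y - t y)) \<longlonglongrightarrow> 0"
    by (subst W12_norm_diff_smooth_tendsto[OF U W(1) sm]) (simp add: zero, simp add: L2norm_def)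
  then show ?thesis
    using W(1) sm trig_periodic[OF assms] by (auto simp: W12_per_def)
qed

text \<open>
  The equation for all periodic Sobolev fields reduces to trigonometric fields: a field orthogonal to
  the gradients of trigonometric polynomials is a limit of divergence-free trigonometric fields.
\<close>

lemma trig_orthogonal_imp_W12_per_orthogonal:
  fixes R :: "real ^ 'n::finite ^ 'm::finite"
  assumes F: "F \<in> L2v cell"
    and orth: "\<And>\<omega>. \<omega> \<in> trig \<Longrightarrow> L2ip cell F (Rgrad R \<omega>) = 0" and \<phi>: "\<phi> \<in> W12_per"
  shows "L2ip cell F (weak_Rgrad R \<phi>) = 0"
proof -
  have wL: "weak_Rgrad R \<phi> \<in> L2v cell" using \<phi> by (intro W12_weak_Rgrad_L2v) (simp add: W12_per_def)
  have "\<bar>L2ip cell F (weak_Rgrad R \<phi>)\<bar> \<le> e * L2norm cell (weak_Rgrad R \<phi>)" if e: "e > 0" for e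
  proof -
    obtain d where d: "d \<in> divfree R" "L2norm cell (\<lambda>y. d y - F y) < e"
      using divfree_approximation[OF F orth e] by blast
    have "L2ip cell (\<lambda>y. d y - F y) (weak_Rgrad R \<phi>) = - L2ip cell F (weak_Rgrad R \<phi>)"
      using W12_per_orthogonal_divfree[OF \<phi> d(1)]
      by (simp add: L2ip_diff[OF divfree_L2v[OF d(1)] F wL] L2ip_commute[of _ d])
    then have "\<bar>L2ip cell F (weak_Rgrad R \<phi>)\<bar> \<le> L2norm cell (\<lambda>y. d y - F y) * L2norm cell (weak_Rgrad R \<phi>)"
      using L2ip_Cauchy_Schwarz[OF L2v_diff[OF divfree_L2v[OF d(1)] F] wL] by simp
    also have "\<dots> \<le> e * L2norm cell (weak_Rgrad R \<phi>)" using d(2) by (intro mult_right_mono) auto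
    finally show ?thesis .
  qed
  then have le: "\<bar>L2ip cell F (weak_Rgrad R \<phi>)\<bar> \<le> e * L2norm cell (weak_Rgrad R \<phi>)" if "e > 0" for e using that by blast
  have "((\<lambda>e. e * L2norm cell (weak_Rgrad R \<phi>)) \<longlongrightarrow> 0 * L2norm cell (weak_Rgrad R \<phi>)) (at_right 0)"
    by (intro tendsto_intros)
  then have "\<bar>L2ip cell F (weak_Rgrad R \<phi>)\<bar> \<le> 0 * L2norm cell (weak_Rgrad R \<phi>)"
    by (rule tendsto_lowerbound) (auto simp: eventually_at_filter le)
  then show ?thesis by simp
qed

definition matrix_unit :: "3 \<Rightarrow> 3 \<Rightarrow> real ^ 3 ^ 3" where
  "matrix_unit k l = (\<chi> p q. kron p k * kron q l)"

definition corrector :: "(3 \<Rightarrow> 3 \<Rightarrow> 3 \<Rightarrow> real ^ 'm \<Rightarrow> real ^ 3) \<Rightarrow> 3 \<Rightarrow> 3 \<Rightarrow> real ^ 'm \<Rightarrow> real ^ 3 ^ 3" where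
  "corrector G k l y = (\<chi> p. G k l p y)"

lemma local_integrand:
  "(\<Sum>i\<in>UNIV. \<Sum>j\<in>UNIV. \<Sum>p\<in>UNIV. \<Sum>q\<in>UNIV. C y $ i $ j $ p $ q * (kron p k * kron q l - G k l p y $ q)
     * R_pderiv R j (\<lambda>z. \<phi> z $ i) y)
   = (\<Sum>i\<in>UNIV. tensor_app (C y) (matrix_unit k l - corrector G k l y) $ i \<bullet> weak_Rgrad R (\<lambda>z. \<phi> z $ i) y)"
  by (simp add: tensor_app_def matrix_unit_def corrector_def weak_Rgrad_def inner_vec_def sum_distrib_right)

lemma local_flux_row_L2v:
  fixes G :: "3 \<Rightarrow> 3 \<Rightarrow> 3 \<Rightarrow> real ^ 'm::finite \<Rightarrow> real ^ 3"
  assumes C: "C \<in> Linf cell" and G: "\<And>k l p. G k l p \<in> L2v cell"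
  shows "(\<lambda>y. tensor_app (C y) (matrix_unit k l - corrector G k l y) $ i) \<in> L2v cell"
proof -
  have cL: "corrector G k l \<in> L2v cell"
    using G by (simp add: L2v_vec_iff[of "corrector G k l"] corrector_def)
  have "(\<lambda>y. matrix_unit k l) \<in> L2v cell"
    by (intro continuous_L2v bounded_unit_cell unit_cell_sets continuous_intros)
  then have "(\<lambda>y. tensor_app (C y) (matrix_unit k l - corrector G k l y)) \<in> L2v cell"
    by (intro tensor_app_Linf_L2v C L2v_diff cL)
  then show ?thesis by (subst (asm) L2v_vec_iff) blast
qed

lemma local_integral:
  fixes R :: "real ^ 3 ^ 'm::finite"
  assumes C: "C \<in> Linf cell" and G: "\<And>k l p. G k l p \<in> L2v cell" and \<phi>: "\<phi> \<in> W12_per_vec"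
  shows "(LINT y|cell. (\<Sum>i\<in>UNIV. \<Sum>j\<in>UNIV. \<Sum>p\<in>UNIV. \<Sum>q\<in>UNIV.
      C y $ i $ j $ p $ q * (kron p k * kron q l - G k l p y $ q) * R_pderiv R j (\<lambda>z. \<phi> z $ i) y))
    = (\<Sum>i\<in>UNIV. L2ip cell (\<lambda>y. tensor_app (C y) (matrix_unit k l - corrector G k l y) $ i) (weak_Rgrad R (\<lambda>z. \<phi> z $ i)))"
proof -
  have sL: "(\<lambda>y. tensor_app (C y) (matrix_unit k l - corrector G k l y) $ i) \<in> L2v cell" for i
    by (rule local_flux_row_L2v[OF C G])
  have wL: "weak_Rgrad R (\<lambda>z. \<phi> z $ i) \<in> L2v cell" for i
    using \<phi> by (intro W12_weak_Rgrad_L2v) (simp add: W12_per_vec_def W12_per_def)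
  show ?thesis
    unfolding local_integrand L2ip_def
    by (intro Bochner_Integration.integral_sum L2v_inner_integrable sL wL)
qed

lemma local_solution_iff:
  fixes R :: "real ^ 3 ^ 'm::finite"
  assumes C: "C \<in> Linf cell"
  shows "local_solution R C G \<longleftrightarrow> (\<forall>k l p. is_R_gradient R (G k l p)) \<and>
    (\<forall>k l i. \<forall>\<omega>\<in>trig. L2ip cell (\<lambda>y. tensor_app (C y) (matrix_unit k l - corrector G k l y) $ i) (Rgrad R \<omega>) = 0)"
    (is "_ \<longleftrightarrow> ?grad \<and> ?eq")
proof
  assume loc: "local_solution R C G"
  then have grad: ?grad by (simp add: local_solution_def)
  then have GL: "G k l p \<in> L2v cell" for k l p by (simp add: is_R_gradient_iff)
  have ?eq
  proof (intro allI ballI)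
    fix k l i and \<omega> :: "real ^ 'm \<Rightarrow> real" assume \<omega>: "\<omega> \<in> trig"
    define \<phi> :: "real ^ 'm \<Rightarrow> real ^ 3" where "\<phi> = (\<lambda>y. \<chi> i'. if i' = i then \<omega> y else 0)"
    have \<phi>t: "(\<lambda>z. \<phi> z $ i') \<in> trig" for i' by (cases "i' = i") (auto simp: \<phi>_def \<omega> trig_const)
    then have \<phi>: "\<phi> \<in> W12_per_vec" by (simp add: W12_per_vec_def trig_W12_per)
    let ?s = "\<lambda>i y. tensor_app (C y) (matrix_unit k l - corrector G k l y) $ i"
    have sL: "?s i \<in> L2v cell" for i by (rule local_flux_row_L2v[OF C GL])
    have each: "L2ip cell (?s i') (weak_Rgrad R (\<lambda>z. \<phi> z $ i')) = (if i' = i then L2ip cell (?s i) (Rgrad R \<omega>) else 0)" for i'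
    proof -
      have W: "(\<lambda>z. \<phi> z $ i') \<in> W12 unit_cell" using trig_W12_per[OF \<phi>t] by (simp add: W12_per_def)
      have "L2ip cell (?s i') (weak_Rgrad R (\<lambda>z. \<phi> z $ i')) = L2ip cell (?s i') (Rgrad R (\<lambda>z. \<phi> z $ i'))"
        by (intro L2ip_cong_AE L2v_measurable sL W12_weak_Rgrad_L2v W Rgrad_L2v trig_smooth \<phi>t weak_Rgrad_smooth) simp
      also have "\<dots> = (if i' = i then L2ip cell (?s i) (Rgrad R \<omega>) else 0)"
        by (auto simp: \<phi>_def Rgrad_def pdiff_const L2ip_def zero_vec_def[symmetric])
      finally show ?thesis .
    qed
    have "0 = (\<Sum>i\<in>UNIV. L2ip cell (?s i) (weak_Rgrad R (\<lambda>z. \<phi> z $ i)))"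
      using loc \<phi> unfolding local_solution_def by (subst local_integral[OF C GL \<phi>, symmetric]) auto
    also have "\<dots> = L2ip cell (?s i) (Rgrad R \<omega>)" by (simp add: each)
    finally show "L2ip cell (?s i) (Rgrad R \<omega>) = 0" by simp
  qed
  with grad show "?grad \<and> ?eq" by blast
next
  assume A: "?grad \<and> ?eq"
  then have GL: "G k l p \<in> L2v cell" for k l p by (simp add: is_R_gradient_iff)
  have "(LINT y|cell. (\<Sum>i\<in>UNIV. \<Sum>j\<in>UNIV. \<Sum>p\<in>UNIV. \<Sum>q\<in>UNIV.
      C y $ i $ j $ p $ q * (kron p k * kron q l - G k l p y $ q) * R_pderiv R j (\<lambda>z. \<phi> z $ i) y)) = 0"
    if \<phi>: "\<phi> \<in> W12_per_vec" for k l \<phi>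
  proof (subst local_integral[OF C GL \<phi>], intro sum.neutral ballI)
    fix i
    have sL: "(\<lambda>y. tensor_app (C y) (matrix_unit k l - corrector G k l y) $ i) \<in> L2v cell"
      by (rule local_flux_row_L2v[OF C GL])
    show "L2ip cell (\<lambda>y. tensor_app (C y) (matrix_unit k l - corrector G k l y) $ i) (weak_Rgrad R (\<lambda>z. \<phi> z $ i)) = 0"
      using A \<phi> by (intro trig_orthogonal_imp_W12_per_orthogonal[OF sL]) (auto simp: W12_per_vec_def)
  qed
  with A show "local_solution R C G" by (simp add: local_solution_def)
qed

text \<open>
  Limits in the mean square are determined on the cell only; this gives them a periodic
  representative.
\<close>

definition periodize :: "(real ^ 'm::finite \<Rightarrow> 'b) \<Rightarrow> real ^ 'm \<Rightarrow> 'b" where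
  "periodize F y = F (\<chi> i. frac (y $ i))"

lemma periodize_periodic: "cell_periodic (periodize F)"
  by (simp add: cell_periodic_def periodize_def int_vec_def frac_def)

lemma periodize_cell: "y \<in> unit_cell \<Longrightarrow> periodize F y = F y"
  by (simp add: periodize_def unit_cell_def frac_eq[THEN iffD2] less_imp_le)

lemma periodize_AE: "AE y in cell. periodize F y = F y"
  by (rule AE_I2) (simp add: periodize_cell space_restrict_space)

lemma periodize_L2v:
  assumes "F \<in> L2v cell"
  shows "periodize F \<in> L2v cell"
proof -
  have "periodize F \<in> borel_measurable cell"
    using L2v_measurable[OF assms] by (rule measurable_cong[THEN iffD1, rotated])
      (simp add: periodize_cell space_restrict_space)
  then show ?thesis
    by (rule L2v_dominated(1)[OF assms, of _ 1]) (use periodize_AE[of F] in \<open>auto elim!: eventually_mono\<close>)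
qed

text \<open>
  Lax and Milgram on the closure of the gradients of trigonometric fields. The limit of gradients is
  orthogonal to the divergence-free fields, hence a generalised gradient, although the potentials
  themselves need not converge.
\<close>

lemma local_solution_exists:
  fixes R :: "real ^ 3 ^ 'm::finite"
  assumes C: "C \<in> Linf cell" "\<And>y. symmetric_tensor (C y)" "AE y in cell. coercive_tensor c (C y)" and c: "c > 0"
  shows "\<exists>G. local_solution R C G"
proof -
  obtain K where K: "K \<ge> 0" "AE y in cell. norm (C y) \<le> K" using C(1) by (rule Linf_bound)
  have Cm: "C \<in> borel_measurable cell" using C(1) by (simp add: Linf_def)
  note CL = tensor_app_L2v[OF Cm K(2,1)]
  define V :: "(real ^ 'm \<Rightarrow> real ^ 3 ^ 3) set" where
    "V = {F. \<exists>\<omega>. (\<forall>p. \<omega> p \<in> trig) \<and> F = (\<lambda>y. \<chi> p. Rgrad R (\<omega> p) y)}"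
  have VL: "V \<subseteq> L2v cell"
  proof
    fix F assume "F \<in> V"
    then obtain \<omega> where \<omega>: "\<And>p. \<omega> p \<in> trig" "F = (\<lambda>y. \<chi> p. Rgrad R (\<omega> p) y)"
      unfolding V_def by blast
    show "F \<in> L2v cell"
      unfolding L2v_vec_iff[of F] by (simp add: \<omega> Rgrad_L2v[OF trig_smooth])
  qed
  have "\<exists>H. H \<in> L2v cell \<and> (\<forall>d\<in>divfree R. \<forall>p. L2ip cell (\<lambda>y. H y $ p) d = 0) \<and>
      (\<forall>w\<in>V. L2ip cell (\<lambda>y. tensor_app (C y) (H y)) w = L2ip cell (\<lambda>y. tensor_app (C y) \<xi>) w)" for \<xi>
  proof -
    have \<xi>L: "(\<lambda>y. \<xi>) \<in> L2v cell"
      by (intro continuous_L2v bounded_unit_cell unit_cell_sets continuous_intros)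
    have "\<exists>F H. (\<forall>n. F n \<in> V) \<and> H \<in> L2v cell \<and> (\<lambda>n. L2norm cell (\<lambda>x. F n x - H x)) \<longlonglongrightarrow> 0 \<and>
      (\<forall>w\<in>V. L2ip cell (\<lambda>y. tensor_app (C y) (H y)) w = L2ip cell (\<lambda>y. tensor_app (C y) \<xi>) w)"
    proof (rule Riesz_on_subspace[OF finite_measure_cell VL, where c = c and K = "81 * K"
          and L = "L2norm cell (\<lambda>y. tensor_app (C y) \<xi>)"])
      show "V \<noteq> {}" using trig_const[of 0] by (auto simp: V_def intro!: exI[of _ "\<lambda>p y. 0"])
      show "(\<lambda>x. a *\<^sub>R v x + b *\<^sub>R w x) \<in> V" if vw: "v \<in> V" "w \<in> V" for a b v w
      proof -
        obtain \<omega> \<omega>' where *: "\<And>p. \<omega> p \<in> trig" "v = (\<lambda>y. \<chi> p. Rgrad R (\<omega> p) y)"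
          "\<And>p. \<omega>' p \<in> trig" "w = (\<lambda>y. \<chi> p. Rgrad R (\<omega>' p) y)"
          using vw unfolding V_def by blast
        show ?thesis
          unfolding V_def mem_Collect_eq
          by (rule exI[of _ "\<lambda>p y. a * \<omega> p y + b * \<omega>' p y"])
            (simp add: * Rgrad_lin trig_smooth trig_add trig_scale vec_eq_iff fun_eq_iff)
      qed
      show "L2ip cell (\<lambda>y. tensor_app (C y) (a *\<^sub>R u y + b *\<^sub>R v y)) w
          = a * L2ip cell (\<lambda>y. tensor_app (C y) (u y)) w + b * L2ip cell (\<lambda>y. tensor_app (C y) (v y)) w"
        if "u \<in> L2v cell" "v \<in> L2v cell" "w \<in> L2v cell" for a b u v w
        unfolding tensor_app_add tensor_app_scale by (rule L2ip_lin[OF CL(1) CL(1)]) (use that in auto)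
      show "L2ip cell (\<lambda>y. tensor_app (C y) (u y)) v = L2ip cell (\<lambda>y. tensor_app (C y) (v y)) u" for u v
        by (rule L2ip_tensor_app_symmetric[OF C(2)])
      show "\<bar>L2ip cell (\<lambda>y. tensor_app (C y) (u y)) v\<bar> \<le> 81 * K * L2norm cell u * L2norm cell v"
        if "u \<in> L2v cell" "v \<in> L2v cell" for u v
        using L2ip_Cauchy_Schwarz[OF CL(1)[OF that(1)] that(2)] mult_right_mono[OF CL(2)[OF that(1)] L2norm_nonneg[of cell v]]
        by linarith
      show "c * (L2norm cell v)\<^sup>2 \<le> L2ip cell (\<lambda>y. tensor_app (C y) (v y)) v" if "v \<in> V" for v
        using that VL by (intro L2ip_tensor_app_coercive C) auto
      show "L2ip cell (\<lambda>y. tensor_app (C y) \<xi>) (\<lambda>x. a *\<^sub>R v x + b *\<^sub>R w x)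
          = a * L2ip cell (\<lambda>y. tensor_app (C y) \<xi>) v + b * L2ip cell (\<lambda>y. tensor_app (C y) \<xi>) w" if "v \<in> V" "w \<in> V" for a b v w
        using L2ip_lin[of v cell w "\<lambda>y. tensor_app (C y) \<xi>" a b] that VL CL(1)[OF \<xi>L]
        by (auto simp: L2ip_commute[of _ "\<lambda>y. tensor_app (C y) \<xi>"])
      show "\<bar>L2ip cell (\<lambda>y. tensor_app (C y) \<xi>) v\<bar> \<le> L2norm cell (\<lambda>y. tensor_app (C y) \<xi>) * L2norm cell v" if "v \<in> V" for v
        using that VL by (intro L2ip_Cauchy_Schwarz CL(1)[OF \<xi>L]) auto
    qed (use c in simp)
    then obtain F H where FH: "\<And>n. F n \<in> V" "H \<in> L2v cell" "(\<lambda>n. L2norm cell (\<lambda>x. F n x - H x)) \<longlonglongrightarrow> 0"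
      "\<forall>w\<in>V. L2ip cell (\<lambda>y. tensor_app (C y) (H y)) w = L2ip cell (\<lambda>y. tensor_app (C y) \<xi>) w" by blast
    have FL: "F n \<in> L2v cell" for n using FH(1) VL by blast
    have "L2ip cell (\<lambda>y. H y $ p) d = 0" if d: "d \<in> divfree R" for d p
    proof -
      have lim: "(\<lambda>n. L2norm cell (\<lambda>y. F n y $ p - H y $ p)) \<longlonglongrightarrow> 0"
        using FH(3) by (subst (asm) L2norm_vec_tendsto_0_iff) (auto intro: L2v_diff FL FH)
      have zero: "L2ip cell (\<lambda>y. F n y $ p) d = 0" for n
      proof -
        obtain \<omega> where "\<And>p. \<omega> p \<in> trig" "F n = (\<lambda>y. \<chi> p. Rgrad R (\<omega> p) y)"
          using FH(1)[of n] unfolding V_def by blast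
        then show ?thesis
          using Rgrad_orthogonal_divfree[OF trig_smooth trig_periodic d] by simp
      qed
      have L: "(\<lambda>y. F n y $ p) \<in> L2v cell" "(\<lambda>y. H y $ p) \<in> L2v cell" for n
        using FL[of n] FH(2) by (subst (asm) (1 2) L2v_vec_iff, blast)+
      from L2ip_tendsto[OF L lim divfree_L2v[OF d]] show ?thesis
        by (simp add: zero LIMSEQ_const_iff)
    qed
    then show ?thesis using FH by blast
  qed
  then have "\<exists>H. \<forall>\<xi>. H \<xi> \<in> L2v cell \<and> (\<forall>d\<in>divfree R. \<forall>p. L2ip cell (\<lambda>y. H \<xi> y $ p) d = 0) \<and>
      (\<forall>w\<in>V. L2ip cell (\<lambda>y. tensor_app (C y) (H \<xi> y)) w = L2ip cell (\<lambda>y. tensor_app (C y) \<xi>) w)"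
    by (intro choice allI)
  then obtain H where H: "\<And>\<xi>. H \<xi> \<in> L2v cell" "\<And>\<xi> d p. d \<in> divfree R \<Longrightarrow> L2ip cell (\<lambda>y. H \<xi> y $ p) d = 0"
    "\<And>\<xi> w. w \<in> V \<Longrightarrow> L2ip cell (\<lambda>y. tensor_app (C y) (H \<xi> y)) w = L2ip cell (\<lambda>y. tensor_app (C y) \<xi>) w"
    by blast
  define G where "G = (\<lambda>k l p. periodize (\<lambda>y. H (matrix_unit k l) y $ p))"
  have HpL: "(\<lambda>y. H \<xi> y $ p) \<in> L2v cell" for \<xi> p using H(1)[of \<xi>] by (subst (asm) L2v_vec_iff) blast
  have GL: "G k l p \<in> L2v cell" for k l p unfolding G_def by (rule periodize_L2v[OF HpL])
  have grad: "is_R_gradient R (G k l p)" for k l p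
  proof -
    have "L2ip cell (G k l p) d = 0" if d: "d \<in> divfree R" for d
    proof -
      have "L2ip cell (G k l p) d = L2ip cell (\<lambda>y. H (matrix_unit k l) y $ p) d"
        unfolding G_def by (intro L2ip_cong_AE L2v_measurable periodize_L2v HpL divfree_L2v[OF d] periodize_AE) simp
      then show ?thesis using H(2)[OF d] by simp
    qed
    then show ?thesis using GL by (simp add: is_R_gradient_iff) (simp add: G_def periodize_periodic)
  qed
  have cor: "AE y in cell. corrector G k l y = H (matrix_unit k l) y" for k l
    by (rule AE_I2) (simp add: corrector_def G_def periodize_cell vec_eq_iff space_restrict_space)
  have cL: "corrector G k l \<in> L2v cell" for k l
    using GL by (simp add: L2v_vec_iff[of "corrector G k l"] corrector_def)
  have eq: "L2ip cell (\<lambda>y. tensor_app (C y) (matrix_unit k l - corrector G k l y) $ i) (Rgrad R \<omega>) = 0" if \<omega>: "\<omega> \<in> trig" for k l i \<omega>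
  proof -
    define w :: "real ^ 'm \<Rightarrow> real ^ 3 ^ 3" where "w = (\<lambda>y. \<chi> p. Rgrad R (if p = i then \<omega> else (\<lambda>y. 0)) y)"
    have wV: "w \<in> V" unfolding V_def w_def mem_Collect_eq
      by (rule exI[of _ "\<lambda>p. if p = i then \<omega> else (\<lambda>y. 0)"]) (use \<omega> trig_const[of 0] in auto)
    then have wL: "w \<in> L2v cell" using VL by blast
    have muL: "(\<lambda>y. matrix_unit k l) \<in> L2v cell"
      by (intro continuous_L2v bounded_unit_cell unit_cell_sets continuous_intros)
    have R0: "Rgrad R (\<lambda>y. 0) y = 0" for y by (simp add: Rgrad_def vec_eq_iff pdiff_const)
    have "x \<bullet> w y = x $ i \<bullet> Rgrad R \<omega> y" for x y
    proof -
      have "x \<bullet> w y = (\<Sum>p\<in>UNIV. if p = i then x $ i \<bullet> Rgrad R \<omega> y else 0)"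
        unfolding inner_vec_def[of x "w y"] by (intro sum.cong refl) (auto simp: w_def R0)
      then show ?thesis by simp
    qed
    then have "L2ip cell (\<lambda>y. tensor_app (C y) (matrix_unit k l - corrector G k l y) $ i) (Rgrad R \<omega>)
        = L2ip cell (\<lambda>y. tensor_app (C y) (matrix_unit k l - corrector G k l y)) w"
      by (simp add: L2ip_def)
    also have "\<dots> = L2ip cell (\<lambda>y. tensor_app (C y) (matrix_unit k l) - tensor_app (C y) (H (matrix_unit k l) y)) w"
    proof (rule L2ip_cong_AE)
      show "AE y in cell. tensor_app (C y) (matrix_unit k l - corrector G k l y) = tensor_app (C y) (matrix_unit k l) - tensor_app (C y) (H (matrix_unit k l) y)"
        using cor[of k l] by eventually_elim (simp add: tensor_app_diff)
    qed (intro L2v_measurable L2v_diff CL(1) muL cL H wL | simp)+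
    also have "\<dots> = 0"
      by (subst L2ip_diff[OF CL(1)[OF muL] CL(1)[OF H(1)] wL]) (simp add: H(3)[OF wV])
    finally show ?thesis .
  qed
  have "local_solution R C G"
    using local_solution_iff[of C R G] C(1) grad eq by blast
  then show ?thesis by blast
qed

section \<open>The homogenized tensor\<close>

text \<open>
  The strain on the cell that belongs to the macroscopic strain \<open>\<xi>\<close>, by linearity from the solutions of the
  nine local problems.
\<close>

definition corrected :: "(3 \<Rightarrow> 3 \<Rightarrow> 3 \<Rightarrow> real ^ 'm \<Rightarrow> real ^ 3) \<Rightarrow> real ^ 3 ^ 3 \<Rightarrow> real ^ 'm \<Rightarrow> real ^ 3 ^ 3" where
  "corrected G \<xi> y = (\<Sum>k\<in>UNIV. \<Sum>l\<in>UNIV. \<xi> $ k $ l *\<^sub>R (matrix_unit k l - corrector G k l y))"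

lemma sum_matrix_unit: "(\<Sum>k\<in>UNIV. \<Sum>l\<in>UNIV. \<xi> $ k $ l *\<^sub>R matrix_unit k l) = \<xi>"
proof -
  have kron_sum: "(\<Sum>l\<in>UNIV. g l * kron q l) = g q" for g :: "3 \<Rightarrow> real" and q
  proof -
    have "(\<Sum>l\<in>UNIV. g l * kron q l) = (\<Sum>l\<in>UNIV. if q = l then g l else 0)"
      by (intro sum.cong) (auto simp: kron_def)
    then show ?thesis by simp
  qed
  have "(\<Sum>k\<in>UNIV. \<Sum>l\<in>UNIV. \<xi> $ k $ l * (kron p k * kron q l)) = \<xi> $ p $ q" for p q
    by (simp only: mult.assoc[symmetric] kron_sum)
  then show ?thesis by (simp add: vec_eq_iff matrix_unit_def)
qed

lemma corrected_diff: "\<xi> - corrected G \<xi> y = (\<Sum>k\<in>UNIV. \<Sum>l\<in>UNIV. \<xi> $ k $ l *\<^sub>R corrector G k l y)"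
  by (subst (1) sum_matrix_unit[of \<xi>, symmetric])
    (simp add: corrected_def scaleR_diff_right sum_subtractf)

locale cell_problem =
  fixes R :: "real ^ 3 ^ 'm::finite" and C :: "real ^ 'm \<Rightarrow> tensor4" and c :: real
    and G :: "3 \<Rightarrow> 3 \<Rightarrow> 3 \<Rightarrow> real ^ 'm \<Rightarrow> real ^ 3"
  assumes irrational: "\<And>k::int ^ 'm. k \<noteq> 0 \<Longrightarrow> transpose R *v int_vec k \<noteq> 0"
    and C_Linf: "C \<in> Linf cell" and C_symmetric: "\<And>y. symmetric_tensor (C y)"
    and C_coercive: "AE y in cell. coercive_tensor c (C y)" and c_pos: "c > 0"
    and local: "local_solution R C G"
begin

lemma G_gradient: "is_R_gradient R (G k l p)"
  using local by (simp add: local_solution_def)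

lemma G_L2v: "G k l p \<in> L2v cell"
  using G_gradient by (simp add: is_R_gradient_iff)

lemma corrector_L2v: "corrector G k l \<in> L2v cell"
  using G_L2v by (simp add: L2v_vec_iff[of "corrector G k l"] corrector_def)

lemma const_L2v: "(\<lambda>y. \<xi>) \<in> L2v cell"
  by (intro continuous_L2v bounded_unit_cell unit_cell_sets continuous_intros)

lemma corrected_L2v: "corrected G \<xi> \<in> L2v cell"
  unfolding corrected_def by (intro L2v_sum L2v_scale L2v_diff const_L2v corrector_L2v)

lemma flux_L2v: "(\<lambda>y. tensor_app (C y) (corrected G \<xi> y)) \<in> L2v cell"
  by (intro tensor_app_Linf_L2v C_Linf corrected_L2v)

lemma row_L2v: "(F :: real ^ 'm \<Rightarrow> real ^ 3 ^ 3) \<in> L2v cell \<Longrightarrow> (\<lambda>y. F y $ p) \<in> L2v cell"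
  by (subst (asm) L2v_vec_iff) blast

lemma correction_orthogonal_divfree:
  assumes d: "d \<in> divfree R"
  shows "L2ip cell (\<lambda>y. (\<xi> - corrected G \<xi> y) $ p) d = 0"
proof -
  have z: "L2ip cell (\<lambda>y. \<xi> $ k $ l *\<^sub>R G k l p y) d = 0" for k l
    using L2ip_lin[OF G_L2v G_L2v divfree_L2v[OF d], of "\<xi> $ k $ l" k l p 0] G_gradient d
    by (simp add: is_R_gradient_iff)
  have "L2ip cell (\<lambda>y. (\<xi> - corrected G \<xi> y) $ p) d
      = L2ip cell (\<lambda>y. \<Sum>k\<in>UNIV. \<Sum>l\<in>UNIV. \<xi> $ k $ l *\<^sub>R G k l p y) d"
    by (simp add: corrected_diff corrector_def)
  also have "\<dots> = (\<Sum>k\<in>UNIV. \<Sum>l\<in>UNIV. L2ip cell (\<lambda>y. \<xi> $ k $ l *\<^sub>R G k l p y) d)"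
    by (subst L2ip_sum_left; intro L2v_sum L2v_scale G_L2v divfree_L2v[OF d] sum.cong refl L2ip_sum_left)
  finally show ?thesis by (simp add: z)
qed

lemma flux_orthogonal_gradient:
  assumes \<omega>: "\<omega> \<in> trig"
  shows "L2ip cell (\<lambda>y. tensor_app (C y) (corrected G \<xi> y) $ i) (Rgrad R \<omega>) = 0"
proof -
  let ?s = "\<lambda>k l y. tensor_app (C y) (matrix_unit k l - corrector G k l y) $ i"
  have sL: "?s k l \<in> L2v cell" for k l
    by (intro row_L2v tensor_app_Linf_L2v C_Linf L2v_diff const_L2v corrector_L2v)
  have gL: "Rgrad R \<omega> \<in> L2v cell" by (rule Rgrad_L2v[OF trig_smooth[OF \<omega>]])
  have "L2ip cell (?s k l) (Rgrad R \<omega>) = 0" for k l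
    using local \<omega> local_solution_iff[of C R G] C_Linf by blast
  then have z: "L2ip cell (\<lambda>y. \<xi> $ k $ l *\<^sub>R ?s k l y) (Rgrad R \<omega>) = 0" for k l
    using L2ip_lin[OF sL sL gL, of "\<xi> $ k $ l" k l 0] by simp
  have "L2ip cell (\<lambda>y. tensor_app (C y) (corrected G \<xi> y) $ i) (Rgrad R \<omega>)
      = L2ip cell (\<lambda>y. \<Sum>k\<in>UNIV. \<Sum>l\<in>UNIV. \<xi> $ k $ l *\<^sub>R ?s k l y) (Rgrad R \<omega>)"
    by (simp add: corrected_def tensor_app_sum tensor_app_scale)
  also have "\<dots> = (\<Sum>k\<in>UNIV. \<Sum>l\<in>UNIV. L2ip cell (\<lambda>y. \<xi> $ k $ l *\<^sub>R ?s k l y) (Rgrad R \<omega>))"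
    by (subst L2ip_sum_left; intro L2v_sum L2v_scale sL gL sum.cong refl L2ip_sum_left)
  finally show ?thesis by (simp add: z)
qed

text \<open>
  The corrections are limits of gradients of trigonometric polynomials, which the flux does not see.
\<close>

lemma flux_orthogonal_correction:
  "L2ip cell (\<lambda>y. tensor_app (C y) (corrected G \<xi> y)) (\<lambda>y. \<zeta> - corrected G \<zeta> y) = 0"
proof -
  let ?f = "\<lambda>y. tensor_app (C y) (corrected G \<xi> y)" and ?g = "\<lambda>y. \<zeta> - corrected G \<zeta> y"
  have gL: "?g \<in> L2v cell" by (intro L2v_diff const_L2v corrected_L2v)
  have "L2ip cell (\<lambda>y. ?f y $ p) (\<lambda>y. ?g y $ p) = 0" for p
  proof -
    have le: "\<bar>L2ip cell (\<lambda>y. ?f y $ p) (\<lambda>y. ?g y $ p)\<bar> \<le> e * L2norm cell (\<lambda>y. ?f y $ p)" if e: "e > 0" for e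
    proof -
      obtain \<omega> where \<omega>: "\<omega> \<in> trig" "L2norm cell (\<lambda>y. Rgrad R \<omega> y - ?g y $ p) < e"
        using gradient_approximation[OF row_L2v[OF gL] correction_orthogonal_divfree e] by blast
      note L = Rgrad_L2v[OF trig_smooth[OF \<omega>(1)], of R] row_L2v[OF gL, of p] row_L2v[OF flux_L2v, of \<xi> p]
      have "L2ip cell (\<lambda>y. Rgrad R \<omega> y - ?g y $ p) (\<lambda>y. ?f y $ p) = - L2ip cell (\<lambda>y. ?f y $ p) (\<lambda>y. ?g y $ p)"
        by (simp only: L2ip_diff[OF L] L2ip_commute[of cell "Rgrad R \<omega>"] flux_orthogonal_gradient[OF \<omega>(1)]
            L2ip_commute[of cell "\<lambda>y. ?g y $ p" "\<lambda>y. ?f y $ p"] diff_0)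
      then have "\<bar>L2ip cell (\<lambda>y. ?f y $ p) (\<lambda>y. ?g y $ p)\<bar> \<le> L2norm cell (\<lambda>y. Rgrad R \<omega> y - ?g y $ p) * L2norm cell (\<lambda>y. ?f y $ p)"
        using L2ip_Cauchy_Schwarz[OF L2v_diff[OF L(1,2)] L(3)] by simp
      also have "\<dots> \<le> e * L2norm cell (\<lambda>y. ?f y $ p)" using \<omega>(2) by (intro mult_right_mono) auto
      finally show ?thesis .
    qed
    have "((\<lambda>e. e * L2norm cell (\<lambda>y. ?f y $ p)) \<longlongrightarrow> 0 * L2norm cell (\<lambda>y. ?f y $ p)) (at_right 0)"
      by (intro tendsto_intros)
    then have "\<bar>L2ip cell (\<lambda>y. ?f y $ p) (\<lambda>y. ?g y $ p)\<bar> \<le> 0 * L2norm cell (\<lambda>y. ?f y $ p)"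
      by (rule tendsto_lowerbound) (rule eventually_mono[OF eventually_at_right_less le], assumption, rule trivial_limit_at_right_real)
    then show ?thesis by simp
  qed
  then show ?thesis by (simp add: L2ip_vec[OF flux_L2v gL])
qed

abbreviation Ch :: tensor4 where "Ch \<equiv> homogenized_tensor C G"

lemma Ch_mean: "tensor_app Ch \<xi> $ i $ j = (LINT y|cell. tensor_app (C y) (corrected G \<xi> y) $ i $ j)"
proof -
  let ?s = "\<lambda>k l y. tensor_app (C y) (matrix_unit k l - corrector G k l y) $ i $ j"
  have "(\<lambda>y. tensor_app (C y) (matrix_unit k l - corrector G k l y) $ i) \<in> L2v cell" for k l
    by (intro row_L2v tensor_app_Linf_L2v C_Linf L2v_diff const_L2v corrector_L2v)
  then have sL: "?s k l \<in> L2v cell" for k l by (subst (asm) L2v_vec_iff) blast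
  have int: "integrable cell (?s k l)" for k l by (rule L2v_integrable[OF finite_measure_cell sL])
  have "Ch $ i $ j $ k $ l = (LINT y|cell. ?s k l y)" for k l
    by (simp add: homogenized_tensor_def tensor_app_def matrix_unit_def corrector_def)
  then have "tensor_app Ch \<xi> $ i $ j = (\<Sum>k\<in>UNIV. \<Sum>l\<in>UNIV. LINT y|cell. \<xi> $ k $ l * ?s k l y)"
    unfolding tensor_app_def[of Ch] by (simp add: mult.commute)
  also have "\<dots> = (LINT y|cell. (\<Sum>k\<in>UNIV. \<Sum>l\<in>UNIV. \<xi> $ k $ l * ?s k l y))"
    using int by (simp add: Bochner_Integration.integral_sum)
  also have "\<dots> = (LINT y|cell. tensor_app (C y) (corrected G \<xi> y) $ i $ j)"
    by (simp add: corrected_def tensor_app_sum tensor_app_scale)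
  finally show ?thesis .
qed

text \<open>
  In this energy form the symmetry and the coercivity of the homogenized tensor are visible; one of
  the two correctors enters only because the flux is orthogonal to it.
\<close>

lemma Ch_form: "tensor_app Ch \<xi> \<bullet> \<zeta> = L2ip cell (\<lambda>y. tensor_app (C y) (corrected G \<xi> y)) (corrected G \<zeta>)"
proof -
  let ?f = "\<lambda>y. tensor_app (C y) (corrected G \<xi> y)"
  have L: "(\<lambda>y. ?f y $ i $ j) \<in> L2v cell" for i j
    using row_L2v[OF flux_L2v, of \<xi> i] by (subst (asm) L2v_vec_iff) blast
  have int: "integrable cell (\<lambda>y. ?f y $ i $ j)" for i j by (rule L2v_integrable[OF finite_measure_cell L])
  have "tensor_app Ch \<xi> \<bullet> \<zeta> = (\<Sum>i\<in>UNIV. \<Sum>j\<in>UNIV. (LINT y|cell. ?f y $ i $ j * \<zeta> $ i $ j))"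
    by (simp add: inner_vec_def Ch_mean)
  also have "\<dots> = (LINT y|cell. (\<Sum>i\<in>UNIV. \<Sum>j\<in>UNIV. ?f y $ i $ j * \<zeta> $ i $ j))"
    using int by (simp add: Bochner_Integration.integral_sum)
  also have "\<dots> = L2ip cell ?f (\<lambda>y. \<zeta>)" by (simp add: L2ip_def inner_vec_def)
  also have "\<dots> = L2ip cell ?f (corrected G \<zeta>)"
    using flux_orthogonal_correction[of \<xi> \<zeta>] L2ip_diff[OF const_L2v corrected_L2v flux_L2v, of \<zeta> \<zeta> \<xi>]
    by (simp add: L2ip_commute[of _ ?f])
  finally show ?thesis .
qed

lemma Ch_symmetric: "tensor_app Ch \<xi> \<bullet> \<zeta> = tensor_app Ch \<zeta> \<bullet> \<xi>"
  unfolding Ch_form by (rule L2ip_tensor_app_symmetric[OF C_symmetric])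

text \<open>
  A correction has mean zero because constant fields are divergence-free; so correcting a constant
  field does not decrease its norm.
\<close>

lemma Ch_coercive: "c * (norm \<xi>)\<^sup>2 \<le> tensor_app Ch \<xi> \<bullet> \<xi>"
proof -
  have cf: "(\<lambda>y. v) \<in> divfree R" for v
    using divfree_wave[of v R 0 0] by (simp add: wave_def)
  have dL: "(\<lambda>y. \<xi> - corrected G \<xi> y) \<in> L2v cell" by (intro L2v_diff const_L2v corrected_L2v)
  have n2c: "L2norm cell (\<lambda>y :: real ^ 'm. \<xi>) = norm \<xi>" by (rule L2norm_cell_const)
  have "L2ip cell (\<lambda>y. \<xi> - corrected G \<xi> y) (\<lambda>y. \<xi>) = 0"
    using correction_orthogonal_divfree[OF cf] unfolding L2ip_vec[OF dL const_L2v] by simp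
  then have "L2ip cell (corrected G \<xi>) (\<lambda>y. \<xi>) = (norm \<xi>)\<^sup>2"
    by (simp add: L2ip_diff[OF const_L2v corrected_L2v const_L2v] L2ip_self n2c)
  then have "norm \<xi> * norm \<xi> \<le> L2norm cell (corrected G \<xi>) * norm \<xi>"
    using L2ip_Cauchy_Schwarz[OF corrected_L2v const_L2v, of \<xi> \<xi>] by (simp add: n2c power2_eq_square)
  then have "norm \<xi> \<le> L2norm cell (corrected G \<xi>)"
    by (cases "\<xi> = 0") (auto dest: mult_right_le_imp_le)
  then have "c * (norm \<xi>)\<^sup>2 \<le> c * (L2norm cell (corrected G \<xi>))\<^sup>2"
    using c_pos by (intro mult_left_mono power_mono) auto
  also have "\<dots> \<le> tensor_app Ch \<xi> \<bullet> \<xi>"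
    unfolding Ch_form by (rule L2ip_tensor_app_coercive[OF C_Linf C_coercive corrected_L2v])
  finally show ?thesis .
qed

end

section \<open>Oscillating functions on the cut\<close>

lemma trig_bounded: "t \<in> trig \<Longrightarrow> \<exists>K\<ge>0. \<forall>y. \<bar>t y\<bar> \<le> K"
proof (induction rule: trig.induct)
  case (trig_wave a k b)
  have "\<bar>a * wave k b y\<bar> \<le> \<bar>a\<bar>" for y
    using mult_left_mono[OF abs_cos_le_one, of "\<bar>a\<bar>"] by (simp add: abs_mult wave_def)
  then show ?case by (intro exI[of _ "\<bar>a\<bar>"]) auto
next
  case (trig_add f g)
  then obtain K L where "K \<ge> 0" "\<And>y. \<bar>f y\<bar> \<le> K" "L \<ge> 0" "\<And>y. \<bar>g y\<bar> \<le> L" by blast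
  then have "\<bar>f y + g y\<bar> \<le> K + L" for y by (meson abs_triangle_ineq add_mono order_trans)
  then show ?case using \<open>K \<ge> 0\<close> \<open>L \<ge> 0\<close> by (intro exI[of _ "K + L"]) auto
qed

lemma cut_wave:
  "wave k b ((R *v x) /\<^sub>R \<eta>) = cos (((2 * pi / \<eta>) *\<^sub>R (transpose R *v int_vec k)) \<bullet> x + b)"
proof -
  have "int_vec k \<bullet> (R *v x) = (transpose R *v int_vec k) \<bullet> x"
    using dot_lmul_matrix[of "int_vec k" R x] by simp
  then show ?thesis by (simp add: wave_def divide_inverse mult_ac)
qed

lemma cut_wave_smooth: "smooth (\<lambda>x. a * wave k b ((R *v x) /\<^sub>R \<eta>))"
  unfolding cut_wave by (rule smooth_cos)

lemma cut_trig_smooth: "t \<in> trig \<Longrightarrow> smooth (\<lambda>x. t ((R *v x) /\<^sub>R \<eta>))"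
  by (induction rule: trig.induct) (auto intro: cut_wave_smooth smooth_add)

lemma cut_wave_pdiff:
  "pdiff j (\<lambda>x. a * wave k b ((R *v x) /\<^sub>R \<eta>)) x
    = (1 / \<eta>) * (2 * pi * a * wave k (b + pi / 2) ((R *v x) /\<^sub>R \<eta>)) * (transpose R *v int_vec k) $ j"
  unfolding cut_wave pdiff_cos by simp

lemma cut_trig_pdiff:
  assumes "t \<in> trig"
  shows "pdiff j (\<lambda>x. t ((R *v x) /\<^sub>R \<eta>)) x = (1 / \<eta>) * Rgrad R t ((R *v x) /\<^sub>R \<eta>) $ j"
  using assms
proof (induction rule: trig.induct)
  case (trig_wave a k b)
  show ?case unfolding cut_wave_pdiff Rgrad_wave by simp
next
  case (trig_add f g)
  have "pdiff j (\<lambda>x. f ((R *v x) /\<^sub>R \<eta>) + g ((R *v x) /\<^sub>R \<eta>)) x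
      = pdiff j (\<lambda>x. f ((R *v x) /\<^sub>R \<eta>)) x + pdiff j (\<lambda>x. g ((R *v x) /\<^sub>R \<eta>)) x"
    by (intro pdiff_add smooth_differentiable cut_trig_smooth trig_add)
  then show ?case
    using trig_add(3,4) Rgrad_lin[OF trig_smooth[OF trig_add(1)] trig_smooth[OF trig_add(2)], where R = R and a = 1 and b = 1]
    by (simp add: distrib_left)
qed

text \<open>The restriction of a divergence-free field to the cut is divergence-free in the physical space.\<close>

lemma cut_divfree:
  assumes "d \<in> divfree R"
  shows "(\<Sum>j\<in>UNIV. pdiff j (\<lambda>x. d ((R *v x) /\<^sub>R \<eta>) $ j) x) = 0"
  using assms
proof (induction rule: divfree.induct)
  case (divfree_wave a k b)
  have "pdiff j (\<lambda>x. (wave k b ((R *v x) /\<^sub>R \<eta>) *\<^sub>R a) $ j) x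
      = (1 / \<eta>) * (2 * pi * wave k (b + pi / 2) ((R *v x) /\<^sub>R \<eta>)) * (a $ j * (transpose R *v int_vec k) $ j)" for j
    using cut_wave_pdiff[where j = j and a = "a $ j" and k = k and b = b and R = R and \<eta> = \<eta> and x = x] by (simp add: mult_ac)
  then have "(\<Sum>j\<in>UNIV. pdiff j (\<lambda>x. (wave k b ((R *v x) /\<^sub>R \<eta>) *\<^sub>R a) $ j) x)
      = (1 / \<eta>) * (2 * pi * wave k (b + pi / 2) ((R *v x) /\<^sub>R \<eta>)) * (a \<bullet> (transpose R *v int_vec k))"
    by (simp only: inner_vec_def inner_real_def sum_distrib_left)
  then show ?case using divfree_wave by simp
next
  case (divfree_add f g)
  have "pdiff j (\<lambda>x. (f ((R *v x) /\<^sub>R \<eta>) + g ((R *v x) /\<^sub>R \<eta>)) $ j) x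
      = pdiff j (\<lambda>x. f ((R *v x) /\<^sub>R \<eta>) $ j) x + pdiff j (\<lambda>x. g ((R *v x) /\<^sub>R \<eta>) $ j) x" for j
    unfolding vector_add_component
    by (intro pdiff_add smooth_differentiable cut_trig_smooth[OF divfree_trig[OF divfree_add(1)]]
        cut_trig_smooth[OF divfree_trig[OF divfree_add(2)]])
  then show ?case using divfree_add by (simp add: sum.distrib)
qed

lemma mean_wave:
  fixes k :: "int ^ 'm::finite"
  assumes "k \<noteq> 0"
  shows "(LINT y|cell. a * wave k b y) = 0"
proof -
  obtain l where l: "k $ l \<noteq> 0" using assms by (auto simp: vec_eq_iff)
  define g where "g = (\<lambda>y. (a / (2 * pi * of_int (k $ l))) * wave k (b - pi / 2) y)"
  have g: "g \<in> trig" unfolding g_def by (rule trig_wave)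
  have "pdiff l g y = a * wave k b y" for y
    unfolding g_def pdiff_wave using l by simp
  then show ?thesis
    using integral_pdiff_periodic[OF trig_smooth[OF g] trig_periodic[OF g], of l] by simp
qed

lemma trig_integrable: "t \<in> trig \<Longrightarrow> integrable cell t"
  by (rule L2v_integrable[OF finite_measure_cell trig_L2v])

lemma mean_const: "(LINT y|(cell :: (real ^ 'm::finite) measure). a) = (a :: real)"
  using measure_unit_cell[where 'm = 'm]
  by (simp add: measure_restrict_space space_restrict_space unit_cell_sets)

lemma mean_le_L2norm:
  assumes "g \<in> L2v cell"
  shows "\<bar>LINT y|cell. g y\<bar> \<le> L2norm cell g"
proof -
  have "(\<lambda>y. 1 :: real) \<in> L2v cell"
    by (intro continuous_L2v bounded_unit_cell unit_cell_sets continuous_intros)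
  from L2ip_Cauchy_Schwarz[OF assms this] show ?thesis
    by (simp add: L2ip_def L2norm_cell_const)
qed

lemma test_mult_L2v:
  assumes "\<theta> \<in> test_functions S" "smooth g" "bounded S" "S \<in> sets lebesgue"
  shows "(\<lambda>x. \<theta> x * g x) \<in> L2v (lebesgue_on S)"
  by (rule test_function_L2v[OF test_function_mult[OF assms(1,2)] assms(3,4)])

text \<open>
  On the cut a wave with frequency \<open>k\<close> has the frequency \<open>(transpose R *v int_vec k) /\<^sub>R \<eta>\<close>, which is large
  unless \<open>k = 0\<close>. Integration by parts in its direction moves a derivative to the other factor and
  gains the factor \<open>\<eta>\<close>. The estimate is uniform for \<open>w\<close> and \<open>\<eta>\<close>, so it applies with \<open>w\<close> running through the
  solutions \<open>u n\<close> themselves.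
\<close>

lemma oscillation_estimate:
  fixes R :: "real ^ 'n::finite ^ 'm::finite"
  assumes irr: "\<And>k::int ^ 'm. k \<noteq> 0 \<Longrightarrow> transpose R *v int_vec k \<noteq> 0"
    and S: "open S" "bounded S" and \<theta>: "\<theta> \<in> test_functions S" and t: "t \<in> trig"
  shows "\<exists>K\<ge>0. \<forall>\<eta>>0. \<forall>w g. w \<in> L2v (lebesgue_on S) \<longrightarrow>
    (\<forall>j. g j \<in> L2v (lebesgue_on S) \<and> has_weak_pderiv S j w (g j)) \<longrightarrow>
    \<bar>L2ip (lebesgue_on S) w (\<lambda>x. \<theta> x * t ((R *v x) /\<^sub>R \<eta>)) - (LINT y|cell. t y) * L2ip (lebesgue_on S) w \<theta>\<bar>
      \<le> \<eta> * K * (L2norm (lebesgue_on S) w + (\<Sum>j\<in>UNIV. L2norm (lebesgue_on S) (g j)))"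
  using t
proof (induction rule: trig.induct)
  case (trig_wave a k b)
  let ?M = "lebesgue_on S"
  have Sm: "S \<in> sets lebesgue" using S by auto
  have \<theta>L: "\<theta> \<in> L2v ?M" by (rule test_function_L2v[OF \<theta> S(2) Sm])
  have d\<theta>L: "pdiff j \<theta> \<in> L2v ?M" for j by (rule test_function_L2v[OF test_function_pdiff[OF \<theta>] S(2) Sm])
  show ?case
  proof (cases "k = 0")
    case True
    have "L2ip ?M w (\<lambda>x. \<theta> x * (a * wave k b ((R *v x) /\<^sub>R \<eta>))) - (LINT y|cell. a * wave k b (y :: real ^ 'm)) * L2ip ?M w \<theta> = 0" for w \<eta>
    proof -
      have "(\<lambda>x. \<theta> x * (a * wave k b ((R *v x) /\<^sub>R \<eta>))) = (\<lambda>x. (a * cos b) * \<theta> x)"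
        using True by (simp add: wave_def fun_eq_iff)
      moreover have "(\<lambda>y. a * wave k b y) = (\<lambda>y. a * cos b)" using True by (simp add: wave_def fun_eq_iff)
      ultimately show ?thesis
        by (simp only: mean_const L2ip_def inner_real_def mult.left_commute[of _ "a * cos b"] integral_mult_right_zero)
    qed
    then show ?thesis by (intro exI[of _ 0]) simp
  next
    case False
    define \<xi> where "\<xi> = transpose R *v int_vec k"
    have \<xi>: "\<xi> \<bullet> \<xi> \<noteq> 0" using irr[OF False] by (simp add: \<xi>_def)
    define A where "A = (\<lambda>j. \<bar>a * \<xi> $ j / (2 * pi * (\<xi> \<bullet> \<xi>))\<bar>)"
    define K where "K = (\<Sum>j\<in>UNIV. A j * (L2norm ?M \<theta> + L2norm ?M (pdiff j \<theta>)))"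
    have A0: "A j \<ge> 0" for j by (simp add: A_def)
    have K0: "K \<ge> 0" unfolding K_def by (intro sum_nonneg mult_nonneg_nonneg A0 add_nonneg_nonneg) auto
    have "\<bar>L2ip ?M w (\<lambda>x. \<theta> x * (a * wave k b ((R *v x) /\<^sub>R \<eta>))) - (LINT y|cell. a * wave k b (y :: real ^ 'm)) * L2ip ?M w \<theta>\<bar>
        \<le> \<eta> * K * (L2norm ?M w + (\<Sum>j\<in>UNIV. L2norm ?M (g j)))"
      if \<eta>: "\<eta> > 0" and w: "w \<in> L2v ?M" and g: "\<forall>j. g j \<in> L2v ?M \<and> has_weak_pderiv S j w (g j)" for \<eta> w g
    proof -
      define N where "N = L2norm ?M w + (\<Sum>j\<in>UNIV. L2norm ?M (g j))"
      define H where "H = (\<lambda>j x. (a * \<xi> $ j / (2 * pi * (\<xi> \<bullet> \<xi>))) * wave k (b - pi / 2) ((R *v x) /\<^sub>R \<eta>))"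
      have Hs: "smooth (H j)" for j unfolding H_def by (rule cut_wave_smooth)
      have Hb: "\<bar>H j x\<bar> \<le> A j" for j x
        using mult_left_mono[OF abs_cos_le_one A0[of j]] by (simp only: H_def A_def abs_mult wave_def) simp
      have dH: "pdiff j (H j) x = (1 / \<eta>) * (a * wave k b ((R *v x) /\<^sub>R \<eta>)) * (\<xi> $ j * \<xi> $ j / (\<xi> \<bullet> \<xi>))" for j x
        unfolding H_def cut_wave_pdiff \<xi>_def[symmetric] by simp
      have "(\<Sum>j\<in>UNIV. pdiff j (H j) x) = (1 / \<eta>) * (a * wave k b ((R *v x) /\<^sub>R \<eta>)) * ((\<Sum>j\<in>UNIV. \<xi> $ j * \<xi> $ j) / (\<xi> \<bullet> \<xi>))" for x
        unfolding dH sum_divide_distrib sum_distrib_left ..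
      then have dsum: "(\<Sum>j\<in>UNIV. pdiff j (H j) x) = (1 / \<eta>) * (a * wave k b ((R *v x) /\<^sub>R \<eta>))" for x
        using \<xi> by (simp add: inner_vec_def)
      have t1: "(\<lambda>x. \<theta> x * H j x) \<in> test_functions S" for j by (rule test_function_mult[OF \<theta> Hs])
      have L1: "(\<lambda>x. \<theta> x * H j x) \<in> L2v ?M" for j by (rule test_function_L2v[OF t1 S(2) Sm])
      have L2: "(\<lambda>x. pdiff j \<theta> x * H j x) \<in> L2v ?M" for j
        by (rule test_mult_L2v[OF test_function_pdiff[OF \<theta>] Hs S(2) Sm])
      have L3: "pdiff j (\<lambda>x. \<theta> x * H j x) \<in> L2v ?M" for j
        by (rule test_function_L2v[OF test_function_pdiff[OF t1] S(2) Sm])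
      have n1: "L2norm ?M (\<lambda>x. \<theta> x * H j x) \<le> A j * L2norm ?M \<theta>" for j
        by (rule L2v_dominated(2)[OF \<theta>L L2v_measurable[OF L1] AE_I2 A0])
          (use mult_right_mono[OF Hb abs_ge_zero] in \<open>simp add: abs_mult mult.commute[of "\<bar>\<theta> _\<bar>"]\<close>)
      have L2norm: "L2norm ?M (\<lambda>x. pdiff j \<theta> x * H j x) \<le> A j * L2norm ?M (pdiff j \<theta>)" for j
        by (rule L2v_dominated(2)[OF d\<theta>L L2v_measurable[OF L2] AE_I2 A0])
          (use mult_right_mono[OF Hb abs_ge_zero] in \<open>simp add: abs_mult mult.commute[of "\<bar>pdiff _ \<theta> _\<bar>"]\<close>)
      have eq: "\<theta> x * (a * wave k b ((R *v x) /\<^sub>R \<eta>))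
          = \<eta> * (\<Sum>j\<in>UNIV. 1 *\<^sub>R pdiff j (\<lambda>x. \<theta> x * H j x) x + (-1) *\<^sub>R (pdiff j \<theta> x * H j x))" for x
      proof -
        have "pdiff j (\<lambda>x. \<theta> x * H j x) x = \<theta> x * pdiff j (H j) x + pdiff j \<theta> x * H j x" for j
          by (rule pdiff_mult[OF smooth_differentiable[OF test_function_smooth[OF \<theta>]] smooth_differentiable[OF Hs]])
        then have "\<eta> * (\<Sum>j\<in>UNIV. 1 *\<^sub>R pdiff j (\<lambda>x. \<theta> x * H j x) x + (-1) *\<^sub>R (pdiff j \<theta> x * H j x))
            = \<eta> * (\<theta> x * (\<Sum>j\<in>UNIV. pdiff j (H j) x))"
          by (simp add: sum_distrib_left)
        then show ?thesis using \<eta> by (simp add: dsum)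
      qed
      have each: "\<bar>L2ip ?M w (\<lambda>x. 1 *\<^sub>R pdiff j (\<lambda>x. \<theta> x * H j x) x + (-1) *\<^sub>R (pdiff j \<theta> x * H j x))\<bar>
          \<le> A j * (L2norm ?M \<theta> + L2norm ?M (pdiff j \<theta>)) * N" for j
      proof -
        have gN: "L2norm ?M (g j) \<le> N" "L2norm ?M w \<le> N"
          unfolding N_def using member_le_sum[of j UNIV "\<lambda>j. L2norm ?M (g j)"] sum_nonneg[of UNIV "\<lambda>j. L2norm ?M (g j)"]
          by (auto intro: add_increasing)
        have "L2ip ?M w (\<lambda>x. 1 *\<^sub>R pdiff j (\<lambda>x. \<theta> x * H j x) x + (-1) *\<^sub>R (pdiff j \<theta> x * H j x))
            = - L2ip ?M (g j) (\<lambda>x. \<theta> x * H j x) - L2ip ?M w (\<lambda>x. pdiff j \<theta> x * H j x)"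
          using L2ip_lin[OF L3 L2 w, of 1 j "-1" j] g t1[of j]
          by (simp add: has_weak_pderiv_L2ip L2ip_commute[of _ w])
        also have "\<bar>\<dots>\<bar> \<le> L2norm ?M (g j) * L2norm ?M (\<lambda>x. \<theta> x * H j x) + L2norm ?M w * L2norm ?M (\<lambda>x. pdiff j \<theta> x * H j x)"
          using L2ip_Cauchy_Schwarz[of "g j" ?M "\<lambda>x. \<theta> x * H j x"] L2ip_Cauchy_Schwarz[OF w L2, of j] g L1[of j] by auto
        also have "\<dots> \<le> N * (A j * L2norm ?M \<theta>) + N * (A j * L2norm ?M (pdiff j \<theta>))"
          using gN n1 L2norm A0 by (intro add_mono mult_mono) (auto intro: order_trans[OF L2norm_nonneg])
        also have "\<dots> = A j * (L2norm ?M \<theta> + L2norm ?M (pdiff j \<theta>)) * N" by (simp add: algebra_simps)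
        finally show ?thesis .
      qed
      have "L2ip ?M w (\<lambda>x. \<theta> x * (a * wave k b ((R *v x) /\<^sub>R \<eta>)))
          = \<eta> * L2ip ?M w (\<lambda>x. \<Sum>j\<in>UNIV. 1 *\<^sub>R pdiff j (\<lambda>x. \<theta> x * H j x) x + (-1) *\<^sub>R (pdiff j \<theta> x * H j x))"
        unfolding eq L2ip_def inner_real_def mult.left_commute[of _ \<eta>] by (rule integral_mult_right_zero)
      also have "L2ip ?M w (\<lambda>x. \<Sum>j\<in>UNIV. 1 *\<^sub>R pdiff j (\<lambda>x. \<theta> x * H j x) x + (-1) *\<^sub>R (pdiff j \<theta> x * H j x))
          = (\<Sum>j\<in>UNIV. L2ip ?M w (\<lambda>x. 1 *\<^sub>R pdiff j (\<lambda>x. \<theta> x * H j x) x + (-1) *\<^sub>R (pdiff j \<theta> x * H j x)))"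
        unfolding L2ip_def inner_sum_right
        by (intro Bochner_Integration.integral_sum L2v_inner_integrable w L2v_lin L3 L2)
      finally have "\<bar>L2ip ?M w (\<lambda>x. \<theta> x * (a * wave k b ((R *v x) /\<^sub>R \<eta>)))\<bar>
          \<le> \<eta> * (\<Sum>j\<in>UNIV. A j * (L2norm ?M \<theta> + L2norm ?M (pdiff j \<theta>)) * N)"
        using \<eta> each by (simp only: abs_mult) (auto intro!: mult_left_mono order_trans[OF sum_abs] sum_mono)
      then show ?thesis
        by (simp only: mean_wave[OF False] mult_zero_left diff_zero)
          (simp add: K_def N_def sum_distrib_right mult.assoc)
    qed
    then show ?thesis using K0 by blast
  qed
next
  case (trig_add t t')
  let ?M = "lebesgue_on S"
  have Sm: "S \<in> sets lebesgue" using S by auto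
  obtain K where K: "K \<ge> 0" "\<And>\<eta> w g. \<eta> > 0 \<Longrightarrow> w \<in> L2v ?M \<Longrightarrow> (\<forall>j. g j \<in> L2v ?M \<and> has_weak_pderiv S j w (g j)) \<Longrightarrow>
    \<bar>L2ip ?M w (\<lambda>x. \<theta> x * t ((R *v x) /\<^sub>R \<eta>)) - (LINT y|cell. t y) * L2ip ?M w \<theta>\<bar>
      \<le> \<eta> * K * (L2norm ?M w + (\<Sum>j\<in>UNIV. L2norm ?M (g j)))"
    using trig_add(3) by blast
  obtain K' where K': "K' \<ge> 0" "\<And>\<eta> w g. \<eta> > 0 \<Longrightarrow> w \<in> L2v ?M \<Longrightarrow> (\<forall>j. g j \<in> L2v ?M \<and> has_weak_pderiv S j w (g j)) \<Longrightarrow>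
    \<bar>L2ip ?M w (\<lambda>x. \<theta> x * t' ((R *v x) /\<^sub>R \<eta>)) - (LINT y|cell. t' y) * L2ip ?M w \<theta>\<bar>
      \<le> \<eta> * K' * (L2norm ?M w + (\<Sum>j\<in>UNIV. L2norm ?M (g j)))"
    using trig_add(4) by blast
  have "\<bar>L2ip ?M w (\<lambda>x. \<theta> x * (t ((R *v x) /\<^sub>R \<eta>) + t' ((R *v x) /\<^sub>R \<eta>))) - (LINT y|cell. t y + t' y) * L2ip ?M w \<theta>\<bar>
      \<le> \<eta> * (K + K') * (L2norm ?M w + (\<Sum>j\<in>UNIV. L2norm ?M (g j)))"
    if \<eta>: "\<eta> > 0" and w: "w \<in> L2v ?M" and g: "\<forall>j. g j \<in> L2v ?M \<and> has_weak_pderiv S j w (g j)" for \<eta> w g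
  proof -
    note L = test_mult_L2v[OF \<theta> cut_trig_smooth[OF trig_add(1)] S(2) Sm] test_mult_L2v[OF \<theta> cut_trig_smooth[OF trig_add(2)] S(2) Sm]
    have "L2ip ?M w (\<lambda>x. \<theta> x * (t ((R *v x) /\<^sub>R \<eta>) + t' ((R *v x) /\<^sub>R \<eta>)))
        = L2ip ?M w (\<lambda>x. \<theta> x * t ((R *v x) /\<^sub>R \<eta>)) + L2ip ?M w (\<lambda>x. \<theta> x * t' ((R *v x) /\<^sub>R \<eta>))"
      using L2ip_lin[OF L w, where a = 1 and b = 1] by (simp add: L2ip_commute[of _ w] distrib_left)
    moreover have "(LINT y|cell. t y + t' y) = (LINT y|cell. t y) + (LINT y|cell. t' y)"
      by (intro Bochner_Integration.integral_add trig_integrable trig_add)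
    ultimately show ?thesis
      using K(2)[OF that] K'(2)[OF that] by (simp add: algebra_simps)
  qed
  then show ?case using K(1) K'(1) by (intro exI[of _ "K + K'"]) auto
qed

section \<open>Convergence of the solutions\<close>

lemma dirichlet_solution_iff:
  "dirichlet_solution \<Omega> A f u \<longleftrightarrow> u \<in> W12_0_vec \<Omega> \<and>
    (\<forall>v\<in>W12_0_vec \<Omega>. L2ip (lebesgue_on \<Omega>) (\<lambda>x. tensor_app (A x) (grad \<Omega> u x)) (grad \<Omega> v) = f v)"
  by (simp add: dirichlet_solution_def L2ip_def tensor_app_inner grad_def)

lemma tensor_app_diff_tensor: "tensor_app (A - B) \<xi> = tensor_app A \<xi> - tensor_app B \<xi>"
  by (simp add: tensor_app_def vec_eq_iff sum_subtractf left_diff_distrib)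

lemma norm_matrix_le_sum: "norm (\<xi> :: real ^ 'n::finite ^ 'd::finite) \<le> (\<Sum>i\<in>UNIV. \<Sum>j\<in>UNIV. \<bar>\<xi> $ i $ j\<bar>)"
proof -
  have "norm \<xi> \<le> (\<Sum>i\<in>UNIV. norm (\<xi> $ i))"
    unfolding norm_vec_def[of \<xi>] by (rule L2_set_le_sum) simp
  also have "\<dots> \<le> (\<Sum>i\<in>UNIV. \<Sum>j\<in>UNIV. \<bar>\<xi> $ i $ j\<bar>)"
    by (intro sum_mono norm_le_l1_cart)
  finally show ?thesis .
qed

lemma norm_matrix_le_bound:
  assumes "\<And>i j. \<bar>(\<xi> :: real ^ 3 ^ 3) $ i $ j\<bar> \<le> b"
  shows "norm \<xi> \<le> 9 * b"
proof -
  have "norm \<xi> \<le> (\<Sum>i\<in>UNIV. \<Sum>j\<in>UNIV. \<bar>\<xi> $ i $ j\<bar>)" by (rule norm_matrix_le_sum)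
  also have "\<dots> \<le> (\<Sum>i\<in>(UNIV::3 set). \<Sum>j\<in>(UNIV::3 set). b)" by (intro sum_mono assms)
  finally show ?thesis by simp
qed

lemma trig_matrix_bounded:
  assumes "\<And>i j. (\<lambda>y. (W y :: real ^ 3 ^ 3) $ i $ j) \<in> trig"
  shows "\<exists>K\<ge>0. \<forall>y. norm (W y) \<le> K"
proof -
  have "\<exists>K. K \<ge> 0 \<and> (\<forall>y. \<bar>W y $ i $ j\<bar> \<le> K)" for i j using trig_bounded[OF assms[of i j]] by blast
  then have "\<exists>K. \<forall>i j. K i j \<ge> 0 \<and> (\<forall>y. \<bar>W y $ i $ j\<bar> \<le> K i j)"
    by (intro choice allI)
  then obtain K where K: "\<And>i j. K i j \<ge> 0" "\<And>i j y. \<bar>W y $ i $ j\<bar> \<le> K i j" by blast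
  have "norm (W y) \<le> (\<Sum>i\<in>UNIV. \<Sum>j\<in>UNIV. K i j)" for y
    by (rule order_trans[OF norm_matrix_le_sum]) (intro sum_mono K)
  moreover have "(\<Sum>i\<in>UNIV. \<Sum>j\<in>UNIV. K i j) \<ge> 0" by (intro sum_nonneg K)
  ultimately show ?thesis by blast
qed

lemma trig_matrix_continuous:
  assumes "\<And>i j. (\<lambda>y. (W y :: real ^ 3 ^ 3) $ i $ j) \<in> trig"
  shows "continuous_on UNIV W"
proof -
  have "continuous_on UNIV (\<lambda>y. \<chi> i j. W y $ i $ j)"
    by (intro continuous_on_vec_lambda smooth_continuous trig_smooth assms)
  then show ?thesis by (simp add: vec_nth_inverse)
qed

lemma trig_tensor_continuous:
  assumes "\<And>i j k l. (\<lambda>y. (\<Psi> y :: tensor4) $ i $ j $ k $ l) \<in> trig"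
  shows "continuous_on UNIV \<Psi>"
proof -
  have "continuous_on UNIV (\<lambda>y. \<chi> i j k l. \<Psi> y $ i $ j $ k $ l)"
    by (intro continuous_on_vec_lambda smooth_continuous trig_smooth assms)
  then show ?thesis by (simp add: vec_nth_inverse)
qed

lemma L2norm_matrix_le_bound:
  fixes F :: "'a \<Rightarrow> real ^ 3 ^ 3"
  assumes F: "F \<in> L2v N" and b: "\<And>i j. L2norm N (\<lambda>x. F x $ i $ j) \<le> b"
  shows "L2norm N F \<le> 9 * b"
proof -
  have row: "(\<lambda>x. F x $ i) \<in> L2v N" for i using F by (subst (asm) L2v_vec_iff) blast
  have "L2norm N F \<le> (\<Sum>i\<in>UNIV. L2norm N (\<lambda>x. F x $ i))" by (rule L2norm_vec_le_sum[OF F])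
  also have "\<dots> \<le> (\<Sum>i\<in>UNIV. \<Sum>j\<in>UNIV. L2norm N (\<lambda>x. F x $ i $ j))"
    by (intro sum_mono L2norm_vec_le_sum[OF row])
  also have "\<dots> \<le> (\<Sum>i\<in>(UNIV::3 set). \<Sum>j\<in>(UNIV::3 set). b)" by (intro sum_mono b)
  finally show ?thesis by simp
qed

lemma L2ip_scale_left: "L2ip N (\<lambda>x. a *\<^sub>R F x) G = a * L2ip N F G"
  by (simp add: L2ip_def)

lemma test_function_bounded:
  assumes "\<theta> \<in> test_functions S" "bounded T"
  shows "\<exists>K\<ge>0. \<forall>x\<in>T. \<bar>\<theta> x\<bar> \<le> K"
  using continuous_bounded_on[OF smooth_continuous[OF test_function_smooth[OF assms(1)]] assms(2)] by simp

text \<open>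
  A sequence of scales \<open>s n\<close> tending to zero, with the solutions \<open>u n\<close> at these scales.
\<close>

locale homogenization = cell_problem R C c G
  for R :: "real ^ 3 ^ 'm::finite" and C c G +
  fixes \<Omega> :: "(real ^ 3) set" and f :: "(real ^ 3 \<Rightarrow> real ^ 3) \<Rightarrow> real"
    and s :: "nat \<Rightarrow> real" and u :: "nat \<Rightarrow> real ^ 3 \<Rightarrow> real ^ 3"
  assumes \<Omega>: "open \<Omega>" "bounded \<Omega>"
    and s_pos: "\<And>n. s n > 0" and s_lim: "s \<longlonglongrightarrow> 0"
    and cut_Linf: "\<And>n. (\<lambda>x. C ((R *v x) /\<^sub>R s n)) \<in> Linf (lebesgue_on \<Omega>)"
    and cut_coercive: "\<And>n. AE x in lebesgue_on \<Omega>. coercive_tensor c (C ((R *v x) /\<^sub>R s n))"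
    and trace: "cut_admissible \<Omega> R C"
    and f: "f \<in> W12_dual \<Omega>"
    and u: "\<And>n. dirichlet_solution \<Omega> (\<lambda>x. C ((R *v x) /\<^sub>R s n)) f (u n)"
begin

abbreviation M :: "(real ^ 3) measure" where "M \<equiv> lebesgue_on \<Omega>"

definition cut_point :: "nat \<Rightarrow> real ^ 3 \<Rightarrow> real ^ 'm" where "cut_point n x = (R *v x) /\<^sub>R s n"

definition Cn :: "nat \<Rightarrow> real ^ 3 \<Rightarrow> tensor4" where "Cn n x = C (cut_point n x)"

definition U :: "nat \<Rightarrow> real ^ 3 \<Rightarrow> real ^ 3 ^ 3" where "U n = grad \<Omega> (u n)"

lemma \<Omega>_sets: "\<Omega> \<in> sets lebesgue" "\<Omega> \<in> sets borel" using \<Omega> by auto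

lemma finite_M: "finite_measure M"
  by (rule finite_measure_lebesgue_on_bounded[OF \<Omega>(2) \<Omega>_sets(1)])

lemma Cn_Linf: "Cn n \<in> Linf M"
  using cut_Linf by (simp add: Cn_def[abs_def] cut_point_def)

lemma Cn_coercive: "AE x in M. coercive_tensor c (Cn n x)"
  using cut_coercive by (simp add: Cn_def cut_point_def)

lemma Cn_symmetric: "symmetric_tensor (Cn n x)"
  by (simp add: Cn_def C_symmetric)

lemma u_W12_0: "u n \<in> W12_0_vec \<Omega>"
  using u by (simp add: dirichlet_solution_def)

lemma U_L2v: "U n \<in> L2v M"
  unfolding U_def by (rule W12_0_vec_L2v(2)[OF u_W12_0])

lemma U_comp_L2v: "(\<lambda>x. U n x $ i $ j) \<in> L2v M"
  using U_L2v[of n] unfolding L2v_vec_iff[of "U n"] by (simp add: L2v_vec_iff)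

lemma u_equation: "v \<in> W12_0_vec \<Omega> \<Longrightarrow> L2ip M (\<lambda>x. tensor_app (Cn n x) (U n x)) (grad \<Omega> v) = f v"
  using u[of n] by (simp add: dirichlet_solution_iff Cn_def cut_point_def U_def)

lemma flux_n_L2v: "F \<in> L2v M \<Longrightarrow> (\<lambda>x. tensor_app (Cn n x) (F x)) \<in> L2v M"
  by (rule tensor_app_Linf_L2v[OF Cn_Linf])

lemma U_bounded: "\<exists>m>0. \<forall>n. L2norm M (U n) \<le> m"
proof -
  obtain L where L: "L \<ge> 0" "\<And>v. v \<in> W12_0_vec \<Omega> \<Longrightarrow> \<bar>f v\<bar> \<le> L * L2norm M (grad \<Omega> v)"
    using W12_dual_bound[OF \<Omega> f] by blast
  have "L2norm M (U n) \<le> L / c + 1" for n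
  proof (cases "L2norm M (U n) = 0")
    case True
    then show ?thesis using L(1) c_pos by (simp add: add_nonneg_nonneg)
  next
    case False
    then have pos: "L2norm M (U n) > 0" using L2norm_nonneg[of M "U n"] by linarith
    have "c * (L2norm M (U n))\<^sup>2 \<le> L2ip M (\<lambda>x. tensor_app (Cn n x) (U n x)) (U n)"
      by (rule L2ip_tensor_app_coercive[OF Cn_Linf Cn_coercive U_L2v])
    also have "\<dots> = f (u n)" using u_equation[OF u_W12_0, of n n] by (simp add: U_def)
    also have "\<dots> \<le> L * L2norm M (U n)" using L(2)[OF u_W12_0, of n] by (simp add: U_def)
    finally have "(c * L2norm M (U n)) * L2norm M (U n) \<le> L * L2norm M (U n)" by (simp add: power2_eq_square mult.assoc)
    then have "c * L2norm M (U n) \<le> L" using pos by (rule mult_right_le_imp_le)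
    then show ?thesis using c_pos by (simp add: field_simps)
  qed
  moreover have "L / c + 1 > 0" using L(1) c_pos by (simp add: add_nonneg_pos)
  ultimately show ?thesis by blast
qed

lemma u_bounded: "\<exists>B\<ge>0. \<forall>n i. L2norm M (\<lambda>x. u n x $ i) + (\<Sum>j\<in>UNIV. L2norm M (\<lambda>x. U n x $ i $ j)) \<le> B"
proof -
  obtain m where m: "m > 0" "\<And>n. L2norm M (U n) \<le> m" using U_bounded by blast
  obtain P where P: "P \<ge> 0" "\<And>v :: real ^ 3 \<Rightarrow> real ^ 3. v \<in> W12_0_vec \<Omega> \<Longrightarrow> L2norm M v \<le> P * L2norm M (grad \<Omega> v)"
    using Poincare[OF \<Omega>, where 'd = 3] by blast
  have "L2norm M (\<lambda>x. u n x $ i) + (\<Sum>j\<in>UNIV. L2norm M (\<lambda>x. U n x $ i $ j)) \<le> P * m + 3 * m" for n i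
  proof -
    have "L2norm M (\<lambda>x. u n x $ i) \<le> L2norm M (u n)" by (rule L2norm_nth_le[OF W12_0_vec_L2v(1)[OF u_W12_0]])
    also have "\<dots> \<le> P * L2norm M (U n)" using P(2)[OF u_W12_0] by (simp add: U_def)
    also have "\<dots> \<le> P * m" using m P by (intro mult_left_mono) auto
    finally have 1: "L2norm M (\<lambda>x. u n x $ i) \<le> P * m" .
    have r: "(\<lambda>x. U n x $ i) \<in> L2v M" using U_L2v[of n] unfolding L2v_vec_iff[of "U n"] by blast
    have "L2norm M (\<lambda>x. U n x $ i $ j) \<le> m" for j
      using L2norm_nth_le[OF r, of j] L2norm_nth_le[OF U_L2v, of n i] m(2)[of n] by linarith
    then have "(\<Sum>j\<in>UNIV. L2norm M (\<lambda>x. U n x $ i $ j)) \<le> (\<Sum>j\<in>(UNIV::3 set). m)" by (intro sum_mono)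
    then show ?thesis using 1 by simp
  qed
  moreover have "P * m + 3 * m \<ge> 0" using P m by simp
  ultimately show ?thesis by blast
qed

lemma cut_smooth: "t \<in> trig \<Longrightarrow> smooth (\<lambda>x. t (cut_point n x))"
  unfolding cut_point_def by (rule cut_trig_smooth)

lemma oscillation_null:
  assumes \<theta>: "\<theta> \<in> test_functions \<Omega>" and t: "t \<in> trig" and w: "\<And>n. w n \<in> L2v M"
    and g: "\<And>n j. g n j \<in> L2v M" "\<And>n j. has_weak_pderiv \<Omega> j (w n) (g n j)"
    and B: "\<And>n. L2norm M (w n) + (\<Sum>j\<in>UNIV. L2norm M (g n j)) \<le> B"
  shows "(\<lambda>n. L2ip M (w n) (\<lambda>x. \<theta> x * t (cut_point n x)) - (LINT y|cell. t y) * L2ip M (w n) \<theta>) \<longlonglongrightarrow> 0"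
proof -
  obtain K where K: "K \<ge> 0" "\<And>\<eta> w g. \<eta> > 0 \<Longrightarrow> w \<in> L2v M \<Longrightarrow> (\<forall>j. g j \<in> L2v M \<and> has_weak_pderiv \<Omega> j w (g j)) \<Longrightarrow>
    \<bar>L2ip M w (\<lambda>x. \<theta> x * t ((R *v x) /\<^sub>R \<eta>)) - (LINT y|cell. t y) * L2ip M w \<theta>\<bar>
      \<le> \<eta> * K * (L2norm M w + (\<Sum>j\<in>UNIV. L2norm M (g j)))"
    using oscillation_estimate[OF irrational \<Omega> \<theta> t] by blast
  have le: "norm (L2ip M (w n) (\<lambda>x. \<theta> x * t (cut_point n x)) - (LINT y|cell. t y) * L2ip M (w n) \<theta>) \<le> s n * (K * B)" for n
  proof -
    have "norm (L2ip M (w n) (\<lambda>x. \<theta> x * t (cut_point n x)) - (LINT y|cell. t y) * L2ip M (w n) \<theta>)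
        \<le> s n * K * (L2norm M (w n) + (\<Sum>j\<in>UNIV. L2norm M (g n j)))"
      unfolding cut_point_def real_norm_def using w g by (intro K(2) s_pos) auto
    also have "\<dots> \<le> s n * K * B"
      using B[of n] K(1) s_pos[of n] by (intro mult_left_mono) auto
    finally show ?thesis by (simp add: mult.assoc)
  qed
  show ?thesis
    by (rule Lim_null_comparison[OF always_eventually[OF allI[OF le]] tendsto_mult_left_zero[OF s_lim]])
qed

text \<open>Here the oscillation estimate is applied to the constant function \<open>1\<close> in place of \<open>w\<close>.\<close>

lemma weighted_norm_limit:
  assumes \<theta>: "\<theta> \<in> test_functions \<Omega>" and t: "t \<in> trig"
  shows "(\<lambda>n. L2norm M (\<lambda>x. \<theta> x * t (cut_point n x))) \<longlonglongrightarrow> L2norm M \<theta> * L2norm cell t"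
proof -
  have one: "(\<lambda>x. 1 :: real) \<in> L2v M"
    by (intro continuous_L2v \<Omega> \<Omega>_sets continuous_intros)
  have w1: "has_weak_pderiv \<Omega> j (\<lambda>x. 1) (\<lambda>x. 0)" for j
  proof -
    have "pdiff j (\<lambda>x. 1 :: real) = (\<lambda>x :: real ^ 3. 0)" by (rule ext) (rule pdiff_const)
    then show ?thesis using smooth_has_weak_pderiv[OF \<Omega> smooth_const, of j 1] by simp
  qed
  have \<theta>2: "(\<lambda>x. \<theta> x * \<theta> x) \<in> test_functions \<Omega>"
    by (rule test_function_mult[OF \<theta> test_function_smooth[OF \<theta>]])
  have "(\<lambda>n. L2ip M (\<lambda>x. 1) (\<lambda>x. \<theta> x * \<theta> x * (t (cut_point n x) * t (cut_point n x)))
      - (LINT y|cell. t y * t y) * L2ip M (\<lambda>x. 1) (\<lambda>x. \<theta> x * \<theta> x)) \<longlonglongrightarrow> 0"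
    by (rule oscillation_null[OF \<theta>2 trig_mult[OF t t], of "\<lambda>_ x. 1" "\<lambda>_ _ x. 0" "L2norm M (\<lambda>x. 1 :: real)"])
      (use one w1 in \<open>auto simp: L2v_zero L2norm_def\<close>)
  moreover have "L2ip M (\<lambda>x. 1) (\<lambda>x. \<theta> x * \<theta> x * (t (cut_point n x) * t (cut_point n x))) = (L2norm M (\<lambda>x. \<theta> x * t (cut_point n x)))\<^sup>2" for n
    unfolding L2norm_power2 L2ip_def by (intro Bochner_Integration.integral_cong) (auto simp: power2_eq_square mult_ac)
  moreover have "(LINT y|cell. t y * t y) = (L2norm cell t)\<^sup>2"
    unfolding L2norm_power2 by (simp add: power2_eq_square)
  moreover have "L2ip M (\<lambda>x. 1) (\<lambda>x. \<theta> x * \<theta> x) = (L2norm M \<theta>)\<^sup>2"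
    unfolding L2norm_power2 L2ip_def by (simp add: power2_eq_square)
  ultimately have "(\<lambda>n. (L2norm M (\<lambda>x. \<theta> x * t (cut_point n x)))\<^sup>2) \<longlonglongrightarrow> (L2norm cell t)\<^sup>2 * (L2norm M \<theta>)\<^sup>2"
    by (simp add: LIM_zero_cancel)
  from tendsto_real_sqrt[OF this] show ?thesis
    by (simp add: real_sqrt_mult mult.commute)
qed

lemma tensor_L2v:
  assumes "A \<in> Linf N" "finite_measure N"
  shows "A \<in> L2v N"
proof -
  obtain K where "AE x in N. norm (A x) \<le> K" using assms(1) by (rule Linf_bound)
  then show ?thesis using assms by (intro L2v_bounded) (auto simp: Linf_def)
qed

lemma tensor_approximation:
  assumes e: "e > 0"
  shows "\<exists>\<Psi> :: real ^ 'm \<Rightarrow> tensor4. (\<forall>i j k l. (\<lambda>y. \<Psi> y $ i $ j $ k $ l) \<in> trig) \<and> L2norm cell (\<lambda>y. C y - \<Psi> y) < e"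
proof -
  have CL: "C \<in> L2v cell" by (rule tensor_L2v[OF C_Linf finite_measure_cell])
  have compL: "(\<lambda>y. C y $ i $ j $ k $ l) \<in> L2v cell" for i j k l
    by (rule L2v_dominated(1)[OF CL tensor_measurable[OF L2v_measurable[OF CL]], of _ _ _ _ 1])
      (auto simp: tensor_component_le)
  have ex: "\<exists>t. t \<in> trig \<and> L2norm cell (\<lambda>y. t y - C y $ i $ j $ k $ l) < e / 81" for i j k l
    using trig_approximation[OF compL, of "e / 81" i j k l] e by auto
  define t where "t = (\<lambda>i j k l. SOME t. t \<in> trig \<and> L2norm cell (\<lambda>y. t y - C y $ i $ j $ k $ l) < e / 81)"
  have t: "t i j k l \<in> trig" "L2norm cell (\<lambda>y. t i j k l y - C y $ i $ j $ k $ l) < e / 81" for i j k l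
    using someI_ex[OF ex[of i j k l]] unfolding t_def by blast+
  define \<Psi> :: "real ^ 'm \<Rightarrow> tensor4" where "\<Psi> = (\<lambda>y. \<chi> i j k l. t i j k l y)"
  have L4: "(\<lambda>y. (C y - \<Psi> y) $ i $ j $ k $ l) \<in> L2v cell" for i j k l
    using L2v_diff[OF compL trig_L2v[OF t(1)], of i j k l i j k l] by (simp add: \<Psi>_def)
  have L3: "(\<lambda>y. (C y - \<Psi> y) $ i $ j $ k) \<in> L2v cell" for i j k
    unfolding L2v_vec_iff[of "\<lambda>y. (C y - \<Psi> y) $ i $ j $ k"] using L4 by blast
  have L2: "(\<lambda>y. (C y - \<Psi> y) $ i $ j) \<in> L2v cell" for i j
    unfolding L2v_vec_iff[of "\<lambda>y. (C y - \<Psi> y) $ i $ j"] using L3 by blast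
  have L1: "(\<lambda>y. (C y - \<Psi> y) $ i) \<in> L2v cell" for i
    unfolding L2v_vec_iff[of "\<lambda>y. (C y - \<Psi> y) $ i"] using L2 by blast
  have L0: "(\<lambda>y. C y - \<Psi> y) \<in> L2v cell"
    unfolding L2v_vec_iff[of "\<lambda>y. C y - \<Psi> y"] using L1 by blast
  have "L2norm cell (\<lambda>y. C y - \<Psi> y) \<le> (\<Sum>i\<in>UNIV. L2norm cell (\<lambda>y. (C y - \<Psi> y) $ i))"
    by (rule L2norm_vec_le_sum[OF L0])
  also have "\<dots> \<le> (\<Sum>i\<in>UNIV. \<Sum>j\<in>UNIV. L2norm cell (\<lambda>y. (C y - \<Psi> y) $ i $ j))"
    by (intro sum_mono L2norm_vec_le_sum[OF L1])
  also have "\<dots> \<le> (\<Sum>i\<in>UNIV. \<Sum>j\<in>UNIV. \<Sum>k\<in>UNIV. L2norm cell (\<lambda>y. (C y - \<Psi> y) $ i $ j $ k))"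
    by (intro sum_mono L2norm_vec_le_sum[OF L2])
  also have "\<dots> \<le> (\<Sum>i\<in>UNIV. \<Sum>j\<in>UNIV. \<Sum>k\<in>UNIV. \<Sum>l\<in>UNIV. L2norm cell (\<lambda>y. (C y - \<Psi> y) $ i $ j $ k $ l))"
    by (intro sum_mono L2norm_vec_le_sum[OF L3])
  also have "\<dots> < (\<Sum>i\<in>(UNIV::3 set). \<Sum>j\<in>(UNIV::3 set). \<Sum>k\<in>(UNIV::3 set). \<Sum>l\<in>(UNIV::3 set). e / 81)"
    using t(2) by (intro sum_strict_mono) (auto simp: \<Psi>_def L2norm_minus_commute)
  finally have "L2norm cell (\<lambda>y. C y - \<Psi> y) < e" by simp
  then show ?thesis using t(1) by (intro exI[of _ \<Psi>]) (simp add: \<Psi>_def)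
qed

lemma trace_limit:
  fixes \<Psi> :: "real ^ 'm \<Rightarrow> tensor4"
  assumes "\<And>i j k l. (\<lambda>y. \<Psi> y $ i $ j $ k $ l) \<in> trig"
  shows "(\<lambda>n. L2norm M (\<lambda>x. Cn n x - \<Psi> (cut_point n x))) \<longlonglongrightarrow> sqrt (measure lebesgue \<Omega>) * L2norm cell (\<lambda>y. C y - \<Psi> y)"
proof -
  have cont: "continuous_on UNIV \<Psi>" by (rule trig_tensor_continuous[OF assms])
  have per: "cell_periodic \<Psi>"
    using trig_periodic[OF assms] by (simp add: cell_periodic_def vec_eq_iff)
  have sl: "filterlim s (at_right 0) sequentially"
    using s_lim s_pos by (auto simp: filterlim_at intro!: always_eventually less_imp_neq[symmetric])
  have "((\<lambda>\<eta>. LINT x|M. (norm (C ((R *v x) /\<^sub>R \<eta>) - \<Psi> ((R *v x) /\<^sub>R \<eta>)))\<^sup>2)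
      \<longlongrightarrow> measure lebesgue \<Omega> * (LINT y|cell. (norm (C y - \<Psi> y))\<^sup>2)) (at_right 0)"
    using trace cont per by (simp add: cut_admissible_def)
  from filterlim_compose[OF this sl]
  have "(\<lambda>n. (L2norm M (\<lambda>x. Cn n x - \<Psi> (cut_point n x)))\<^sup>2) \<longlonglongrightarrow> measure lebesgue \<Omega> * (L2norm cell (\<lambda>y. C y - \<Psi> y))\<^sup>2"
    by (simp add: L2norm_power2 Cn_def cut_point_def)
  from tendsto_real_sqrt[OF this] show ?thesis by (simp add: real_sqrt_mult)
qed

lemma cut_continuous: "continuous_on UNIV (cut_point n)"
  unfolding cut_point_def by (intro continuous_intros matrix_vector_mult_linear_continuous_on)

lemma continuous_cut_L2v:
  fixes F :: "real ^ 'm \<Rightarrow> 'b::euclidean_space"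
  assumes "continuous_on UNIV F"
  shows "(\<lambda>x. F (cut_point n x)) \<in> L2v M"
  by (intro continuous_L2v \<Omega> \<Omega>_sets continuous_on_compose2[OF assms cut_continuous]) simp

lemma Cn_L2v: "Cn n \<in> L2v M"
  by (rule tensor_L2v[OF Cn_Linf finite_M])

lemma one_L2v: "(\<lambda>x. 1 :: real) \<in> L2v M"
  by (intro continuous_L2v \<Omega> \<Omega>_sets continuous_intros)

lemma test_scaleR_L2v:
  fixes F :: "real ^ 3 \<Rightarrow> 'b::euclidean_space"
  assumes \<theta>: "\<theta> \<in> test_functions \<Omega>" and F: "F \<in> L2v M"
  shows "(\<lambda>x. \<theta> x *\<^sub>R F x) \<in> L2v M"
proof -
  obtain K where K: "K \<ge> 0" "\<forall>x\<in>\<Omega>. \<bar>\<theta> x\<bar> \<le> K" using test_function_bounded[OF \<theta> \<Omega>(2)] by blast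
  have "\<theta> \<in> borel_measurable M"
    by (rule L2v_measurable[OF test_function_L2v[OF \<theta> \<Omega>(2) \<Omega>_sets(1)]])
  then have m: "(\<lambda>x. \<theta> x *\<^sub>R F x) \<in> borel_measurable M"
    using L2v_measurable[OF F] by (rule borel_measurable_scaleR)
  show ?thesis
    by (rule L2v_dominated(1)[OF F m AE_I2 K(1)]) (use K(2) in \<open>auto simp: space_restrict_space intro: mult_right_mono\<close>)
qed

text \<open>
  The trace condition says that replacing \<open>C\<close> by a trigonometric approximation costs the same in the
  mean square on the cut as on the cell; for trigonometric polynomials the mean squares on the
  cut converge by the oscillation estimate.
\<close>

lemma flux_error:
  fixes W :: "real ^ 'm \<Rightarrow> real ^ 3 ^ 3"
  assumes \<theta>: "\<theta> \<in> test_functions \<Omega>" and W: "\<And>i j. (\<lambda>y. W y $ i $ j) \<in> trig" and \<tau>: "\<tau> \<in> trig" and e: "e > 0"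
  shows "\<forall>\<^sub>F n in sequentially. L2norm M (\<lambda>x. \<theta> x * (tensor_app (Cn n x) (W (cut_point n x)) $ a $ b - \<tau> (cut_point n x)))
    < L2norm M \<theta> * L2norm cell (\<lambda>y. tensor_app (C y) (W y) $ a $ b - \<tau> y) + e"
proof -
  obtain \<Theta> where \<Theta>: "\<Theta> \<ge> 0" "\<forall>x\<in>\<Omega>. \<bar>\<theta> x\<bar> \<le> \<Theta>" using test_function_bounded[OF \<theta> \<Omega>(2)] by blast
  obtain K where K: "K \<ge> 0" "\<And>y. norm (W y) \<le> K" using trig_matrix_bounded[OF W] by blast
  define v where "v = sqrt (measure lebesgue \<Omega>)"
  define D where "D = \<Theta> * (81 * K) * (v + 1) + 1 + L2norm M \<theta> * (81 * K)"
  have v: "v \<ge> 0" by (simp add: v_def)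
  have D: "D > 0" unfolding D_def using \<Theta>(1) K(1) v by (intro add_pos_nonneg add_nonneg_pos) auto
  define \<delta> where "\<delta> = e / D"
  have \<delta>: "\<delta> > 0" using e D by (simp add: \<delta>_def)
  obtain \<Psi> :: "real ^ 'm \<Rightarrow> tensor4" where \<Psi>: "\<And>i j k l. (\<lambda>y. \<Psi> y $ i $ j $ k $ l) \<in> trig"
    "L2norm cell (\<lambda>y. C y - \<Psi> y) < \<delta>" using tensor_approximation[OF \<delta>] by blast
  note \<Psi>c = trig_tensor_continuous[OF \<Psi>(1)] and Wc = trig_matrix_continuous[OF W]
  define P where "P = (\<lambda>y. tensor_app (\<Psi> y) (W y) $ a $ b - \<tau> y)"
  have P: "P \<in> trig"
    unfolding P_def tensor_app_def vec_lambda_beta by (intro trig_diff trig_sum trig_mult \<Psi> W \<tau>)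
  have comp: "\<bar>tensor_app A (W y) $ a $ b\<bar> \<le> (81 * K) * norm A" for A y
  proof -
    have "\<bar>tensor_app A (W y) $ a $ b\<bar> \<le> norm (tensor_app A (W y))" by (rule matrix_component_le)
    also have "\<dots> \<le> 81 * norm A * norm (W y)" by (rule norm_tensor_app_le)
    also have "\<dots> \<le> 81 * norm A * K" using K(2) by (intro mult_left_mono) auto
    finally show ?thesis by (simp add: mult_ac)
  qed
  have CL: "C \<in> L2v cell" by (rule tensor_L2v[OF C_Linf finite_measure_cell])
  have WL: "W \<in> L2v cell" by (intro continuous_L2v Wc bounded_unit_cell unit_cell_sets)
  have \<Psi>L: "\<Psi> \<in> L2v cell" by (intro continuous_L2v \<Psi>c bounded_unit_cell unit_cell_sets)
  have DL: "(\<lambda>y. C y - \<Psi> y) \<in> L2v cell" by (rule L2v_diff[OF CL \<Psi>L])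
  have "L2norm cell (\<lambda>y. tensor_app (C y - \<Psi> y) (W y) $ a $ b) \<le> (81 * K) * L2norm cell (\<lambda>y. C y - \<Psi> y)"
    and EL: "(\<lambda>y. tensor_app (C y - \<Psi> y) (W y) $ a $ b) \<in> L2v cell"
    by (rule L2v_dominated[OF DL matrix_measurable[OF tensor_app_measurable[OF L2v_measurable[OF DL] L2v_measurable[OF WL]]],
          where K = "81 * K"]; use comp K(1) in simp)+
  then have E: "L2norm cell (\<lambda>y. tensor_app (C y - \<Psi> y) (W y) $ a $ b) \<le> (81 * K) * \<delta>"
    using \<Psi>(2) K(1) by (smt (verit) mult_left_mono)
  have ZL: "(\<lambda>y. tensor_app (C y) (W y) $ a $ b - \<tau> y) \<in> L2v cell"
  proof -
    have "(\<lambda>y. tensor_app (C y) (W y) $ a) \<in> L2v cell" by (rule row_L2v[OF tensor_app_Linf_L2v[OF C_Linf WL]])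
    then have "(\<lambda>y. tensor_app (C y) (W y) $ a $ b) \<in> L2v cell" by (subst (asm) L2v_vec_iff) blast
    then show ?thesis by (rule L2v_diff[OF _ trig_L2v[OF \<tau>]])
  qed
  have nP: "L2norm cell P \<le> L2norm cell (\<lambda>y. tensor_app (C y) (W y) $ a $ b - \<tau> y) + (81 * K) * \<delta>"
  proof -
    have "P = (\<lambda>y. (tensor_app (C y) (W y) $ a $ b - \<tau> y) + (-1) *\<^sub>R tensor_app (C y - \<Psi> y) (W y) $ a $ b)"
      by (simp add: P_def tensor_app_diff_tensor)
    then have "L2norm cell P \<le> L2norm cell (\<lambda>y. tensor_app (C y) (W y) $ a $ b - \<tau> y)
        + L2norm cell (\<lambda>y. (-1) *\<^sub>R tensor_app (C y - \<Psi> y) (W y) $ a $ b)"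
      using L2norm_triangle[OF ZL L2v_scale[OF EL, of "-1"]] by simp
    then show ?thesis using E by (simp only: L2norm_scale)
  qed
  have ev1: "\<forall>\<^sub>F n in sequentially. L2norm M (\<lambda>x. Cn n x - \<Psi> (cut_point n x)) < (v + 1) * \<delta>"
  proof (rule order_tendstoD(2)[OF trace_limit[OF \<Psi>(1)]])
    have "sqrt (measure lebesgue \<Omega>) * L2norm cell (\<lambda>y. C y - \<Psi> y) \<le> v * \<delta>"
      unfolding v_def using \<Psi>(2) by (intro mult_left_mono) auto
    also have "\<dots> < (v + 1) * \<delta>" using \<delta> by simp
    finally show "sqrt (measure lebesgue \<Omega>) * L2norm cell (\<lambda>y. C y - \<Psi> y) < (v + 1) * \<delta>" .
  qed
  have ev2: "\<forall>\<^sub>F n in sequentially. L2norm M (\<lambda>x. \<theta> x * P (cut_point n x)) < L2norm M \<theta> * L2norm cell P + \<delta>"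
    by (rule order_tendstoD(2)[OF weighted_norm_limit[OF \<theta> P]]) (use \<delta> in simp)
  show ?thesis
    using ev1 ev2
  proof eventually_elim
    case (elim n)
    let ?F1 = "\<lambda>x. \<theta> x * tensor_app (Cn n x - \<Psi> (cut_point n x)) (W (cut_point n x)) $ a $ b"
    let ?F2 = "\<lambda>x. \<theta> x * P (cut_point n x)"
    have DnL: "(\<lambda>x. Cn n x - \<Psi> (cut_point n x)) \<in> L2v M"
      by (intro L2v_diff Cn_L2v continuous_cut_L2v \<Psi>c)
    have m1: "?F1 \<in> borel_measurable M"
      by (intro borel_measurable_times L2v_measurable[OF test_function_L2v[OF \<theta> \<Omega>(2) \<Omega>_sets(1)]]
          matrix_measurable tensor_app_measurable L2v_measurable[OF DnL] L2v_measurable[OF continuous_cut_L2v[OF Wc]])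
    have b1: "norm (?F1 x) \<le> (\<Theta> * (81 * K)) * norm (Cn n x - \<Psi> (cut_point n x))" if "x \<in> space M" for x
    proof -
      have "norm (?F1 x) \<le> \<Theta> * ((81 * K) * norm (Cn n x - \<Psi> (cut_point n x)))"
        using comp[of "Cn n x - \<Psi> (cut_point n x)" "cut_point n x"] \<Theta> that
        by (simp only: real_norm_def abs_mult) (intro mult_mono; auto simp: space_restrict_space)
      then show ?thesis by (simp add: mult.assoc)
    qed
    have F1: "?F1 \<in> L2v M" "L2norm M ?F1 \<le> (\<Theta> * (81 * K)) * L2norm M (\<lambda>x. Cn n x - \<Psi> (cut_point n x))"
      by (rule L2v_dominated[OF DnL m1 AE_I2[OF b1]]; use \<Theta>(1) K(1) in simp)+
    have F2: "?F2 \<in> L2v M"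
      by (rule test_mult_L2v[OF \<theta> cut_smooth[OF P] \<Omega>(2) \<Omega>_sets(1)])
    have "(\<lambda>x. \<theta> x * (tensor_app (Cn n x) (W (cut_point n x)) $ a $ b - \<tau> (cut_point n x))) = (\<lambda>x. ?F1 x + ?F2 x)"
      by (simp add: P_def tensor_app_diff_tensor algebra_simps)
    then have "L2norm M (\<lambda>x. \<theta> x * (tensor_app (Cn n x) (W (cut_point n x)) $ a $ b - \<tau> (cut_point n x))) \<le> L2norm M ?F1 + L2norm M ?F2"
      using L2norm_triangle[OF F1(1) F2] by simp
    also have "\<dots> < (\<Theta> * (81 * K)) * ((v + 1) * \<delta>) + (L2norm M \<theta> * L2norm cell P + \<delta>)"
    proof (rule add_le_less_mono[OF order_trans[OF F1(2)] elim(2)])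
      show "(\<Theta> * (81 * K)) * L2norm M (\<lambda>x. Cn n x - \<Psi> (cut_point n x)) \<le> (\<Theta> * (81 * K)) * ((v + 1) * \<delta>)"
        using elim(1) \<Theta>(1) K(1) by (intro mult_left_mono) auto
    qed
    also have "\<dots> \<le> (\<Theta> * (81 * K)) * ((v + 1) * \<delta>)
        + (L2norm M \<theta> * (L2norm cell (\<lambda>y. tensor_app (C y) (W y) $ a $ b - \<tau> y) + (81 * K) * \<delta>) + \<delta>)"
      using nP by (intro add_left_mono add_right_mono mult_left_mono) auto
    also have "\<dots> = L2norm M \<theta> * L2norm cell (\<lambda>y. tensor_app (C y) (W y) $ a $ b - \<tau> y) + D * \<delta>"
      by (simp add: D_def algebra_simps)
    also have "D * \<delta> = e" using D by (simp add: \<delta>_def)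
    finally show ?case .
  qed
qed

text \<open>
  A divergence-free field may be replaced by its mean: the derivative of \<open>u\<close> is moved to the cutoff,
  where the oscillation estimate applies, and back.
\<close>

lemma divfree_limit:
  assumes \<theta>: "\<theta> \<in> test_functions \<Omega>" and d: "d \<in> divfree R"
  shows "(\<lambda>n. (\<Sum>j\<in>UNIV. L2ip M (\<lambda>x. U n x $ i $ j) (\<lambda>x. \<theta> x * d (cut_point n x) $ j))
    - (\<Sum>j\<in>UNIV. (LINT y|cell. d y $ j) * L2ip M (\<lambda>x. U n x $ i $ j) \<theta>)) \<longlonglongrightarrow> 0"
proof -
  note dt = divfree_trig[OF d]
  have weak: "L2ip M (\<lambda>x. u n x $ i) (pdiff j \<phi>) = - L2ip M (\<lambda>x. U n x $ i $ j) \<phi>"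
    if "\<phi> \<in> test_functions \<Omega>" for n j \<phi>
    using W12_0_vec_L2v(3)[OF u_W12_0[of n], of j i] that unfolding has_weak_pderiv_L2ip U_def by blast
  have wL: "(\<lambda>x. u n x $ i) \<in> L2v M" for n
    using W12_0_vec_L2v(1)[OF u_W12_0, of n] unfolding L2v_vec_iff[of "u n"] by blast
  obtain B where B: "\<And>n. L2norm M (\<lambda>x. u n x $ i) + (\<Sum>j\<in>UNIV. L2norm M (\<lambda>x. U n x $ i $ j)) \<le> B"
    using u_bounded by blast
  have osc: "(\<lambda>n. L2ip M (\<lambda>x. u n x $ i) (\<lambda>x. pdiff j \<theta> x * d (cut_point n x) $ j)
      - (LINT y|cell. d y $ j) * L2ip M (\<lambda>x. u n x $ i) (pdiff j \<theta>)) \<longlonglongrightarrow> 0" for j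
    by (rule oscillation_null[OF test_function_pdiff[OF \<theta>] dt wL U_comp_L2v _ B])
      (use W12_0_vec_L2v(3)[OF u_W12_0] in \<open>simp add: U_def\<close>)
  have "(\<lambda>n. - (\<Sum>j\<in>UNIV. L2ip M (\<lambda>x. u n x $ i) (\<lambda>x. pdiff j \<theta> x * d (cut_point n x) $ j)
      - (LINT y|cell. d y $ j) * L2ip M (\<lambda>x. u n x $ i) (pdiff j \<theta>))) \<longlonglongrightarrow> - 0"
    by (intro tendsto_minus tendsto_null_sum osc)
  moreover have "- (\<Sum>j\<in>UNIV. L2ip M (\<lambda>x. u n x $ i) (\<lambda>x. pdiff j \<theta> x * d (cut_point n x) $ j)
      - (LINT y|cell. d y $ j) * L2ip M (\<lambda>x. u n x $ i) (pdiff j \<theta>))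
    = (\<Sum>j\<in>UNIV. L2ip M (\<lambda>x. U n x $ i $ j) (\<lambda>x. \<theta> x * d (cut_point n x) $ j))
    - (\<Sum>j\<in>UNIV. (LINT y|cell. d y $ j) * L2ip M (\<lambda>x. U n x $ i $ j) \<theta>)" for n
  proof -
    have sd: "smooth (\<lambda>x. d (cut_point n x) $ j)" for j by (rule cut_smooth[OF dt])
    have t: "(\<lambda>x. \<theta> x * d (cut_point n x) $ j) \<in> test_functions \<Omega>" for j
      by (rule test_function_mult[OF \<theta> sd])
    have L1: "pdiff j (\<lambda>x. \<theta> x * d (cut_point n x) $ j) \<in> L2v M" for j
      by (rule test_function_L2v[OF test_function_pdiff[OF t] \<Omega>(2) \<Omega>_sets(1)])
    have L2: "(\<lambda>x. pdiff j \<theta> x * d (cut_point n x) $ j) \<in> L2v M" for j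
      by (rule test_mult_L2v[OF test_function_pdiff[OF \<theta>] sd \<Omega>(2) \<Omega>_sets(1)])
    have "(\<Sum>j\<in>UNIV. pdiff j (\<lambda>x. \<theta> x * d (cut_point n x) $ j) x) = (\<Sum>j\<in>UNIV. pdiff j \<theta> x * d (cut_point n x) $ j)" for x
    proof -
      have "pdiff j (\<lambda>x. \<theta> x * d (cut_point n x) $ j) x = \<theta> x * pdiff j (\<lambda>x. d (cut_point n x) $ j) x + pdiff j \<theta> x * d (cut_point n x) $ j" for j
        by (rule pdiff_mult[OF smooth_differentiable[OF test_function_smooth[OF \<theta>]] smooth_differentiable[OF sd]])
      then show ?thesis
        using cut_divfree[OF d, of "s n" x] by (simp add: sum.distrib flip: sum_distrib_left) (simp add: cut_point_def)
    qed
    then have "L2ip M (\<lambda>x. \<Sum>j\<in>UNIV. pdiff j (\<lambda>x. \<theta> x * d (cut_point n x) $ j) x) (\<lambda>x. u n x $ i)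
        = L2ip M (\<lambda>x. \<Sum>j\<in>UNIV. pdiff j \<theta> x * d (cut_point n x) $ j) (\<lambda>x. u n x $ i)"
      by simp
    then have "(\<Sum>j\<in>UNIV. L2ip M (\<lambda>x. u n x $ i) (pdiff j (\<lambda>x. \<theta> x * d (cut_point n x) $ j)))
        = (\<Sum>j\<in>UNIV. L2ip M (\<lambda>x. u n x $ i) (\<lambda>x. pdiff j \<theta> x * d (cut_point n x) $ j))"
      by (simp only: L2ip_sum_left[OF L1 wL] L2ip_sum_left[OF L2 wL]) (simp only: L2ip_commute[of M _ "\<lambda>x. u n x $ i"])
    then have "- (\<Sum>j\<in>UNIV. L2ip M (\<lambda>x. u n x $ i) (\<lambda>x. pdiff j \<theta> x * d (cut_point n x) $ j))
        = (\<Sum>j\<in>UNIV. L2ip M (\<lambda>x. U n x $ i $ j) (\<lambda>x. \<theta> x * d (cut_point n x) $ j))"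
      by (simp add: weak[OF t] sum_negf)
    then show ?thesis
      by (simp add: sum_subtractf weak[OF \<theta>] sum_negf sum.distrib)
  qed
  ultimately show ?thesis by simp
qed

text \<open>
  The core of the proof. The equation is tested with \<open>\<theta>\<close> times \<open>s n\<close> times the potentials of the
  correction, approximated by trigonometric polynomials \<open>\<omega> p\<close>. This trades the constant \<open>\<xi>\<close> for the field
  \<open>W\<close>, close to the corrected one, whose flux is close to a divergence-free trigonometric field \<open>T\<close>.
\<close>

lemma flux_limit:
  assumes \<theta>: "\<theta> \<in> test_functions \<Omega>"
  shows "(\<lambda>n. L2ip M (\<lambda>x. tensor_app (Cn n x) (U n x)) (\<lambda>x. \<theta> x *\<^sub>R \<xi>)
    - L2ip M (\<lambda>x. \<theta> x *\<^sub>R tensor_app Ch \<xi>) (U n)) \<longlonglongrightarrow> 0"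
proof (rule LIMSEQ_I)
  fix e :: real assume e: "e > 0"
  obtain m where m: "m > 0" "\<And>n. L2norm M (U n) \<le> m" using U_bounded by blast
  obtain KC where KC: "KC \<ge> 0" "AE y in cell. norm (C y) \<le> KC" using C_Linf by (rule Linf_bound)
  define \<kappa> where "\<kappa> = 81 * KC * (9 * 1) + 9 * 1"
  define \<kappa>' where "\<kappa>' = 9 * (L2norm M \<theta> * \<kappa> + 1) * m + L2norm M \<theta> * 9 * m"
  have \<kappa>: "\<kappa> \<ge> 0" using KC(1) by (simp add: \<kappa>_def)
  have \<kappa>': "\<kappa>' \<ge> 0" unfolding \<kappa>'_def using \<kappa> m(1) by (intro add_nonneg_nonneg mult_nonneg_nonneg) auto
  define \<delta> where "\<delta> = e / (2 * (\<kappa>' + 1))"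
  have \<delta>: "\<delta> > 0" using e \<kappa>' by (simp add: \<delta>_def)
  have \<kappa>'\<delta>: "\<kappa>' * \<delta> < e / 2"
  proof -
    have "\<kappa>' * \<delta> < (\<kappa>' + 1) * \<delta>" using \<delta> by simp
    also have "\<dots> = e / 2" using \<kappa>' by (simp add: \<delta>_def field_split_simps)
    finally show ?thesis .
  qed
  let ?X = "corrected G \<xi>"
  let ?h = "\<lambda>y. \<xi> - corrected G \<xi> y"
  let ?\<sigma> = "\<lambda>y. tensor_app (C y) (corrected G \<xi> y)"
  have hL: "?h \<in> L2v cell" by (intro L2v_diff const_L2v corrected_L2v)
  have "\<exists>\<omega>. \<omega> \<in> trig \<and> L2norm cell (\<lambda>y. Rgrad R \<omega> y - ?h y $ p) < \<delta>" for p
    using gradient_approximation[OF row_L2v[OF hL, of p] correction_orthogonal_divfree \<delta>] by blast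
  then have "\<exists>\<omega>. \<forall>p. \<omega> p \<in> trig \<and> L2norm cell (\<lambda>y. Rgrad R (\<omega> p) y - ?h y $ p) < \<delta>" by (intro choice allI)
  then obtain \<omega> where \<omega>: "\<And>p. \<omega> p \<in> trig" "\<And>p. L2norm cell (\<lambda>y. Rgrad R (\<omega> p) y - ?h y $ p) < \<delta>" by blast
  have "\<exists>d. d \<in> divfree R \<and> L2norm cell (\<lambda>y. d y - ?\<sigma> y $ p) < \<delta>" for p
    using divfree_approximation[OF row_L2v[OF flux_L2v, of \<xi> p] flux_orthogonal_gradient \<delta>] by blast
  then have "\<exists>\<tau>. \<forall>p. \<tau> p \<in> divfree R \<and> L2norm cell (\<lambda>y. \<tau> p y - ?\<sigma> y $ p) < \<delta>" by (intro choice allI)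
  then obtain \<tau> where \<tau>: "\<And>p. \<tau> p \<in> divfree R" "\<And>p. L2norm cell (\<lambda>y. \<tau> p y - ?\<sigma> y $ p) < \<delta>" by blast
  define W :: "real ^ 'm \<Rightarrow> real ^ 3 ^ 3" where "W = (\<lambda>y. \<xi> - (\<chi> p. Rgrad R (\<omega> p) y))"
  define T :: "real ^ 'm \<Rightarrow> real ^ 3 ^ 3" where "T = (\<lambda>y. \<chi> p. \<tau> p y)"
  have Wt: "(\<lambda>y. W y $ i $ j) \<in> trig" for i j
    unfolding W_def by (simp add: trig_diff trig_const Rgrad_trig \<omega>)
  have Tt: "(\<lambda>y. T y $ i $ j) \<in> trig" for i j
    unfolding T_def by (simp add: divfree_trig[OF \<tau>(1)])
  note Wc = trig_matrix_continuous[OF Wt] and Tc = trig_matrix_continuous[OF Tt]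
  have WL: "W \<in> L2v cell" by (intro continuous_L2v Wc bounded_unit_cell unit_cell_sets)
  have TL: "T \<in> L2v cell" by (intro continuous_L2v Tc bounded_unit_cell unit_cell_sets)
  have entry: "L2norm cell (\<lambda>y. F y $ i $ j) \<le> L2norm cell (\<lambda>y. F y $ i)" if "F \<in> L2v cell" for F :: "real ^ 'm \<Rightarrow> real ^ 3 ^ 3" and i j
    by (rule L2norm_nth_le[OF row_L2v[OF that]])

  (* W replaces the corrected field and T its flux; they are chosen independently, and ZT says
     that the flux of W is still close to T *)
  have WX: "L2norm cell (\<lambda>y. W y - ?X y) \<le> 9 * \<delta>"
  proof (rule L2norm_matrix_le_bound[OF L2v_diff[OF WL corrected_L2v]])
    fix i j
    have "L2norm cell (\<lambda>y. (W y - ?X y) $ i $ j) \<le> L2norm cell (\<lambda>y. (W y - ?X y) $ i)"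
      by (rule entry[OF L2v_diff[OF WL corrected_L2v]])
    also have "\<dots> = L2norm cell (\<lambda>y. ?h y $ i - Rgrad R (\<omega> i) y)"
      by (simp add: W_def algebra_simps)
    also have "\<dots> = L2norm cell (\<lambda>y. Rgrad R (\<omega> i) y - ?h y $ i)"
      by (rule L2norm_minus_commute)
    finally show "L2norm cell (\<lambda>y. (W y - ?X y) $ i $ j) \<le> \<delta>"
      using \<omega>(2)[of i] by linarith
  qed
  have \<sigma>T: "L2norm cell (\<lambda>y. (?\<sigma> y - T y) $ i $ j) \<le> \<delta>" for i j
  proof -
    have "L2norm cell (\<lambda>y. (?\<sigma> y - T y) $ i $ j) \<le> L2norm cell (\<lambda>y. (?\<sigma> y - T y) $ i)"
      by (rule entry[OF L2v_diff[OF flux_L2v TL]])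
    also have "\<dots> = L2norm cell (\<lambda>y. \<tau> i y - ?\<sigma> y $ i)"
      using L2norm_minus_commute[of cell "\<lambda>y. ?\<sigma> y $ i" "\<tau> i"] by (simp add: T_def)
    finally show ?thesis using \<tau>(2)[of i] by simp
  qed
  have ZT: "L2norm cell (\<lambda>y. tensor_app (C y) (W y) $ i $ j - T y $ i $ j) \<le> \<kappa> * \<delta>" for i j
  proof -
    have dL: "(\<lambda>y. W y - ?X y) \<in> L2v cell" by (rule L2v_diff[OF WL corrected_L2v])
    have tL: "(\<lambda>y. tensor_app (C y) (W y - ?X y)) \<in> L2v cell" by (rule tensor_app_Linf_L2v[OF C_Linf dL])
    have sL: "(\<lambda>y. ?\<sigma> y - T y) \<in> L2v cell" by (rule L2v_diff[OF flux_L2v TL])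
    have "(\<lambda>y. tensor_app (C y) (W y) $ i $ j - T y $ i $ j)
        = (\<lambda>y. (tensor_app (C y) (W y - ?X y) + (?\<sigma> y - T y)) $ i $ j)"
      by (simp add: tensor_app_diff)
    then have "L2norm cell (\<lambda>y. tensor_app (C y) (W y) $ i $ j - T y $ i $ j)
        \<le> L2norm cell (\<lambda>y. tensor_app (C y) (W y - ?X y) + (?\<sigma> y - T y))"
      using entry[OF L2v_add[OF tL sL], of i j] L2norm_nth_le[OF L2v_add[OF tL sL], of i] by simp
    also have "\<dots> \<le> L2norm cell (\<lambda>y. tensor_app (C y) (W y - ?X y)) + L2norm cell (\<lambda>y. ?\<sigma> y - T y)"
      by (rule L2norm_triangle[OF tL sL])
    also have "\<dots> \<le> 81 * KC * (9 * \<delta>) + 9 * \<delta>"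
    proof (rule add_mono)
      have "C \<in> borel_measurable cell" using C_Linf by (simp add: Linf_def)
      from tensor_app_L2v(2)[OF this KC(2,1) dL]
      show "L2norm cell (\<lambda>y. tensor_app (C y) (W y - ?X y)) \<le> 81 * KC * (9 * \<delta>)"
        by (rule order_trans) (intro mult_left_mono WX; use KC(1) in simp)
      show "L2norm cell (\<lambda>y. ?\<sigma> y - T y) \<le> 9 * \<delta>"
        by (rule L2norm_matrix_le_bound[OF sL \<sigma>T])
    qed
    also have "\<dots> = \<kappa> * \<delta>" by (simp add: \<kappa>_def algebra_simps)
    finally show ?thesis .
  qed

  (* one constant for the cutoff and its derivatives, one for the three potentials *)
  obtain \<Theta>0 where \<Theta>0: "\<Theta>0 \<ge> 0" "\<forall>x\<in>\<Omega>. \<bar>\<theta> x\<bar> \<le> \<Theta>0" using test_function_bounded[OF \<theta> \<Omega>(2)] by blast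
  have "\<exists>K. K \<ge> 0 \<and> (\<forall>x\<in>\<Omega>. \<bar>pdiff j \<theta> x\<bar> \<le> K)" for j
    using test_function_bounded[OF test_function_pdiff[OF \<theta>] \<Omega>(2)] by blast
  then have "\<exists>K. \<forall>j. K j \<ge> 0 \<and> (\<forall>x\<in>\<Omega>. \<bar>pdiff j \<theta> x\<bar> \<le> K j)" by (intro choice allI)
  then obtain \<Theta>1 where \<Theta>1: "\<And>j. \<Theta>1 j \<ge> 0" "\<And>j x. x \<in> \<Omega> \<Longrightarrow> \<bar>pdiff j \<theta> x\<bar> \<le> \<Theta>1 j" by blast
  define \<Theta> where "\<Theta> = \<Theta>0 + (\<Sum>j\<in>UNIV. \<Theta>1 j)"
  have S1: "0 \<le> (\<Sum>j\<in>UNIV. \<Theta>1 j)" by (intro sum_nonneg \<Theta>1)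
  have \<Theta>: "\<Theta> \<ge> 0" "\<And>x. x \<in> \<Omega> \<Longrightarrow> \<bar>\<theta> x\<bar> \<le> \<Theta>" "\<And>x j. x \<in> \<Omega> \<Longrightarrow> \<bar>pdiff j \<theta> x\<bar> \<le> \<Theta>"
  proof -
    show "\<Theta> \<ge> 0" using \<Theta>0 S1 by (simp add: \<Theta>_def)
    fix x assume x: "x \<in> \<Omega>"
    then show "\<bar>\<theta> x\<bar> \<le> \<Theta>" using \<Theta>0(2) S1 by (simp add: \<Theta>_def add_increasing2)
    fix j
    have "\<Theta>1 j \<le> (\<Sum>j\<in>UNIV. \<Theta>1 j)" using \<Theta>1(1) by (intro member_le_sum) auto
    then show "\<bar>pdiff j \<theta> x\<bar> \<le> \<Theta>" using \<Theta>1(2)[OF x, of j] \<Theta>0(1) by (simp add: \<Theta>_def)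
  qed
  have "\<exists>K. K \<ge> 0 \<and> (\<forall>y. \<bar>\<omega> p y\<bar> \<le> K)" for p using trig_bounded[OF \<omega>(1)] by blast
  then have "\<exists>K. \<forall>p. K p \<ge> 0 \<and> (\<forall>y. \<bar>\<omega> p y\<bar> \<le> K p)" by (intro choice allI)
  then obtain k\<omega> where k\<omega>: "\<And>p. k\<omega> p \<ge> 0" "\<And>p y. \<bar>\<omega> p y\<bar> \<le> k\<omega> p" by blast
  define K where "K = (\<Sum>p\<in>UNIV. k\<omega> p)"
  have K: "K \<ge> 0" "\<And>p y. \<bar>\<omega> p y\<bar> \<le> K"
  proof -
    show "K \<ge> 0" unfolding K_def by (intro sum_nonneg k\<omega>)
    fix p y
    have "k\<omega> p \<le> K" unfolding K_def using k\<omega>(1) by (intro member_le_sum) auto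
    then show "\<bar>\<omega> p y\<bar> \<le> K" using k\<omega>(2)[of p y] by simp
  qed
  obtain KW where KW: "KW \<ge> 0" "\<And>y. norm (W y) \<le> KW" using trig_matrix_bounded[OF Wt] by blast
  obtain Bs where Bs: "\<And>n. s n \<le> Bs" "Bs > 0"
    using convergent_imp_Bseq[OF convergentI[OF s_lim]] unfolding Bseq_def
    by (metis abs_le_D1 real_norm_def)
  define v where "v = (\<lambda>n x. s n *\<^sub>R (\<theta> x *\<^sub>R (\<chi> p. \<omega> p (cut_point n x)) :: real ^ 3))"
  define Q :: "nat \<Rightarrow> real ^ 3 \<Rightarrow> real ^ 3 ^ 3" where "Q = (\<lambda>n x. \<chi> i j. pdiff j \<theta> x * \<omega> i (cut_point n x))"
  have vt: "v n \<in> test_fields \<Omega>" for n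
    unfolding test_fields_def v_def
    using test_function_scale[OF test_function_mult[OF \<theta> cut_smooth[OF \<omega>(1)]]] by (simp add: mult.assoc)
  have jac_v: "jac (v n) x = s n *\<^sub>R Q n x + \<theta> x *\<^sub>R (\<xi> - W (cut_point n x))" for n x
  proof -
    have "pdiff j (\<lambda>z. s n * (\<theta> z * \<omega> i (cut_point n z))) x = s n * (pdiff j \<theta> x * \<omega> i (cut_point n x)) + \<theta> x * Rgrad R (\<omega> i) (cut_point n x) $ j" for i j
    proof -
      note d = smooth_differentiable[OF test_function_smooth[OF \<theta>]] smooth_differentiable[OF cut_smooth[OF \<omega>(1)]]
        smooth_differentiable[OF test_function_smooth[OF test_function_mult[OF \<theta> cut_smooth[OF \<omega>(1)]]]]
      have "pdiff j (\<lambda>z. s n * (\<theta> z * \<omega> i (cut_point n z))) x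
          = s n * (\<theta> x * pdiff j (\<lambda>z. \<omega> i (cut_point n z)) x + pdiff j \<theta> x * \<omega> i (cut_point n x))"
        by (simp only: pdiff_scale[OF d(3)] pdiff_mult[OF d(1) d(2)])
      then show ?thesis
        using cut_trig_pdiff[OF \<omega>(1)[of i], where j = j and R = R and \<eta> = "s n" and x = x] s_pos[of n] by (simp add: cut_point_def field_simps)
    qed
    then show ?thesis
      by (simp add: jac_def v_def Q_def W_def vec_eq_iff mult.assoc)
  qed
  have v0: "v n \<in> W12_0_vec \<Omega>" "AE x in M. grad \<Omega> (v n) x = jac (v n) x" for n
    by (rule test_field_W12_0_vec[OF \<Omega> vt])+
  have jL: "jac (v n) \<in> L2v M" "v n \<in> L2v M" for n using test_field_L2v[OF \<Omega> vt] by auto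
  have Qb: "norm (Q n x) \<le> 9 * (\<Theta> * K)" if "x \<in> \<Omega>" for n x
    by (rule norm_matrix_le_bound)
      (use mult_mono[OF \<Theta>(3)[OF that] K(2) \<Theta>(1) abs_ge_zero] in \<open>simp add: Q_def abs_mult\<close>)
  have QL: "Q n \<in> L2v M" for n
  proof -
    have "(\<lambda>x. Q n x $ i $ j) \<in> L2v M" for i j
      unfolding Q_def using test_mult_L2v[OF test_function_pdiff[OF \<theta>] cut_smooth[OF \<omega>(1)] \<Omega>(2) \<Omega>_sets(1)] by simp
    then have "(\<lambda>x. Q n x $ i) \<in> L2v M" for i unfolding L2v_vec_iff[of "\<lambda>x. Q n x $ i"] by blast
    then show ?thesis unfolding L2v_vec_iff[of "Q n"] by blast
  qed
  have fv: "(\<lambda>n. f (v n)) \<longlonglongrightarrow> 0"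
  proof (rule W12_dual_null_of_L2_null[OF \<Omega> f v0(1)])
    define m0 where "m0 = Bs * (9 * (\<Theta> * K)) + \<Theta> * (norm \<xi> + KW)"
    have m0: "m0 \<ge> 0" unfolding m0_def using Bs(2) \<Theta>(1) K(1) KW(1) by (intro add_nonneg_nonneg mult_nonneg_nonneg) auto
    show "L2norm M (grad \<Omega> (v n)) \<le> m0 * L2norm M (\<lambda>x. 1 :: real)" for n
    proof -
      have "norm (jac (v n) x) \<le> m0 * norm (1 :: real)" if "x \<in> space M" for x
      proof -
        have x: "x \<in> \<Omega>" using that by (simp add: space_restrict_space)
        have "norm (jac (v n) x) \<le> norm (s n *\<^sub>R Q n x) + norm (\<theta> x *\<^sub>R (\<xi> - W (cut_point n x)))"
          unfolding jac_v by (rule norm_triangle_ineq)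
        also have "\<dots> \<le> Bs * (9 * (\<Theta> * K)) + \<Theta> * (norm \<xi> + KW)"
          unfolding norm_scaleR
        proof (intro add_mono mult_mono)
          show "\<bar>s n\<bar> \<le> Bs" using Bs(1)[of n] s_pos[of n] by simp
          show "norm (Q n x) \<le> 9 * (\<Theta> * K)" by (rule Qb[OF x])
          show "\<bar>\<theta> x\<bar> \<le> \<Theta>" by (rule \<Theta>(2)[OF x])
          show "norm (\<xi> - W (cut_point n x)) \<le> norm \<xi> + KW"
            using norm_triangle_ineq4[of \<xi> "W (cut_point n x)"] KW(2)[of "cut_point n x"] by simp
        qed (use Bs(2) \<Theta>(1) in auto)
        finally show ?thesis by (simp add: m0_def)
      qed
      from L2v_dominated(2)[OF one_L2v L2v_measurable[OF jL(1)] AE_I2[OF this] m0]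
      have "L2norm M (jac (v n)) \<le> m0 * L2norm M (\<lambda>x. 1 :: real)" .
      moreover have "L2norm M (grad \<Omega> (v n)) = L2norm M (jac (v n))"
        by (rule L2norm_cong_AE[OF L2v_measurable[OF W12_0_vec_L2v(2)[OF v0(1)]] L2v_measurable[OF jL(1)] v0(2)])
      ultimately show ?thesis by simp
    qed
    have le: "L2norm M (v n) \<le> s n * (3 * (\<Theta> * K) * L2norm M (\<lambda>x. 1 :: real))" for n
    proof -
      have "norm (v n x) \<le> (s n * (3 * (\<Theta> * K))) * norm (1 :: real)" if "x \<in> space M" for x
      proof -
        have x: "x \<in> \<Omega>" using that by (simp add: space_restrict_space)
        have "norm (v n x) \<le> (\<Sum>p\<in>UNIV. \<bar>v n x $ p\<bar>)" by (rule norm_le_l1_cart)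
        also have "\<dots> \<le> (\<Sum>p\<in>(UNIV::3 set). s n * (\<Theta> * K))"
        proof (rule sum_mono)
          fix p :: 3
          have "\<bar>v n x $ p\<bar> = s n * (\<bar>\<theta> x\<bar> * \<bar>\<omega> p (cut_point n x)\<bar>)"
            using s_pos[of n] by (simp add: v_def abs_mult)
          then show "\<bar>v n x $ p\<bar> \<le> s n * (\<Theta> * K)"
            using mult_mono[OF \<Theta>(2)[OF x] K(2)[of p "cut_point n x"] \<Theta>(1) abs_ge_zero] s_pos[of n] by simp
        qed
        finally show ?thesis by simp
      qed
      from L2v_dominated(2)[OF one_L2v L2v_measurable[OF jL(2)] AE_I2[OF this]]
      show ?thesis using s_pos[of n] \<Theta>(1) K(1) by (simp add: mult.assoc)
    qed
    show "(\<lambda>n. L2norm M (v n)) \<longlonglongrightarrow> 0"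
      by (rule tendsto_sandwich[OF _ _ tendsto_const tendsto_mult_left_zero[OF s_lim]])
        (auto intro!: always_eventually le)
  qed

  (* the tensors on the cut are bounded in mean square, by the trace condition with psi = 0,
     and Q n is bounded, so the factor s n decides *)
  have sQ: "(\<lambda>n. s n * L2ip M (\<lambda>x. tensor_app (Cn n x) (U n x)) (Q n)) \<longlonglongrightarrow> 0"
  proof -
    have "(\<lambda>n. L2norm M (\<lambda>x. Cn n x - 0)) \<longlonglongrightarrow> sqrt (measure lebesgue \<Omega>) * L2norm cell (\<lambda>y. C y - 0)"
      by (rule trace_limit[of "\<lambda>y. 0"]) (simp add: trig_const)
    then have "Bseq (\<lambda>n. L2norm M (Cn n))" by (auto intro: convergent_imp_Bseq convergentI)
    then obtain BC where BC: "BC > 0" "\<And>n. L2norm M (Cn n) \<le> BC"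
      unfolding Bseq_def by (metis abs_le_D1 real_norm_def)
    define q where "q = 81 * (9 * (\<Theta> * K))"
    have q: "q \<ge> 0" using \<Theta>(1) K(1) by (simp add: q_def)
    have le: "norm (s n * L2ip M (\<lambda>x. tensor_app (Cn n x) (U n x)) (Q n)) \<le> s n * (q * BC * m)" for n
    proof -
      have tL: "(\<lambda>x. tensor_app (Cn n x) (Q n x)) \<in> L2v M" by (rule flux_n_L2v[OF QL])
      have "norm (tensor_app (Cn n x) (Q n x)) \<le> q * norm (Cn n x)" if "x \<in> space M" for x
      proof -
        have "norm (tensor_app (Cn n x) (Q n x)) \<le> 81 * norm (Cn n x) * norm (Q n x)" by (rule norm_tensor_app_le)
        also have "\<dots> \<le> 81 * norm (Cn n x) * (9 * (\<Theta> * K))"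
          using Qb[of x n] that by (intro mult_left_mono) (auto simp: space_restrict_space)
        finally show ?thesis by (simp add: q_def mult_ac)
      qed
      from L2v_dominated(2)[OF Cn_L2v L2v_measurable[OF tL] AE_I2[OF this] q]
      have "L2norm M (\<lambda>x. tensor_app (Cn n x) (Q n x)) \<le> q * L2norm M (Cn n)" .
      also have "\<dots> \<le> q * BC" using BC(2)[of n] q by (intro mult_left_mono)
      finally have n1: "L2norm M (\<lambda>x. tensor_app (Cn n x) (Q n x)) \<le> q * BC" .
      have "\<bar>L2ip M (\<lambda>x. tensor_app (Cn n x) (U n x)) (Q n)\<bar> = \<bar>L2ip M (\<lambda>x. tensor_app (Cn n x) (Q n x)) (U n)\<bar>"
        by (simp only: L2ip_tensor_app_symmetric[where A = "Cn n" and F = "U n", OF Cn_symmetric])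
      also have "\<dots> \<le> L2norm M (\<lambda>x. tensor_app (Cn n x) (Q n x)) * L2norm M (U n)"
        by (rule L2ip_Cauchy_Schwarz[OF tL U_L2v])
      also have "\<dots> \<le> (q * BC) * m"
        using n1 m(2)[of n] q BC(1) by (intro mult_mono) auto
      finally show ?thesis using s_pos[of n] by (simp add: abs_mult)
    qed
    show ?thesis
      by (rule Lim_null_comparison[OF always_eventually[OF allI[OF le]] tendsto_mult_left_zero[OF s_lim]])
  qed

  define mT :: "real ^ 3 ^ 3" where "mT = (\<chi> i j. LINT y|cell. \<tau> i y $ j)"
  have cT: "(\<lambda>x. T (cut_point n x)) \<in> L2v M" for n by (rule continuous_cut_L2v[OF Tc])
  have cW: "(\<lambda>x. W (cut_point n x)) \<in> L2v M" for n by (rule continuous_cut_L2v[OF Wc])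
  have cst: "(\<lambda>x. \<zeta>) \<in> L2v M" for \<zeta> :: "real ^ 3 ^ 3" using continuous_cut_L2v[of "\<lambda>y. \<zeta>"] by (simp add: continuous_on_const)
  have L2ip_entries: "L2ip M F F' = (\<Sum>i\<in>UNIV. \<Sum>j\<in>UNIV. L2ip M (\<lambda>x. F x $ i $ j) (\<lambda>x. F' x $ i $ j))"
    if "F \<in> L2v M" "F' \<in> L2v M" for F F' :: "real ^ 3 \<Rightarrow> real ^ 3 ^ 3"
  proof -
    have row: "(\<lambda>x. F x $ i) \<in> L2v M" "(\<lambda>x. F' x $ i) \<in> L2v M" for i
      using that unfolding L2v_vec_iff[of F] L2v_vec_iff[of F'] by blast+
    show ?thesis unfolding L2ip_vec[OF that] L2ip_vec[OF row] ..
  qed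
  have mean: "(\<lambda>n. L2ip M (\<lambda>x. \<theta> x *\<^sub>R T (cut_point n x)) (U n) - L2ip M (\<lambda>x. \<theta> x *\<^sub>R mT) (U n)) \<longlonglongrightarrow> 0"
  proof -
    have "L2ip M (\<lambda>x. \<theta> x *\<^sub>R T (cut_point n x)) (U n) - L2ip M (\<lambda>x. \<theta> x *\<^sub>R mT) (U n)
        = (\<Sum>i\<in>UNIV. (\<Sum>j\<in>UNIV. L2ip M (\<lambda>x. U n x $ i $ j) (\<lambda>x. \<theta> x * \<tau> i (cut_point n x) $ j))
            - (\<Sum>j\<in>UNIV. (LINT y|cell. \<tau> i y $ j) * L2ip M (\<lambda>x. U n x $ i $ j) \<theta>))" for n
    proof -
      have "L2ip M (\<lambda>x. \<theta> x * mT $ i $ j) (\<lambda>x. U n x $ i $ j) = mT $ i $ j * L2ip M (\<lambda>x. U n x $ i $ j) \<theta>" for i j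
        using L2ip_scale_left[of M "mT $ i $ j" \<theta> "\<lambda>x. U n x $ i $ j"] by (simp add: mult.commute L2ip_commute[of _ \<theta>])
      then show ?thesis
        unfolding L2ip_entries[OF test_scaleR_L2v[OF \<theta> cT] U_L2v] L2ip_entries[OF test_scaleR_L2v[OF \<theta> cst] U_L2v]
        by (simp add: T_def mT_def sum_subtractf L2ip_commute[of _ "\<lambda>x. U n x $ _ $ _"])
    qed
    then show ?thesis by (simp only:) (intro tendsto_null_sum divfree_limit \<theta> \<tau>)
  qed

  (* E1 and E3 do not tend to zero, but they are small with the quality of the approximation,
     uniformly in n *)
  have E1: "\<forall>\<^sub>F n in sequentially. \<bar>L2ip M (\<lambda>x. \<theta> x *\<^sub>R (tensor_app (Cn n x) (W (cut_point n x)) - T (cut_point n x))) (U n)\<bar>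
      \<le> 9 * (L2norm M \<theta> * \<kappa> + 1) * m * \<delta>"
  proof -
    have "\<forall>\<^sub>F n in sequentially. \<forall>i j. L2norm M (\<lambda>x. \<theta> x * (tensor_app (Cn n x) (W (cut_point n x)) $ i $ j - T (cut_point n x) $ i $ j))
        < L2norm M \<theta> * L2norm cell (\<lambda>y. tensor_app (C y) (W y) $ i $ j - T y $ i $ j) + \<delta>"
      by (intro eventually_all_finite flux_error[OF \<theta> Wt Tt \<delta>])
    then show ?thesis
    proof eventually_elim
      case (elim n)
      let ?F = "\<lambda>x. \<theta> x *\<^sub>R (tensor_app (Cn n x) (W (cut_point n x)) - T (cut_point n x))"
      have FL: "?F \<in> L2v M" by (intro test_scaleR_L2v[OF \<theta>] L2v_diff flux_n_L2v cW cT)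
      have "L2norm M ?F \<le> 9 * (L2norm M \<theta> * (\<kappa> * \<delta>) + \<delta>)"
      proof (rule L2norm_matrix_le_bound[OF FL])
        fix i j
        have "L2norm M (\<lambda>x. ?F x $ i $ j) \<le> L2norm M \<theta> * L2norm cell (\<lambda>y. tensor_app (C y) (W y) $ i $ j - T y $ i $ j) + \<delta>"
          using elim[rule_format, of i j] by simp
        also have "\<dots> \<le> L2norm M \<theta> * (\<kappa> * \<delta>) + \<delta>" using ZT[of i j] by (intro add_mono mult_left_mono) auto
        finally show "L2norm M (\<lambda>x. ?F x $ i $ j) \<le> L2norm M \<theta> * (\<kappa> * \<delta>) + \<delta>" .
      qed
      then have "L2norm M ?F * L2norm M (U n) \<le> 9 * (L2norm M \<theta> * (\<kappa> * \<delta>) + \<delta>) * m"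
        using m(2)[of n] \<kappa> \<delta> by (intro mult_mono mult_nonneg_nonneg add_nonneg_nonneg) auto
      then show ?case
        using L2ip_Cauchy_Schwarz[OF FL U_L2v, of n] by (simp add: algebra_simps)
    qed
  qed
  have E3: "\<bar>L2ip M (\<lambda>x. \<theta> x *\<^sub>R (mT - tensor_app Ch \<xi>)) (U n)\<bar> \<le> L2norm M \<theta> * 9 * m * \<delta>" for n
  proof -
    have "\<bar>(mT - tensor_app Ch \<xi>) $ i $ j\<bar> \<le> \<delta>" for i j
    proof -
      have sL: "(\<lambda>y. ?\<sigma> y $ i $ j) \<in> L2v cell"
        using row_L2v[OF flux_L2v, of \<xi> i] by (subst (asm) L2v_vec_iff) blast
      have tL: "(\<lambda>y. \<tau> i y $ j) \<in> L2v cell" by (rule trig_L2v[OF divfree_trig[OF \<tau>(1)]])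
      have "(mT - tensor_app Ch \<xi>) $ i $ j = (LINT y|cell. \<tau> i y $ j) - (LINT y|cell. ?\<sigma> y $ i $ j)"
        by (simp add: mT_def Ch_mean)
      also have "\<dots> = (LINT y|cell. \<tau> i y $ j - ?\<sigma> y $ i $ j)"
        using L2v_integrable[OF finite_measure_cell sL] L2v_integrable[OF finite_measure_cell tL] by simp
      also have "\<bar>\<dots>\<bar> \<le> L2norm cell (\<lambda>y. \<tau> i y $ j - ?\<sigma> y $ i $ j)"
        by (rule mean_le_L2norm[OF L2v_diff[OF tL sL]])
      also have "\<dots> \<le> \<delta>"
        using \<sigma>T[of i j] L2norm_minus_commute[of cell "\<lambda>y. \<tau> i y $ j" "\<lambda>y. ?\<sigma> y $ i $ j"] by (simp add: T_def)
      finally show ?thesis .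
    qed
    then have nm: "norm (mT - tensor_app Ch \<xi>) \<le> 9 * \<delta>" by (rule norm_matrix_le_bound)
    have "L2norm M (\<lambda>x. \<theta> x *\<^sub>R (mT - tensor_app Ch \<xi>)) \<le> norm (mT - tensor_app Ch \<xi>) * L2norm M \<theta>"
      by (rule L2v_dominated(2)[OF test_function_L2v[OF \<theta> \<Omega>(2) \<Omega>_sets(1)] L2v_measurable[OF test_scaleR_L2v[OF \<theta> cst]]])
        (auto simp: mult.commute)
    also have "\<dots> \<le> (9 * \<delta>) * L2norm M \<theta>" using nm by (intro mult_right_mono) auto
    finally have "L2norm M (\<lambda>x. \<theta> x *\<^sub>R (mT - tensor_app Ch \<xi>)) * L2norm M (U n) \<le> ((9 * \<delta>) * L2norm M \<theta>) * m"
      using m(2)[of n] \<delta> by (intro mult_mono mult_nonneg_nonneg) auto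
    then show ?thesis
      using L2ip_Cauchy_Schwarz[OF test_scaleR_L2v[OF \<theta> cst] U_L2v, of "mT - tensor_app Ch \<xi>" n] by (simp add: mult_ac)
  qed

  have A: "(\<lambda>n. f (v n) - s n * L2ip M (\<lambda>x. tensor_app (Cn n x) (U n x)) (Q n)
      + (L2ip M (\<lambda>x. \<theta> x *\<^sub>R T (cut_point n x)) (U n) - L2ip M (\<lambda>x. \<theta> x *\<^sub>R mT) (U n))) \<longlonglongrightarrow> 0 - 0 + 0"
    by (intro tendsto_add tendsto_diff fv sQ mean)
  have decomposition: "L2ip M (\<lambda>x. tensor_app (Cn n x) (U n x)) (\<lambda>x. \<theta> x *\<^sub>R \<xi>) - L2ip M (\<lambda>x. \<theta> x *\<^sub>R tensor_app Ch \<xi>) (U n)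
      = (f (v n) - s n * L2ip M (\<lambda>x. tensor_app (Cn n x) (U n x)) (Q n)
        + (L2ip M (\<lambda>x. \<theta> x *\<^sub>R T (cut_point n x)) (U n) - L2ip M (\<lambda>x. \<theta> x *\<^sub>R mT) (U n)))
      + L2ip M (\<lambda>x. \<theta> x *\<^sub>R (tensor_app (Cn n x) (W (cut_point n x)) - T (cut_point n x))) (U n)
      + L2ip M (\<lambda>x. \<theta> x *\<^sub>R (mT - tensor_app Ch \<xi>)) (U n)" for n
  proof -
    let ?s = "\<lambda>x. tensor_app (Cn n x) (U n x)"
    note sL = flux_n_L2v[OF U_L2v, of n n] and tL = test_scaleR_L2v[OF \<theta>]
    have WL': "(\<lambda>x. tensor_app (Cn n x) (W (cut_point n x))) \<in> L2v M" by (rule flux_n_L2v[OF cW])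
    have "f (v n) = L2ip M ?s (grad \<Omega> (v n))" by (rule u_equation[OF v0(1), symmetric])
    also have "\<dots> = L2ip M (jac (v n)) ?s"
      by (subst L2ip_commute, rule L2ip_cong_AE[OF L2v_measurable[OF W12_0_vec_L2v(2)[OF v0(1)]] L2v_measurable[OF jL(1)]
            L2v_measurable[OF sL] L2v_measurable[OF sL] v0(2)]) simp
    also have "jac (v n) = (\<lambda>x. s n *\<^sub>R Q n x + 1 *\<^sub>R (\<theta> x *\<^sub>R (\<xi> - W (cut_point n x))))"
      by (rule ext) (simp add: jac_v)
    also have "L2ip M \<dots> ?s = s n * L2ip M (Q n) ?s + L2ip M (\<lambda>x. \<theta> x *\<^sub>R (\<xi> - W (cut_point n x))) ?s"
      by (subst L2ip_lin[OF QL tL[OF L2v_diff[OF cst cW]] sL]) simp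
    also have "L2ip M (\<lambda>x. \<theta> x *\<^sub>R (\<xi> - W (cut_point n x))) ?s = L2ip M (\<lambda>x. \<theta> x *\<^sub>R \<xi>) ?s - L2ip M (\<lambda>x. \<theta> x *\<^sub>R W (cut_point n x)) ?s"
      unfolding scaleR_diff_right by (rule L2ip_diff[OF tL[OF cst] tL[OF cW] sL])
    also have "L2ip M (\<lambda>x. \<theta> x *\<^sub>R W (cut_point n x)) ?s = L2ip M (\<lambda>x. \<theta> x *\<^sub>R tensor_app (Cn n x) (W (cut_point n x))) (U n)"
      using L2ip_tensor_app_symmetric[where A = "Cn n" and F = "U n" and G = "\<lambda>x. \<theta> x *\<^sub>R W (cut_point n x)" and M = M, OF Cn_symmetric]
      by (simp add: L2ip_commute[of _ _ ?s] tensor_app_scale)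
    finally have 1: "f (v n) = s n * L2ip M ?s (Q n) + (L2ip M ?s (\<lambda>x. \<theta> x *\<^sub>R \<xi>)
        - L2ip M (\<lambda>x. \<theta> x *\<^sub>R tensor_app (Cn n x) (W (cut_point n x))) (U n))"
      by (simp only: L2ip_commute[of _ _ ?s])
    have 2: "L2ip M (\<lambda>x. \<theta> x *\<^sub>R (tensor_app (Cn n x) (W (cut_point n x)) - T (cut_point n x))) (U n)
        = L2ip M (\<lambda>x. \<theta> x *\<^sub>R tensor_app (Cn n x) (W (cut_point n x))) (U n) - L2ip M (\<lambda>x. \<theta> x *\<^sub>R T (cut_point n x)) (U n)"
      unfolding scaleR_diff_right by (rule L2ip_diff[OF tL[OF WL'] tL[OF cT] U_L2v])
    have 3: "L2ip M (\<lambda>x. \<theta> x *\<^sub>R (mT - tensor_app Ch \<xi>)) (U n) = L2ip M (\<lambda>x. \<theta> x *\<^sub>R mT) (U n) - L2ip M (\<lambda>x. \<theta> x *\<^sub>R tensor_app Ch \<xi>) (U n)"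
      unfolding scaleR_diff_right by (rule L2ip_diff[OF tL[OF cst] tL[OF cst] U_L2v])
    show ?thesis using 1 2 3 by linarith
  qed
  have "\<forall>\<^sub>F n in sequentially. \<bar>f (v n) - s n * L2ip M (\<lambda>x. tensor_app (Cn n x) (U n x)) (Q n)
      + (L2ip M (\<lambda>x. \<theta> x *\<^sub>R T (cut_point n x)) (U n) - L2ip M (\<lambda>x. \<theta> x *\<^sub>R mT) (U n))\<bar> < e / 2"
    using order_tendstoD(2)[OF tendsto_rabs[OF A], of "e / 2"] e by simp
  with E1 have "\<forall>\<^sub>F n in sequentially. norm (L2ip M (\<lambda>x. tensor_app (Cn n x) (U n x)) (\<lambda>x. \<theta> x *\<^sub>R \<xi>)
    - L2ip M (\<lambda>x. \<theta> x *\<^sub>R tensor_app Ch \<xi>) (U n) - 0) < e"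
  proof eventually_elim
    case (elim n)
    have "9 * (L2norm M \<theta> * \<kappa> + 1) * m * \<delta> + L2norm M \<theta> * 9 * m * \<delta> = \<kappa>' * \<delta>"
      by (simp add: \<kappa>'_def algebra_simps)
    then show ?case
      unfolding decomposition diff_zero real_norm_def using elim E3[of n] \<kappa>'\<delta> by linarith
  qed
  then show "\<exists>no. \<forall>n\<ge>no. norm (L2ip M (\<lambda>x. tensor_app (Cn n x) (U n x)) (\<lambda>x. \<theta> x *\<^sub>R \<xi>)
    - L2ip M (\<lambda>x. \<theta> x *\<^sub>R tensor_app Ch \<xi>) (U n) - 0) < e"
    by (simp add: eventually_sequentially)
qed

text \<open>
  Every entry of the gradient of a test field is a test function, so summing the limits of the flux
  over the entries gives the limit of the equation.
\<close>

lemma equation_limit: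
  assumes \<phi>: "\<phi> \<in> test_fields \<Omega>"
  shows "(\<lambda>n. L2ip M (\<lambda>x. tensor_app Ch (jac \<phi> x)) (U n)) \<longlonglongrightarrow> f \<phi>"
proof -
  let ?\<theta> = "\<lambda>k l. pdiff l (\<lambda>z. \<phi> z $ k)"
  have \<theta>: "?\<theta> k l \<in> test_functions \<Omega>" for k l
    using \<phi> by (intro test_function_pdiff) (simp add: test_fields_def)
  have jac: "jac \<phi> x = (\<Sum>k\<in>UNIV. \<Sum>l\<in>UNIV. ?\<theta> k l x *\<^sub>R matrix_unit k l)" for x
    using sum_matrix_unit[of "jac \<phi> x"] by (simp add: jac_def)
  note W = test_field_W12_0_vec[OF \<Omega> \<phi>] and jL = test_field_L2v(2)[OF \<Omega> \<phi>]
  have cst: "(\<lambda>x. \<zeta>) \<in> L2v M" for \<zeta> :: "real ^ 3 ^ 3"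
    by (intro continuous_L2v \<Omega> \<Omega>_sets continuous_intros)
  have L: "(\<lambda>x. ?\<theta> k l x *\<^sub>R \<zeta>) \<in> L2v M" for k l and \<zeta> :: "real ^ 3 ^ 3"
    by (rule test_scaleR_L2v[OF \<theta> cst])
  have sum_L2ip: "L2ip M (\<lambda>x. \<Sum>k\<in>UNIV. \<Sum>l\<in>UNIV. ?\<theta> k l x *\<^sub>R \<zeta> k l) g
      = (\<Sum>k\<in>UNIV. \<Sum>l\<in>UNIV. L2ip M (\<lambda>x. ?\<theta> k l x *\<^sub>R \<zeta> k l) g)" if "g \<in> L2v M"
    for \<zeta> :: "3 \<Rightarrow> 3 \<Rightarrow> real ^ 3 ^ 3" and g
    by (subst L2ip_sum_left; intro L2v_sum L that sum.cong refl L2ip_sum_left)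
  have f\<phi>: "f \<phi> = (\<Sum>k\<in>UNIV. \<Sum>l\<in>UNIV. L2ip M (\<lambda>x. tensor_app (Cn n x) (U n x)) (\<lambda>x. ?\<theta> k l x *\<^sub>R matrix_unit k l))" for n
  proof -
    note sL = flux_n_L2v[OF U_L2v, of n n]
    have "f \<phi> = L2ip M (\<lambda>x. tensor_app (Cn n x) (U n x)) (grad \<Omega> \<phi>)" by (rule u_equation[OF W(1), symmetric])
    also have "\<dots> = L2ip M (jac \<phi>) (\<lambda>x. tensor_app (Cn n x) (U n x))"
      by (subst L2ip_commute, rule L2ip_cong_AE[OF L2v_measurable[OF W12_0_vec_L2v(2)[OF W(1)]] L2v_measurable[OF jL]
            L2v_measurable[OF sL] L2v_measurable[OF sL] W(2)]) simp
    also have "\<dots> = (\<Sum>k\<in>UNIV. \<Sum>l\<in>UNIV. L2ip M (\<lambda>x. ?\<theta> k l x *\<^sub>R matrix_unit k l) (\<lambda>x. tensor_app (Cn n x) (U n x)))"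
      using sum_L2ip[OF sL, of matrix_unit] by (simp only: jac[abs_def])
    finally show ?thesis by (simp only: L2ip_commute[of M _ "\<lambda>x. tensor_app (Cn n x) (U n x)"])
  qed
  have h\<phi>: "L2ip M (\<lambda>x. tensor_app Ch (jac \<phi> x)) (U n)
      = (\<Sum>k\<in>UNIV. \<Sum>l\<in>UNIV. L2ip M (\<lambda>x. ?\<theta> k l x *\<^sub>R tensor_app Ch (matrix_unit k l)) (U n))" for n
    using sum_L2ip[OF U_L2v, of "\<lambda>k l. tensor_app Ch (matrix_unit k l)" n] by (simp only: jac tensor_app_sum tensor_app_scale)
  have "(\<lambda>n. \<Sum>k\<in>UNIV. \<Sum>l\<in>UNIV. L2ip M (\<lambda>x. tensor_app (Cn n x) (U n x)) (\<lambda>x. ?\<theta> k l x *\<^sub>R matrix_unit k l)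
      - L2ip M (\<lambda>x. ?\<theta> k l x *\<^sub>R tensor_app Ch (matrix_unit k l)) (U n)) \<longlonglongrightarrow> 0"
    by (intro tendsto_null_sum flux_limit \<theta>)
  moreover have "(\<Sum>k\<in>UNIV. \<Sum>l\<in>UNIV. L2ip M (\<lambda>x. tensor_app (Cn n x) (U n x)) (\<lambda>x. ?\<theta> k l x *\<^sub>R matrix_unit k l)
      - L2ip M (\<lambda>x. ?\<theta> k l x *\<^sub>R tensor_app Ch (matrix_unit k l)) (U n)) = f \<phi> - L2ip M (\<lambda>x. tensor_app Ch (jac \<phi> x)) (U n)" for n
    by (simp only: sum_subtractf f\<phi>[of n] h\<phi>)
  ultimately have "(\<lambda>n. f \<phi> - L2ip M (\<lambda>x. tensor_app Ch (jac \<phi> x)) (U n)) \<longlonglongrightarrow> 0" by simp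
  from tendsto_diff[OF tendsto_const[of "f \<phi>"] this] show ?thesis by simp
qed

text \<open>
  The Dirichlet problem for the homogenized tensor represents \<open>F\<close>, and the difference \<open>u n - u0\<close> is bounded,
  so it is enough that it is asymptotically orthogonal to test fields in the energy product.
\<close>

lemma weak_limit:
  assumes u0: "dirichlet_solution \<Omega> (\<lambda>x. Ch) f u0" and F: "F \<in> W12_dual \<Omega>"
  shows "(\<lambda>n. F (u n)) \<longlonglongrightarrow> F u0"
proof -
  have W0: "u0 \<in> W12_0_vec \<Omega>" using u0 by (simp add: dirichlet_solution_def)
  note g0L = W12_0_vec_L2v(2)[OF W0]
  obtain m where m: "m > 0" "\<And>n. L2norm M (U n) \<le> m" using U_bounded by blast
  define w where "w = (\<lambda>n x. 1 *\<^sub>R u n x + (-1) *\<^sub>R u0 x)"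
  have w: "w n \<in> W12_0_vec \<Omega>" "AE x in M. grad \<Omega> (w n) x = 1 *\<^sub>R grad \<Omega> (u n) x + (-1) *\<^sub>R grad \<Omega> u0 x" for n
    unfolding w_def by (rule W12_0_vec_lin[OF \<Omega> u_W12_0 W0])+
  have ae: "AE x in M. grad \<Omega> (w n) x = U n x - grad \<Omega> u0 x" for n
    using w(2)[of n] by eventually_elim (simp add: U_def)
  have DL: "(\<lambda>x. U n x - grad \<Omega> u0 x) \<in> L2v M" for n by (intro L2v_diff U_L2v g0L)
  note gwL = W12_0_vec_L2v(2)[OF w(1)]
  have "(\<lambda>n. F (w n)) \<longlonglongrightarrow> 0"
  proof (rule W12_dual_null[OF \<Omega> linear_tensor_app Ch_symmetric Ch_coercive c_pos F w(1)])
    show "L2norm M (grad \<Omega> (w n)) \<le> m + L2norm M (grad \<Omega> u0)" for n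
    proof -
      have "L2norm M (grad \<Omega> (w n)) = L2norm M (\<lambda>x. U n x - grad \<Omega> u0 x)"
        by (intro L2norm_cong_AE ae L2v_measurable gwL DL)
      also have "\<dots> \<le> L2norm M (U n) + L2norm M (grad \<Omega> u0)"
        using L2norm_triangle[OF U_L2v L2v_scale[OF g0L, of "-1"], of n] by (simp only: L2norm_scale) simp
      finally show ?thesis using m(2)[of n] by simp
    qed
    fix \<phi> :: "real ^ 3 \<Rightarrow> real ^ 3" assume \<phi>: "\<phi> \<in> test_fields \<Omega>"
    note W = test_field_W12_0_vec[OF \<Omega> \<phi>] and jL = test_field_L2v(2)[OF \<Omega> \<phi>]
    have linT: "(\<lambda>x. tensor_app Ch (g x)) \<in> L2v M" if "g \<in> L2v M" for g
      using linear_L2v[OF linear_tensor_app, of Ch] that by metis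
    have "f \<phi> = L2ip M (\<lambda>x. tensor_app Ch (grad \<Omega> u0 x)) (grad \<Omega> \<phi>)"
      using u0 W(1) by (simp add: dirichlet_solution_iff)
    also have "\<dots> = L2ip M (\<lambda>x. tensor_app Ch (grad \<Omega> u0 x)) (jac \<phi>)"
      by (rule L2ip_cong_AE[OF L2v_measurable[OF linT[OF g0L]] L2v_measurable[OF linT[OF g0L]]
            L2v_measurable[OF W12_0_vec_L2v(2)[OF W(1)]] L2v_measurable[OF jL] _ W(2)]) simp
    also have "\<dots> = L2ip M (\<lambda>x. tensor_app Ch (jac \<phi> x)) (grad \<Omega> u0)"
      by (simp add: L2ip_def Ch_symmetric)
    finally have f\<phi>: "f \<phi> = L2ip M (\<lambda>x. tensor_app Ch (jac \<phi> x)) (grad \<Omega> u0)" .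
    have "L2ip M (\<lambda>x. tensor_app Ch (jac \<phi> x)) (grad \<Omega> (w n)) = L2ip M (\<lambda>x. tensor_app Ch (jac \<phi> x)) (U n) - f \<phi>" for n
    proof -
      have "L2ip M (\<lambda>x. tensor_app Ch (jac \<phi> x)) (grad \<Omega> (w n)) = L2ip M (\<lambda>x. tensor_app Ch (jac \<phi> x)) (\<lambda>x. U n x - grad \<Omega> u0 x)"
        by (rule L2ip_cong_AE[OF L2v_measurable[OF linT[OF jL]] L2v_measurable[OF linT[OF jL]]
              L2v_measurable[OF gwL] L2v_measurable[OF DL] _ ae]) simp
      also have "\<dots> = L2ip M (\<lambda>x. U n x - grad \<Omega> u0 x) (\<lambda>x. tensor_app Ch (jac \<phi> x))" by (rule L2ip_commute)
      also have "\<dots> = L2ip M (\<lambda>x. tensor_app Ch (jac \<phi> x)) (U n) - f \<phi>"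
        unfolding L2ip_diff[OF U_L2v g0L linT[OF jL]] f\<phi> by (simp only: L2ip_commute[of M _ "\<lambda>x. tensor_app Ch (jac \<phi> x)"])
      finally show ?thesis .
    qed
    then show "(\<lambda>n. L2ip M (\<lambda>x. tensor_app Ch (jac \<phi> x)) (grad \<Omega> (w n))) \<longlonglongrightarrow> 0"
      using tendsto_diff[OF equation_limit[OF \<phi>] tendsto_const[of "f \<phi>"]] by simp
  qed
  moreover have "F (w n) = F (u n) - F u0" for n
    unfolding w_def by (subst W12_dual_lin[OF F u_W12_0 W0]) simp
  ultimately show ?thesis by (simp add: LIM_zero_cancel)
qed

end

lemma (in cell_problem) homogenized_unique:
  assumes \<Omega>: "open \<Omega>" "bounded \<Omega>" and f: "f \<in> W12_dual \<Omega>"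
    and u: "dirichlet_solution \<Omega> (\<lambda>x. Ch) f u" and v: "dirichlet_solution \<Omega> (\<lambda>x. Ch) f v"
  shows "AE x in lebesgue_on \<Omega>. v x = u x"
proof -
  let ?M = "lebesgue_on \<Omega>"
  have W: "u \<in> W12_0_vec \<Omega>" "v \<in> W12_0_vec \<Omega>" using u v by (auto simp: dirichlet_solution_def)
  define w where "w = (\<lambda>x. 1 *\<^sub>R v x + (-1) *\<^sub>R u x)"
  have w: "w \<in> W12_0_vec \<Omega>" "AE x in ?M. grad \<Omega> w x = 1 *\<^sub>R grad \<Omega> v x + (-1) *\<^sub>R grad \<Omega> u x"
    unfolding w_def by (rule W12_0_vec_lin[OF \<Omega> W(2,1)])+
  note L = W12_0_vec_L2v(2)[OF W(1)] W12_0_vec_L2v(2)[OF W(2)] W12_0_vec_L2v(2)[OF w(1)]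
  have linT: "(\<lambda>x. tensor_app Ch (g x)) \<in> L2v ?M" if "g \<in> L2v ?M" for g
    using linear_L2v[OF linear_tensor_app, of Ch] that by metis
  have "L2ip ?M (\<lambda>x. tensor_app Ch (grad \<Omega> w x)) (grad \<Omega> w)
      = L2ip ?M (\<lambda>x. 1 *\<^sub>R tensor_app Ch (grad \<Omega> v x) + (-1) *\<^sub>R tensor_app Ch (grad \<Omega> u x)) (grad \<Omega> w)"
  proof (rule L2ip_cong_AE)
    show "AE x in ?M. tensor_app Ch (grad \<Omega> w x) = 1 *\<^sub>R tensor_app Ch (grad \<Omega> v x) + (-1) *\<^sub>R tensor_app Ch (grad \<Omega> u x)"
      using w(2) by eventually_elim (simp only: tensor_app_add tensor_app_scale)
  qed (rule L2v_measurable[OF linT[OF L(3)]] L2v_measurable[OF L2v_lin[OF linT[OF L(2)] linT[OF L(1)]]]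
      L2v_measurable[OF L(3)] | simp)+
  also have "\<dots> = f w - f w"
    using u v w(1) by (subst L2ip_lin[OF linT[OF L(2)] linT[OF L(1)] L(3)]) (simp add: dirichlet_solution_iff)
  finally have "L2ip ?M (\<lambda>x. tensor_app Ch (grad \<Omega> w x)) (grad \<Omega> w) = 0" by simp
  moreover have "c * (L2norm ?M (grad \<Omega> w))\<^sup>2 \<le> L2ip ?M (\<lambda>x. tensor_app Ch (grad \<Omega> w x)) (grad \<Omega> w)"
  proof -
    have "c * (L2norm ?M (grad \<Omega> w))\<^sup>2 = (LINT x|?M. c * (norm (grad \<Omega> w x))\<^sup>2)" by (simp add: L2norm_power2)
    also have "\<dots> \<le> (LINT x|?M. tensor_app Ch (grad \<Omega> w x) \<bullet> grad \<Omega> w x)"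
      using L(3) by (intro integral_mono Ch_coercive L2v_inner_integrable linT) (auto simp: L2v_def)
    finally show ?thesis by (simp add: L2ip_def)
  qed
  ultimately have "c * (L2norm ?M (grad \<Omega> w))\<^sup>2 \<le> 0" by simp
  then have zero: "L2norm ?M (grad \<Omega> w) = 0"
    using c_pos by (simp add: mult_le_0_iff)
  obtain P where P: "P \<ge> 0" "\<And>v :: real ^ 3 \<Rightarrow> real ^ 3. v \<in> W12_0_vec \<Omega> \<Longrightarrow> L2norm ?M v \<le> P * L2norm ?M (grad \<Omega> v)"
    using Poincare[OF \<Omega>, where 'd = 3] by blast
  have "L2norm ?M w \<le> 0" using P(2)[OF w(1)] zero by simp
  then have "L2norm ?M w = 0" using L2norm_nonneg[of ?M w] by linarith
  from L2norm_eq_0_AE[OF W12_0_vec_L2v(1)[OF w(1)] this] show ?thesis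
    by eventually_elim (simp add: w_def)
qed

lemma (in cell_problem) homogenized_exists:
  assumes \<Omega>: "open \<Omega>" "bounded \<Omega>" and f: "f \<in> W12_dual \<Omega>"
  shows "\<exists>u. dirichlet_solution \<Omega> (\<lambda>x. Ch) f u"
  unfolding dirichlet_solution_iff
  using dirichlet_exists[OF \<Omega> linear_tensor_app Ch_symmetric Ch_coercive c_pos f] by blast

theorem theorem2:
  fixes \<Omega> :: "(real ^ 3) set"
    and R :: "real ^ 3 ^ 'm::finite"
    and C :: "real ^ 'm \<Rightarrow> tensor4"
    and c :: real
    and f :: "(real ^ 3 \<Rightarrow> real ^ 3) \<Rightarrow> real"
    and u :: "real \<Rightarrow> real ^ 3 \<Rightarrow> real ^ 3"
  assumes domain: "bounded_lipschitz_domain \<Omega>"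
    and dim: "CARD('m) > 3"
    and irrational: "\<And>k::int ^ 'm. k \<noteq> 0 \<Longrightarrow> transpose R *v int_vec k \<noteq> 0"
    and C_periodic: "cell_periodic C"
    and C_symmetric: "\<And>y. symmetric_tensor (C y)"
    and C_Linf: "C \<in> Linf (lebesgue_on unit_cell)"
    and C_cut_Linf: "\<And>\<eta>. \<eta> > 0 \<Longrightarrow> (\<lambda>x. C ((R *v x) /\<^sub>R \<eta>)) \<in> Linf (lebesgue_on \<Omega>)"
    and C_cut_trace: "cut_admissible \<Omega> R C"
    and c_pos: "c > 0"
    and C_coercive: "AE y in lebesgue_on unit_cell. coercive_tensor c (C y)"
    and C_cut_coercive:
      "\<And>\<eta>. \<eta> > 0 \<Longrightarrow> AE x in lebesgue_on \<Omega>. coercive_tensor c (C ((R *v x) /\<^sub>R \<eta>))"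
    and f: "f \<in> W12_dual \<Omega>"
    and u: "\<And>\<eta>. \<eta> > 0 \<Longrightarrow> dirichlet_solution \<Omega> (\<lambda>x. C ((R *v x) /\<^sub>R \<eta>)) f (u \<eta>)"
  shows "(\<exists>G. local_solution R C G) \<and>
    (\<forall>G. local_solution R C G \<longrightarrow>
      (\<exists>u\<^sub>0. dirichlet_solution \<Omega> (\<lambda>x. homogenized_tensor C G) f u\<^sub>0 \<and>
        (\<forall>v. dirichlet_solution \<Omega> (\<lambda>x. homogenized_tensor C G) f v \<longrightarrow>
          (AE x in lebesgue_on \<Omega>. v x = u\<^sub>0 x)) \<and>
        (\<forall>s::nat \<Rightarrow> real. (\<forall>n. s n > 0) \<longrightarrow> s \<longlonglongrightarrow> 0 \<longrightarrow>
          (\<exists>r. strict_mono r \<and> weakly_converges_W12_0 \<Omega> (\<lambda>n. u (s (r n))) u\<^sub>0))))"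
proof (intro conjI allI impI)
  have \<Omega>: "open \<Omega>" "bounded \<Omega>" using domain by (auto simp: bounded_lipschitz_domain_def)
  show "\<exists>G. local_solution R C G"
    by (rule local_solution_exists[OF C_Linf C_symmetric C_coercive c_pos])
  fix G assume G: "local_solution R C G"
  interpret cell_problem R C c G
    by unfold_locales (use irrational C_Linf C_symmetric C_coercive c_pos G in auto)
  obtain u0 where u0: "dirichlet_solution \<Omega> (\<lambda>x. Ch) f u0"
    using homogenized_exists[OF \<Omega> f] by blast
  show "\<exists>u\<^sub>0. dirichlet_solution \<Omega> (\<lambda>x. homogenized_tensor C G) f u\<^sub>0 \<and>
        (\<forall>v. dirichlet_solution \<Omega> (\<lambda>x. homogenized_tensor C G) f v \<longrightarrow>
          (AE x in lebesgue_on \<Omega>. v x = u\<^sub>0 x)) \<and>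
        (\<forall>s::nat \<Rightarrow> real. (\<forall>n. s n > 0) \<longrightarrow> s \<longlonglongrightarrow> 0 \<longrightarrow>
          (\<exists>r. strict_mono r \<and> weakly_converges_W12_0 \<Omega> (\<lambda>n. u (s (r n))) u\<^sub>0))"
  proof (intro exI[of _ u0] conjI allI impI)
    show "dirichlet_solution \<Omega> (\<lambda>x. Ch) f u0" by (rule u0)
    show "AE x in lebesgue_on \<Omega>. v x = u0 x" if "dirichlet_solution \<Omega> (\<lambda>x. Ch) f v" for v
      by (rule homogenized_unique[OF \<Omega> f u0 that])
    fix s :: "nat \<Rightarrow> real" assume s: "\<forall>n. s n > 0" "s \<longlonglongrightarrow> 0"
    interpret homogenization R C c G \<Omega> f s "\<lambda>n. u (s n)"
      by unfold_locales (use \<Omega> s C_cut_Linf C_cut_coercive C_cut_trace f u in auto)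
    have "weakly_converges_W12_0 \<Omega> (\<lambda>n. u (s n)) u0"
      unfolding weakly_converges_W12_0_def
      using u_W12_0 u0 weak_limit[OF u0] by (simp add: dirichlet_solution_def)
    (* all of the sequence converges, and r is the identity *)
    then show "\<exists>r. strict_mono r \<and> weakly_converges_W12_0 \<Omega> (\<lambda>n. u (s (r n))) u0"
      by (intro exI[of _ "\<lambda>n. n"]) (simp add: strict_mono_def)
  qed
qed

end
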